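(* Let $\mathbb{K}$ be an arbitrary field, and let $$H_1=1+3t+3t^2,\quad H_2=(1+t)^3,\quad H_3=\frac{1+2t-2t^3}{1-t},\quad H_4=1+3t+3t^2+2t^3,$$ $$H_5=1+3t+3t^2+2t^3+t^4,\quad H_6=\frac{1+2t-t^3-t^4}{1-t},\quad H_7=\frac{1+2t-t^3}{1-t},\quad H_8=\frac{1+2t}{1-t},$$ $$H_9=\frac{1+2t+t^3}{1-t},\quad H_{10}=\frac{1+t-2t^2+t^3}{(1-t)^2},\quad H_{11}=\frac{1+2t-t^2-t^3}{1-t-t^2}.$$ For Koszul $\mathbb{K}$-algebras $A$ satisfying $\dim A_1=\dim A_2=3$, the complete list of Hilbert series consists of $H_j$ with $j\in\{2,5,6,7,8,9,10,11\}$. That is, every such $A$ has $H_A=H_j$ for some $j\in\{2,5,6,7,8,9,10,11\}$; for each $j\in\{2,5,6,7,8,9,10,11\}$ there is a Koszul algebra $A$ satisfying $H_A=H_j$; and for $j\in\{1,3,4\}$ every quadratic algebra $A$ satisfying $H_A=H_j$ is non-Koszul.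
   Context: For a finite-dimensional vector space $V$ over $\mathbb{K}$, let $F(V)$ be the tensor (free associative) algebra of $V$, with the degree grading. For a subspace $R\subseteq V\otimes V$, the quadratic algebra $A(V,R)$ is the quotient of $F(V)$ by the two-sided ideal generated by $R$, with the induced grading. A degree graded algebra is a quotient of some $F(V)$ by a proper graded ideal. The Hilbert series of a graded algebra $A$ is $H_A(t)=\sum_{j=0}^\infty\dim_{\mathbb{K}}(A_j)\,t^j$. A degree graded algebra $A$ is called Koszul if the graded left $A$-module $\mathbb{K}$ (with structure given by the augmentation map) has a free graded resolution $\dots\to M_m\to\dots\to M_1\to A\to\mathbb{K}\to 0$, where $A\to\mathbb{K}$ is the augmentation map and each $M_k$ is a free graded module generated in degree $k$. Every Koszul algebra is quadratic. *)

theory Defs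
  imports
    "HOL-Computational_Algebra.Formal_Power_Series"
    "HOL-Algebra.Embedded_Algebras"
    "HOL-Algebra.QuotRing"
    "HOL-Algebra.Module"
begin

section \<open>The free algebra and its graded quotients\<close>

text \<open>
  A finite-dimensional vector space over the field \<open>'k\<close> is given by a basis
  \<open>x\<^sub>0, \<dots>, x\<^sub>n\<^sub>-\<^sub>1\<close>. Its tensor algebra is the algebra of
  noncommutative polynomials in these variables: the word \<open>[i\<^sub>1, \<dots>, i\<^sub>d]\<close>
  stands for the monomial \<open>x\<^sub>i\<^sub>1 \<otimes> \<dots> \<otimes> x\<^sub>i\<^sub>d\<close>, and a polynomial is its finitely
  supported family of coefficients.
\<close>

type_synonym 'k ncpoly = "nat list \<Rightarrow> 'k"

definition free_algebra :: "nat \<Rightarrow> 'k::field ncpoly ring" where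
  "free_algebra n =
    \<lparr>carrier = {f. finite {w. f w \<noteq> 0} \<and> (\<forall>w. f w \<noteq> 0 \<longrightarrow> set w \<subseteq> {..<n})},
     mult = (\<lambda>f g w. \<Sum>i\<le>length w. f (take i w) * g (drop i w)),
     one = (\<lambda>w. if w = [] then 1 else 0),
     zero = (\<lambda>w. 0),
     add = (\<lambda>f g w. f w + g w)\<rparr>"

definition const_poly :: "'k::field \<Rightarrow> 'k ncpoly" where
  "const_poly c = (\<lambda>w. if w = [] then c else 0)"

definition hom_part :: "nat \<Rightarrow> 'k::field ncpoly \<Rightarrow> 'k ncpoly" where
  "hom_part j f = (\<lambda>w. if length w = j then f w else 0)"

definition free_comp :: "nat \<Rightarrow> nat \<Rightarrow> 'k::field ncpoly set" where
  "free_comp n j = {f \<in> carrier (free_algebra n). \<forall>w. f w \<noteq> 0 \<longrightarrow> length w = j}"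

text \<open>
  A degree graded algebra is the quotient of \<open>free_algebra n\<close> by a proper graded two-sided
  ideal \<open>I\<close>; it is referred to below by the pair \<open>n\<close>, \<open>I\<close>.
\<close>

definition proper_graded_ideal :: "nat \<Rightarrow> 'k::field ncpoly set \<Rightarrow> bool" where
  "proper_graded_ideal n I \<longleftrightarrow>
     ideal I (free_algebra n) \<and> I \<noteq> carrier (free_algebra n) \<and>
     (\<forall>f\<in>I. \<forall>j. hom_part j f \<in> I)"

definition graded_algebra :: "nat \<Rightarrow> 'k::field ncpoly set \<Rightarrow> 'k ncpoly set ring" where
  "graded_algebra n I = free_algebra n Quot I"

definition alg_comp :: "nat \<Rightarrow> 'k::field ncpoly set \<Rightarrow> nat \<Rightarrow> 'k ncpoly set set" where
  "alg_comp n I j = (\<lambda>f. I +>\<^bsub>free_algebra n\<^esub> f) ` free_comp n j"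

text \<open>The copy of the ground field inside the quotient (see \<open>scalars_subfield\<close> below).\<close>

definition scalars :: "nat \<Rightarrow> 'k::field ncpoly set \<Rightarrow> 'k ncpoly set set" where
  "scalars n I = range (\<lambda>c. I +>\<^bsub>free_algebra n\<^esub> const_poly c)"

definition comp_dim :: "nat \<Rightarrow> 'k::field ncpoly set \<Rightarrow> nat \<Rightarrow> nat" where
  "comp_dim n I j = ring.dim (graded_algebra n I) (scalars n I) (alg_comp n I j)"

definition hilbert_series :: "nat \<Rightarrow> 'k::field ncpoly set \<Rightarrow> rat fps" where
  "hilbert_series n I = Abs_fps (\<lambda>j. of_nat (comp_dim n I j))"

definition quadratic_relations :: "nat \<Rightarrow> 'k::field ncpoly set \<Rightarrow> bool" where
  "quadratic_relations n R \<longleftrightarrow>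
     R \<subseteq> free_comp n 2 \<and> additive_subgroup R (free_algebra n) \<and>
     (\<forall>c. \<forall>f\<in>R. (\<lambda>w. c * f w) \<in> R)"

text \<open>With \<open>R\<close> as above, the pair \<open>n\<close>, \<open>quadratic_ideal n R\<close> is the quadratic algebra
  \<open>A(V, R)\<close>.\<close>

definition quadratic_ideal :: "nat \<Rightarrow> 'k::field ncpoly set \<Rightarrow> 'k ncpoly set" where
  "quadratic_ideal n R = genideal (free_algebra n) R"


section \<open>Graded left modules and Koszulness\<close>

text \<open>
  The library's locale for modules is restricted to commutative rings, so only its record type
  is used; the fields \<open>mult\<close> and \<open>one\<close> inherited by that record from rings play no role.
\<close>

record ('a, 'm) graded_module = "('a, 'm) module" +
  grade :: "nat \<Rightarrow> 'm set"

text \<open>The algebra as a left module over itself.\<close>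

definition regular_module ::
    "nat \<Rightarrow> 'k::field ncpoly set \<Rightarrow> ('k ncpoly set, 'k ncpoly set) graded_module" where
  "regular_module n I =
    \<lparr>carrier = carrier (graded_algebra n I), mult = undefined, one = undefined,
     zero = \<zero>\<^bsub>graded_algebra n I\<^esub>,
     add = add (graded_algebra n I),
     smult = mult (graded_algebra n I),
     grade = alg_comp n I\<rparr>"

text \<open>
  The augmentation map sends a coset to the constant coefficient that all its elements have in
  common (elements of a proper graded ideal have constant coefficient \<open>0\<close>).
\<close>

definition augmentation :: "'k::field ncpoly set \<Rightarrow> 'k" where
  "augmentation X = (THE c. \<forall>f\<in>X. f [] = c)"

definition trivial_module :: "('k::field ncpoly set, 'k) graded_module" where
  "trivial_module =
    \<lparr>carrier = UNIV, mult = undefined, one = undefined,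
     zero = 0,
     add = (+),
     smult = (\<lambda>a c. augmentation a * c),
     grade = (\<lambda>j. if j = 0 then UNIV else {0})\<rparr>"

text \<open>
  The free graded left module with a basis indexed by \<open>B\<close> whose elements all have degree \<open>k\<close>.
  An element is the family of its coordinates, extended by zero outside \<open>B\<close>.
\<close>

definition free_module ::
    "nat \<Rightarrow> 'k::field ncpoly set \<Rightarrow> nat \<Rightarrow> nat set
      \<Rightarrow> ('k ncpoly set, nat \<Rightarrow> 'k ncpoly set) graded_module" where
  "free_module n I k B = (let A = graded_algebra n I;
      M = {x. (\<forall>b. x b \<in> carrier A) \<and> (\<forall>b. b \<notin> B \<longrightarrow> x b = \<zero>\<^bsub>A\<^esub>) \<and> finite {b. x b \<noteq> \<zero>\<^bsub>A\<^esub>}} in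
    \<lparr>carrier = M, mult = undefined, one = undefined,
     zero = (\<lambda>b. \<zero>\<^bsub>A\<^esub>),
     add = (\<lambda>x y b. x b \<oplus>\<^bsub>A\<^esub> y b),
     smult = (\<lambda>a x b. a \<otimes>\<^bsub>A\<^esub> x b),
     grade = (\<lambda>j. {x \<in> M. \<forall>b. x b \<in> (if k \<le> j then alg_comp n I (j - k) else {\<zero>\<^bsub>A\<^esub>})})\<rparr>)"

definition graded_module_hom ::
    "('a, 'b) ring_scheme \<Rightarrow> ('a, 'm) graded_module \<Rightarrow> ('a, 'p) graded_module \<Rightarrow> ('m \<Rightarrow> 'p) set" where
  "graded_module_hom A M N =
    {h \<in> carrier M \<rightarrow> carrier N.
       (\<forall>x\<in>carrier M. \<forall>y\<in>carrier M. h (x \<oplus>\<^bsub>M\<^esub> y) = h x \<oplus>\<^bsub>N\<^esub> h y) \<and>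
       (\<forall>a\<in>carrier A. \<forall>x\<in>carrier M. h (a \<odot>\<^bsub>M\<^esub> x) = a \<odot>\<^bsub>N\<^esub> h x) \<and>
       (\<forall>j. h ` grade M j \<subseteq> grade N j)}"

definition exact_at ::
    "('a, 'l) graded_module \<Rightarrow> ('l \<Rightarrow> 'm) \<Rightarrow> ('a, 'm) graded_module
      \<Rightarrow> ('m \<Rightarrow> 'p) \<Rightarrow> ('a, 'p) graded_module \<Rightarrow> bool" where
  "exact_at L f M g N \<longleftrightarrow> f ` carrier L = a_kernel M N g"

text \<open>
  The resolution is \<open>\<dots> \<rightarrow> M 2 \<rightarrow> M 1 \<rightarrow> A \<rightarrow> K \<rightarrow> 0\<close>, with maps \<open>e : M 1 \<rightarrow> A\<close> and
  \<open>d k : M (k + 1) \<rightarrow> M k\<close> for \<open>k \<ge> 1\<close>. The index set \<open>B k\<close> of the basis of \<open>M k\<close> is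
  an arbitrary set of natural numbers. Larger bases cannot occur: the differentials preserve
  degree, so the degree \<open>k\<close> part of \<open>M k\<close>, which is the span of its basis, embeds into the
  degree \<open>k\<close> part of the preceding term, and hence every \<open>M k\<close> has finite rank.
\<close>

definition koszul :: "nat \<Rightarrow> 'k::field ncpoly set \<Rightarrow> bool" where
  "koszul n I \<longleftrightarrow> proper_graded_ideal n I \<and>
    (\<exists>B e d. let A = graded_algebra n I; A' = regular_module n I;
                 M = (\<lambda>k. free_module n I k (B k)) in
       e \<in> graded_module_hom A (M 1) A' \<and>
       (\<forall>k\<ge>1. d k \<in> graded_module_hom A (M (k + 1)) (M k)) \<and>
       augmentation \<in> graded_module_hom A A' trivial_module \<and>
       augmentation ` carrier A' = UNIV \<and>
       exact_at (M 1) e A' augmentation trivial_module \<and>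
       exact_at (M 2) (d 1) (M 1) e A' \<and>
       (\<forall>k\<ge>1. exact_at (M (k + 2)) (d (k + 1)) (M (k + 1)) (d k) (M k)))"


section \<open>The list of power series\<close>

definition H :: "nat \<Rightarrow> rat fps" where
  "H j = (let t = fps_X in
     if j = 1 then 1 + 3 * t + 3 * t^2
     else if j = 2 then (1 + t)^3
     else if j = 3 then (1 + 2 * t - 2 * t^3) / (1 - t)
     else if j = 4 then 1 + 3 * t + 3 * t^2 + 2 * t^3
     else if j = 5 then 1 + 3 * t + 3 * t^2 + 2 * t^3 + t^4
     else if j = 6 then (1 + 2 * t - t^3 - t^4) / (1 - t)
     else if j = 7 then (1 + 2 * t - t^3) / (1 - t)
     else if j = 8 then (1 + 2 * t) / (1 - t)
     else if j = 9 then (1 + 2 * t + t^3) / (1 - t)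
     else if j = 10 then (1 + t - 2 * t^2 + t^3) / (1 - t)^2
     else if j = 11 then (1 + 2 * t - t^2 - t^3) / (1 - t - t^2)
     else undefined)"


section \<open>The definitions are meaningful\<close>

text \<open>
  The free algebra is a ring, \<^const>\<open>scalars\<close> is a subfield of a degree graded algebra (so that
  the dimension over it is well defined), and \<^const>\<open>augmentation\<close> is well defined on cosets.
\<close>

lemma free_algebra_simps:
  "f \<in> carrier (free_algebra n) \<longleftrightarrow> finite {w. f w \<noteq> 0} \<and> (\<forall>w. f w \<noteq> 0 \<longrightarrow> set w \<subseteq> {..<n})"
  "mult (free_algebra n) f g = (\<lambda>w. \<Sum>i\<le>length w. f (take i w) * g (drop i w))"
  "one (free_algebra n) = (\<lambda>w. if w = [] then 1 else 0)"
  "zero (free_algebra n) = (\<lambda>w. 0)"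
  "add (free_algebra n) f g = (\<lambda>w. f w + g w)"
  by (simp_all add: free_algebra_def)

lemma ncpoly_mult_supp:
  fixes f g :: "'k::field ncpoly"
  assumes "(\<Sum>i\<le>length w. f (take i w) * g (drop i w)) \<noteq> 0"
  shows "\<exists>u v. w = u @ v \<and> f u \<noteq> 0 \<and> g v \<noteq> 0"
proof -
  from assms obtain i where "f (take i w) * g (drop i w) \<noteq> 0"
    by (meson sum.not_neutral_contains_not_neutral)
  then show ?thesis by (intro exI[of _ "take i w"] exI[of _ "drop i w"]) auto
qed

lemma ncpoly_mult_assoc:
  fixes f g h :: "'k::field ncpoly"
  shows "(\<Sum>i\<le>length w. (\<Sum>j\<le>length (take i w). f (take j (take i w)) * g (drop j (take i w))) * h (drop i w))
       = (\<Sum>i\<le>length w. f (take i w) * (\<Sum>j\<le>length (drop i w). g (take j (drop i w)) * h (drop j (drop i w))))"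
proof -
  let ?F = "\<lambda>a b c. f (take a w) * g (take b (drop a w)) * h (drop (a + b) w)"
  have "(\<Sum>i\<le>length w. (\<Sum>j\<le>length (take i w). f (take j (take i w)) * g (drop j (take i w))) * h (drop i w))
      = (\<Sum>j=0..length w. \<Sum>i=0..j. ?F i (j - i) (length w - j))"
    unfolding atLeast0AtMost
    by (intro sum.cong refl) (auto simp: sum_distrib_right drop_take min_def intro!: sum.cong)
  also have "\<dots> = (\<Sum>j=0..length w. \<Sum>i=0..length w - j. ?F j i (length w - j - i))"
    by (rule fps_mult_assoc_lemma)
  also have "\<dots> = (\<Sum>i\<le>length w. f (take i w) * (\<Sum>j\<le>length (drop i w). g (take j (drop i w)) * h (drop j (drop i w))))"
    unfolding atLeast0AtMost
    by (intro sum.cong refl) (auto simp: sum_distrib_left mult.assoc add.commute intro!: sum.cong)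
  finally show ?thesis .
qed

lemma const_mult: "(\<Sum>i\<le>length w. const_poly c (take i w) * g (drop i w)) = c * g w"
  for g :: "'k::field ncpoly"
proof -
  have "(\<Sum>i\<le>length w. const_poly c (take i w) * g (drop i w)) = (\<Sum>i\<in>{0}. const_poly c (take i w) * g (drop i w))"
    by (rule sum.mono_neutral_right) (auto simp: const_poly_def)
  then show ?thesis by (simp add: const_poly_def)
qed

lemma mult_const: "(\<Sum>i\<le>length w. g (take i w) * const_poly c (drop i w)) = g w * c"
  for g :: "'k::field ncpoly"
proof -
  have "(\<Sum>i\<le>length w. g (take i w) * const_poly c (drop i w)) = (\<Sum>i\<in>{length w}. g (take i w) * const_poly c (drop i w))"
    by (rule sum.mono_neutral_right) (auto simp: const_poly_def)
  then show ?thesis by (simp add: const_poly_def)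
qed

lemma free_algebra_ring: "ring (free_algebra n :: 'k::field ncpoly ring)"
proof (rule ringI)
  let ?F = "free_algebra n :: 'k::field ncpoly ring"
  have addcl: "f \<oplus>\<^bsub>?F\<^esub> g \<in> carrier ?F" if "f \<in> carrier ?F" "g \<in> carrier ?F" for f g
  proof -
    have "{w. f w + g w \<noteq> 0} \<subseteq> {w. f w \<noteq> 0} \<union> {w. g w \<noteq> 0}" by auto
    then have "finite {w. f w + g w \<noteq> 0}" using that by (auto simp: free_algebra_simps intro: finite_subset)
    moreover have "\<forall>w. f w + g w \<noteq> 0 \<longrightarrow> set w \<subseteq> {..<n}"
    proof (intro allI impI)
      fix w assume "f w + g w \<noteq> 0"
      then have "f w \<noteq> 0 \<or> g w \<noteq> 0" by auto
      then show "set w \<subseteq> {..<n}" using that unfolding free_algebra_simps(1) by blast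
    qed
    ultimately show ?thesis unfolding free_algebra_simps(1) free_algebra_simps(5) by blast
  qed
  show "abelian_group ?F"
  proof (rule abelian_groupI)
    fix f assume f: "f \<in> carrier ?F"
    show "\<exists>y\<in>carrier ?F. y \<oplus>\<^bsub>?F\<^esub> f = \<zero>\<^bsub>?F\<^esub>"
      using f by (intro bexI[of _ "\<lambda>w. - f w"]) (auto simp: free_algebra_simps)
  next
    show "\<zero>\<^bsub>?F\<^esub> \<in> carrier ?F" by (simp add: free_algebra_simps)
  qed (blast intro: addcl, simp_all add: free_algebra_simps(4,5) add_ac)
  have one: "\<one>\<^bsub>?F\<^esub> = const_poly 1" by (simp add: free_algebra_simps const_poly_def)
  show "Group.monoid ?F"
  proof (rule monoidI)
    fix f g assume fg: "f \<in> carrier ?F" "g \<in> carrier ?F"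
    have s: "{w. (f \<otimes>\<^bsub>?F\<^esub> g) w \<noteq> 0} \<subseteq> (\<lambda>(u, v). u @ v) ` ({w. f w \<noteq> 0} \<times> {w. g w \<noteq> 0})"
      using ncpoly_mult_supp[where f=f and g=g] by (fastforce simp: free_algebra_simps)
    have "finite {w. (f \<otimes>\<^bsub>?F\<^esub> g) w \<noteq> 0}"
      by (rule finite_subset[OF s]) (use fg in \<open>auto simp: free_algebra_simps\<close>)
    moreover have "\<forall>w. (f \<otimes>\<^bsub>?F\<^esub> g) w \<noteq> 0 \<longrightarrow> set w \<subseteq> {..<n}"
    proof (intro allI impI)
      fix w assume "(f \<otimes>\<^bsub>?F\<^esub> g) w \<noteq> 0"
      then obtain u v where w: "w = u @ v" "f u \<noteq> 0" "g v \<noteq> 0"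
        using ncpoly_mult_supp[where f=f and g=g and w=w] unfolding free_algebra_simps(2) by blast
      then have "set u \<subseteq> {..<n}" "set v \<subseteq> {..<n}" using fg unfolding free_algebra_simps(1) by blast+
      then show "set w \<subseteq> {..<n}" by (simp add: w)
    qed
    ultimately show "f \<otimes>\<^bsub>?F\<^esub> g \<in> carrier ?F" by (simp add: free_algebra_simps(1))
  next
    fix f g h :: "'k ncpoly"
    show "f \<otimes>\<^bsub>?F\<^esub> g \<otimes>\<^bsub>?F\<^esub> h = f \<otimes>\<^bsub>?F\<^esub> (g \<otimes>\<^bsub>?F\<^esub> h)"
      unfolding free_algebra_simps(2) by (intro ext ncpoly_mult_assoc)
  next
    show "\<one>\<^bsub>?F\<^esub> \<in> carrier ?F" by (auto simp: free_algebra_simps)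
  next
    fix f :: "'k ncpoly"
    show "\<one>\<^bsub>?F\<^esub> \<otimes>\<^bsub>?F\<^esub> f = f" "f \<otimes>\<^bsub>?F\<^esub> \<one>\<^bsub>?F\<^esub> = f"
      unfolding one by (simp_all add: free_algebra_simps(2) const_mult mult_const)
  qed
qed (simp_all add: free_algebra_simps(2,5) sum.distrib distrib_left distrib_right)

lemma const_in: "const_poly c \<in> carrier (free_algebra n)"
  by (auto simp: free_algebra_simps const_poly_def)

lemma scalars_subfield:
  fixes I :: "'k::field ncpoly set"
  assumes "proper_graded_ideal n I"
  shows "subfield (scalars n I) (graded_algebra n I)"
proof -
  let ?F = "free_algebra n :: 'k::field ncpoly ring"
  interpret F: ring ?F by (rule free_algebra_ring)
  interpret I: ideal I ?F using assms by (simp add: proper_graded_ideal_def)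
  interpret A: ring "graded_algebra n I" unfolding graded_algebra_def by (rule I.quotient_is_ring)
  define q where "q = (\<lambda>f. I +>\<^bsub>?F\<^esub> f)"
  have q: "q \<in> ring_hom ?F (graded_algebra n I)"
    unfolding q_def graded_algebra_def by (rule I.rcos_ring_hom)
  have S: "scalars n I = range (\<lambda>c. q (const_poly c))" by (simp add: scalars_def q_def)
  have cm: "const_poly (c * d) = const_poly c \<otimes>\<^bsub>?F\<^esub> (const_poly d :: 'k ncpoly)" for c d
    by (simp add: free_algebra_simps(2) const_mult) (auto simp: const_poly_def)
  have ca: "const_poly (c + d) = const_poly c \<oplus>\<^bsub>?F\<^esub> (const_poly d :: 'k ncpoly)" for c d
    by (auto simp: free_algebra_simps const_poly_def)
  have c1: "const_poly 1 = \<one>\<^bsub>?F\<^esub>" and c0: "const_poly 0 = \<zero>\<^bsub>?F\<^esub>"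
    by (auto simp: free_algebra_simps const_poly_def)
  have qm: "q (const_poly (c * d)) = q (const_poly c) \<otimes>\<^bsub>graded_algebra n I\<^esub> q (const_poly d)" for c d
    unfolding cm by (rule ring_hom_mult[OF q const_in const_in])
  have qa: "q (const_poly (c + d)) = q (const_poly c) \<oplus>\<^bsub>graded_algebra n I\<^esub> q (const_poly d)" for c d
    unfolding ca by (rule ring_hom_add[OF q const_in const_in])
  have q1: "q (const_poly 1) = \<one>\<^bsub>graded_algebra n I\<^esub>" unfolding c1 by (rule ring_hom_one[OF q])
  have q0: "q (const_poly 0) = \<zero>\<^bsub>graded_algebra n I\<^esub>" unfolding c0 using q ring_hom_zero[OF q free_algebra_ring A.ring_axioms] by simp
  have qc: "q (const_poly c) \<in> carrier (graded_algebra n I)" for c by (rule ring_hom_closed[OF q const_in])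
  have neq: "\<one>\<^bsub>graded_algebra n I\<^esub> \<noteq> \<zero>\<^bsub>graded_algebra n I\<^esub>"
  proof
    assume "\<one>\<^bsub>graded_algebra n I\<^esub> = \<zero>\<^bsub>graded_algebra n I\<^esub>"
    then have "I +>\<^bsub>?F\<^esub> \<one>\<^bsub>?F\<^esub> = I" by (simp add: graded_algebra_def FactRing_def)
    then have "\<one>\<^bsub>?F\<^esub> \<in> I" using F.one_closed I.a_rcos_self by blast
    then show False using assms I.one_imp_carrier by (auto simp: proper_graded_ideal_def)
  qed
  have sr: "subring (scalars n I) (graded_algebra n I)"
  proof (rule A.subringI)
      show "scalars n I \<subseteq> carrier (graded_algebra n I)" using qc by (auto simp: S)
      show "\<one>\<^bsub>graded_algebra n I\<^esub> \<in> scalars n I" unfolding q1[symmetric] by (auto simp: S)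
      fix h1 h2 assume h: "h1 \<in> scalars n I" "h2 \<in> scalars n I"
      then obtain c d where cd: "h1 = q (const_poly c)" "h2 = q (const_poly d)" by (auto simp: S)
      show "h1 \<otimes>\<^bsub>graded_algebra n I\<^esub> h2 \<in> scalars n I" "h1 \<oplus>\<^bsub>graded_algebra n I\<^esub> h2 \<in> scalars n I"
        unfolding cd qm[symmetric] qa[symmetric] by (auto simp: S)
      have "q (const_poly (- c)) \<oplus>\<^bsub>graded_algebra n I\<^esub> h1 = \<zero>\<^bsub>graded_algebra n I\<^esub>"
        unfolding cd qa[symmetric] by (simp add: q0)
      then have "\<ominus>\<^bsub>graded_algebra n I\<^esub> h1 = q (const_poly (- c))"
        using A.minus_equality qc cd by auto
      then show "\<ominus>\<^bsub>graded_algebra n I\<^esub> h1 \<in> scalars n I" by (auto simp: S)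
  qed
  have comm: "x \<otimes>\<^bsub>graded_algebra n I\<^esub> y = y \<otimes>\<^bsub>graded_algebra n I\<^esub> x"
    if "x \<in> scalars n I" "y \<in> scalars n I" for x y
    using that by (auto simp: S qm[symmetric] mult.commute)
  show ?thesis
  proof (rule A.subfieldI)
    show "subcring (scalars n I) (graded_algebra n I)"
      by (rule A.subcringI[OF sr comm])
    show "Units (graded_algebra n I\<lparr>carrier := scalars n I\<rparr>) = scalars n I - {\<zero>\<^bsub>graded_algebra n I\<^esub>}"
    proof (intro equalityI subsetI)
      fix x assume "x \<in> Units (graded_algebra n I\<lparr>carrier := scalars n I\<rparr>)"
      then obtain y where x: "x \<in> scalars n I" and y: "y \<in> scalars n I"
        and xy: "y \<otimes>\<^bsub>graded_algebra n I\<^esub> x = \<one>\<^bsub>graded_algebra n I\<^esub>"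
        by (auto simp: Units_def)
      have "x \<noteq> \<zero>\<^bsub>graded_algebra n I\<^esub>"
      proof
        assume "x = \<zero>\<^bsub>graded_algebra n I\<^esub>"
        then show False using xy y qc neq by (auto simp: S)
      qed
      then show "x \<in> scalars n I - {\<zero>\<^bsub>graded_algebra n I\<^esub>}" using x by auto
    next
      fix x assume x: "x \<in> scalars n I - {\<zero>\<^bsub>graded_algebra n I\<^esub>}"
      then obtain c where c: "x = q (const_poly c)" by (auto simp: S)
      with x q0 have "c \<noteq> 0" by auto
      then have "q (const_poly (inverse c)) \<otimes>\<^bsub>graded_algebra n I\<^esub> x = \<one>\<^bsub>graded_algebra n I\<^esub>"
        "x \<otimes>\<^bsub>graded_algebra n I\<^esub> q (const_poly (inverse c)) = \<one>\<^bsub>graded_algebra n I\<^esub>"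
        unfolding c qm[symmetric] by (simp_all add: q1)
      moreover have "q (const_poly (inverse c)) \<in> scalars n I" by (auto simp: S)
      ultimately show "x \<in> Units (graded_algebra n I\<lparr>carrier := scalars n I\<rparr>)"
        using x by (auto simp: Units_def)
    qed
  qed
qed

lemma augmentation_coset:
  fixes I :: "'k::field ncpoly set"
  assumes "proper_graded_ideal n I" "f \<in> carrier (free_algebra n)"
  shows "augmentation (I +>\<^bsub>free_algebra n\<^esub> f) = f []"
proof -
  let ?F = "free_algebra n :: 'k::field ncpoly ring"
  interpret I: ideal I ?F using assms by (simp add: proper_graded_ideal_def)
  have z: "g [] = 0" if g: "g \<in> I" for g
  proof (rule ccontr)
    assume ne: "g [] \<noteq> 0"
    have "hom_part 0 g \<in> I" using assms g by (auto simp: proper_graded_ideal_def)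
    moreover have "hom_part 0 g = const_poly (g [])" by (auto simp: hom_part_def const_poly_def)
    ultimately have "const_poly (inverse (g [])) \<otimes>\<^bsub>?F\<^esub> const_poly (g []) \<in> I"
      using I.I_l_closed const_in by auto
    moreover have "const_poly (inverse (g [])) \<otimes>\<^bsub>?F\<^esub> const_poly (g []) = \<one>\<^bsub>?F\<^esub>"
      using ne by (simp add: free_algebra_simps(2) const_mult) (auto simp: const_poly_def free_algebra_simps)
    ultimately have "I = carrier ?F" using I.one_imp_carrier by auto
    then show False using assms by (auto simp: proper_graded_ideal_def)
  qed
  have mem: "g [] = f []" if "g \<in> I +>\<^bsub>?F\<^esub> f" for g
    using that z by (auto simp: a_r_coset_def' free_algebra_simps(5))
  have f: "f \<in> I +>\<^bsub>?F\<^esub> f" using assms(2) I.a_rcos_self by blast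
  show ?thesis unfolding augmentation_def
  proof (rule the_equality)
    show "\<forall>g\<in>I +>\<^bsub>?F\<^esub> f. g [] = f []" by (rule ballI) (rule mem)
  next
    fix c assume "\<forall>g\<in>I +>\<^bsub>?F\<^esub> f. g [] = c"
    then have "f [] = c" using f by (rule bspec)
    then show "c = f []" by (rule sym)
  qed
qed

end

theory Submission
  imports Defs "HOL-Library.Function_Algebras" "HOL-Library.Numeral_Type" "HOL-Library.Nat_Bijection"
    "HOL-Algebra.Algebraic_Closure_Type"
begin

text \<open>A linear resolution with free modules of ranks \<open>b\<^sub>k\<close> is exact in each degree, so the dimensions \<open>d\<^sub>n\<close> of a
  Koszul algebra satisfy \<open>\<Sum>k\<le>n. (-1)\<^sup>k b\<^sub>k d\<^bsub>n-k\<^esub> = 0\<close> for \<open>n > 0\<close>. The algebra is moreover quadratic, so by duality \<open>d\<^sub>n\<close> is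
  the dimension of the space of tensors of degree \<open>n\<close> whose slices at two adjacent places all lie in the
  annihilator of the relations. Extending the ground field does not change these dimensions, so it may be taken
  to be algebraically closed.

  If some degree one element acts surjectively from degree one to degree two, then from degree one on \<open>d\<^sub>n\<close> is
  nonincreasing, and from degree two on it is constant once a value is repeated. Otherwise all multiplications
  by degree one elements are singular, which produces elements of rank one in the annihilator of the relations.
  Then \<open>d\<^sub>3 \<le> 1\<close>, or \<open>d\<^sub>n = d\<^sub>3 \<le> 4\<close> for \<open>n \<ge> 3\<close>, or the problem reduces to two variables with one relation, where
  the dimensions are \<open>n + 1\<close> or Fibonacci numbers. What remains beyond the list is excluded by \<open>b\<^sub>k \<ge> 0\<close> and by
  \<open>b\<^bsub>k+1\<^esub> \<le> 2 b\<^sub>k\<close>, which holds in the first case.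

  Conversely, in a quadratic monomial algebra the annihilators of letters are generated by letters, and iterating
  them gives a linear resolution. \<open>H\<^sub>5\<close> and \<open>H\<^sub>6\<close> are realised by non-monomial algebras where the same argument
  works once one more linear form is added to the letters.\<close>


section \<open>Linear algebra in spaces of functions\<close>

text \<open>The argument runs on the dual side: a functional on the degree n component is a concrete
  tensor, so subspaces of one function space replace quotients, and multiplication by a degree one
  element becomes contraction of the first or last slot. The ranks b_k are dimensions of the same
  kind, with \<open>sol 2 R\<close> taken as relations in place of \<open>R\<close>. Positivity of
  ranks alone does not separate the list. The series 1+3t+3t^2 gives b_6 = -27 and H_3 gives b_7 =
  -4, but 1+3t+3t^2+2t^3 passes these tests with b_3, ..., b_7 = 11, 21, 42, 85, 171; it fails only
  by 85 > 2 * 42, which is why the growth bound is proved at all. The algebraic closure supplies two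
  things: infinitely many scalars, for elements in general position, and a root of a quadratic
  polynomial, which removes one coefficient of the single relation in two variables. A given algebra
  may use more than three variables, since its ideal may contain linear forms. Hence the passage to
  three generators whose classes form a basis in degree one.\<close>

definition scl :: "'k::field \<Rightarrow> ('a \<Rightarrow> 'k) \<Rightarrow> 'a \<Rightarrow> 'k" where
  "scl c f = (\<lambda>x. c * f x)"

lemma scl_apply: "scl c f x = c * f x"
  by (simp add: scl_def)

lemma sum_fun_apply: "(\<Sum>i\<in>A. f i) x = (\<Sum>i\<in>A. f i x)"
  for f :: "'i \<Rightarrow> 'a \<Rightarrow> 'b::comm_monoid_add"
  by (induction A rule: infinite_finite_induct) auto

lemmas pointwise = plus_fun_apply zero_fun_apply minus_apply uminus_apply sum_fun_apply scl_apply

declare plus_fun_apply [simp del] zero_fun_apply [simp del] minus_apply [simp del] uminus_apply [simp del]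

interpretation fs: vector_space "scl :: 'k::field \<Rightarrow> ('a \<Rightarrow> 'k) \<Rightarrow> 'a \<Rightarrow> 'k"
  by unfold_locales (auto simp: fun_eq_iff pointwise algebra_simps)

interpretation fsp: vector_space_pair "scl :: 'k::field \<Rightarrow> ('a \<Rightarrow> 'k) \<Rightarrow> 'a \<Rightarrow> 'k"
  "scl :: 'k::field \<Rightarrow> ('b \<Rightarrow> 'k) \<Rightarrow> 'b \<Rightarrow> 'k"
  by unfold_locales

abbreviation lin :: "(('a \<Rightarrow> 'k::field) \<Rightarrow> 'b \<Rightarrow> 'k) \<Rightarrow> bool" where
  "lin \<equiv> Vector_Spaces.linear scl scl"

lemma linI: "(\<And>f g. F (f + g) = F f + F g) \<Longrightarrow> (\<And>c f. F (scl c f) = scl c (F f)) \<Longrightarrow> lin F"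
  by (simp add: Vector_Spaces.linear_iff fs.vector_space_axioms)

lemma lin_simps:
  assumes "lin F"
  shows "F (f + g) = F f + F g" "F (scl c f) = scl c (F f)" "F 0 = 0" "F (- f) = - F f"
    "F (f - g) = F f - F g" "F (\<Sum>i\<in>A. h i) = (\<Sum>i\<in>A. F (h i))"
  using assms fsp.linear_0[OF assms] fsp.linear_neg[OF assms] fsp.linear_diff[OF assms] fsp.linear_sum[OF assms]
  by (simp_all add: Vector_Spaces.linear_iff)

text \<open>The ambient function spaces may be infinite-dimensional, where \<open>fs.dim\<close>
  does not measure size; the dimension arguments therefore carry this hypothesis.\<close>

definition fin_dim :: "('a \<Rightarrow> 'k::field) set \<Rightarrow> bool" where
  "fin_dim S \<longleftrightarrow> (\<exists>B. finite B \<and> S \<subseteq> fs.span B)"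

lemma fin_dim_subset: "fin_dim T \<Longrightarrow> S \<subseteq> T \<Longrightarrow> fin_dim S"
  by (auto simp: fin_dim_def)

lemma fin_dim_indep:
  assumes "fin_dim S" "fs.independent B" "B \<subseteq> S"
  shows "finite B"
  using assms fs.independent_span_bound unfolding fin_dim_def by (metis subset_trans)

lemma fin_dim_basis:
  assumes "fs.subspace S" "fin_dim S"
  obtains B where "B \<subseteq> S" "finite B" "fs.independent B" "fs.span B = S" "card B = fs.dim S"
proof -
  obtain B where B: "B \<subseteq> S" "fs.independent B" "S \<subseteq> fs.span B" "card B = fs.dim S"
    by (rule fs.basis_exists)
  then show thesis
    using that[of B] fin_dim_indep assms fs.span_minimal[of B S] by blast
qed

lemma extend_basis:
  assumes "fs.subspace S" "fin_dim S" "fs.independent A" "A \<subseteq> S"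
  obtains B where "A \<subseteq> B" "B \<subseteq> S" "finite B" "fs.independent B" "fs.span B = S"
proof -
  obtain B where B: "A \<subseteq> B" "B \<subseteq> S" "fs.independent B" "S \<subseteq> fs.span B"
    using fs.maximal_independent_subset_extend[OF assms(4,3)] by blast
  then show thesis
    using that[of B] fin_dim_indep assms fs.span_minimal[of B S] by blast
qed

lemma dim_subset:
  assumes "S \<subseteq> T" "fin_dim T"
  shows "fs.dim S \<le> fs.dim T"
proof -
  have "fin_dim (fs.span T)"
    using assms(2) unfolding fin_dim_def by (metis fs.span_minimal fs.subspace_span)
  then obtain B where B: "finite B" "fs.span B = fs.span T" "card B = fs.dim (fs.span T)"
    using fin_dim_basis[OF fs.subspace_span] by metis
  have "S \<subseteq> fs.span B"
    using assms(1) B(2) fs.span_superset by blast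
  then show ?thesis
    using fs.dim_le_card[of S B] B by simp
qed

lemma dim_subset_eq:
  assumes "S \<subseteq> T" "fin_dim T" "fs.subspace S" "fs.subspace T" "fs.dim T \<le> fs.dim S"
  shows "S = T"
proof -
  have "fin_dim S" using assms(1,2) fin_dim_subset by blast
  then obtain A where A: "A \<subseteq> S" "finite A" "fs.independent A" "fs.span A = S" "card A = fs.dim S"
    using fin_dim_basis assms(3) by metis
  obtain B where B: "A \<subseteq> B" "B \<subseteq> T" "finite B" "fs.independent B" "fs.span B = T"
    using extend_basis[OF assms(4,2) A(3)] A(1) assms(1) by auto
  have "card B = fs.dim T" using B(4,5) fs.dim_span_eq_card_independent by metis
  then have "A = B" using A(5) assms(5) B(1,3) by (intro card_seteq) auto
  then show ?thesis using A B by simp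
qed

text \<open>A basis of the kernel is extended to a basis of \<open>S\<close>; the map is injective
  on the span of the added vectors, and their images span the image of \<open>S\<close>.\<close>

theorem rank_nullity:
  assumes f: "lin f" and S: "fs.subspace S" "fin_dim S"
  shows "fs.dim S = fs.dim {x \<in> S. f x = 0} + fs.dim (f ` S)"
proof -
  let ?N = "{x \<in> S. f x = 0}"
  have N: "fs.subspace ?N"
    using S(1) by (simp add: fs.subspace_def lin_simps(1-3)[OF f])
  have "fin_dim ?N" by (rule fin_dim_subset[OF S(2)]) blast
  then obtain A where A: "A \<subseteq> ?N" "finite A" "fs.independent A" "fs.span A = ?N" "card A = fs.dim ?N"
    by (rule fin_dim_basis[OF N])
  obtain B where B: "A \<subseteq> B" "B \<subseteq> S" "finite B" "fs.independent B" "fs.span B = S"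
    by (rule extend_basis[OF S A(3)]) (use A(1) in blast)
  let ?C = "B - A"
  have inj: "inj_on f (fs.span ?C)"
  proof (subst fsp.linear_inj_on_iff_eq_0[OF f fs.subspace_span], intro ballI impI)
    fix x assume x: "x \<in> fs.span ?C" "f x = 0"
    have "x \<in> S" using x(1) B(5) fs.span_mono[of ?C B] by auto
    then have xA: "x \<in> fs.span A" using x(2) A(4) by simp
    \<comment> \<open>The coordinates of \<open>x\<close> are supported on the added vectors and
      also on the kernel basis, so they all vanish.\<close>
    have r: "fs.representation B x = fs.representation ?C x" "fs.representation B x = fs.representation A x"
      by (rule fs.representation_extend[OF B(4) x(1)], simp, rule fs.representation_extend[OF B(4) xA B(1)])
    have "fs.representation B x b = 0" for b
    proof (rule ccontr)
      assume "fs.representation B x b \<noteq> 0"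
      then have "b \<in> ?C" "b \<in> A" using r fs.representation_ne_zero by metis+
      then show False by simp
    qed
    then show "x = 0"
      using fs.sum_nonzero_representation_eq[OF B(4), of x] \<open>x \<in> S\<close> B(5) by simp
  qed
  have "fs.independent ?C" using B(4) fs.independent_mono by blast
  then have ind: "fs.independent (f ` ?C)"
    using fsp.linear_independent_injective_image[OF f _ inj] by blast
  have "f ` S = f ` fs.span (A \<union> ?C)" using B(1,5) by (simp add: Un_absorb1)
  also have "\<dots> = fs.span (f ` A \<union> f ` ?C)"
    unfolding image_Un[symmetric] by (rule fsp.linear_span_image[OF f, symmetric])
  also have "\<dots> = fs.span (f ` ?C)"
  proof (rule antisym)
    have "f ` A \<subseteq> fs.span (f ` ?C)"
    proof (rule image_subsetI)
      fix x assume "x \<in> A"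
      then have "x \<in> ?N" by (rule subsetD[OF A(1)])
      then show "f x \<in> fs.span (f ` ?C)" by (simp add: fs.span_zero)
    qed
    then show "fs.span (f ` A \<union> f ` ?C) \<subseteq> fs.span (f ` ?C)"
      by (rule fs.span_minimal[OF Un_least[OF _ fs.span_superset] fs.subspace_span])
  next
    show "fs.span (f ` ?C) \<subseteq> fs.span (f ` A \<union> f ` ?C)" by (rule fs.span_mono[OF Un_upper2])
  qed
  finally have "fs.dim (f ` S) = card (f ` ?C)"
    by (simp only: fs.dim_span_eq_card_independent[OF ind])
  also have "\<dots> = card ?C"
    by (rule card_image[OF inj_on_subset[OF inj fs.span_superset]])
  finally have "fs.dim (f ` S) = card ?C" .
  moreover have "fs.dim S = card B" unfolding B(5)[symmetric] by (rule fs.dim_span_eq_card_independent[OF B(4)])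
  moreover have "card B = card A + card ?C"
    using B(1,3) A(2) by (simp add: card_Diff_subset card_mono)
  ultimately show ?thesis using A(5) by simp
qed

lemma dim_zero: "fs.dim {0 :: 'a \<Rightarrow> 'k::field} = 0"
  using fs.dim_le_card[of "{0}" "{}"] by simp

lemma dim_inj_image:
  fixes f :: "('a \<Rightarrow> 'b::field) \<Rightarrow> 'c \<Rightarrow> 'b"
  assumes "lin f" "fs.subspace S" "fin_dim S" "\<And>x. x \<in> S \<Longrightarrow> f x = 0 \<Longrightarrow> x = 0"
  shows "fs.dim (f ` S) = fs.dim S"
proof -
  have "{x \<in> S. f x = 0} = {0}"
    using assms(4) lin_simps(3)[OF assms(1)] fs.subspace_0[OF assms(2)] by auto
  moreover have "fs.dim {0 :: 'a \<Rightarrow> 'b} = 0"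
    by (rule dim_zero)
  ultimately show ?thesis using rank_nullity[OF assms(1-3)] by simp
qed

lemma dim_eq_0: "fin_dim S \<Longrightarrow> fs.subspace S \<Longrightarrow> fs.dim S = 0 \<longleftrightarrow> S = {0}"
  using dim_subset_eq[of "{0}" S] by (auto simp: dim_zero fs.subspace_0 fs.subspace_single_0)

section \<open>Coordinate subspaces and the duality pairing\<close>

definition supp_on :: "'a set \<Rightarrow> ('a \<Rightarrow> 'k::field) set" where
  "supp_on Y = {f. \<forall>x. x \<notin> Y \<longrightarrow> f x = 0}"

definition delta :: "'a \<Rightarrow> 'a \<Rightarrow> 'k::field" where
  "delta a = (\<lambda>x. if x = a then 1 else 0)"

lemma subspace_supp_on: "fs.subspace (supp_on Y)"
  by (auto simp: fs.subspace_def supp_on_def pointwise)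

lemma supp_on_expand:
  assumes "finite Y" "f \<in> supp_on Y"
  shows "f = (\<Sum>x\<in>Y. scl (f x) (delta x))"
proof
  fix y
  have "(\<Sum>x\<in>Y. scl (f x) (delta x)) y = (\<Sum>x\<in>Y. if y = x then f x else 0)"
    unfolding sum_fun_apply by (rule sum.cong) (auto simp: delta_def pointwise)
  also have "\<dots> = f y" using assms by (simp add: supp_on_def)
  finally show "f y = (\<Sum>x\<in>Y. scl (f x) (delta x)) y" by simp
qed

lemma supp_on_span:
  assumes "finite Y"
  shows "supp_on Y \<subseteq> fs.span (delta ` Y)"
proof
  fix f :: "'a \<Rightarrow> 'b" assume "f \<in> supp_on Y"
  moreover have "(\<Sum>x\<in>Y. scl (f x) (delta x)) \<in> fs.span (delta ` Y)"
    by (intro fs.span_sum fs.span_scale fs.span_base) auto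
  ultimately show "f \<in> fs.span (delta ` Y)" using supp_on_expand[OF assms] by metis
qed

lemma fin_dim_supp_on: "finite Y \<Longrightarrow> fin_dim (supp_on Y)"
  unfolding fin_dim_def using supp_on_span by blast

lemma dim_supp_on:
  assumes "finite Y"
  shows "fs.dim (supp_on Y :: ('a \<Rightarrow> 'k::field) set) = card Y"
proof (rule fs.dim_unique)
  let ?d = "delta :: 'a \<Rightarrow> 'a \<Rightarrow> 'k"
  show "?d ` Y \<subseteq> supp_on Y" by (auto simp: supp_on_def delta_def)
  show "supp_on Y \<subseteq> fs.span (?d ` Y)"
    by (rule supp_on_span[OF assms])
  have inj: "inj_on ?d Y"
    by (rule inj_onI) (metis delta_def zero_neq_one)
  then show "card (?d ` Y) = card Y" by (rule card_image)
  show "fs.independent (?d ` Y)"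
  proof (rule fs.independent_if_scalars_zero)
    fix u x assume u: "(\<Sum>x\<in>?d ` Y. scl (u x) x) = 0" and x: "x \<in> ?d ` Y"
    then obtain a where a: "a \<in> Y" "x = ?d a" by auto
    have "0 = (\<Sum>b\<in>Y. scl (u (?d b)) (?d b)) a" using u inj by (simp add: sum.reindex pointwise)
    also have "(\<Sum>b\<in>Y. scl (u (?d b)) (?d b)) a = (\<Sum>b\<in>Y. if a = b then u (?d b) else 0)"
      unfolding sum_fun_apply by (rule sum.cong) (auto simp: delta_def pointwise)
    finally show "u x = 0" using a assms by simp
  qed (use assms in auto)
qed

lemma dim_coords:
  assumes "lin f" "fs.subspace S" "finite Y" "\<And>x. x \<in> S \<Longrightarrow> f x = 0 \<Longrightarrow> x = 0" "f ` S = supp_on Y" "fin_dim S"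
  shows "fs.dim S = card Y"
  using dim_inj_image[OF assms(1,2,6,4)] dim_supp_on[OF assms(3)] assms(5) by metis

definition pair :: "'a set \<Rightarrow> ('a \<Rightarrow> 'k::field) \<Rightarrow> ('a \<Rightarrow> 'k) \<Rightarrow> 'k" where
  "pair Y f g = (\<Sum>w\<in>Y. f w * g w)"

definition perp :: "'a set \<Rightarrow> ('a \<Rightarrow> 'k::field) set \<Rightarrow> ('a \<Rightarrow> 'k) set" where
  "perp Y S = {t \<in> supp_on Y. \<forall>g\<in>S. pair Y g t = 0}"

lemma pair_lin: "pair Y (f + g) t = pair Y f t + pair Y g t" "pair Y (scl c f) t = c * pair Y f t"
  "pair Y t (f + g) = pair Y t f + pair Y t g" "pair Y t (scl c f) = c * pair Y t f" "pair Y 0 t = 0" "pair Y t 0 = 0"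
  "pair Y (f - g) t = pair Y f t - pair Y g t"
  by (simp_all add: pair_def pointwise algebra_simps sum.distrib sum_distrib_left sum_subtractf)

lemma pair_sum: "pair Y (\<Sum>i\<in>I. f i) t = (\<Sum>i\<in>I. pair Y (f i) t)" "pair Y t (\<Sum>i\<in>I. f i) = (\<Sum>i\<in>I. pair Y t (f i))"
  by (induction I rule: infinite_finite_induct) (simp_all add: pair_lin)

lemma pair_commute: "pair Y f g = pair Y g f"
  by (simp add: pair_def mult.commute)

lemma subspace_perp: "fs.subspace (perp Y S)"
  using subspace_supp_on[of Y] by (auto simp: fs.subspace_def perp_def pair_lin)

text \<open>A functional can take arbitrary values on independent elements. Applied to a basis of an
  annihilator, this makes pairing with that basis a coordinate map on a quotient space.\<close>

lemma pairing_surj: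
  fixes A :: "('a \<Rightarrow> 'k::field) set"
  assumes Y: "finite Y" and A: "finite A" "A \<subseteq> supp_on Y" "fs.independent A"
  shows "(\<lambda>t a. if a \<in> A then pair Y a t else 0) ` supp_on Y = supp_on A"
proof (intro equalityI subsetI)
  fix h :: "('a \<Rightarrow> 'k) \<Rightarrow> 'k" assume h: "h \<in> supp_on A"
  obtain B where B: "A \<subseteq> B" "B \<subseteq> supp_on Y" "finite B" "fs.independent B" "fs.span B = supp_on Y"
    by (rule extend_basis[OF subspace_supp_on fin_dim_supp_on[OF Y] A(3,2)])
  \<comment> \<open>The functional with value \<open>h a\<close> at each \<open>a\<close> in
    \<open>A\<close> and 0 on the rest of the basis \<open>B\<close>, recorded by its values on unit
    vectors.\<close>
  define t where "t y = (if y \<in> Y then \<Sum>a\<in>A. h a * fs.representation B (delta y) a else 0)" for y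
  have "pair Y a t = h a" if a: "a \<in> A" for a
  proof -
    have dB: "delta y \<in> fs.span B" if "y \<in> Y" for y
      using that by (auto simp: B(5) supp_on_def delta_def)
    have rep: "(\<Sum>y\<in>Y. a y * fs.representation B (delta y) a') = (if a = a' then 1 else 0)" for a'
    proof -
      have "fs.representation B a a' = fs.representation B (\<Sum>y\<in>Y. scl (a y) (delta y)) a'"
        using supp_on_expand[OF Y, of a] a A(2) by (metis subsetD)
      also have "\<dots> = (\<Sum>y\<in>Y. a y * fs.representation B (delta y) a')"
        using dB by (subst fs.representation_sum[OF B(4)])
          (auto simp: fs.span_scale fs.representation_scale[OF B(4)] sum_fun_apply intro!: sum.cong)
      finally show ?thesis using fs.representation_basis[OF B(4), of a] a B(1) by auto
    qed
    have "pair Y a t = (\<Sum>y\<in>Y. \<Sum>a'\<in>A. h a' * (a y * fs.representation B (delta y) a'))"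
      by (simp add: pair_def t_def sum_distrib_left mult.left_commute)
    also have "\<dots> = (\<Sum>a'\<in>A. h a' * (\<Sum>y\<in>Y. a y * fs.representation B (delta y) a'))"
      by (subst sum.swap) (simp add: sum_distrib_left)
    also have "\<dots> = (\<Sum>a'\<in>A. if a = a' then h a' else 0)"
      unfolding rep by (intro sum.cong) auto
    also have "\<dots> = h a" using a A(1) by simp
    finally show ?thesis .
  qed
  then have "h = (\<lambda>a. if a \<in> A then pair Y a t else 0)" using h by (auto simp: supp_on_def)
  moreover have "t \<in> supp_on Y" by (simp add: t_def supp_on_def)
  ultimately show "h \<in> (\<lambda>t a. if a \<in> A then pair Y a t else 0) ` supp_on Y" by (rule image_eqI)
qed (auto simp: supp_on_def)

lemma perp_span: "perp Y (fs.span S) = perp Y S"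
proof -
  have "pair Y g t = 0" if "g \<in> fs.span S" "\<forall>g\<in>S. pair Y g t = 0" for g t
    using that by (induction rule: fs.span_induct_alt) (simp_all add: pair_lin)
  then show ?thesis unfolding perp_def using fs.span_base by blast
qed

lemma dim_perp:
  assumes Y: "finite Y" and S: "fs.subspace S" "S \<subseteq> supp_on Y"
  shows "fs.dim (perp Y S) + fs.dim S = card Y"
proof -
  have fS: "fin_dim S" by (rule fin_dim_subset[OF fin_dim_supp_on[OF Y] S(2)])
  obtain A where A: "A \<subseteq> S" "finite A" "fs.independent A" "fs.span A = S" "card A = fs.dim S"
    by (rule fin_dim_basis[OF S(1) fS])
  let ?F = "\<lambda>t a. if a \<in> A then pair Y a t else 0"
  have lin: "lin ?F" by (rule linI) (auto simp: fun_eq_iff pointwise pair_lin)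
  have "{t \<in> supp_on Y. ?F t = 0} = perp Y A" by (auto simp: perp_def fun_eq_iff pointwise)
  also have "\<dots> = perp Y S" using perp_span[of Y A] A(4) by simp
  finally show ?thesis
    using rank_nullity[OF lin subspace_supp_on fin_dim_supp_on[OF Y]] pairing_surj[OF Y A(2) _ A(3)] A S(2) Y
    by (simp add: dim_supp_on)
qed

text \<open>One inclusion is formal; two applications of \<open>dim_perp\<close> show that the
  dimensions agree.\<close>

lemma perp_perp:
  fixes S :: "('a \<Rightarrow> 'k::field) set"
  assumes Y: "finite Y" and S: "fs.subspace S" "S \<subseteq> supp_on Y"
  shows "perp Y (perp Y S) = S"
proof (rule dim_subset_eq[symmetric])
  have p: "perp Y T \<subseteq> supp_on Y" for T :: "('a \<Rightarrow> 'k) set" by (auto simp: perp_def)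
  show "S \<subseteq> perp Y (perp Y S)" using S(2) by (auto simp: perp_def) (metis pair_commute)
  show "fin_dim (perp Y (perp Y S))" by (rule fin_dim_subset[OF fin_dim_supp_on[OF Y] p])
  show "fs.dim (perp Y (perp Y S)) \<le> fs.dim S"
    using dim_perp[OF Y S] dim_perp[OF Y subspace_perp p, of S] by linarith
qed (rule S(1), rule subspace_perp)

section \<open>Tensors with prescribed adjacent slices\<close>

type_synonym 'k tens = "3 list \<Rightarrow> 'k"

lemma UNIV_three: "(UNIV :: 3 set) = {0, 1, 2}"
proof -
  have "z = 0 \<or> z = 1 \<or> z = 2" for z :: 3
  proof (induct z)
    case (of_int z)
    then have "0 \<le> z" "z < 3" by simp_all
    then have "z = 0 \<or> z = 1 \<or> z = 2" by arith
    then show ?case by auto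
  qed
  then show ?thesis by auto
qed

definition tens :: "nat \<Rightarrow> 'k::field tens set" where
  "tens n = supp_on {w. length w = n}"

text \<open>Functionals on tensors of degree \<open>n\<close> that vanish on every relation placed
  at two adjacent slots: the dual of the degree \<open>n\<close> component of the algebra with three
  generators and quadratic relations \<open>G\<close>. With \<open>sol 2 R\<close> in place of
  \<open>G\<close>, the same formula gives the dual of a component of the quadratic dual
  algebra.\<close>

definition sol :: "nat \<Rightarrow> 'k::field tens set \<Rightarrow> 'k tens set" where
  "sol n G = {t \<in> tens n. \<forall>g\<in>G. \<forall>u v. (\<Sum>i\<in>UNIV. \<Sum>j\<in>UNIV. g [i, j] * t (u @ [i, j] @ v)) = 0}"

lemma tensD: "t \<in> tens n \<Longrightarrow> length w \<noteq> n \<Longrightarrow> t w = 0"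
  by (simp add: tens_def supp_on_def)

lemma tensI: "(\<And>w. length w \<noteq> n \<Longrightarrow> t w = 0) \<Longrightarrow> t \<in> tens n"
  by (simp add: tens_def supp_on_def)

lemma finite_words: "finite {w :: 'a::finite list. length w = n}"
  using finite_lists_length_eq[of "UNIV :: 'a set" n] by simp

lemma fin_dim_tens: "fin_dim (tens n)"
  unfolding tens_def by (rule fin_dim_supp_on[OF finite_words])

lemma sol_tens: "t \<in> sol n G \<Longrightarrow> t \<in> tens n"
  by (simp add: sol_def)

lemma solD: "t \<in> sol n G \<Longrightarrow> g \<in> G \<Longrightarrow> (\<Sum>i\<in>UNIV. \<Sum>j\<in>UNIV. g [i, j] * t (u @ [i, j] @ v)) = 0"
  by (simp add: sol_def)

lemma solI: "t \<in> tens n \<Longrightarrow> (\<And>g u v. g \<in> G \<Longrightarrow> (\<Sum>i\<in>UNIV. \<Sum>j\<in>UNIV. g [i, j] * t (u @ [i, j] @ v)) = 0) \<Longrightarrow> t \<in> sol n G"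
  by (simp add: sol_def)

lemma fin_dim_sol: "fin_dim (sol n G)"
  by (rule fin_dim_subset[OF fin_dim_tens[of n]]) (auto simp: sol_def)

lemma subspace_sol: "fs.subspace (sol n G)"
proof -
  have "t + s \<in> sol n G" if "t \<in> sol n G" "s \<in> sol n G" for t s
    using that solD[OF that(1)] solD[OF that(2)]
    by (intro solI tensI) (simp_all add: pointwise distrib_left sum.distrib tensD[OF sol_tens] del: append.simps)
  moreover have "scl c t \<in> sol n G" if "t \<in> sol n G" for c t
    using that solD[OF that(1)]
    by (intro solI tensI)
      (simp_all add: pointwise mult.left_commute[of _ c] sum_distrib_left[symmetric] tensD[OF sol_tens] del: append.simps)
  moreover have "0 \<in> sol n G" by (intro solI tensI) (simp_all add: pointwise)
  ultimately show ?thesis by (simp add: fs.subspace_def)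
qed

lemma sol_small: "n < 2 \<Longrightarrow> sol n G = tens n"
  by (auto simp: sol_def tensD)

section \<open>Contractions, and degree two tensors as bilinear forms\<close>

definition ctl :: "(3 \<Rightarrow> 'k::field) \<Rightarrow> 'k tens \<Rightarrow> 'k tens" where
  "ctl v t = (\<lambda>w. \<Sum>i\<in>UNIV. v i * t (i # w))"

definition ctr :: "(3 \<Rightarrow> 'k::field) \<Rightarrow> 'k tens \<Rightarrow> 'k tens" where
  "ctr v t = (\<lambda>w. \<Sum>i\<in>UNIV. v i * t (w @ [i]))"

definition bl :: "'k::field tens \<Rightarrow> (3 \<Rightarrow> 'k) \<Rightarrow> (3 \<Rightarrow> 'k) \<Rightarrow> 'k" where
  "bl w u v = (\<Sum>i\<in>UNIV. \<Sum>j\<in>UNIV. u i * v j * w [i, j])"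

lemma ctl_lin: "lin (ctl v)"
  by (rule linI) (auto simp: pointwise ctl_def fun_eq_iff distrib_left sum.distrib sum_distrib_left mult_ac)

lemma ctr_lin: "lin (ctr v)"
  by (rule linI) (auto simp: pointwise ctr_def fun_eq_iff distrib_left sum.distrib sum_distrib_left mult_ac)

lemma ctl_vec: "ctl (u + v) t = ctl u t + ctl v t" "ctl (scl c u) t = scl c (ctl u t)"
  by (auto simp: pointwise ctl_def fun_eq_iff distrib_right sum.distrib sum_distrib_left mult.assoc)

lemma ctl_delta [simp]: "ctl (delta i) t w = t (i # w)"
proof -
  have "ctl (delta i) t w = (\<Sum>j\<in>UNIV. if i = j then t (j # w) else 0)"
    unfolding ctl_def by (rule sum.cong) (auto simp: delta_def)
  then show ?thesis by simp
qed

lemma ctl_tens: "t \<in> tens (Suc n) \<Longrightarrow> ctl v t \<in> tens n"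
  by (rule tensI) (simp add: ctl_def tensD)

lemma ctr_tens: "t \<in> tens (Suc n) \<Longrightarrow> ctr v t \<in> tens n"
  by (rule tensI) (simp add: ctr_def tensD)

lemma sum_rotate:
  fixes v :: "'l \<Rightarrow> 'k::field"
  shows "(\<Sum>i\<in>I. \<Sum>j\<in>J. \<Sum>l\<in>L. v l * F i j l) = (\<Sum>l\<in>L. v l * (\<Sum>i\<in>I. \<Sum>j\<in>J. F i j l))"
proof -
  have "(\<Sum>i\<in>I. \<Sum>j\<in>J. \<Sum>l\<in>L. v l * F i j l) = (\<Sum>i\<in>I. \<Sum>l\<in>L. \<Sum>j\<in>J. v l * F i j l)"
    by (intro sum.cong refl sum.swap)
  also have "\<dots> = (\<Sum>l\<in>L. \<Sum>i\<in>I. \<Sum>j\<in>J. v l * F i j l)"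
    by (rule sum.swap)
  finally show ?thesis by (simp add: sum_distrib_left)
qed

text \<open>Adjacent slots of the contracted tensor were adjacent before the contraction. Dually,
  the ideal of relations is stable under multiplication by degree one elements.\<close>

lemma ctl_sol: "t \<in> sol (Suc n) G \<Longrightarrow> ctl v t \<in> sol n G"
proof (rule solI)
  fix g a b assume t: "t \<in> sol (Suc n) G" and g: "g \<in> G"
  have "(\<Sum>i\<in>UNIV. \<Sum>j\<in>UNIV. g [i, j] * ctl v t (a @ [i, j] @ b))
      = (\<Sum>i\<in>UNIV. \<Sum>j\<in>UNIV. \<Sum>l\<in>UNIV. v l * (g [i, j] * t ((l # a) @ [i, j] @ b)))"
    by (simp add: ctl_def sum_distrib_left mult_ac)
  also have "\<dots> = (\<Sum>l\<in>UNIV. v l * (\<Sum>i\<in>UNIV. \<Sum>j\<in>UNIV. g [i, j] * t ((l # a) @ [i, j] @ b)))"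
    by (rule sum_rotate)
  also have "\<dots> = 0" using solD[OF t g] by (simp del: append.simps)
  finally show "(\<Sum>i\<in>UNIV. \<Sum>j\<in>UNIV. g [i, j] * ctl v t (a @ [i, j] @ b)) = 0" .
qed (simp add: sol_tens ctl_tens)

lemma ctr_sol: "t \<in> sol (Suc n) G \<Longrightarrow> ctr v t \<in> sol n G"
proof (rule solI)
  fix g a b assume t: "t \<in> sol (Suc n) G" and g: "g \<in> G"
  have "(\<Sum>i\<in>UNIV. \<Sum>j\<in>UNIV. g [i, j] * ctr v t (a @ [i, j] @ b))
      = (\<Sum>i\<in>UNIV. \<Sum>j\<in>UNIV. \<Sum>l\<in>UNIV. v l * (g [i, j] * t (a @ [i, j] @ (b @ [l]))))"
    by (simp add: ctr_def sum_distrib_left mult_ac)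
  also have "\<dots> = (\<Sum>l\<in>UNIV. v l * (\<Sum>i\<in>UNIV. \<Sum>j\<in>UNIV. g [i, j] * t (a @ [i, j] @ (b @ [l]))))"
    by (rule sum_rotate)
  also have "\<dots> = 0" using solD[OF t g] by (simp del: append.simps)
  finally show "(\<Sum>i\<in>UNIV. \<Sum>j\<in>UNIV. g [i, j] * ctr v t (a @ [i, j] @ b)) = 0" .
qed (simp add: sol_tens ctr_tens)

lemma slice_sol_gen:
  assumes "t \<in> sol (a + p) G" "length w = p"
  shows "(\<lambda>l. t (l @ w)) \<in> sol a G"
proof (rule solI)
  show "(\<lambda>l. t (l @ w)) \<in> tens a"
    using assms by (intro tensI) (auto intro!: tensD sol_tens)
  fix g u v assume "g \<in> G"
  then show "(\<Sum>i\<in>UNIV. \<Sum>j\<in>UNIV. g [i, j] * t ((u @ [i, j] @ v) @ w)) = 0"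
    using solD[OF assms(1), of g u "v @ w"] by simp
qed

lemma slice_sol: "t \<in> sol (Suc (Suc n)) G \<Longrightarrow> length w = n \<Longrightarrow> (\<lambda>l. t (l @ w)) \<in> sol 2 G"
  by (rule slice_sol_gen[of t 2 n]) simp_all

text \<open>The slices test the first two slots, the contractions of the first slot test all later
  pairs; together they cover every adjacent pair.\<close>

lemma sol_Suc_I:
  assumes "t \<in> tens (Suc (Suc n))" "\<And>i. ctl (delta i) t \<in> sol (Suc n) G"
    "\<And>w. length w = n \<Longrightarrow> (\<lambda>l. t (l @ w)) \<in> sol 2 G"
  shows "t \<in> sol (Suc (Suc n)) G"
proof (rule solI)
  fix g u v assume g: "g \<in> G"
  show "(\<Sum>i\<in>UNIV. \<Sum>j\<in>UNIV. g [i, j] * t (u @ [i, j] @ v)) = 0"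
  proof (cases u)
    case Nil
    show ?thesis
    proof (cases "length v = n")
      case True
      then show ?thesis using solD[OF assms(3)[OF True] g, of "[]" "[]"] Nil by simp
    qed (use Nil tensD[OF assms(1)] in simp)
  next
    case (Cons l u')
    then show ?thesis using solD[OF assms(2)[of l] g, of u' v] by simp
  qed
qed (rule assms(1))

text \<open>Fixes the order of the arguments: \<open>u\<close> enters the first slot and
  \<open>v\<close> the second.\<close>

lemma ctl_ctl: "ctl v (ctl u t) w = bl (\<lambda>l. t (l @ w)) u v"
  unfolding ctl_def bl_def sum_distrib_left
  by (subst sum.swap) (simp add: mult_ac)

lemma bl_add: "bl (a + b) u v = bl a u v + bl b u v" "bl (scl c a) u v = c * bl a u v"
  "bl w (x + y) v = bl w x v + bl w y v" "bl w (scl c x) v = c * bl w x v"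
  "bl w u (x + y) = bl w u x + bl w u y" "bl w u (scl c x) = c * bl w u x"
  by (simp_all add: pointwise bl_def distrib_left distrib_right sum.distrib sum_distrib_left mult_ac)

lemma bl_delta [simp]: "bl w (delta i) (delta j) = w [i, j]"
proof -
  have "bl w (delta i) (delta j) = (\<Sum>k\<in>UNIV. if i = k then (\<Sum>l\<in>UNIV. if j = l then w [k, l] else 0) else 0)"
    unfolding bl_def by (intro sum.cong refl) (simp add: delta_def if_distrib[where f="\<lambda>x. x * _"] eq_commute cong: if_cong)
  then show ?thesis by simp
qed

lemma vec_expand: "v = (\<Sum>i\<in>UNIV. scl (v i) (delta i))" for v :: "'i::finite \<Rightarrow> 'k::field"
  by (rule supp_on_expand) (auto simp: supp_on_def)

lemma tens_eqI: "t \<in> tens (Suc n) \<Longrightarrow> s \<in> tens (Suc n) \<Longrightarrow> (\<And>i. ctl (delta i) t = ctl (delta i) s) \<Longrightarrow> t = s"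
proof
  fix w assume *: "t \<in> tens (Suc n)" "s \<in> tens (Suc n)" "\<And>i. ctl (delta i) t = ctl (delta i) s"
  show "t w = s w"
  proof (cases w)
    case Nil then show ?thesis using * by (simp add: tensD)
  next
    case (Cons i v) then show ?thesis using fun_cong[OF *(3)[of i], of v] by simp
  qed
qed

section \<open>Algebras with a degree one element acting surjectively\<close>

text \<open>Dimension three in degree one is built into the index type; the assumption is dimension
  three in degree two, stated for functionals.\<close>

locale three_rel =
  fixes R :: "'k::field tens set"
  assumes dim_W: "fs.dim (sol 2 R) = 3"
begin

abbreviation C :: "nat \<Rightarrow> 'k tens set" where "C n \<equiv> sol n R"

lemma C0: "0 \<in> C n" and C_add: "t \<in> C n \<Longrightarrow> s \<in> C n \<Longrightarrow> t + s \<in> C n"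
  and C_scl: "t \<in> C n \<Longrightarrow> scl c t \<in> C n" and C_diff: "t \<in> C n \<Longrightarrow> s \<in> C n \<Longrightarrow> t - s \<in> C n"
  and C_sum: "(\<And>i. i \<in> I \<Longrightarrow> h i \<in> C n) \<Longrightarrow> (\<Sum>i\<in>I. h i) \<in> C n"
  by (auto intro: fs.subspace_0 fs.subspace_add fs.subspace_scale fs.subspace_diff fs.subspace_sum subspace_sol)

end

definition row :: "(3 \<Rightarrow> 'k::field) \<Rightarrow> 'k tens \<Rightarrow> 3 \<Rightarrow> 'k" where
  "row u w = (\<lambda>j. \<Sum>i\<in>UNIV. u i * w [i, j])"

lemma row_lin: "lin (row u)"
  by (rule linI) (auto simp: pointwise row_def fun_eq_iff distrib_left sum.distrib sum_distrib_left mult_ac)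

lemma bl_row: "bl w u v = (\<Sum>j\<in>UNIV. v j * row u w j)"
  unfolding bl_def row_def sum_distrib_left by (subst sum.swap) (simp add: mult_ac)

lemma row_bl: "row u w j = bl w u (delta j)"
proof -
  have "bl w u (delta j) = (\<Sum>k\<in>UNIV. if j = k then row u w k else 0)"
    unfolding bl_row by (rule sum.cong) (auto simp: delta_def)
  then show ?thesis by simp
qed

lemma bl_sum: "bl (\<Sum>i\<in>I. h i) u v = (\<Sum>i\<in>I. bl (h i) u v)" "bl w (\<Sum>i\<in>I. x i) v = (\<Sum>i\<in>I. bl w (x i) v)"
  "bl w u (\<Sum>i\<in>I. x i) = (\<Sum>i\<in>I. bl w u (x i))"
  "bl 0 u v = 0" "bl w 0 v = 0" "bl w u 0 = 0"
proof -
  show z: "bl 0 u v = 0" "bl w 0 v = 0" "bl w u 0 = 0" by (simp_all add: bl_def pointwise)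
  show "bl (\<Sum>i\<in>I. h i) u v = (\<Sum>i\<in>I. bl (h i) u v)"
    by (induction I rule: infinite_finite_induct) (simp_all add: bl_add z)
  show "bl w (\<Sum>i\<in>I. x i) v = (\<Sum>i\<in>I. bl w (x i) v)"
    by (induction I rule: infinite_finite_induct) (simp_all add: bl_add z)
  show "bl w u (\<Sum>i\<in>I. x i) = (\<Sum>i\<in>I. bl w u (x i))"
    by (induction I rule: infinite_finite_induct) (simp_all add: bl_add z)
qed

lemma bl_eqI: "w \<in> tens 2 \<Longrightarrow> w' \<in> tens 2 \<Longrightarrow> (\<And>u v. bl w u v = bl w' u v) \<Longrightarrow> w = w'"
proof
  fix l assume *: "w \<in> tens 2" "w' \<in> tens 2" "\<And>u v. bl w u v = bl w' u v"
  show "w l = w' l"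
  proof (cases "length l = 2")
    case True
    then obtain i j where "l = [i, j]" by (auto simp: length_Suc_conv numeral_2_eq_2)
    then show ?thesis using *(3)[of "delta i" "delta j"] by simp
  qed (use * tensD in metis)
qed

lemma ctl_sum: "ctl (\<Sum>i\<in>I. v i) t = (\<Sum>i\<in>I. ctl (v i) t)"
proof -
  have "ctl 0 t = 0" by (simp add: pointwise ctl_def fun_eq_iff)
  then show ?thesis
    by (induction I rule: infinite_finite_induct) (simp_all add: ctl_vec)
qed

lemma ctl_expand: "ctl u t = (\<Sum>i\<in>UNIV. scl (u i) (ctl (delta i) t))"
  by (subst vec_expand[of u]) (simp add: ctl_sum ctl_vec)

lemma ctl_ctr: "ctl v (ctr e t) = ctr e (ctl v t)"
  unfolding ctl_def ctr_def fun_eq_iff sum_distrib_left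
  by (intro allI, subst sum.swap) (simp add: mult_ac)

lemma lin_comp: "lin F \<Longrightarrow> lin G \<Longrightarrow> lin (F \<circ> G)"
  by (simp add: Vector_Spaces.linear_iff fs.vector_space_axioms)

lemma lin_funpow: "lin F \<Longrightarrow> lin (F ^^ n)" for F :: "('a \<Rightarrow> 'k::field) \<Rightarrow> 'a \<Rightarrow> 'k"
proof (induction n)
  case 0
  show ?case by (rule linI) simp_all
next
  case (Suc n)
  then have "lin (F \<circ> F ^^ n)" by (intro lin_comp)
  then show ?case by (simp only: funpow.simps)
qed

text \<open>A functional on degree two that vanishes on all products of \<open>x\<close> with degree
  one is zero; that is, left multiplication by \<open>x\<close> maps degree one onto degree
  two.\<close>

locale left_full = three_rel R for R :: "'k::field tens set" +
  fixes x :: "3 \<Rightarrow> 'k"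
  assumes full: "w \<in> sol 2 R \<Longrightarrow> (\<And>v. bl w x v = 0) \<Longrightarrow> w = 0"
begin

text \<open>Restricting the first argument to \<open>x\<close> is injective on \<open>C 2\<close>,
  and both spaces have dimension three. The elements \<open>dual j\<close> below are the preimages
  of the unit vectors.\<close>

lemma row_surj: "row x ` C 2 = UNIV"
proof (rule dim_subset_eq)
  have U: "UNIV = supp_on (UNIV :: 3 set)" by (auto simp: supp_on_def)
  show "fin_dim (UNIV :: (3 \<Rightarrow> 'k) set)" unfolding U by (rule fin_dim_supp_on) simp
  have "fs.dim (row x ` C 2) = fs.dim (C 2)"
    by (rule dim_inj_image[OF row_lin subspace_sol fin_dim_sol])
      (use full in \<open>auto simp: bl_row pointwise\<close>)
  then show "fs.dim (UNIV :: (3 \<Rightarrow> 'k) set) \<le> fs.dim (row x ` C 2)"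
    using dim_W by (subst U) (simp add: dim_supp_on)
  show "fs.subspace (row x ` C 2)" by (rule fsp.linear_subspace_image[OF row_lin subspace_sol])
qed auto

definition dual :: "3 \<Rightarrow> 'k tens" where
  "dual j = (SOME w. w \<in> C 2 \<and> row x w = delta j)"

lemma dual: "dual j \<in> C 2" "row x (dual j) = delta j"
proof -
  have "\<exists>w. w \<in> C 2 \<and> row x w = delta j" using row_surj by (metis UNIV_I imageE)
  from someI_ex[OF this] show "dual j \<in> C 2" "row x (dual j) = delta j" by (auto simp: dual_def)
qed

text \<open>The relations say that the product of \<open>u\<close> and \<open>v\<close> equals the product of \<open>x\<close> and \<open>sg u v\<close>.\<close>

definition sg :: "(3 \<Rightarrow> 'k) \<Rightarrow> (3 \<Rightarrow> 'k) \<Rightarrow> 3 \<Rightarrow> 'k" where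
  "sg u v = (\<lambda>j. bl (dual j) u v)"

text \<open>In the algebra, u x = x (tau u): the factor \<open>x\<close> is moved to the
  front.\<close>

definition tau :: "(3 \<Rightarrow> 'k) \<Rightarrow> 3 \<Rightarrow> 'k" where
  "tau u = sg u x"

lemma sg_add: "sg (a + b) v = sg a v + sg b v" "sg (scl c a) v = scl c (sg a v)"
  "sg u (y + z) = sg u y + sg u z" "sg u (scl c y) = scl c (sg u y)"
  by (simp_all add: sg_def fun_eq_iff pointwise bl_add)

lemma tau_pow_lin: "lin (tau ^^ n)"
  by (intro lin_funpow linI) (simp_all add: tau_def sg_add)

lemma dual_expand: "w \<in> C 2 \<Longrightarrow> w = (\<Sum>j\<in>UNIV. scl (row x w j) (dual j))"
proof -
  assume w: "w \<in> C 2"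
  let ?s = "\<Sum>j\<in>UNIV. scl (row x w j) (dual j)"
  have "row x ?s = row x w"
    by (subst (2) vec_expand) (simp add: lin_simps(2,6)[OF row_lin] dual)
  then have "bl (w - ?s) x v = 0" for v by (simp add: bl_row pointwise lin_simps(5)[OF row_lin])
  moreover have "w - ?s \<in> C 2" by (intro C_diff C_sum C_scl w dual)
  ultimately have "w - ?s = 0" by (intro full)
  then show ?thesis by simp
qed

lemma bl_sg: "w \<in> C 2 \<Longrightarrow> bl w u v = bl w x (sg u v)"
  by (subst dual_expand, assumption) (simp add: bl_sum(1) bl_add(2) bl_row[of w] sg_def mult.commute)

lemma sg_x: "sg x v = v"
  by (rule ext) (simp add: sg_def bl_row dual, simp add: delta_def if_distrib[where f="\<lambda>x. _ * x"] cong: if_cong)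

lemma tau_x: "(tau ^^ n) x = x"
  by (induction n) (simp_all add: tau_def sg_x)

lemma slide:
  assumes t: "t \<in> C (Suc (Suc n))"
  shows "ctl v (ctl u t) = ctl (sg u v) (ctl x t)"
proof
  fix w
  show "ctl v (ctl u t) w = ctl (sg u v) (ctl x t) w"
  proof (cases "length w = n")
    case True
    with t show ?thesis unfolding ctl_ctl by (intro bl_sg slice_sol)
  next
    case False
    have "ctl a (ctl b t) \<in> tens n" for a b using t sol_tens ctl_tens by blast
    then show ?thesis using False tensD by metis
  qed
qed

text \<open>The value of \<open>t\<close> on x^n v. Since all products of degree n + 1 turn out to
  have this form, the three numbers in \<open>fvec n t\<close> represent \<open>t\<close>.\<close>

definition fv :: "nat \<Rightarrow> 'k tens \<Rightarrow> (3 \<Rightarrow> 'k) \<Rightarrow> 'k" where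
  "fv n t v = ctl v ((ctl x ^^ n) t) []"

definition fvec :: "nat \<Rightarrow> 'k tens \<Rightarrow> 3 \<Rightarrow> 'k" where
  "fvec n t = (\<lambda>j. (ctl x ^^ n) t [j])"

lemma fv_fvec: "fv n t v = (\<Sum>j\<in>UNIV. v j * fvec n t j)"
  by (simp add: fv_def fvec_def ctl_def)

lemma fvec_lin: "lin (fvec n)"
  by (rule linI) (simp_all add: fvec_def fun_eq_iff lin_simps(1,2)[OF lin_funpow[OF ctl_lin]] pointwise)

lemma fv_add: "fv n t (u + v) = fv n t u + fv n t v" "fv n t (scl c u) = c * fv n t u"
  "fv n (t + s) v = fv n t v + fv n s v" "fv n (scl c t) v = c * fv n t v"
  by (simp_all add: pointwise fv_fvec lin_simps(1,2)[OF fvec_lin] distrib_left distrib_right sum.distrib sum_distrib_left mult_ac)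

lemma fv_Suc: "fv (Suc n) t v = fv n (ctl x t) v" "fvec (Suc n) t = fvec n (ctl x t)"
  by (simp_all add: fv_def fvec_def funpow_swap1)

text \<open>In the algebra, u x^n v = x^n (tau^n u) v = x^(n+1) (sg (tau^n u) v).\<close>

lemma key: "t \<in> C (Suc (Suc n)) \<Longrightarrow> fv n (ctl u t) v = fv (Suc n) t (sg ((tau ^^ n) u) v)"
proof (induction n arbitrary: t u)
  case 0
  show ?case using slide[OF 0, where u=u and v=v] by (simp add: fv_def)
next
  case (Suc n)
  have "fv (Suc n) (ctl u t) v = fv n (ctl (tau u) (ctl x t)) v"
    using slide[OF Suc.prems, where u=u and v=x] by (simp add: fv_Suc tau_def)
  also have "\<dots> = fv (Suc n) (ctl x t) (sg ((tau ^^ n) (tau u)) v)"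
    by (intro Suc.IH ctl_sol Suc.prems)
  finally show ?case by (simp add: fv_Suc funpow_swap1)
qed

text \<open>By \<open>key\<close>, every first factor can be moved behind a power of
  \<open>x\<close>, so the products x^n v span degree n + 1.\<close>

lemma fvec_inj: "t \<in> C (Suc n) \<Longrightarrow> fvec n t = 0 \<Longrightarrow> t = 0"
proof (induction n arbitrary: t)
  case 0
  have "t [j] = 0" for j using fun_cong[OF 0(2), of j] by (simp add: fvec_def pointwise)
  then show ?case using tensD[OF sol_tens[OF 0(1)]]
    by (auto simp: fun_eq_iff pointwise) (metis length_Suc_conv length_0_conv One_nat_def)
next
  case (Suc n)
  have "fv n (ctl u t) v = 0" for u v using key[OF Suc.prems(1)] Suc.prems(2) by (simp add: fv_fvec pointwise)
  moreover have "fvec n s j = fv n s (delta j)" for s j by (simp add: fvec_def fv_def)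
  ultimately have "fvec n (ctl u t) = 0" for u by (simp add: fun_eq_iff pointwise)
  then have "ctl u t = 0" for u using Suc.IH Suc.prems(1) ctl_sol by blast
  then show ?case
    by (intro tens_eqI[OF sol_tens[OF Suc.prems(1)] sol_tens[OF C0]]) (simp add: lin_simps(3)[OF ctl_lin])
qed

lemma dim_fvec: "fs.dim (fvec n ` C (Suc n)) = fs.dim (C (Suc n))"
  by (rule dim_inj_image[OF fvec_lin subspace_sol fin_dim_sol fvec_inj])

text \<open>The value on x^(n+1) v is the value of the contraction with \<open>x\<close> on x^n v.
  Thus the components of all degrees become a decreasing chain of subspaces of one three-dimensional
  space.\<close>

lemma fvec_decr: "fvec (Suc n) ` C (Suc (Suc n)) \<subseteq> fvec n ` C (Suc n)"
  by (auto simp: fv_Suc(2) intro: ctl_sol)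

lemma fin_dim_3: "fin_dim (S :: (3 \<Rightarrow> 'k) set)"
  by (rule fin_dim_subset[OF fin_dim_supp_on[of UNIV]]) (auto simp: supp_on_def)

lemma dim_decr: "fs.dim (C (Suc (Suc n))) \<le> fs.dim (C (Suc n))"
  using dim_subset[OF fvec_decr fin_dim_3] by (simp add: dim_fvec)

section \<open>Extending tensors once the chain repeats a term\<close>

context
  fixes m :: nat and t :: "'k tens"
  assumes m: "1 \<le> m" and stab: "fvec m ` C (Suc m) \<subseteq> fvec (Suc m) ` C (Suc (Suc m))"
    and t: "t \<in> C (Suc (Suc m))"
begin

text \<open>Both sides are values of \<open>t\<close> on x^(m-1) a b e, bracketed as a (b e) and as
  (a b) e. Since \<open>1 \<le> m\<close>, a tensor of degree three is left after m - 1
  contractions.\<close>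

lemma assoc1: "fv (Suc m) t (sg (tau a) (sg b e)) = fv (Suc m) t (sg (sg a b) e)"
proof -
  define s where "s = (ctl x ^^ (m - 1)) t"
  have "(ctl x ^^ i) t \<in> C (Suc (Suc (Suc (m - 1 - i))))" if "i \<le> m - 1" for i
    using that
  proof (induction i)
    case (Suc i)
    then have "m - 1 - i = Suc (m - 1 - Suc i)" by auto
    then show ?case using Suc ctl_sol[of "(ctl x ^^ i) t"] by simp
  qed (use t m in simp)
  from this[of "m - 1"] have s: "s \<in> C (Suc (Suc (Suc 0)))" by (simp add: s_def)
  have "(ctl x ^^ Suc m) t = (ctl x ^^ (2 + (m - 1))) t" using m by (intro arg_cong[where f="\<lambda>n. (ctl x ^^ n) t"]) simp
  then have f: "fv (Suc m) t = fv 2 s" by (intro ext) (simp only: fv_def s_def funpow_add o_apply)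
  have k1: "fv 0 (ctl p (ctl q s)) e = fv (Suc 0) (ctl q s) (sg p e)" for p q
    using key[OF ctl_sol[OF s], of p q e] by (simp only: funpow_0)
  have k2: "fv (Suc 0) (ctl q s) v = fv 2 s (sg (tau q) v)" for q v
    using key[OF s, of q v] by (simp only: funpow_0 funpow.simps o_apply id_apply numeral_2_eq_2)
  have "fv 2 s (sg (tau a) (sg b e)) = fv 0 (ctl b (ctl a s)) e"
    by (simp only: k1 k2)
  also have "\<dots> = fv 0 (ctl (sg a b) (ctl x s)) e"
    by (simp only: slide[OF s, where u=a and v=b])
  also have "\<dots> = fv 2 s (sg (sg a b) e)"
    using tau_x[of 1] by (simp only: k1 k2) (simp add: sg_x)
  finally show ?thesis by (simp only: f)
qed

text \<open>The product u v x^m is computed in two ways: by moving both factors through x^m, or by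
  first replacing u v with x (sg u v). Stability supplies a tensor on which this product can be
  evaluated.\<close>

lemma assoc2: "fv (Suc m) t (sg (sg ((tau ^^ m) u) ((tau ^^ m) v)) e) = fv (Suc m) t (sg ((tau ^^ m) (sg u v)) e)"
proof -
  have p: "(ctl x ^^ i) (ctr e t) = ctr e ((ctl x ^^ i) t)" for i
    by (induction i) (simp_all add: ctl_ctr)
  have pc: "(ctl x ^^ i) t \<in> C (Suc (Suc (m - i)))" if "i \<le> m" for i
    using that
  proof (induction i)
    case (Suc i)
    then have "m - i = Suc (m - Suc i)" by auto
    then show ?case using Suc ctl_sol[of "(ctl x ^^ i) t"] by simp
  qed (use t in simp)
  have "fv m (ctr e t) v = fv (Suc m) t (sg v e)" for v
  proof -
    have "fv m (ctr e t) v = ctl e (ctl v ((ctl x ^^ m) t)) []"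
      by (simp add: fv_def p ctl_ctr) (simp add: ctl_def ctr_def)
    also have "\<dots> = fv (Suc m) t (sg v e)"
      using slide[OF pc[of m]] by (simp add: fv_def)
    finally show ?thesis .
  qed
  \<comment> \<open>The functional sending v to t(x^m, v, e) comes from degree m + 1, hence by
    stability also from a tensor of degree m + 2.\<close>
  moreover have "fvec m (ctr e t) \<in> fvec (Suc m) ` C (Suc (Suc m))"
    using stab ctr_sol[OF t] by blast
  then obtain s where s: "s \<in> C (Suc (Suc m))" "fvec (Suc m) s = fvec m (ctr e t)"
    by (auto simp: image_iff)
  ultimately have g: "fv (Suc m) s v = fv (Suc m) t (sg v e)" for v by (metis fv_fvec)
  obtain m' where m': "m = Suc m'" using m by (cases m) auto
  have *: "fv m' (ctl b (ctl a s)) x = fv (Suc m) s (sg ((tau ^^ m) a) ((tau ^^ m) b))" for a b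
    using key[of "ctl a s" m' b x] key[OF s(1), of a "sg ((tau ^^ m') b) x"] ctl_sol[OF s(1)]
    by (simp add: m' tau_def)
  have "fv (Suc m) s (sg ((tau ^^ m) u) ((tau ^^ m) v)) = fv (Suc m) s (sg ((tau ^^ m) x) ((tau ^^ m) (sg u v)))"
    using slide[OF s(1), where u=u and v=v] by (simp flip: *)
  then show ?thesis by (simp add: g tau_x sg_x)
qed

text \<open>A tensor \<open>r\<close> one degree higher with the same vector must take on u x^(m+1)
  v the value of \<open>fv (Suc m) t\<close> at sg (tau^(m+1) u) v. This prescribes its first
  contractions, which exist by stability; the two associativity laws then give the relations at the
  first two slots.\<close>

lemma extend: "fvec (Suc m) t \<in> fvec (Suc (Suc m)) ` C (Suc (Suc (Suc m)))"
proof -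
  let ?f = "fv (Suc m) t"
  have "\<exists>s \<in> C (Suc (Suc m)). fvec (Suc m) s = fvec m (ctl (tau (delta i)) t)" for i
  proof -
    have "fvec m (ctl (tau (delta i)) t) \<in> fvec (Suc m) ` C (Suc (Suc m))"
      by (rule subsetD[OF stab imageI[OF ctl_sol[OF t]]])
    then show ?thesis by (auto simp: image_iff)
  qed
  then obtain s where s: "\<And>i. s i \<in> C (Suc (Suc m))"
    and fs: "\<And>i. fvec (Suc m) (s i) = fvec m (ctl (tau (delta i)) t)" by metis
  have fs': "fv (Suc m) (s i) v = ?f (sg ((tau ^^ Suc m) (delta i)) v)" for i v
    using key[OF t, of "tau (delta i)" v] fs[of i] by (simp add: fv_fvec funpow_swap1)
  define r where "r = (\<lambda>w. case w of [] \<Rightarrow> 0 | i # w' \<Rightarrow> s i w')"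
  have ri: "ctl (delta i) r = s i" for i by (rule ext) (simp add: r_def)
  have rt: "r \<in> tens (Suc (Suc (Suc m)))"
    by (rule tensI) (auto simp: r_def tensD[OF sol_tens[OF s]] split: list.split)
  have ru: "ctl u r = (\<Sum>i\<in>UNIV. scl (u i) (s i))" for u by (subst ctl_expand) (simp add: ri)
  have ruC: "ctl u r \<in> C (Suc (Suc m))" for u unfolding ru by (intro C_sum C_scl s)
  have fsum: "?f (\<Sum>i\<in>I. h i) = (\<Sum>i\<in>I. ?f (h i))" for I :: "3 set" and h
    by (induction I rule: infinite_finite_induct) (simp_all add: fv_add, simp_all add: fv_fvec pointwise)
  have fru: "fv (Suc m) (ctl u r) v = ?f (sg ((tau ^^ Suc m) u) v)" for u v
  proof -
    have "fv (Suc m) (ctl u r) v = (\<Sum>i\<in>UNIV. u i * fv (Suc m) (s i) v)"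
      unfolding ru by (simp add: pointwise fv_fvec lin_simps(2,6)[OF fvec_lin] sum_distrib_left) (subst sum.swap, simp add: mult_ac)
    also have "\<dots> = ?f (\<Sum>i\<in>UNIV. sg ((tau ^^ Suc m) (scl (u i) (delta i))) v)"
      by (simp only: fs' fsum lin_simps(2)[OF tau_pow_lin] sg_add fv_add)
    also have "(\<Sum>i\<in>UNIV. sg ((tau ^^ Suc m) (scl (u i) (delta i))) v) = sg (\<Sum>i\<in>UNIV. (tau ^^ Suc m) (scl (u i) (delta i))) v"
      by (simp add: sg_def fun_eq_iff bl_sum(2) pointwise)
    finally show ?thesis by (simp only: lin_simps(6)[OF tau_pow_lin, symmetric] vec_expand[of u, symmetric])
  qed
  \<comment> \<open>The relation u v = x (sg u v) at the first two slots. By \<open>fvec_inj\<close>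
    it suffices to compare values on x^m e, where \<open>assoc1\<close> and \<open>assoc2\<close>
    apply.\<close>
  have sl: "ctl v (ctl u r) = ctl (sg u v) (ctl x r)" for u v
  proof -
    have "fv m (ctl v (ctl u r)) e = fv m (ctl (sg u v) (ctl x r)) e" for e
      using assoc1[of "(tau ^^ m) u" "(tau ^^ m) v" e] assoc2[of u v e] tau_x[of "Suc m"]
      unfolding key[OF ruC] fru by (simp add: sg_x)
    moreover have "fvec m s j = fv m s (delta j)" for s j by (simp add: fvec_def fv_def)
    ultimately have "fvec m (ctl v (ctl u r) - ctl (sg u v) (ctl x r)) = 0"
      by (simp add: fun_eq_iff pointwise lin_simps(5)[OF fvec_lin])
    then have "ctl v (ctl u r) - ctl (sg u v) (ctl x r) = 0"
      by (intro fvec_inj[of _ m] C_diff ctl_sol ruC)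
    then show ?thesis by simp
  qed
  have "r \<in> C (Suc (Suc (Suc m)))"
  proof (rule sol_Suc_I[OF rt])
    fix w :: "3 list" assume w: "length w = Suc m"
    let ?b = "\<lambda>l. r (l @ w)"
    \<comment> \<open>The element of \<open>C 2\<close> with the same restriction to
      \<open>x\<close> as the slice; by \<open>sl\<close> the slice is determined by this
      restriction, so the two coincide.\<close>
    let ?w = "\<Sum>j\<in>UNIV. scl (row x ?b j) (dual j)"
    have b: "?b \<in> tens 2" using w by (intro tensI tensD[OF rt]) simp
    have W: "?w \<in> C 2" by (intro C_sum C_scl dual)
    have "row x ?w = row x ?b"
      by (subst (3) vec_expand) (simp add: lin_simps(2,6)[OF row_lin] dual)
    then have "bl ?w u v = bl ?b u v" for u v
      unfolding bl_sg[OF W, of u v] using fun_cong[OF sl[of v u], of w] by (simp only: ctl_ctl bl_row)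
    then have "?w = ?b" by (intro bl_eqI b sol_tens[OF W])
    then show "?b \<in> C 2" using W by simp
  qed (simp add: ri s)
  moreover have "fvec (Suc (Suc m)) r = fvec (Suc m) t"
  proof
    fix j
    have "fvec (Suc (Suc m)) r j = fv (Suc m) (ctl x r) (delta j)"
      by (simp only: fv_def fvec_def ctl_delta funpow_Suc_right o_apply)
    also have "\<dots> = ?f (delta j)" by (simp only: fru tau_x sg_x)
    also have "\<dots> = fvec (Suc m) t j" by (simp only: fv_def fvec_def ctl_delta)
    finally show "fvec (Suc (Suc m)) r j = fvec (Suc m) t j" .
  qed
  ultimately show ?thesis by (intro image_eqI[of _ _ r]) simp_all
qed

end

text \<open>Equal dimensions make two consecutive terms of the chain equal, and
  \<open>extend\<close> propagates the equality. The coincidence of the dimensions in degrees one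
  and two is excluded, because associativity is first felt in degree three.\<close>

theorem dim_stable:
  assumes "2 \<le> n" "fs.dim (C (Suc n)) = fs.dim (C n)"
  shows "fs.dim (C (Suc (Suc n))) = fs.dim (C (Suc n))"
proof -
  obtain m where m: "n = Suc m" "1 \<le> m" using assms(1) by (cases n) auto
  have "fvec (Suc m) ` C (Suc (Suc m)) = fvec m ` C (Suc m)"
    using assms(2) by (intro dim_subset_eq fvec_decr fin_dim_3 fsp.linear_subspace_image[OF fvec_lin subspace_sol])
      (simp add: dim_fvec m)
  then have "fvec (Suc m) ` C (Suc (Suc m)) \<subseteq> fvec (Suc (Suc m)) ` C (Suc (Suc (Suc m)))"
    using extend[OF m(2)] by blast
  then have "fvec (Suc m) ` C (Suc (Suc m)) = fvec (Suc (Suc m)) ` C (Suc (Suc (Suc m)))"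
    using fvec_decr by blast
  then show ?thesis using dim_fvec[of "Suc m"] dim_fvec[of "Suc (Suc m)"] m by simp
qed

end

section \<open>Linearly independent pairs and common zeros\<close>

definition indep2 :: "('a \<Rightarrow> 'k::field) \<Rightarrow> ('a \<Rightarrow> 'k) \<Rightarrow> bool" where
  "indep2 f g \<longleftrightarrow> (\<forall>a b. scl a f + scl b g = 0 \<longrightarrow> a = 0 \<and> b = 0)"

lemma indep2D: "indep2 f g \<Longrightarrow> scl a f + scl b g = 0 \<Longrightarrow> a = 0 \<and> b = 0"
  by (simp add: indep2_def)

lemma indep2_nz: "indep2 f g \<Longrightarrow> f \<noteq> 0" "indep2 f g \<Longrightarrow> g \<noteq> 0"
  using indep2D[of f g 1 0] indep2D[of f g 0 1] by auto

lemma indep2_iff: "indep2 f g \<longleftrightarrow> fs.independent {f, g} \<and> f \<noteq> g"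
proof
  assume ind: "indep2 f g"
  have "f \<notin> fs.span {g}"
  proof
    assume "f \<in> fs.span {g}"
    then obtain c where "f = scl c g" by (auto simp: fs.span_singleton)
    then show False using indep2D[OF ind, of 1 "- c"] by simp
  qed
  moreover have "fs.independent {g}" using indep2_nz(2)[OF ind] by simp
  ultimately have "fs.independent {f, g}" by (rule fs.independent_insertI)
  moreover have "f \<noteq> g" using \<open>f \<notin> fs.span {g}\<close> fs.span_base[of g "{g}"] by blast
  ultimately show "fs.independent {f, g} \<and> f \<noteq> g" ..
next
  assume *: "fs.independent {f, g} \<and> f \<noteq> g"
  show "indep2 f g" unfolding indep2_def
  proof (intro allI impI)
    fix a b assume ab: "scl a f + scl b g = 0"
    let ?u = "\<lambda>v. if v = f then a else b"
    have s: "(\<Sum>v\<in>{f, g}. scl (?u v) v) = 0" using * ab by (cases "g = f") auto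
    have "?u v = 0" if "v \<in> {f, g}" for v
      using fs.independentD[OF _ _ _ s that] * by blast
    from this[of f] this[of g] show "a = 0 \<and> b = 0" using * by (simp split: if_splits)
  qed
qed

lemma not_indep2:
  assumes "\<not> indep2 f g" "f \<noteq> 0"
  obtains c where "g = scl c f"
proof -
  obtain a b where ab: "scl a f + scl b g = 0" "\<not> (a = 0 \<and> b = 0)"
    using assms by (auto simp: indep2_def)
  then have "b \<noteq> 0" using assms(2) by auto
  have "scl (inverse b) (scl a f + scl b g) = 0" using ab by simp
  then have "g = scl (- inverse b * a) f"
    using \<open>b \<noteq> 0\<close> by (simp add: fs.scale_right_distrib add_eq_0_iff)
  then show thesis by (rule that)
qed

lemma card_indep_le:
  assumes "fin_dim S" "fs.independent B" "B \<subseteq> S"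
  shows "card B \<le> fs.dim S"
  using dim_subset[OF assms(3,1)] assms(2) by (simp add: fs.dim_eq_card_independent)

lemma dim_ge_2E:
  assumes "fs.subspace S" "fin_dim S" "2 \<le> fs.dim S"
  obtains f g where "f \<in> S" "g \<in> S" "indep2 f g"
proof -
  obtain B where B: "B \<subseteq> S" "finite B" "fs.independent B" "fs.span B = S" "card B = fs.dim S"
    by (rule fin_dim_basis[OF assms(1,2)])
  obtain f where f: "f \<in> B" using B(5) assms(3) by (cases "B = {}") auto
  have "card (B - {f}) \<noteq> 0" using B(2,5) assms(3) f by simp
  then obtain g where g: "g \<in> B - {f}" by (metis card.empty equals0I)
  have "fs.independent {f, g}" using fs.independent_mono[OF B(3), of "{f, g}"] f g by auto
  then show thesis using that[of f g] f g B(1) by (auto simp: indep2_iff)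
qed

lemma dim_le_2D:
  assumes "fin_dim S" "fs.dim S \<le> 2" "f \<in> S" "g \<in> S" "h \<in> S" "indep2 f g"
  shows "\<exists>a b. h = scl a f + scl b g"
proof -
  have ind: "fs.independent {f, g}" "f \<noteq> g" using assms(6) by (auto simp: indep2_iff)
  have "h \<in> fs.span {f, g}"
  proof (rule ccontr)
    assume h: "h \<notin> fs.span {f, g}"
    moreover have "f \<in> fs.span {f, g}" "g \<in> fs.span {f, g}" by (rule fs.span_base, simp)+
    ultimately have "h \<notin> {f, g}" by blast
    then have "card {h, f, g} = 3" using ind(2) by simp
    then show False
      using card_indep_le[OF assms(1) fs.independent_insertI[OF h ind(1)]] assms by simp
  qed
  then obtain a where "h - scl a f \<in> fs.span {g}" by (auto simp: fs.span_breakdown_eq[of h f])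
  then obtain b where "h - scl a f = scl b g" by (auto simp: fs.span_singleton)
  then show ?thesis by (metis diff_add_cancel add.commute)
qed

lemma basis3:
  assumes "fs.subspace S" "fin_dim S" "fs.dim S = 3" "p \<in> S" "q \<in> S" "indep2 p q"
  obtains r where "r \<in> S" "\<And>w. w \<in> S \<Longrightarrow> \<exists>a b c. w = scl a p + scl b q + scl c r"
proof -
  have ind: "fs.independent {p, q}" "p \<noteq> q" using assms(6) by (auto simp: indep2_iff)
  obtain B where B: "{p, q} \<subseteq> B" "B \<subseteq> S" "finite B" "fs.independent B" "fs.span B = S"
    by (rule extend_basis[OF assms(1,2) ind(1)]) (use assms in auto)
  have "card B = 3" using fs.dim_span_eq_card_independent[OF B(4)] B(5) assms(3) by simp
  then have "card (B - {p, q}) = 1" using B(1,3) ind(2) by (simp add: card_Diff_subset)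
  then obtain r where "B - {p, q} = {r}" by (auto simp: card_1_singleton_iff)
  then have Br: "B = {p, q, r}" using B(1) by auto
  have "\<exists>a b c. w = scl a p + scl b q + scl c r" if "w \<in> S" for w
  proof -
    have "w \<in> fs.span {p, q, r}" using that B(5) Br by simp
    then obtain a where "w - scl a p \<in> fs.span {q, r}" by (auto simp: fs.span_breakdown_eq[of w p])
    then obtain b where "w - scl a p - scl b q \<in> fs.span {r}"
      by (auto simp: fs.span_breakdown_eq[of "w - scl a p" q])
    then obtain c where "w - scl a p - scl b q = scl c r" by (auto simp: fs.span_singleton)
    then have "w = scl a p + scl b q + scl c r" by (simp add: algebra_simps)
    then show ?thesis by blast
  qed
  then show thesis using that[of r] B(2) Br by auto
qed

lemma basis3_1:
  assumes "fs.subspace S" "fin_dim S" "fs.dim S = 3" "p \<in> S" "p \<noteq> 0"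
  obtains q r where "q \<in> S" "r \<in> S" "indep2 p q" "\<And>w. w \<in> S \<Longrightarrow> \<exists>a b c. w = scl a p + scl b q + scl c r"
proof -
  obtain B where B: "{p} \<subseteq> B" "B \<subseteq> S" "finite B" "fs.independent B" "fs.span B = S"
    by (rule extend_basis[OF assms(1,2), of "{p}"]) (use assms in auto)
  have "card B = 3" using fs.dim_span_eq_card_independent[OF B(4)] B(5) assms(3) by simp
  then have "card (B - {p}) \<noteq> 0" using B(1,3) by simp
  then obtain q where q: "q \<in> B - {p}" by (metis card.empty equals0I)
  have "indep2 p q" using fs.independent_mono[OF B(4), of "{p, q}"] B(1) q by (auto simp: indep2_iff)
  moreover have "q \<in> S" using q B(2) by auto
  ultimately show thesis using basis3[OF assms(1-4), of q] that by metis
qed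

text \<open>Linear forms and vectors share one type; in \<open>pr f v\<close> the first argument is
  the form.\<close>

definition pr :: "(3 \<Rightarrow> 'k::field) \<Rightarrow> (3 \<Rightarrow> 'k) \<Rightarrow> 'k" where
  "pr f v = (\<Sum>j\<in>UNIV. v j * f j)"

lemma pr_simps: "pr (f + g) v = pr f v + pr g v" "pr (scl c f) v = c * pr f v" "pr 0 v = 0"
  "pr f (u + v) = pr f u + pr f v" "pr f (scl c v) = c * pr f v" "pr f 0 = 0"
  "pr f (- v) = - pr f v" "pr (- f) v = - pr f v" "pr f (u - v) = pr f u - pr f v" "pr (f - g) v = pr f v - pr g v"
  by (simp_all add: pr_def pointwise distrib_left distrib_right sum.distrib sum_distrib_left mult_ac
      sum_negf right_diff_distrib left_diff_distrib sum_subtractf)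

lemma bl_pr: "bl w u v = pr (row u w) v"
  by (simp add: bl_row pr_def)

lemma pr_delta [simp]: "pr f (delta i) = f i" "pr (delta i) v = v i"
proof -
  have "pr f (delta i) = (\<Sum>j\<in>UNIV. if i = j then f j else 0)"
    unfolding pr_def by (rule sum.cong) (auto simp: delta_def)
  then show "pr f (delta i) = f i" by simp
  have "pr (delta i) v = (\<Sum>j\<in>UNIV. if i = j then v j else 0)"
    unfolding pr_def by (rule sum.cong) (auto simp: delta_def)
  then show "pr (delta i) v = v i" by simp
qed

lemma pr_nz: "f \<noteq> 0 \<Longrightarrow> \<exists>v. pr f v \<noteq> 0"
  by (metis pr_delta(1) ext zero_fun_apply)

lemma pr_nz': "f \<noteq> 0 \<Longrightarrow> \<exists>v. pr f v = 1"
proof -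
  assume "f \<noteq> 0"
  then obtain v where "pr f v \<noteq> 0" using pr_nz by blast
  then have "pr f (scl (inverse (pr f v)) v) = 1" by (simp add: pr_simps)
  then show ?thesis by blast
qed

lemma pr_eqI: "(\<And>v. pr f v = pr g v) \<Longrightarrow> f = g"
  by (rule ext) (metis pr_delta(1))

text \<open>Two linear forms map a three-dimensional space to a plane, so there is a kernel.\<close>

lemma common_zero2: "\<exists>k. k \<noteq> 0 \<and> pr f k = 0 \<and> pr g k = 0"
proof -
  let ?U = "supp_on UNIV :: (3 \<Rightarrow> 'a) set" and ?V = "supp_on UNIV :: (bool \<Rightarrow> 'a) set"
  let ?F = "\<lambda>k (b :: bool). if b then pr f k else pr g k"
  have lin: "lin ?F" by (rule linI) (auto simp: fun_eq_iff pointwise pr_simps)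
  have U: "fin_dim ?U" "fs.dim ?U = 3" by (simp_all add: fin_dim_supp_on dim_supp_on)
  have "fs.dim (?F ` ?U) \<le> fs.dim ?V"
    by (rule dim_subset[OF _ fin_dim_supp_on[OF finite]]) (simp add: supp_on_def)
  also have "fs.dim ?V = 2" by (simp add: dim_supp_on)
  finally have "fs.dim {k \<in> ?U. ?F k = 0} \<noteq> 0"
    using rank_nullity[OF lin subspace_supp_on U(1)] U(2) by linarith
  then have "{k \<in> ?U. ?F k = 0} \<noteq> {0}" using dim_zero by metis
  moreover have "0 \<in> {k \<in> ?U. ?F k = 0}" using lin_simps(3)[OF lin] by (simp add: supp_on_def pointwise)
  ultimately obtain k where k: "?F k = 0" "k \<noteq> 0" by blast
  show ?thesis using fun_cong[OF k(1), of True] fun_cong[OF k(1), of False] k(2) by (auto simp: pointwise)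
qed

text \<open>The dependency expresses one form through the other two, and a common zero of those two
  serves all three.\<close>

lemma common_zero3:
  assumes "scl a f + scl b g + scl c h = 0" "a \<noteq> 0 \<or> b \<noteq> 0 \<or> c \<noteq> 0"
  shows "\<exists>k. k \<noteq> 0 \<and> pr f k = 0 \<and> pr g k = 0 \<and> pr h k = 0"
proof -
  have *: "a * pr f v + b * pr g v + c * pr h v = 0" for v
    using arg_cong[OF assms(1), of "\<lambda>u. pr u v"] by (simp add: pr_simps)
  consider "a \<noteq> 0" | "b \<noteq> 0" | "c \<noteq> 0" using assms(2) by blast
  then show ?thesis
  proof cases
    case 1 then show ?thesis using common_zero2[of g h] * by (metis add.right_neutral mult_eq_0_iff)
  next
    case 2 then show ?thesis using common_zero2[of f h] * by (metis add.right_neutral add.left_neutral mult_eq_0_iff)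
  next
    case 3 then show ?thesis using common_zero2[of f g] * by (metis add.left_neutral mult_eq_0_iff add.right_neutral)
  qed
qed

lemma dim_annihilator:
  assumes "k \<noteq> 0"
  shows "fs.dim {f :: 3 \<Rightarrow> 'k::field. pr f k = 0} = 2" "fs.subspace {f :: 3 \<Rightarrow> 'k::field. pr f k = 0}"
    "fin_dim {f :: 3 \<Rightarrow> 'k::field. pr f k = 0}"
proof -
  have e: "{f. pr f k = 0} = perp UNIV (fs.span {k})"
    by (auto simp: perp_span) (auto simp: perp_def supp_on_def pair_def pr_def)
  show "fs.subspace {f. pr f k = 0}" unfolding e by (rule subspace_perp)
  show "fin_dim {f :: 3 \<Rightarrow> 'k. pr f k = 0}"
    by (rule fin_dim_subset[OF fin_dim_supp_on[of UNIV]]) (auto simp: supp_on_def)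
  have "fs.dim (fs.span {k}) = 1" using fs.dim_span_eq_card_independent[of "{k}"] assms by simp
  then show "fs.dim {f. pr f k = 0} = 2"
    using dim_perp[of UNIV "fs.span {k}"] unfolding e by (simp add: supp_on_def)
qed

section \<open>Reversal of tensors\<close>

text \<open>Reversal passes to the opposite algebra: the two sides are exchanged and all dimensions
  are kept, so a one-sided statement has to be proved for one side only.\<close>

definition rv :: "'k::field tens \<Rightarrow> 'k tens" where
  "rv t = (\<lambda>w. t (rev w))"

lemma rv_rv [simp]: "rv (rv t) = t"
  by (simp add: rv_def)

lemma rv_lin: "lin rv"
  by (rule linI) (simp_all add: rv_def fun_eq_iff pointwise)

lemma rv_eq_0: "rv t = 0 \<longleftrightarrow> t = 0"
  by (metis lin_simps(3)[OF rv_lin] rv_rv)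

lemma bl_rv: "bl (rv w) u v = bl w v u"
  unfolding bl_def by (subst sum.swap) (simp add: rv_def mult_ac)

lemma rv_sol_sub: "t \<in> sol n G \<Longrightarrow> rv t \<in> sol n (rv ` G)"
proof (rule solI)
  fix g u v assume t: "t \<in> sol n G" and "g \<in> rv ` G"
  then obtain h where h: "h \<in> G" "g = rv h" by auto
  have "(\<Sum>i\<in>UNIV. \<Sum>j\<in>UNIV. g [i, j] * rv t (u @ [i, j] @ v)) =
      (\<Sum>i\<in>UNIV. \<Sum>j\<in>UNIV. h [j, i] * t (rev v @ [j, i] @ rev u))"
    by (simp add: h rv_def)
  also have "\<dots> = 0" using solD[OF t h(1), of "rev v" "rev u"] by (subst sum.swap) simp
  finally show "(\<Sum>i\<in>UNIV. \<Sum>j\<in>UNIV. g [i, j] * rv t (u @ [i, j] @ v)) = 0" .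
qed (auto simp: rv_def tensD[OF sol_tens] intro!: tensI)

lemma rv_sol: "sol n (rv ` G) = rv ` sol n G"
proof (intro equalityI subsetI)
  fix t assume "t \<in> sol n (rv ` G)"
  then have "rv t \<in> sol n (rv ` rv ` G)" by (rule rv_sol_sub)
  then have "rv t \<in> sol n G" by (simp add: image_image)
  then show "t \<in> rv ` sol n G" by (metis rv_rv image_eqI)
qed (auto intro: rv_sol_sub)

lemma dim_rv_sol: "fs.dim (sol n (rv ` G)) = fs.dim (sol n G)"
  unfolding rv_sol by (rule dim_inj_image[OF rv_lin subspace_sol fin_dim_sol]) (simp add: rv_eq_0)

lemma (in three_rel) three_rel_rv: "three_rel (rv ` R)"
  by unfold_locales (simp add: dim_rv_sol dim_W)

section \<open>Rank one relations\<close>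

definition rank1 :: "(3 \<Rightarrow> 'k::field) \<Rightarrow> (3 \<Rightarrow> 'k) \<Rightarrow> 'k tens" where
  "rank1 a b = (\<lambda>w. case w of [i, j] \<Rightarrow> a i * b j | _ \<Rightarrow> 0)"

lemma rank1_ij [simp]: "rank1 a b [i, j] = a i * b j"
  by (simp add: rank1_def)

lemma rank1_tens: "rank1 a b \<in> tens 2"
  by (rule tensI) (auto simp: rank1_def split: list.splits)

lemma bl_rank1 [simp]: "bl (rank1 a b) u v = pr a u * pr b v"
  by (simp add: bl_def pr_def sum_product mult_ac)

lemma rv_rank1 [simp]: "rv (rank1 a b) = rank1 b a"
proof (rule bl_eqI)
  show "rv (rank1 a b) \<in> tens 2"
    by (rule tensI) (simp add: rv_def tensD[OF rank1_tens])
qed (simp_all add: bl_rv rank1_tens)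

lemma rank1_eq_0: "rank1 a b = 0 \<longleftrightarrow> a = 0 \<or> b = 0"
proof
  assume z: "rank1 a b = 0"
  show "a = 0 \<or> b = 0"
  proof (rule ccontr)
    assume "\<not> ?thesis"
    then obtain u v where "pr a u \<noteq> 0" "pr b v \<noteq> 0" using pr_nz by blast
    moreover have "pr a u * pr b v = 0" unfolding bl_rank1[symmetric] z by (rule bl_sum)
    ultimately show False by simp
  qed
next
  assume "a = 0 \<or> b = 0"
  then show "rank1 a b = 0" by (intro bl_eqI rank1_tens) (auto simp: pr_simps bl_sum intro!: tensI simp: pointwise)
qed

lemma row_eq_0: "w \<in> tens 2 \<Longrightarrow> (\<And>u. row u w = 0) \<Longrightarrow> w = 0"
  by (rule bl_eqI) (auto simp: bl_pr[of w] pr_simps bl_sum pointwise intro: tensI)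

lemma row_vec: "row (u + v) w = row u w + row v w" "row (scl c u) w = scl c (row u w)"
  by (simp_all add: row_def fun_eq_iff pointwise distrib_left distrib_right sum.distrib sum_distrib_left mult_ac)

text \<open>In the algebra: v k = 0 for all \<open>v\<close> of degree one, and k v = 0 in the case
  of \<open>left_null\<close>.\<close>

definition right_null :: "'k::field tens set \<Rightarrow> (3 \<Rightarrow> 'k) \<Rightarrow> bool" where
  "right_null S k \<longleftrightarrow> k \<noteq> 0 \<and> (\<forall>w\<in>S. \<forall>v. bl w v k = 0)"

definition left_null :: "'k::field tens set \<Rightarrow> (3 \<Rightarrow> 'k) \<Rightarrow> bool" where
  "left_null S k \<longleftrightarrow> k \<noteq> 0 \<and> (\<forall>w\<in>S. \<forall>v. bl w k v = 0)"

lemma left_null_rv: "left_null (rv ` S) k \<longleftrightarrow> right_null S k" "right_null (rv ` S) k \<longleftrightarrow> left_null S k"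
  by (auto simp: left_null_def right_null_def bl_rv)

text \<open>Each of the three conditions excludes at most one scalar.\<close>

lemma ex_scalar:
  fixes p q r s :: "'k::field"
  assumes "infinite (UNIV :: 'k set)" "p \<noteq> 0" "r \<noteq> 0"
  shows "\<exists>t. t \<noteq> 0 \<and> p + t * q \<noteq> 0 \<and> r + t * s \<noteq> 0"
proof -
  have "finite {t. p + t * q = 0}" if "p \<noteq> 0" for p q :: 'k
  proof (rule finite_subset)
    show "{t. p + t * q = 0} \<subseteq> {- p * inverse q}"
    proof
      fix t assume "t \<in> {t. p + t * q = 0}"
      then have t: "p = - (t * q)" by (simp add: add_eq_0_iff2)
      then have "q \<noteq> 0" using that by auto
      then show "t \<in> {- p * inverse q}" by (simp add: t)
    qed
  qed simp
  then have "finite ({0} \<union> {t. p + t * q = 0} \<union> {t. r + t * s = 0})" using assms by simp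
  from ex_new_if_finite[OF assms(1) this]
  obtain t where "t \<notin> {0} \<union> {t. p + t * q = 0} \<union> {t. r + t * s = 0}" ..
  then show ?thesis by auto
qed

text \<open>No degree one element maps degree one onto degree two, neither by left nor by right
  multiplication. Infinitely many scalars permit arguments with elements in general
  position.\<close>

locale no_full = three_rel R for R :: "'k::field tens set" +
  assumes inf: "infinite (UNIV :: 'k set)"
    and left_sing: "\<exists>w\<in>C 2. w \<noteq> 0 \<and> (\<forall>v. bl w x v = 0)"
    and right_sing: "\<exists>w\<in>C 2. w \<noteq> 0 \<and> (\<forall>u. bl w u x = 0)"
begin

lemma no_full_rv: "no_full (rv ` R)"
proof (intro no_full.intro three_rel_rv no_full_axioms.intro inf)
  fix x
  show "\<exists>w\<in>sol 2 (rv ` R). w \<noteq> 0 \<and> (\<forall>v. bl w x v = 0)"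
    using right_sing[of x] by (auto simp: rv_sol bl_rv rv_eq_0)
  show "\<exists>w\<in>sol 2 (rv ` R). w \<noteq> 0 \<and> (\<forall>u. bl w u x = 0)"
    using left_sing[of x] by (auto simp: rv_sol bl_rv rv_eq_0)
qed

lemma common_nonzero:
  assumes "a \<noteq> 0" "c \<noteq> 0"
  shows "\<exists>x. pr a x \<noteq> 0 \<and> pr c x \<noteq> 0"
proof -
  obtain x y where xy: "pr a x \<noteq> 0" "pr c y \<noteq> 0" using pr_nz assms by blast
  consider "pr c x \<noteq> 0" | "pr a y \<noteq> 0" | "pr c x = 0" "pr a y = 0" by blast
  then show ?thesis
  proof cases
    case 3
    then have "pr a (x + y) \<noteq> 0 \<and> pr c (x + y) \<noteq> 0" using xy by (simp add: pr_simps)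
    then show ?thesis by blast
  qed (use xy in blast)+
qed

text \<open>Let \<open>w\<close> complete the two rank one elements to a basis. For \<open>x\<close>
  in general position the element singular at \<open>x\<close> must involve \<open>w\<close>, since
  \<open>b\<close> and \<open>d\<close> are independent. So \<open>w\<close> at \<open>x\<close> is
  a combination of \<open>b\<close> and \<open>d\<close> and vanishes at their common zero
  \<open>k\<close>; moving \<open>x\<close> along a line carries this over to all
  \<open>x\<close>.\<close>

lemma right_null_of_rank1:
  assumes W: "rank1 a b \<in> C 2" "rank1 c d \<in> C 2" and nz: "a \<noteq> 0" "c \<noteq> 0" and ind: "indep2 b d"
  shows "\<exists>k. right_null (C 2) k"
proof -
  have key: "p = 0 \<and> q = 0" if "scl p (rank1 a b) + scl q (rank1 c d) = 0 \<or> scl (p * pr a x) b + scl (q * pr c x) d = 0"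
    "pr a x \<noteq> 0" "pr c x \<noteq> 0" for p q x
  proof -
    have "scl (p * pr a x) b + scl (q * pr c x) d = 0"
      using that(1)
    proof
      assume *: "scl p (rank1 a b) + scl q (rank1 c d) = 0"
      show ?thesis
      proof (rule pr_eqI)
        fix v show "pr (scl (p * pr a x) b + scl (q * pr c x) d) v = pr 0 v"
          using arg_cong[OF *, of "\<lambda>w. bl w x v"] by (simp add: bl_add bl_sum pr_simps mult_ac)
      qed
    qed
    then show ?thesis using indep2D[OF ind] that by fastforce
  qed
  obtain x0 where x0: "pr a x0 \<noteq> 0" "pr c x0 \<noteq> 0" using common_nonzero nz by blast
  have "indep2 (rank1 a b) (rank1 c d)" unfolding indep2_def using key[OF disjI1 x0] by blast
  then obtain w where w: "\<And>w'. w' \<in> C 2 \<Longrightarrow> \<exists>p q r. w' = scl p (rank1 a b) + scl q (rank1 c d) + scl r w"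
    using basis3[OF subspace_sol fin_dim_sol dim_W W] by metis
  obtain k where k: "k \<noteq> 0" "pr b k = 0" "pr d k = 0" using common_zero2 by blast
  have good: "bl w x k = 0" if "pr a x \<noteq> 0" "pr c x \<noteq> 0" for x
  proof -
    obtain w' where w': "w' \<in> C 2" "w' \<noteq> 0" "\<And>v. bl w' x v = 0" using left_sing by blast
    obtain p q r where e: "w' = scl p (rank1 a b) + scl q (rank1 c d) + scl r w" using w[OF w'(1)] by blast
    have *: "p * pr a x * pr b v + q * pr c x * pr d v + r * bl w x v = 0" for v
      using w'(3)[of v] by (simp add: e bl_add mult_ac)
    have "r \<noteq> 0"
    proof
      assume r: "r = 0"
      have "scl (p * pr a x) b + scl (q * pr c x) d = 0"
        by (rule pr_eqI) (use * r in \<open>simp add: pr_simps\<close>)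
      then have "p = 0 \<and> q = 0" using key[OF disjI2] that by blast
      then show False using e r w'(2) by simp
    qed
    then show ?thesis using *[of k] k by simp
  qed
  have "bl w x k = 0" for x
  proof -
    obtain t where t: "t \<noteq> 0" "pr a x0 + t * pr a x \<noteq> 0" "pr c x0 + t * pr c x \<noteq> 0"
      using ex_scalar[OF inf x0] by blast
    have "bl w (x0 + scl t x) k = 0" using t by (intro good) (simp_all add: pr_simps)
    then show ?thesis using good[OF x0] t by (simp add: bl_add)
  qed
  then have "bl w' v k = 0" if "w' \<in> C 2" for w' v
    using w[OF that] k by (auto simp: bl_add)
  then show ?thesis using k by (auto simp: right_null_def)
qed

end

context no_full
begin

lemma left_null_of_rank1:
  assumes W: "rank1 a b \<in> C 2" "rank1 c d \<in> C 2" and nz: "b \<noteq> 0" "d \<noteq> 0" and ind: "indep2 a c"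
  shows "\<exists>k. left_null (C 2) k"
proof -
  interpret r: no_full "rv ` R" by (rule no_full_rv)
  have "rank1 b a \<in> r.C 2" "rank1 d c \<in> r.C 2"
    unfolding rv_sol by (metis W rv_rank1 image_eqI)+
  from r.right_null_of_rank1[OF this nz ind] show ?thesis by (simp add: rv_sol left_null_rv)
qed

text \<open>Used as uniqueness of the rank one element of \<open>C 2\<close>: independent right
  factors would yield a right null vector, independent left factors a left null vector.\<close>

lemma rank1_prop:
  assumes "\<nexists>k. right_null (C 2) k" "\<nexists>k. left_null (C 2) k"
    "rank1 a b \<in> C 2" "rank1 c d \<in> C 2" "a \<noteq> 0" "b \<noteq> 0" "c \<noteq> 0" "d \<noteq> 0"
  shows "\<exists>p. c = scl p a" "\<exists>p. d = scl p b"
  using assms right_null_of_rank1 left_null_of_rank1 not_indep2 by metis+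

end

lemma span2: "h \<in> fs.span {f, g} \<longleftrightarrow> (\<exists>a b. h = scl a f + scl b g)"
proof
  assume "h \<in> fs.span {f, g}"
  then obtain a where "h - scl a f \<in> fs.span {g}" by (auto simp: fs.span_breakdown_eq[of h f])
  then obtain b where "h - scl a f = scl b g" by (auto simp: fs.span_singleton)
  then show "\<exists>a b. h = scl a f + scl b g" by (metis diff_add_cancel add.commute)
next
  assume "\<exists>a b. h = scl a f + scl b g"
  then obtain a b where "h = scl a f + scl b g" by blast
  moreover have "scl a f + scl b g \<in> fs.span {f, g}"
    by (intro fs.span_add fs.span_scale fs.span_base) simp_all
  ultimately show "h \<in> fs.span {f, g}" by simp
qed

lemma pr_commute: "pr f v = pr v f"
  by (simp add: pr_def mult.commute)

lemma kernel_combination: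
  assumes "p \<noteq> 0" "pr p x = 0" "pr p v = 0" "indep2 x v" "pr p y = 0"
  shows "\<exists>a b. y = scl a x + scl b v"
  using dim_le_2D[OF dim_annihilator(3) _ _ _ _ assms(4)] assms dim_annihilator(1)[OF assms(1)]
  by (simp add: pr_commute[of p])

text \<open>A bilinear form that vanishes on a plane in its first argument factors through the
  linear form \<open>p\<close> defining the plane.\<close>

lemma rank1_of_rows:
  assumes "w \<in> tens 2" "indep2 x v" "row x w = 0" "row v w = 0"
  obtains p h where "pr p x = 0" "pr p v = 0" "w = rank1 p h" "p \<noteq> 0"
proof -
  obtain p where p: "p \<noteq> 0" "pr p x = 0" "pr p v = 0"
    using common_zero2[of x v] by (metis pr_commute)
  obtain u where u: "pr p u = 1" using pr_nz'[OF p(1)] by blast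
  have "bl w y z = bl (rank1 p (row u w)) y z" for y z
  proof -
    have "pr p (y - scl (pr p y) u) = 0" by (simp add: pr_simps u)
    then obtain a b where "y - scl (pr p y) u = scl a x + scl b v"
      using kernel_combination[OF p assms(2)] by blast
    then have "y = scl a x + scl b v + scl (pr p y) u" by (simp add: algebra_simps)
    then have "bl w y z = bl w (scl a x + scl b v + scl (pr p y) u) z" by (rule arg_cong)
    then show ?thesis by (simp add: bl_add bl_pr[of w] assms pr_simps)
  qed
  then have "w = rank1 p (row u w)" by (intro bl_eqI assms(1) rank1_tens)
  then show thesis using that p by blast
qed

lemma row_diff: "row (u - v) w = row u w - row v w"
  by (simp add: row_def fun_eq_iff pointwise left_diff_distrib sum_subtractf)

section \<open>Elements of degree two that are singular at a given vector\<close>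

context no_full
begin

context
  assumes no_right: "\<nexists>k. right_null (C 2) k" and no_left: "\<nexists>k. left_null (C 2) k"
begin

text \<open>Two rank one elements share their left factor, hence also the plane on which it
  vanishes.\<close>

lemma rank1_rows_prop:
  assumes "w \<in> C 2" "indep2 x v" "row x w = 0" "row v w = 0" "w \<noteq> 0"
    "w' \<in> C 2" "indep2 x' v'" "row x' w' = 0" "row v' w' = 0" "w' \<noteq> 0"
  shows "row x' w = 0" "row v' w = 0"
proof -
  obtain p h where p: "pr p x = 0" "pr p v = 0" "w = rank1 p h" "p \<noteq> 0"
    using rank1_of_rows[OF sol_tens[OF assms(1)] assms(2-4)] by blast
  obtain p' h' where p': "pr p' x' = 0" "pr p' v' = 0" "w' = rank1 p' h'" "p' \<noteq> 0"
    using rank1_of_rows[OF sol_tens[OF assms(6)] assms(7-9)] by blast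
  have "h \<noteq> 0" "h' \<noteq> 0" using assms(5,10) p p' by (auto simp: rank1_eq_0)
  then obtain c where "p = scl c p'"
    using rank1_prop(1)[OF no_right no_left, of p' h' p h] assms(1,6) p p' by metis
  then have "bl w x' z = 0" "bl w v' z = 0" for z using p p' by (simp_all add: pr_simps)
  then show "row x' w = 0" "row v' w = 0" by (simp_all add: fun_eq_iff row_bl pointwise)
qed

text \<open>Suppose \<open>w1\<close>, \<open>w2\<close> are independent and vanish at
  \<open>x0\<close>, and let \<open>w\<close> complete them to a basis, with restriction g to
  \<open>x0\<close>. Singularity at x0 + t v puts g and the restriction of \<open>w\<close> to
  \<open>v\<close> into the span of the restrictions of \<open>w1\<close> and \<open>w2\<close>.
  Comparing \<open>v1\<close>, \<open>v2\<close> and \<open>v1 + v2\<close> gives either three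
  dependent forms, whose common zero is a right null vector, or two rank one elements with different
  left factors.\<close>

lemma left_kernel_dim:
  assumes x0: "x0 \<noteq> 0" and w12: "w1 \<in> C 2" "w2 \<in> C 2" "row x0 w1 = 0" "row x0 w2 = 0"
  shows "\<not> indep2 w1 w2"
proof
  assume ind: "indep2 w1 w2"
  obtain w where w: "w \<in> C 2" "\<And>w'. w' \<in> C 2 \<Longrightarrow> \<exists>a b c. w' = scl a w1 + scl b w2 + scl c w"
    using basis3[OF subspace_sol fin_dim_sol dim_W w12(1,2) ind] by metis
  define g where "g = row x0 w"
  have g0: "g \<noteq> 0"
  proof
    assume g: "g = 0"
    have "bl w' x0 v = 0" if w': "w' \<in> C 2" for w' v
    proof -
      obtain a b c where "w' = scl a w1 + scl b w2 + scl c w" using w(2)[OF w'] by blast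
      then show ?thesis using g w12 by (simp add: bl_add bl_pr[of w1] bl_pr[of w2] bl_pr[of w] g_def pr_simps)
    qed
    then show False using no_left x0 by (auto simp: left_null_def)
  qed
  define I where "I v = fs.span {row v w1, row v w2}" for v
  have good: "g \<in> I v \<and> row v w \<in> I v" if iv: "indep2 (row v w1) (row v w2)" for v
  proof -
    \<comment> \<open>Singularity at \<open>x0 + scl t v\<close>. As \<open>w1\<close> and
      \<open>w2\<close> vanish at \<open>x0\<close>, they contribute only their restrictions to
      \<open>v\<close>.\<close>
    have *: "g + scl t (row v w) \<in> I v" if t: "t \<noteq> 0" for t
    proof -
      obtain w' where w': "w' \<in> C 2" "w' \<noteq> 0" "\<And>y. bl w' (x0 + scl t v) y = 0" using left_sing by blast
      obtain a b c where e: "w' = scl a w1 + scl b w2 + scl c w" using w(2)[OF w'(1)] by blast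
      have "row (x0 + scl t v) w' = 0" using w'(3) by (simp add: fun_eq_iff row_bl pointwise)
      moreover have "row (x0 + scl t v) w' = scl (a * t) (row v w1) + scl (b * t) (row v w2) + scl c (g + scl t (row v w))"
        by (simp add: e lin_simps(1,2)[OF row_lin] row_vec w12 g_def fs.scale_right_distrib mult_ac)
      ultimately have z: "scl (a * t) (row v w1) + scl (b * t) (row v w2) + scl c (g + scl t (row v w)) = 0" by simp
      have c: "c \<noteq> 0"
      proof
        assume c: "c = 0"
        then have "scl (a * t) (row v w1) + scl (b * t) (row v w2) = 0" using z by simp
        then have "a = 0 \<and> b = 0" using indep2D[OF iv, of "a * t" "b * t"] t by simp
        then show False using w'(2) e c by simp
      qed
      have "scl c (g + scl t (row v w)) = - (scl (a * t) (row v w1) + scl (b * t) (row v w2))"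
        using z by (intro minus_unique[symmetric]) (simp add: add.commute)
      also have "\<dots> \<in> I v" unfolding I_def
        by (intro fs.span_neg fs.span_add fs.span_scale fs.span_base) simp_all
      finally have "scl (inverse c) (scl c (g + scl t (row v w))) \<in> I v" unfolding I_def by (rule fs.span_scale)
      then show ?thesis using c by simp
    qed
    \<comment> \<open>A second value of \<open>t\<close> besides 1, so that the two memberships
      separate \<open>g\<close> from \<open>row v w\<close>.\<close>
    obtain s :: 'k where s: "s \<noteq> 0" "- 1 + s * 1 \<noteq> 0" using ex_scalar[OF inf, of "- 1" 1 1 0] by auto
    have "(g + scl s (row v w)) - (g + scl 1 (row v w)) \<in> I v"
      using *[OF s(1)] *[of 1] unfolding I_def by (intro fs.span_diff) simp_all
    also have "(g + scl s (row v w)) - (g + scl 1 (row v w)) = scl (s - 1) (row v w)"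
      by (simp add: fs.scale_left_diff_distrib)
    finally have "scl (inverse (s - 1)) (scl (s - 1) (row v w)) \<in> I v" unfolding I_def by (rule fs.span_scale)
    then have r: "row v w \<in> I v" using s(2) by simp
    have "(g + scl 1 (row v w)) - row v w \<in> I v"
      using *[of 1] r unfolding I_def by (intro fs.span_diff) simp_all
    then show ?thesis using r by simp
  qed
  \<comment> \<open>The vectors at which \<open>w1\<close> and \<open>w2\<close> become dependent
    lie in one plane through \<open>x0\<close>: each such vector outside the line of
    \<open>x0\<close> gives a rank one element vanishing at \<open>x0\<close>, and these elements
    share their left factor.\<close>
  obtain p0 where p0: "p0 \<noteq> 0" "pr p0 x0 = 0" and
    gd: "\<And>v. pr p0 v \<noteq> 0 \<Longrightarrow> indep2 (row v w1) (row v w2)"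
  proof (cases "\<exists>v. indep2 x0 v \<and> \<not> indep2 (row v w1) (row v w2)")
    case True
    then obtain v where v: "indep2 x0 v" "\<not> indep2 (row v w1) (row v w2)" by blast
    have bad: "\<exists>r. r \<in> C 2 \<and> r \<noteq> 0 \<and> row x0 r = 0 \<and> row v r = 0" if b: "\<not> indep2 (row v w1) (row v w2)" for v
    proof -
      obtain a b where ab: "scl a (row v w1) + scl b (row v w2) = 0" "\<not> (a = 0 \<and> b = 0)"
        using b by (auto simp: indep2_def)
      then show ?thesis
        using w12 indep2D[OF ind, of a b]
        by (intro exI[of _ "scl a w1 + scl b w2"]) (auto simp: lin_simps(1,2)[OF row_lin] intro: C_add C_scl)
    qed
    obtain r where r: "r \<in> C 2" "r \<noteq> 0" "row x0 r = 0" "row v r = 0" using bad[OF v(2)] by blast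
    obtain p h where p: "pr p x0 = 0" "pr p v = 0" "r = rank1 p h" "p \<noteq> 0"
      by (rule rank1_of_rows[OF sol_tens[OF r(1)] v(1) r(3,4)])
    have "indep2 (row u w1) (row u w2)" if u: "pr p u \<noteq> 0" for u
    proof (rule ccontr)
      assume "\<not> ?thesis"
      then obtain r' where r': "r' \<in> C 2" "r' \<noteq> 0" "row x0 r' = 0" "row u r' = 0" using bad by blast
      have "indep2 x0 u" unfolding indep2_def
      proof (intro allI impI)
        fix a b assume z: "scl a x0 + scl b u = 0"
        have "b * pr p u = 0" using arg_cong[OF z, of "pr p"] p by (simp add: pr_simps)
        then show "a = 0 \<and> b = 0" using u z x0 by auto
      qed
      then have "row u r = 0" using rank1_rows_prop(2)[OF r(1) v(1) r(3,4,2) r'(1) _ r'(3,4,2)] by blast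
      moreover have "h \<noteq> 0" using r(2) p by (auto simp: rank1_eq_0)
      then obtain z where "pr h z \<noteq> 0" using pr_nz by blast
      moreover have "pr p u * pr h z = pr (row u r) z" by (simp add: p(3) flip: bl_pr)
      ultimately show False using u by (simp add: pr_simps)
    qed
    then show thesis using that p by blast
  next
    case False
    obtain p where p: "p \<noteq> 0" "pr p x0 = 0" using common_zero2[of x0 x0] by (metis pr_commute)
    have "indep2 x0 u" if u: "pr p u \<noteq> 0" for u unfolding indep2_def
    proof (intro allI impI)
      fix a b assume z: "scl a x0 + scl b u = 0"
      have "b * pr p u = 0" using arg_cong[OF z, of "pr p"] p by (simp add: pr_simps)
      then show "a = 0 \<and> b = 0" using u z x0 by auto
    qed
    then show thesis using that[OF p] False by blast
  qed
  obtain v1 where v1: "pr p0 v1 = 1" using pr_nz'[OF p0(1)] by blast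
  obtain z where z: "pr p0 z = 0" "indep2 x0 z"
  proof -
    obtain f f' where f: "pr p0 f = 0" "pr p0 f' = 0" "indep2 f f'"
      using dim_ge_2E[OF dim_annihilator(2,3)[OF p0(1)]] dim_annihilator(1)[OF p0(1)]
      by (metis (mono_tags, lifting) mem_Collect_eq order_refl pr_commute)
    show thesis
    proof (cases "indep2 x0 f")
      case False
      then obtain c where c: "f = scl c x0" using not_indep2 x0 by blast
      have "indep2 x0 f'"
      proof (rule ccontr)
        assume "\<not> ?thesis"
        then obtain d where d: "f' = scl d x0" using not_indep2 x0 by blast
        have "scl d f + scl (- c) f' = 0" by (simp add: c d mult.commute)
        then have "c = 0" using indep2D[OF f(3)] by fastforce
        then show False using c indep2_nz(1)[OF f(3)] by simp
      qed
      then show thesis using that f by blast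
    qed (use that f in blast)
  qed
  \<comment> \<open>Neither 0 nor -1, so that both \<open>v2\<close> and \<open>v1 + v2\<close> lie
    off the plane of \<open>p0\<close>.\<close>
  obtain s :: 'k where s: "s \<noteq> 0" "1 + s * 1 \<noteq> 0" using ex_scalar[OF inf, of 1 1 1 0] by auto
  define v2 where "v2 = z + scl s v1"
  have basis: "\<exists>a b c. y = scl a x0 + scl b v1 + scl c v2" for y
  proof -
    have "pr p0 (y - scl (pr p0 y) v1) = 0" by (simp add: pr_simps v1)
    then obtain a b where "y - scl (pr p0 y) v1 = scl a x0 + scl b z"
      using kernel_combination[OF p0(1,2) z] by blast
    then have "y = scl a x0 + scl (pr p0 y - b * s) v1 + scl b v2"
      by (simp add: v2_def algebra_simps fs.scale_right_distrib fs.scale_left_diff_distrib)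
    then show ?thesis by blast
  qed
  have G1: "indep2 (row v1 w1) (row v1 w2)" and G2: "indep2 (row v2 w1) (row v2 w2)"
    and G3: "indep2 (row (v1 + v2) w1) (row (v1 + v2) w2)"
    using s by (auto intro!: gd simp: v2_def pr_simps v1 z)
  \<comment> \<open>Such a \<open>k\<close> also annihilates the restrictions of \<open>w\<close>,
    which lie in the spans found above; it would be a right null vector.\<close>
  have K: False if k: "k \<noteq> 0" "pr g k = 0" "pr (row v1 w1) k = 0" "pr (row v1 w2) k = 0"
    "pr (row v2 w1) k = 0" "pr (row v2 w2) k = 0" for k
  proof -
    have "pr (row v1 w) k = 0" "pr (row v2 w) k = 0"
      using good[OF G1] good[OF G2] k by (auto simp: I_def span2 pr_simps)
    then have "bl w' y k = 0" if w': "w' \<in> C 2" for w' y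
    proof -
      obtain a b c where "w' = scl a w1 + scl b w2 + scl c w" using w(2)[OF w'] by blast
      moreover obtain a' b' c' where "y = scl a' x0 + scl b' v1 + scl c' v2" using basis by blast
      ultimately show ?thesis
        using k \<open>pr (row v1 w) k = 0\<close> \<open>pr (row v2 w) k = 0\<close> w12
        by (simp add: bl_add bl_pr[of w1] bl_pr[of w2] bl_pr[of w] g_def[symmetric] pr_simps)
    qed
    then show False using no_right k by (auto simp: right_null_def)
  qed
  define S where "S = fs.span {w1, w2}"
  have S: "fs.dim S \<le> 2" "fin_dim S"
    using fs.dim_le_card[of S "{w1, w2}"] card_insert_le_m1[of 2 "{w2}" w1]
    by (auto simp: S_def fin_dim_def intro: exI[of _ "{w1, w2}"])
  have SC: "r \<in> C 2" and Sx: "row x0 r = 0" if "r \<in> S" for r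
    using that w12 by (auto simp: S_def span2 lin_simps(1,2)[OF row_lin] intro: C_add C_scl)
  have rows: "pr (row v w1) k = 0 \<and> pr (row v w2) k = 0"
    if rr: "r \<in> S" "r' \<in> S" "indep2 r r'" "pr (row v r) k = 0" "pr (row v r') k = 0" for r r' v k
  proof -
    have "w1 \<in> S" "w2 \<in> S" by (auto simp: S_def intro: fs.span_base)
    then obtain a b a' b' where "w1 = scl a r + scl b r'" "w2 = scl a' r + scl b' r'"
      using dim_le_2D[OF S(2,1) rr(1,2) _ rr(3)] by meson
    then show ?thesis using rr by (simp add: lin_simps(1,2)[OF row_lin] pr_simps)
  qed
  have gS: "\<exists>r\<in>S. row v r = g" if iv: "indep2 (row v w1) (row v w2)" for v
  proof -
    obtain a b where "g = scl a (row v w1) + scl b (row v w2)" using good[OF iv] by (auto simp: I_def span2)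
    then have "row v (scl a w1 + scl b w2) = g" by (simp add: lin_simps(1,2)[OF row_lin])
    moreover have "scl a w1 + scl b w2 \<in> S" by (auto simp: S_def span2)
    ultimately show ?thesis by blast
  qed
  obtain r1 r2 r3 where r: "r1 \<in> S" "r2 \<in> S" "r3 \<in> S" "row v1 r1 = g" "row v2 r2 = g" "row (v1 + v2) r3 = g"
    using gS[OF G1] gS[OF G2] gS[OF G3] by metis
  show False
  proof (cases "indep2 r1 r2")
    case True
    obtain a b where ab: "r3 = scl a r1 + scl b r2" using dim_le_2D[OF S(2,1) r(1,2,3) True] by blast
    \<comment> \<open>Expansion of \<open>row (v1 + v2) r3 = g\<close>. The three coefficients
      cannot vanish simultaneously.\<close>
    have "scl (a + b - 1) g + scl a (row v2 r1) + scl b (row v1 r2) = 0"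
      using r(6) by (simp add: ab lin_simps(1,2)[OF row_lin] row_vec r(4,5) fs.scale_right_distrib
          fs.scale_left_distrib fs.scale_left_diff_distrib algebra_simps)
    moreover have "a + b - 1 \<noteq> 0 \<or> a \<noteq> 0 \<or> b \<noteq> 0" by auto
    ultimately obtain k where k: "k \<noteq> 0" "pr g k = 0" "pr (row v2 r1) k = 0" "pr (row v1 r2) k = 0"
      using common_zero3 by blast
    then show False
      using K[OF k(1,2)] rows[OF r(1,2) True, of v1 k] rows[OF r(1,2) True, of v2 k] r(4,5) by simp
  next
    case False
    have "r1 \<noteq> 0" using r(4) g0 lin_simps(3)[OF row_lin] by auto
    then obtain l where l: "r2 = scl l r1" using not_indep2 False by blast
    have l0: "l \<noteq> 0" using l r(5) g0 lin_simps(3)[OF row_lin, of v2] by auto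
    have g2: "scl l (row v2 r1) = g" using r(5) by (simp add: l lin_simps(2)[OF row_lin])
    obtain q where q: "q \<in> S" "indep2 r1 q"
    proof (cases "indep2 r1 w1")
      case True then show thesis using that by (auto simp: S_def intro: fs.span_base)
    next
      case False
      then obtain c where c: "w1 = scl c r1" using not_indep2 \<open>r1 \<noteq> 0\<close> by blast
      have "indep2 r1 w2"
      proof (rule ccontr)
        assume "\<not> ?thesis"
        then obtain d where d: "w2 = scl d r1" using not_indep2 \<open>r1 \<noteq> 0\<close> by blast
        have "scl d w1 + scl (- c) w2 = 0" by (simp add: c d mult.commute)
        then have "c = 0" using indep2D[OF ind] by fastforce
        then show False using c indep2_nz(1)[OF ind] by simp
      qed
      then show thesis using that by (auto simp: S_def intro: fs.span_base)
    qed
    have comb: "\<exists>c d. row v w = scl c (row v q) + scl d (row v r1)" if iv: "indep2 (row v w1) (row v w2)" for v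
    proof -
      obtain a b where ab: "row v w = row v (scl a w1 + scl b w2)"
        using good[OF iv] by (auto simp: I_def span2 lin_simps(1,2)[OF row_lin])
      have "scl a w1 + scl b w2 \<in> S" by (auto simp: S_def span2)
      then obtain c d where "scl a w1 + scl b w2 = scl c r1 + scl d q"
        using dim_le_2D[OF S(2,1) r(1) q(1) _ q(2)] by blast
      then show ?thesis using ab by (metis lin_simps(1,2)[OF row_lin] add.commute)
    qed
    have g2': "row v2 r1 = scl (inverse l) g" unfolding g2[symmetric] using l0 by simp
    have g3': "row (v1 + v2) r1 = scl (1 + inverse l) g" by (simp add: row_vec r(4) g2' fs.scale_left_distrib)
    obtain c1 d1 where c1: "row v1 w = scl c1 (row v1 q) + scl d1 g" using comb[OF G1] r(4) by metis
    obtain c2 d2 where c2: "row v2 w = scl c2 (row v2 q) + scl d2 g" using comb[OF G2] g2' by (metis fs.scale_scale)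
    obtain c3 d3 where c3: "row (v1 + v2) w = scl c3 (row (v1 + v2) q) + scl d3 g"
      using comb[OF G3] g3' by (metis fs.scale_scale)
    \<comment> \<open>Restrictions of \<open>w\<close> are additive in the vector. Unless
      \<open>c1\<close>, \<open>c2\<close> and \<open>c3\<close> agree, this is a nontrivial
      dependency and yields a common zero as before.\<close>
    have rel: "scl (c3 - c1) (row v1 q) + scl (c3 - c2) (row v2 q) + scl (d3 - d1 - d2) g = 0"
      using c3 by (simp add: row_vec c1 c2 fs.scale_right_distrib fs.scale_left_diff_distrib algebra_simps)
    show False
    proof (cases "c3 - c1 \<noteq> 0 \<or> c3 - c2 \<noteq> 0")
      case True
      then obtain k where k: "k \<noteq> 0" "pr (row v1 q) k = 0" "pr (row v2 q) k = 0" "pr g k = 0"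
        using common_zero3[OF rel] by blast
      then show False
        using K[OF k(1,4)] rows[OF r(1) q(1) q(2), of v1 k] rows[OF r(1) q(1) q(2), of v2 k] r(4) g2'
        by (simp add: pr_simps)
    next
      case False
      \<comment> \<open>All restrictions of this element are multiples of \<open>g\<close>, so it
        has rank one without vanishing at \<open>x0\<close>, whereas the rank one element
        \<open>r1\<close> vanishes there.\<close>
      define o' where "o' = w - scl c1 q"
      have oC: "o' \<in> C 2" unfolding o'_def by (intro C_diff C_scl w SC q)
      have ox: "row x0 o' = g" and o1: "row v1 o' = scl d1 g" and o2: "row v2 o' = scl d2 g"
        using False Sx[OF q(1)] by (simp_all add: o'_def lin_simps(2,5)[OF row_lin] g_def c1 c2)
      have ind1: "indep2 (v1 - scl d1 x0) (v2 - scl d2 x0)" unfolding indep2_def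
      proof (intro allI impI)
        fix a b assume e: "scl a (v1 - scl d1 x0) + scl b (v2 - scl d2 x0) = 0"
        have "a + b * s = 0" using arg_cong[OF e, of "pr p0"] by (simp add: pr_simps v1 p0 v2_def z)
        then have a: "a = - (b * s)" by (simp add: eq_neg_iff_add_eq_0)
        have "scl (- a * d1 - b * d2) x0 + scl b z = 0"
          using e by (simp add: a v2_def algebra_simps fs.scale_right_distrib fs.scale_left_diff_distrib
              fs.scale_right_diff_distrib fs.scale_left_distrib)
        then have "b = 0" using indep2D[OF z(2)] by blast
        then show "a = 0 \<and> b = 0" using a by simp
      qed
      obtain p h where p: "pr p (v1 - scl d1 x0) = 0" "pr p (v2 - scl d2 x0) = 0" "o' = rank1 p h" "p \<noteq> 0"
        by (rule rank1_of_rows[OF sol_tens[OF oC] ind1]) (simp_all add: row_vec ox o1 o2 row_diff)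
      have ind2: "indep2 x0 (v2 - scl (inverse l) v1)" unfolding indep2_def
      proof (intro allI impI)
        fix a b assume e: "scl a x0 + scl b (v2 - scl (inverse l) v1) = 0"
        have "scl a x0 + scl b z + scl (b * s - b * inverse l) v1 = 0"
          using e by (simp add: v2_def algebra_simps fs.scale_right_distrib fs.scale_left_diff_distrib
              fs.scale_right_diff_distrib fs.scale_left_distrib)
        moreover from arg_cong[OF this, of "pr p0"] have "b * s - b * inverse l = 0"
          by (simp add: pr_simps v1 p0 z)
        ultimately show "a = 0 \<and> b = 0" using indep2D[OF z(2)] by simp
      qed
      obtain p' h' where p': "pr p' x0 = 0" "pr p' (v2 - scl (inverse l) v1) = 0" "r1 = rank1 p' h'" "p' \<noteq> 0"
        by (rule rank1_of_rows[OF sol_tens[OF SC[OF r(1)]] ind2])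
          (simp_all add: row_vec row_diff Sx[OF r(1)] g2' r(4))
      have "o' \<noteq> 0" using ox g0 lin_simps(3)[OF row_lin] by auto
      then have "h \<noteq> 0" "h' \<noteq> 0" using p(3) p'(3) \<open>r1 \<noteq> 0\<close> by (auto simp: rank1_eq_0)
      then obtain c where "p = scl c p'"
        using rank1_prop(1)[OF no_right no_left, of p' h' p h] SC[OF r(1)] oC p p' by metis
      then have "pr p x0 = 0" using p' by (simp add: pr_simps)
      then have "row x0 o' = 0" by (simp add: p(3) fun_eq_iff row_bl pointwise)
      then show False using ox g0 by simp
    qed
  qed
qed

end

end

section \<open>Degree three in the absence of null vectors\<close>

lemma ctr_delta [simp]: "ctr (delta i) t w = t (w @ [i])"
proof -
  have "ctr (delta i) t w = (\<Sum>j\<in>UNIV. if i = j then t (w @ [j]) else 0)"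
    unfolding ctr_def by (rule sum.cong) (auto simp: delta_def)
  then show ?thesis by simp
qed

lemma ctl_single: "ctl a w [j] = row a w j"
  by (simp add: ctl_def row_def)

lemma bl_ctl: "bl w u v = ctl v (ctl u w) []"
  by (simp add: ctl_ctl)

lemma bl_zero_row: "(\<And>v. bl w u v = 0) \<Longrightarrow> row u w = 0"
  by (simp add: fun_eq_iff row_bl pointwise)

lemma tens2_eqI: "w \<in> tens 2 \<Longrightarrow> w' \<in> tens 2 \<Longrightarrow> (\<And>i j. w [i, j] = w' [i, j]) \<Longrightarrow> w = w'"
proof
  fix l assume *: "w \<in> tens 2" "w' \<in> tens 2" "\<And>i j. w [i, j] = w' [i, j]"
  show "w l = w' l"
  proof (cases "length l = 2")
    case True
    then obtain i j where "l = [i, j]" by (auto simp: length_Suc_conv numeral_2_eq_2)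
    then show ?thesis using *(3) by simp
  qed (use * tensD in metis)
qed

lemma tens_eqI_right:
  assumes "t \<in> tens (Suc n)" "s \<in> tens (Suc n)" "\<And>i. ctr (delta i) t = ctr (delta i) s"
  shows "t = s"
proof
  fix w show "t w = s w"
  proof (cases w rule: rev_cases)
    case Nil then show ?thesis using assms by (simp add: tensD)
  next
    case (snoc v i) then show ?thesis using fun_cong[OF assms(3)[of i], of v] by simp
  qed
qed

text \<open>If u v = 0 in degree two, then no functional of higher degree sees this product in its
  first two slots.\<close>

lemma (in three_rel) product_zero:
  assumes "t \<in> C (Suc (Suc n))" "\<And>w. w \<in> C 2 \<Longrightarrow> bl w u v = 0"
  shows "ctl v (ctl u t) = 0"
proof
  fix w
  show "ctl v (ctl u t) w = 0 w"
  proof (cases "length w = n")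
    case True
    then show ?thesis using assms(2)[OF slice_sol[OF assms(1) True]] by (simp add: ctl_ctl pointwise)
  next
    case False
    have "ctl v (ctl u t) \<in> tens n" using assms(1) sol_tens ctl_tens by blast
    then show ?thesis using False by (simp add: tensD pointwise)
  qed
qed

text \<open>The element \<open>wx\<close> vanishing at \<open>x\<close> is unique up to scalars, so
  x k = 0 for some \<open>k\<close>. Contractions of degree three tensors with \<open>x\<close>
  vanish at \<open>k\<close> and therefore fill at most a line, so some nonzero \<open>S\<close>
  vanishes at \<open>x\<close>. Its right contractions are multiples of \<open>wx\<close>, hence
  \<open>S\<close> is \<open>wx\<close> times a form \<open>u\<close> and its left contractions have
  rank one. Uniqueness of the rank one element makes both factors of \<open>wx\<close> proportional,
  and they vanish at \<open>x\<close>.\<close>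

lemma (in no_full) degenerate_rank1:
  assumes null: "\<nexists>k. right_null (C 2) k" "\<nexists>k. left_null (C 2) k"
    and T: "T1 \<in> C 3" "T2 \<in> C 3" "indep2 T1 T2" and x: "x \<noteq> 0"
  shows "\<exists>f u. f \<noteq> 0 \<and> u \<noteq> 0 \<and> pr f x = 0 \<and> rank1 f u \<in> C 2"
proof -
  have C3: "C 3 = C (Suc (Suc (Suc 0)))" "C 3 = C (Suc 2)" "C 2 = C (Suc (Suc 0))" by (simp_all add: numeral_3_eq_3 numeral_2_eq_2)
  obtain wx where wx: "wx \<in> C 2" "wx \<noteq> 0" "\<And>v. bl wx x v = 0" using left_sing by blast
  have rwx: "row x wx = 0" by (rule bl_zero_row[OF wx(3)])
  have mult: "\<exists>c. w = scl c wy" if "wy \<in> C 2" "wy \<noteq> 0" "row y wy = 0" "w \<in> C 2" "row y w = 0" "y \<noteq> 0" for w wy y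
    using left_kernel_dim[OF null that(6,1,4,3,5)] not_indep2[OF _ that(2)] by blast
  obtain k where k: "k \<noteq> 0" "\<And>w. w \<in> C 2 \<Longrightarrow> bl w x k = 0"
  proof -
    obtain q r where qr: "\<And>w. w \<in> C 2 \<Longrightarrow> \<exists>a b c. w = scl a wx + scl b q + scl c r"
      using basis3_1[OF subspace_sol fin_dim_sol dim_W wx(1,2)] by metis
    obtain k where k: "k \<noteq> 0" "pr (row x q) k = 0" "pr (row x r) k = 0" using common_zero2 by blast
    have "bl w x k = 0" if "w \<in> C 2" for w
      using qr[OF that] k by (auto simp: bl_add wx bl_pr[of q] bl_pr[of r])
    then show thesis using that k by blast
  qed
  obtain wk where wk: "wk \<in> C 2" "wk \<noteq> 0" "\<And>v. bl wk k v = 0" using left_sing by blast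
  have im: "\<exists>c. ctl x T = scl c wk" if T: "T \<in> C 3" for T
  proof (rule mult[OF wk(1,2) bl_zero_row[OF wk(3)] _ _ k(1)])
    show "ctl x T \<in> C 2" using T unfolding C3(2) by (rule ctl_sol)
    have "ctl k (ctl x T) = 0" using T k(2) unfolding C3(1) by (rule product_zero)
    then show "row k (ctl x T) = 0" by (intro bl_zero_row) (simp add: bl_ctl lin_simps(3)[OF ctl_lin] pointwise)
  qed
  obtain a b where ab: "ctl x T1 = scl a wk" "ctl x T2 = scl b wk" using im T by blast
  obtain S where S: "S \<in> C 3" "S \<noteq> 0" "ctl x S = 0"
  proof (cases "a = 0")
    case True
    then show thesis using T ab indep2_nz(1)[OF T(3)] by (intro that[of T1]) simp_all
  next
    case False
    then have "scl b T1 - scl a T2 \<noteq> 0" using indep2D[OF T(3), of b "- a"] by auto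
    moreover have "ctl x (scl b T1 - scl a T2) = 0"
      by (simp add: lin_simps(2,5)[OF ctl_lin] ab mult.commute)
    moreover have "scl b T1 - scl a T2 \<in> C 3" by (intro C_diff C_scl T)
    ultimately show thesis using that by blast
  qed
  have "\<exists>c. ctr (delta i) S = scl c wx" for i
  proof (rule mult[OF wx(1,2) rwx _ _ x])
    show "ctr (delta i) S \<in> C 2" using S(1) unfolding C3(2) by (rule ctr_sol)
    show "row x (ctr (delta i) S) = 0"
      by (intro bl_zero_row) (simp add: bl_ctl ctl_ctr S lin_simps(3)[OF ctr_lin] lin_simps(3)[OF ctl_lin] pointwise)
  qed
  then obtain u where u: "\<And>i. ctr (delta i) S = scl (u i) wx" by metis
  have u0: "u \<noteq> 0"
  proof
    assume "u = 0"
    then have "S = 0" using S(1) u unfolding C3(2)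
      by (intro tens_eqI_right[of S 2]) (auto simp: pointwise lin_simps(3)[OF ctr_lin] intro: sol_tens tensI)
    then show False using S by simp
  qed
  have rk: "rank1 (row y wx) u \<in> C 2" for y
  proof -
    have c: "ctl y S \<in> C 2" using S(1) unfolding C3(2) by (rule ctl_sol)
    have "ctl y S = rank1 (row y wx) u"
    proof (rule tens2_eqI[OF sol_tens[OF c] rank1_tens])
      fix i j
      have "ctl y S [i, j] = ctr (delta j) (ctl y S) [i]" by simp
      also have "\<dots> = ctl y (scl (u j) wx) [i]" by (simp only: ctl_ctr[symmetric] u)
      also have "\<dots> = rank1 (row y wx) u [i, j]"
        by (simp add: lin_simps(2)[OF ctl_lin] scl_apply ctl_single mult.commute)
      finally show "ctl y S [i, j] = rank1 (row y wx) u [i, j]" .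
    qed
    then show ?thesis using c by simp
  qed
  obtain y where f0: "row y wx \<noteq> 0" using row_eq_0[OF sol_tens[OF wx(1)]] wx(2) by blast
  let ?f = "row y wx"
  have "\<exists>m. row z wx = scl m ?f" for z
  proof (cases "row z wx = 0")
    case True then show ?thesis by (intro exI[of _ 0]) simp
  next
    case False then show ?thesis using rank1_prop(1)[OF null rk[of y] rk[of z] f0 u0] u0 by blast
  qed
  then have "\<forall>i. \<exists>m. row (delta i) wx = scl m ?f" by blast
  then obtain m where m: "\<And>i. row (delta i) wx = scl (m i) ?f" by (auto dest!: choice)
  have wm: "wx = rank1 m ?f"
  proof (rule tens2_eqI[OF sol_tens[OF wx(1)] rank1_tens])
    fix i j
    have "wx [i, j] = row (delta i) wx j" by (simp add: row_bl)
    also have "\<dots> = m i * ?f j" unfolding m by (simp add: scl_apply)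
    finally show "wx [i, j] = rank1 m ?f [i, j]" by simp
  qed
  have m0: "m \<noteq> 0" using wm wx(2) rank1_eq_0 by metis
  have "rank1 m ?f \<in> C 2" using wm wx(1) by simp
  then obtain c where c: "?f = scl c m" using rank1_prop(1)[OF null _ rk[of y] m0 f0 f0 u0] by blast
  obtain z where z: "pr ?f z \<noteq> 0" using pr_nz[OF f0] by blast
  have "bl (rank1 m ?f) x z = 0" using wx(3)[of z] by (simp only: wm[symmetric])
  then have "pr m x = 0" using z by simp
  then have "pr ?f x = 0" by (subst c) (simp add: pr_simps)
  then show ?thesis using f0 u0 rk[of y] by blast
qed

lemma (in no_full) dim_C3_le_1:
  assumes null: "\<nexists>k. right_null (C 2) k" "\<nexists>k. left_null (C 2) k"
  shows "fs.dim (C 3) \<le> 1"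
proof (rule ccontr)
  assume "\<not> ?thesis"
  then have "2 \<le> fs.dim (C 3)" by simp
  then obtain T1 T2 where T: "T1 \<in> C 3" "T2 \<in> C 3" "indep2 T1 T2"
    using dim_ge_2E[OF subspace_sol fin_dim_sol] by blast
  \<comment> \<open>Any nonzero vector serves for the first application; the second one uses a
    vector at which the left factor just found is nonzero.\<close>
  have "delta 0 \<noteq> (0 :: 3 \<Rightarrow> 'k)" by (auto simp: delta_def fun_eq_iff pointwise)
  then obtain f u where f: "f \<noteq> 0" "u \<noteq> 0" "rank1 f u \<in> C 2" using degenerate_rank1[OF null T] by blast
  obtain x where x: "pr f x \<noteq> 0" using pr_nz[OF f(1)] by blast
  then have "x \<noteq> 0" by (auto simp: pr_simps)
  then obtain f' u' where f': "f' \<noteq> 0" "u' \<noteq> 0" "pr f' x = 0" "rank1 f' u' \<in> C 2"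
    using degenerate_rank1[OF null T] by blast
  obtain c where c: "f' = scl c f" using rank1_prop(1)[OF null f(3) f'(4) f(1,2) f'(1,2)] by blast
  then have "c = 0" using f'(3) x by (simp add: pr_simps)
  then show False using c f'(1) by simp
qed

section \<open>At most one relation in degree three\<close>

definition tpow :: "(3 \<Rightarrow> 'k::field) \<Rightarrow> nat \<Rightarrow> 'k tens" where
  "tpow f n = (\<lambda>w. if length w = n then prod_list (map f w) else 0)"

context three_rel
begin

lemma C_eq_0_Suc: "C n = {0} \<Longrightarrow> C (Suc n) = {0}"
proof (intro equalityI subsetI)
  fix t assume n: "C n = {0}" and t: "t \<in> C (Suc n)"
  have "t = 0"
  proof (rule tens_eqI[OF sol_tens[OF t] sol_tens[OF C0]])
    fix i show "ctl (delta i) t = ctl (delta i) 0"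
      using ctl_sol[OF t, of "delta i"] by (simp add: n lin_simps(3)[OF ctl_lin])
  qed
  then show "t \<in> {0}" by simp
qed (auto intro: C0)

lemma dim_0_mono:
  assumes "fs.dim (C n) = 0" "n \<le> m"
  shows "fs.dim (C m) = 0"
proof -
  have "C n = {0}" using assms(1) dim_eq_0[OF fin_dim_sol subspace_sol] by blast
  with assms(2) have "C m = {0}"
  proof (induction m rule: dec_induct)
    case (step m)
    then show ?case by (intro C_eq_0_Suc)
  qed
  then show ?thesis by (simp add: dim_zero)
qed

lemma dim_one_span:
  assumes "T \<noteq> 0" "\<And>t. t \<in> C n \<Longrightarrow> \<exists>c. t = scl c T" "T \<in> C n"
  shows "fs.dim (C n) = 1"
proof (rule fs.dim_unique[of "{T}"])
  show "C n \<subseteq> fs.span {T}" using assms(2) by (auto simp: fs.span_singleton)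
qed (use assms in auto)

text \<open>A nonzero tensor of degree four has all left and all right contractions on the line of
  \<open>T\<close>. Comparing them rotates indices and makes \<open>T\<close> a multiple of the cube
  of a form \<open>l\<close>. Then every power of \<open>l\<close> satisfies the relations, and the
  same comparison shows that the powers span.\<close>

lemma dim_C3_one:
  assumes "fs.dim (C 3) = 1"
  shows "(\<forall>n\<ge>4. fs.dim (C n) = 0) \<or> (\<forall>n\<ge>3. fs.dim (C n) = 1)"
proof (cases "C 4 = {0}")
  case True
  then show ?thesis using dim_0_mono[of 4] by (simp add: dim_zero)
next
  case False
  have C4: "C 4 = C (Suc 3)" "C 3 = C (Suc 2)" by simp_all
  obtain T where T: "T \<in> C 3" "T \<noteq> 0" "\<And>t. t \<in> C 3 \<Longrightarrow> \<exists>c. t = scl c T"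
  proof -
    obtain B where B: "B \<subseteq> C 3" "finite B" "fs.independent B" "fs.span B = C 3" "card B = fs.dim (C 3)"
      by (rule fin_dim_basis[OF subspace_sol fin_dim_sol])
    then obtain T where "B = {T}" using assms by (auto simp: card_1_singleton_iff)
    then show thesis using that[of T] B by (auto simp: fs.span_singleton)
  qed
  obtain S where S: "S \<in> C 4" "S \<noteq> 0" using False C0[of 4] by blast
  have "\<exists>c. ctl (delta i) S = scl c T" "\<exists>c. ctr (delta i) S = scl c T" for i
    using T(3)[OF ctl_sol[OF S(1)[unfolded C4(1)]]] T(3)[OF ctr_sol[OF S(1)[unfolded C4(1)]]] by blast+
  then obtain l m where lm: "\<And>i. ctl (delta i) S = scl (l i) T" "\<And>i. ctr (delta i) S = scl (m i) T" by metis
  have Sl: "S (i # w) = l i * T w" and Sm: "S (w @ [i]) = m i * T w" for i w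
    using fun_cong[OF lm(1)[of i], of w] fun_cong[OF lm(2)[of i], of w] by (simp_all add: scl_apply)
  have "m \<noteq> 0"
  proof
    assume "m = 0"
    then have "S = 0" using S(1) lm(2) unfolding C4(1)
      by (intro tens_eqI_right[of S 3]) (auto simp: pointwise lin_simps(3)[OF ctr_lin] intro: sol_tens tensI)
    then show False using S by simp
  qed
  then obtain q where q: "m q \<noteq> 0" by (auto simp: fun_eq_iff pointwise)
  \<comment> \<open>A first index is traded for the last index \<open>q\<close>; three such moves
    lead to \<open>T [q, q, q]\<close>.\<close>
  have shift: "T (i # w) = l i / m q * T (w @ [q])" for i w
    using Sl[of i "w @ [q]"] Sm[of "i # w" q] q by (simp add: field_simps)
  have T3: "T [i, j, k] = l i * l j * l k * (T [q, q, q] / (m q * m q * m q))" for i j k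
    using shift[of i "[j, k]"] shift[of j "[k, q]"] shift[of k "[q, q]"] q by (simp add: field_simps)
  define c where "c = T [q, q, q] / (m q * m q * m q)"
  have T3': "T [i, j, k] = c * (l i * l j * l k)" for i j k unfolding T3[of i j k] c_def by simp
  obtain i j k where ijk: "T [i, j, k] \<noteq> 0"
  proof -
    obtain w where w: "T w \<noteq> 0" using T(2) by (auto simp: fun_eq_iff pointwise)
    then have "length w = 3" using tensD[OF sol_tens[OF T(1)]] by blast
    then obtain i j k where "w = [i, j, k]" by (auto simp: length_Suc_conv numeral_3_eq_3)
    then show thesis using that w by blast
  qed
  have rel: "(\<Sum>i\<in>UNIV. \<Sum>j\<in>UNIV. g [i, j] * (l i * l j)) = 0" if "g \<in> R" for g
  proof -
    have "c * l k * (\<Sum>i\<in>UNIV. \<Sum>j\<in>UNIV. g [i, j] * (l i * l j)) = (\<Sum>i\<in>UNIV. \<Sum>j\<in>UNIV. g [i, j] * T ([] @ [i, j] @ [k]))"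
      by (simp add: T3' sum_distrib_left mult_ac)
    also have "\<dots> = 0" by (rule solD[OF T(1) that])
    finally show ?thesis using ijk T3'[of i j k] by auto
  qed
  have powC: "tpow l n \<in> C n" for n
  proof (rule solI)
    show "tpow l n \<in> tens n" by (rule tensI) (simp add: tpow_def)
    fix g u v assume g: "g \<in> R"
    have "(\<Sum>i\<in>UNIV. \<Sum>j\<in>UNIV. g [i, j] * tpow l n (u @ [i, j] @ v)) =
      (if length u + length v + 2 = n then prod_list (map l u) * prod_list (map l v) * (\<Sum>i\<in>UNIV. \<Sum>j\<in>UNIV. g [i, j] * (l i * l j)) else 0)"
      by (auto simp: tpow_def sum_distrib_left mult_ac)
    then show "(\<Sum>i\<in>UNIV. \<Sum>j\<in>UNIV. g [i, j] * tpow l n (u @ [i, j] @ v)) = 0" by (simp add: rel[OF g])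
  qed
  have li: "l i \<noteq> 0" using ijk T3'[of i j k] by auto
  have pow0: "tpow l n \<noteq> 0" for n
  proof
    assume "tpow l n = 0"
    then have "tpow l n (replicate n i) = 0" by (simp add: pointwise)
    then show False using li by (simp add: tpow_def)
  qed
  have span: "\<exists>c. t = scl c (tpow l n)" if "3 \<le> n" "t \<in> C n" for n t
    using that
  proof (induction n arbitrary: t rule: dec_induct)
    case base
    have "T = scl c (tpow l 3)"
    proof
      fix w show "T w = scl c (tpow l 3) w"
      proof (cases "length w = 3")
        case True
        then obtain i j k where "w = [i, j, k]" by (auto simp: length_Suc_conv numeral_3_eq_3)
        then show ?thesis by (simp add: T3' tpow_def scl_apply mult_ac)
      qed (simp add: tpow_def scl_apply tensD[OF sol_tens[OF T(1)]])
    qed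
    then show ?case using T(3)[OF base] by auto
  next
    case (step n)
    have "\<exists>c. ctl (delta p) t = scl c (tpow l n)" "\<exists>c. ctr (delta p) t = scl c (tpow l n)" for p
      using step.prems by (auto intro!: step.IH ctl_sol ctr_sol)
    then obtain a b where ab: "\<And>p. ctl (delta p) t = scl (a p) (tpow l n)" "\<And>p. ctr (delta p) t = scl (b p) (tpow l n)" by metis
    have ta: "t (p # w) = a p * tpow l n w" and tb: "t (w @ [p]) = b p * tpow l n w" for p w
      using fun_cong[OF ab(1)[of p], of w] fun_cong[OF ab(2)[of p], of w] by (simp_all add: scl_apply)
    define v where "v = replicate (n - 1) i"
    have v: "length v = n - 1" "prod_list (map l v) \<noteq> 0" using li by (simp_all add: v_def)
    have ap: "a p = b i / l i * l p" for p
    proof -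
      have "a p * tpow l n (v @ [i]) = b i * tpow l n (p # v)" using ta[of p "v @ [i]"] tb[of "p # v" i] by simp
      then have "a p * l i = b i * l p" using v step.hyps by (simp add: tpow_def)
      then show ?thesis using li by (simp add: field_simps)
    qed
    have "t = scl (b i / l i) (tpow l (Suc n))"
    proof
      fix w show "t w = scl (b i / l i) (tpow l (Suc n)) w"
      proof (cases w)
        case Nil then show ?thesis using tensD[OF sol_tens[OF step.prems]] by (simp add: tpow_def scl_apply)
      next
        case (Cons p w') then show ?thesis by (simp add: ta ap tpow_def scl_apply)
      qed
    qed
    then show ?case by blast
  qed
  show ?thesis using dim_one_span[OF pow0 span powC] by blast
qed

end

section \<open>Relations with a common middle factor\<close>

context three_rel
begin

context
  fixes c z :: "3 \<Rightarrow> 'k"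
  assumes mid: "\<And>T u v. T \<in> C 3 \<Longrightarrow> pr c v = 0 \<Longrightarrow> ctl v (ctl u T) = 0"
    and z: "pr c z = 1"
begin

text \<open>Hypothesis \<open>mid\<close> says that the second slot of a degree three tensor carries
  the form \<open>c\<close>; slices transfer this to higher degrees.\<close>

lemma mid_gen: "T \<in> C (Suc (Suc (Suc p))) \<Longrightarrow> ctl v (ctl u T) = scl (pr c v) (ctl z (ctl u T))"
proof -
  assume T: "T \<in> C (Suc (Suc (Suc p)))"
  have "ctl y (ctl u T) = 0" if y: "pr c y = 0" for y
  proof
    fix w
    show "ctl y (ctl u T) w = 0 w"
    proof (cases "length w = Suc p")
      case True
      then obtain j w' where w: "w = j # w'" "length w' = p" by (auto simp: length_Suc_conv)
      have S: "(\<lambda>l. T (l @ w')) \<in> C 3" by (rule slice_sol_gen[OF _ w(2)]) (use T in \<open>simp add: numeral_3_eq_3\<close>)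
      have "ctl y (ctl u T) w = ctl y (ctl u (\<lambda>l. T (l @ w'))) [j]" by (simp add: ctl_def w)
      then show ?thesis by (simp add: mid[OF S y] pointwise)
    next
      case False
      have "ctl y (ctl u T) \<in> tens (Suc p)" using T sol_tens ctl_tens by blast
      then show ?thesis using False by (simp add: tensD pointwise)
    qed
  qed
  from this[of "v - scl (pr c v) z"] have "ctl (v + scl (- pr c v) z) (ctl u T) = 0"
    by (simp add: pr_simps z)
  then show ?thesis unfolding ctl_vec by simp
qed

text \<open>Contracts the second slot with \<open>z\<close>. That slot carries \<open>c\<close> and
  \<open>pr c z = 1\<close>, so no information is lost.\<close>

definition drop_mid :: "'k tens \<Rightarrow> 'k tens" where
  "drop_mid T = (\<lambda>w. case w of [] \<Rightarrow> 0 | i # w' \<Rightarrow> ctl z (ctl (delta i) T) w')"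

lemma drop_mid_lin: "lin drop_mid"
  by (rule linI) (auto simp: drop_mid_def fun_eq_iff pointwise lin_simps(1,2)[OF ctl_lin] split: list.split)

lemma ctl_drop_mid: "ctl (delta i) (drop_mid T) = ctl z (ctl (delta i) T)"
  by (rule ext) (simp add: drop_mid_def)

lemma drop_mid_inj: "T \<in> C (Suc (Suc (Suc p))) \<Longrightarrow> drop_mid T = 0 \<Longrightarrow> T = 0"
proof -
  assume T: "T \<in> C (Suc (Suc (Suc p)))" and 0: "drop_mid T = 0"
  have "ctl z (ctl (delta i) T) = 0" for i
    unfolding ctl_drop_mid[symmetric] 0 by (simp add: lin_simps(3)[OF ctl_lin])
  then have "ctl v (ctl (delta i) T) = 0" for v i using mid_gen[OF T, of v "delta i"] by simp
  then have "ctl (delta i) T = 0" for i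
    by (intro tens_eqI[OF sol_tens[OF ctl_sol[OF T]] sol_tens[OF C0]]) (simp only: lin_simps(3)[OF ctl_lin])
  then show ?thesis
    by (intro tens_eqI[OF sol_tens[OF T] sol_tens[OF C0]]) (simp only: lin_simps(3)[OF ctl_lin])
qed

lemma drop_mid_C:
  assumes "T \<in> C (Suc (Suc (Suc (Suc m))))"
  shows "drop_mid T \<in> C (Suc (Suc (Suc m)))"
proof (rule sol_Suc_I)
  have i: "ctl z (ctl (delta i) T) \<in> C (Suc (Suc m))" for i by (intro ctl_sol assms)
  show dt: "drop_mid T \<in> tens (Suc (Suc (Suc m)))"
    by (rule tensI) (auto simp: drop_mid_def split: list.split intro!: tensD[OF sol_tens[OF i]])
  show "ctl (delta i) (drop_mid T) \<in> C (Suc (Suc m))" for i by (simp only: ctl_drop_mid i)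
  fix w :: "3 list" assume w: "length w = Suc m"
  have d: "(\<lambda>l. drop_mid T (l @ w)) \<in> tens 2" using w by (intro tensI tensD[OF dt]) simp
  let ?s = "\<Sum>l\<in>UNIV. scl (z l) (\<lambda>s. T (s @ (l # w)))"
  have s: "?s \<in> C 2" by (intro C_sum C_scl slice_sol[OF assms]) (simp add: w)
  have "(\<lambda>l. drop_mid T (l @ w)) = ?s"
  proof (rule tens2_eqI[OF d sol_tens[OF s]])
    fix i j
    \<comment> \<open>In degree at least four the second and the third slot both carry
      \<open>c\<close>, so the contractions with \<open>z\<close> and with a unit vector may be
      exchanged. The slice becomes a combination of slices of \<open>T\<close>.\<close>
    have "drop_mid T ([i, j] @ w) = ctl (delta j) (ctl z (ctl (delta i) T)) w" by (simp add: drop_mid_def)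
    also have "\<dots> = ctl z (ctl (delta j) (ctl (delta i) T)) w"
      unfolding mid_gen[OF ctl_sol[OF assms], of "delta j"] mid_gen[OF assms, of "delta j"]
      by (simp add: lin_simps(2)[OF ctl_lin])
    also have "\<dots> = ?s [i, j]" by (simp add: ctl_def[of z] pointwise)
    finally show "drop_mid T ([i, j] @ w) = ?s [i, j]" .
  qed
  then show "(\<lambda>l. drop_mid T (l @ w)) \<in> C 2" using s by simp
qed

text \<open>The inverse construction inserts \<open>c\<close> as a new second slot. The pair formed
  by the second and third slots is \<open>c\<close> with \<open>c\<close>, admissible by hypothesis;
  the first pair is governed by the first pair of \<open>S\<close>.\<close>

lemma insert_mid:
  assumes cc: "rank1 c c \<in> C 2" and S: "S \<in> C (Suc (Suc (Suc m)))"
  obtains T where "T \<in> C (Suc (Suc (Suc (Suc m))))" "drop_mid T = S"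
proof -
  define app where "app s = (\<lambda>w. case w of [] \<Rightarrow> 0 | j # w' \<Rightarrow> c j * s w')" for s :: "'k tens"
  define T where "T = (\<lambda>w. case w of [] \<Rightarrow> 0 | i # w' \<Rightarrow> app (ctl (delta i) S) w')"
  have cT: "ctl (delta i) T = app (ctl (delta i) S)" for i by (rule ext) (simp add: T_def)
  have ca: "ctl (delta j) (app s) = scl (c j) s" for j s by (rule ext) (simp add: app_def scl_apply)
  have St: "length w \<noteq> Suc (Suc (Suc m)) \<Longrightarrow> S w = 0" for w by (rule tensD[OF sol_tens[OF S]])
  have Sz: "S (i # j # w) = c j * ctl z (ctl (delta i) S) w" for i j w
    using fun_cong[OF mid_gen[OF S, of "delta j" "delta i"], of w] by (simp add: scl_apply)
  have at: "app (ctl (delta i) S) \<in> tens (Suc (Suc (Suc m)))" for i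
    by (rule tensI) (auto simp: app_def St split: list.split)
  have aC: "app (ctl (delta i) S) \<in> C (Suc (Suc (Suc m)))" for i
  proof (rule sol_Suc_I[OF at])
    show "ctl (delta j) (app (ctl (delta i) S)) \<in> C (Suc (Suc m))" for j
      unfolding ca by (intro C_scl ctl_sol S)
    fix w :: "3 list" assume w: "length w = Suc m"
    have "(\<lambda>l. app (ctl (delta i) S) (l @ w)) = scl (ctl z (ctl (delta i) S) w) (rank1 c c)"
      by (rule tens2_eqI)
        (auto simp: app_def Sz scl_apply w tensD[OF rank1_tens] intro!: tensI tensD[OF at, unfolded app_def])
    then show "(\<lambda>l. app (ctl (delta i) S) (l @ w)) \<in> C 2" by (simp add: C_scl cc)
  qed
  have tt: "T \<in> tens (Suc (Suc (Suc (Suc m))))"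
    by (rule tensI) (auto simp: T_def tensD[OF at] split: list.split)
  have "T \<in> C (Suc (Suc (Suc (Suc m))))"
  proof (rule sol_Suc_I[OF tt])
    fix w :: "3 list" assume w: "length w = Suc (Suc m)"
    then obtain q w' where w': "w = q # w'" "length w' = Suc m" by (auto simp: length_Suc_conv)
    have s: "scl (c q) (\<lambda>l. S (l @ w')) \<in> C 2" by (intro C_scl slice_sol[OF S] w')
    have "(\<lambda>l. T (l @ w)) \<in> tens 2" using w by (intro tensI tensD[OF tt]) simp
    then have "(\<lambda>l. T (l @ w)) = scl (c q) (\<lambda>l. S (l @ w'))"
      by (rule tens2_eqI[OF _ sol_tens[OF s]]) (simp add: w' T_def app_def Sz scl_apply)
    then show "(\<lambda>l. T (l @ w)) \<in> C 2" using s by simp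
  qed (simp only: cT aC)
  moreover have "drop_mid T = S"
  proof
    fix w show "drop_mid T w = S w"
    proof (cases w)
      case (Cons i w')
      have "ctl z (app (ctl (delta i) S)) w' = pr c z * S (i # w')"
        by (simp add: ctl_def[of z] app_def pr_def sum_distrib_right mult.assoc)
      then show ?thesis by (simp add: Cons drop_mid_def cT z)
    qed (simp add: drop_mid_def St)
  qed
  ultimately show thesis by (rule that)
qed

lemma mid_dim:
  assumes "rank1 c c \<in> C 2" "3 \<le> n"
  shows "fs.dim (C n) = fs.dim (C 3)"
  using assms(2)
proof (induction n rule: dec_induct)
  case (step n)
  obtain m where m: "n = Suc (Suc (Suc m))" using step.hyps by (metis Suc_le_D numeral_3_eq_3 le_Suc_ex add_Suc)
  have "drop_mid ` C (Suc n) = C n"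
  proof (intro equalityI subsetI)
    fix S assume "S \<in> C n"
    then show "S \<in> drop_mid ` C (Suc n)"
      unfolding m using insert_mid[OF assms(1)] by (metis image_eqI)
  qed (use drop_mid_C m in blast)
  then have "fs.dim (C (Suc n)) = fs.dim (C n)"
    using dim_inj_image[OF drop_mid_lin subspace_sol fin_dim_sol, of "Suc n" R] drop_mid_inj m by auto
  then show ?case using step.IH by simp
qed simp

text \<open>A degree three tensor amounts to a 3 by 3 matrix with \<open>c\<close> in the middle
  slot. It is annihilated by \<open>k'\<close> from the left and by \<open>k\<close> from the right,
  so it is determined by the 2 by 2 block outside row \<open>p\<close> and column
  \<open>q\<close>.\<close>

lemma mid_dim_le_4:
  assumes k: "k' \<noteq> 0" "k \<noteq> 0" and T0: "\<And>T. T \<in> C 3 \<Longrightarrow> ctl k' T = 0" "\<And>T. T \<in> C 3 \<Longrightarrow> ctr k T = 0"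
  shows "fs.dim (C 3) \<le> 4"
proof -
  obtain p q where pq: "k' p \<noteq> 0" "k q \<noteq> 0" using k by (auto simp: fun_eq_iff pointwise)
  let ?Y = "(UNIV - {p}) \<times> (UNIV - {q}) :: (3 \<times> 3) set"
  let ?F = "\<lambda>T :: 'k tens. (\<lambda>x. if x \<in> ?Y then ctl z (ctl (delta (fst x)) T) [snd x] else 0)"
  have lin: "lin ?F"
    by (rule linI) (auto simp: fun_eq_iff pointwise lin_simps(1,2)[OF ctl_lin])
  have inj: "T = 0" if T: "T \<in> C 3" and 0: "?F T = 0" for T
  proof -
    let ?b = "\<lambda>i j. ctl z (ctl (delta i) T) [j]"
    have b0: "?b i j = 0" if "i \<noteq> p" "j \<noteq> q" for i j
      using fun_cong[OF 0, of "(i, j)"] that by (simp add: pointwise)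
    have bl: "(\<Sum>i\<in>UNIV. k' i * ?b i j) = 0" for j
    proof -
      have "(\<Sum>i\<in>UNIV. k' i * ?b i j) = ctl z (ctl k' T) [j]"
        unfolding ctl_def[of z] ctl_delta unfolding ctl_def sum_distrib_left by (subst sum.swap) (simp add: mult_ac)
      then show ?thesis by (simp add: T0[OF T] lin_simps(3)[OF ctl_lin] pointwise)
    qed
    have br: "(\<Sum>j\<in>UNIV. k j * ?b i j) = 0" for i
    proof -
      have "(\<Sum>j\<in>UNIV. k j * ?b i j) = ctr k (ctl z (ctl (delta i) T)) []" by (simp add: ctr_def)
      also have "\<dots> = ctl z (ctl (delta i) (ctr k T)) []" by (simp only: ctl_ctr)
      finally show ?thesis by (simp add: T0[OF T] lin_simps(3)[OF ctl_lin] pointwise)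
    qed
    have b1: "?b i j = 0" if "j \<noteq> q" for i j
    proof (cases "i = p")
      case True
      have "(\<Sum>i\<in>UNIV. k' i * ?b i j) = (\<Sum>i\<in>{p}. k' i * ?b i j)"
        by (rule sum.mono_neutral_right) (use b0 that in auto)
      then show ?thesis using bl[of j] pq True by simp
    qed (use b0 that in blast)
    have "?b i j = 0" for i j
    proof (cases "j = q")
      case True
      have "(\<Sum>j\<in>UNIV. k j * ?b i j) = (\<Sum>j\<in>{q}. k j * ?b i j)"
        by (rule sum.mono_neutral_right) (use b1 in auto)
      then show ?thesis using br[of i] pq True by simp
    qed (use b1 in blast)
    then have e: "ctl (delta j) (ctl z (ctl (delta i) T)) [] = 0" for i j by simp
    have T': "T \<in> C (Suc (Suc (Suc 0)))" using T by (simp add: numeral_3_eq_3)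
    have "drop_mid T = 0"
    proof
      fix w show "drop_mid T w = 0 w"
      proof (cases "length w = 2")
        case True
        then obtain i j where "w = [i, j]" by (auto simp: length_Suc_conv numeral_2_eq_2)
        then show ?thesis using e[of j i] by (simp add: drop_mid_def pointwise)
      next
        case False
        have "ctl z (ctl (delta i) T) \<in> tens (Suc 0)" for i using T' sol_tens ctl_tens by blast
        then show ?thesis using False by (auto simp: drop_mid_def pointwise split: list.split intro!: tensD)
      qed
    qed
    then show ?thesis by (rule drop_mid_inj[OF T'])
  qed
  have "fs.dim (C 3) = fs.dim (?F ` C 3)"
    using dim_inj_image[OF lin subspace_sol fin_dim_sol inj] by simp
  also have "\<dots> \<le> fs.dim (supp_on ?Y :: (3 \<times> 3 \<Rightarrow> 'k) set)"
    by (rule dim_subset[OF _ fin_dim_supp_on]) (auto simp: supp_on_def)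
  also have "\<dots> = 4" by (subst dim_supp_on) (simp_all add: card_cartesian_product)
  finally show ?thesis .
qed

end

lemma left_null_ctl:
  assumes "left_null (C 2) k" "T \<in> C (Suc (Suc n))"
  shows "ctl k T = 0"
proof (rule tens_eqI[OF sol_tens[OF ctl_sol[OF assms(2)]] sol_tens[OF C0]])
  fix i
  have "ctl (delta i) (ctl k T) = 0"
    by (rule product_zero[OF assms(2)]) (use assms(1) in \<open>simp add: left_null_def\<close>)
  then show "ctl (delta i) (ctl k T) = ctl (delta i) 0" by (simp only: lin_simps(3)[OF ctl_lin])
qed

lemma right_null_ctr: "right_null (C 2) k \<Longrightarrow> T \<in> C 3 \<Longrightarrow> ctr k T = 0"
proof
  fix w assume k: "right_null (C 2) k" and T: "T \<in> C 3"
  have T': "T \<in> C (Suc 2)" using T by simp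
  show "ctr k T w = 0 w"
  proof (cases "length w = 2")
    case True
    then obtain i j where w: "w = [i, j]" by (auto simp: length_Suc_conv numeral_2_eq_2)
    have "ctl (delta i) T \<in> C 2" by (rule ctl_sol[OF T'])
    then have "bl (ctl (delta i) T) (delta j) k = 0" using k by (auto simp: right_null_def)
    then show ?thesis by (simp add: w ctr_def bl_ctl pointwise) (simp add: ctl_def[of k])
  next
    case False
    then show ?thesis using ctr_tens[OF sol_tens[OF T'], of k] by (simp add: tensD pointwise)
  qed
qed

lemma right_null_ctl: "right_null (C 2) k \<Longrightarrow> T \<in> C (Suc (Suc n)) \<Longrightarrow> ctl k (ctl u T) = 0"
  by (rule product_zero) (auto simp: right_null_def)

text \<open>The middle slot vanishes at \<open>k\<close>, as a right factor, and at
  \<open>k'\<close>, as a left factor, so it carries the form \<open>c\<close> whose kernel they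
  span. If \<open>rank1 c c\<close> were not in \<open>C 2\<close>, both outer factors would be
  unique up to scalars, contradicting the dimension of \<open>C 3\<close>.\<close>

lemma distinct_null_mid:
  assumes k: "right_null (C 2) k" and k': "left_null (C 2) k'" and ind: "indep2 k k'" and d: "2 \<le> fs.dim (C 3)"
  shows "\<forall>n\<ge>3. fs.dim (C n) = fs.dim (C 3)" "fs.dim (C 3) \<le> 4"
proof -
  have C3: "C 3 = C (Suc (Suc (Suc 0)))" "C 3 = C (Suc 2)" by (simp_all add: numeral_3_eq_3)
  obtain c where c: "c \<noteq> 0" "pr c k = 0" "pr c k' = 0" using common_zero2[of k k'] by (metis pr_commute)
  obtain z where z: "pr c z = 1" using pr_nz'[OF c(1)] by blast
  have mid: "ctl v (ctl u T) = 0" if T: "T \<in> C 3" and v: "pr c v = 0" for T u v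
  proof -
    obtain a b where ab: "v = scl a k + scl b k'" using kernel_combination[OF c ind v] by blast
    have "ctl k (ctl u T) = 0" using right_null_ctl[OF k] T unfolding C3(1) by blast
    moreover have "ctl u T \<in> C (Suc (Suc 0))" using T unfolding C3(1) by (rule ctl_sol)
    then have "ctl k' (ctl u T) = 0" by (rule left_null_ctl[OF k'])
    ultimately show ?thesis by (simp add: ab ctl_vec)
  qed
  have kl: "ctl k' T = 0" if "T \<in> C 3" for T using left_null_ctl[OF k'] that unfolding C3(1) by blast
  have nz: "k \<noteq> 0" "k' \<noteq> 0" using k k' by (auto simp: right_null_def left_null_def)
  show "fs.dim (C 3) \<le> 4"
    by (rule mid_dim_le_4[OF mid z nz(2,1) kl right_null_ctr[OF k]])
  have cc: "rank1 c c \<in> C 2"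
  proof (rule ccontr)
    assume ncc: "rank1 c c \<notin> C 2"
    obtain T1 T2 where T: "T1 \<in> C 3" "T2 \<in> C 3" "indep2 T1 T2"
      using dim_ge_2E[OF subspace_sol fin_dim_sol d] by blast
    define b where "b T i j = ctl z (ctl (delta i) T) [j]" for T i j
    have Tb: "T [i, l, j] = c l * b T i j" if T: "T \<in> C 3" for T i j l
      using fun_cong[OF mid_gen[OF mid z T[unfolded C3(1)], of "delta l" "delta i"], of "[j]"]
      by (simp add: b_def scl_apply)
    have col: "rank1 (\<lambda>i. b T i j) c \<in> C 2" if T: "T \<in> C 3" for T j
    proof -
      have s: "ctr (delta j) T \<in> C 2" using T unfolding C3(2) by (rule ctr_sol)
      have "ctr (delta j) T = rank1 (\<lambda>i. b T i j) c"
        by (rule tens2_eqI[OF sol_tens[OF s] rank1_tens]) (simp add: Tb[OF T] mult.commute)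
      then show ?thesis using s by simp
    qed
    have rw: "rank1 c (b T i) \<in> C 2" if T: "T \<in> C 3" for T i
    proof -
      have s: "ctl (delta i) T \<in> C 2" using T unfolding C3(2) by (rule ctl_sol)
      have "ctl (delta i) T = rank1 c (b T i)"
        by (rule tens2_eqI[OF sol_tens[OF s] rank1_tens]) (simp add: Tb[OF T])
      then show ?thesis using s by simp
    qed
    have lin1: "rank1 (scl a f + scl b g) h = scl a (rank1 f h) + scl b (rank1 g h)"
      "rank1 h (scl a f + scl b g) = scl a (rank1 h f) + scl b (rank1 h g)" for a b and f g h :: "3 \<Rightarrow> 'k"
      by (auto simp: rank1_def fun_eq_iff pointwise algebra_simps split: list.split)
    \<comment> \<open>Both left factors lie in the plane of forms vanishing at \<open>k'\<close>.
      That plane contains \<open>c\<close>, so independence would put \<open>rank1 c c\<close> into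
      \<open>C 2\<close>.\<close>
    have dep1: "\<not> indep2 m m'" if "rank1 m c \<in> C 2" "rank1 m' c \<in> C 2" for m m'
    proof
      assume i: "indep2 m m'"
      have "pr m k' * pr c z = 0" "pr m' k' * pr c z = 0"
        using that k' unfolding left_null_def by (metis bl_rank1)+
      then obtain a b where "c = scl a m + scl b m'"
        using dim_le_2D[OF dim_annihilator(3)[OF nz(2)] _ _ _ _ i, of c] dim_annihilator(1)[OF nz(2)] c z by auto
      then have "rank1 c c = scl a (rank1 m c) + scl b (rank1 m' c)" using lin1(1) by metis
      then show False using ncc that by (metis C_add C_scl)
    qed
    have dep2: "\<not> indep2 m m'" if "rank1 c m \<in> C 2" "rank1 c m' \<in> C 2" for m m'
    proof
      assume i: "indep2 m m'"
      have "pr c z * pr m k = 0" "pr c z * pr m' k = 0"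
        using that k unfolding right_null_def by (metis bl_rank1)+
      then obtain a b where "c = scl a m + scl b m'"
        using dim_le_2D[OF dim_annihilator(3)[OF nz(1)] _ _ _ _ i, of c] dim_annihilator(1)[OF nz(1)] c z by auto
      then have "rank1 c c = scl a (rank1 c m) + scl b (rank1 c m')" using lin1(2) by metis
      then show False using ncc that by (metis C_add C_scl)
    qed
    have Tnz: "T = 0" if T: "T \<in> C 3" and b: "\<And>i j. b T i j = 0" for T
    proof
      fix w show "T w = 0 w"
      proof (cases "length w = 3")
        case True
        then obtain i l j where "w = [i, l, j]" by (auto simp: length_Suc_conv numeral_3_eq_3)
        then show ?thesis by (simp add: Tb[OF T] b pointwise)
      qed (use tensD[OF sol_tens[OF T]] in \<open>simp add: pointwise\<close>)
    qed
    obtain p q where pq: "b T1 p q \<noteq> 0" using Tnz[OF T(1)] indep2_nz(1)[OF T(3)] by blast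
    define m0 where "m0 = (\<lambda>i. b T1 i q)"
    define y0 where "y0 = b T1 p"
    have m0: "m0 p \<noteq> 0" "m0 \<noteq> 0" and y0: "y0 \<noteq> 0"
      using pq by (auto simp: m0_def y0_def fun_eq_iff pointwise)
    have form: "\<exists>s. \<forall>i j. b T i j = s * (m0 i * y0 j)" if T': "T \<in> C 3" for T
    proof -
      have "\<exists>s. (\<lambda>i. b T i j) = scl s m0" for j
        using not_indep2[OF dep1[OF col[OF T(1)] col[OF T']]] m0(2) unfolding m0_def by metis
      then obtain s where "\<forall>j. (\<lambda>i. b T i j) = scl (s j) m0" by metis
      then have s: "b T i j = s j * m0 i" for i j by (metis scl_apply)
      have "\<exists>s. b T p = scl s y0"
        using not_indep2[OF dep2[OF rw[OF T(1)] rw[OF T']]] y0 unfolding y0_def by metis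
      then obtain n where "b T p = scl n y0" by blast
      then have "s j * m0 p = n * y0 j" for j using s by (metis scl_apply)
      then have "s j = n / m0 p * y0 j" for j using m0(1) by (simp add: field_simps)
      then have "\<forall>i j. b T i j = (n / m0 p) * (m0 i * y0 j)" using s by simp
      then show ?thesis by blast
    qed
    obtain s1 s2 where s: "\<And>i j. b T1 i j = s1 * (m0 i * y0 j)" "\<And>i j. b T2 i j = s2 * (m0 i * y0 j)"
      using form T by metis
    have "b (scl s2 T1 - scl s1 T2) i j = s2 * b T1 i j - s1 * b T2 i j" for i j
      unfolding b_def by (simp add: lin_simps(2,5)[OF ctl_lin] pointwise)
    then have "scl s2 T1 - scl s1 T2 = 0" using s T by (intro Tnz C_diff C_scl) auto
    then have "scl s2 T1 + scl (- s1) T2 = 0" by simp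
    then have "s1 = 0" using indep2D[OF T(3), of s2 "- s1"] by simp
    then show False using s(1) pq by simp
  qed
  show "\<forall>n\<ge>3. fs.dim (C n) = fs.dim (C 3)" using mid_dim[OF mid z cc] by blast
qed

end

lemma rank1_of_columns:
  assumes "w \<in> tens 2" "indep2 x v" "\<And>u. bl w u x = 0" "\<And>u. bl w u v = 0"
  obtains p h where "pr p x = 0" "pr p v = 0" "w = rank1 h p" "p \<noteq> 0"
proof -
  have t: "rv w \<in> tens 2" by (rule tensI) (simp add: rv_def tensD[OF assms(1)])
  have "row x (rv w) = 0" "row v (rv w) = 0" using assms(3,4) by (auto intro: bl_zero_row simp: bl_rv)
  from rank1_of_rows[OF t assms(2) this] obtain p h where p: "pr p x = 0" "pr p v = 0" "rv w = rank1 p h" "p \<noteq> 0"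
    by blast
  have "w = rank1 h p" using p(3) by (metis rv_rv rv_rank1)
  then show thesis using that p by blast
qed

lemma rank1_comb: "rank1 (scl a f + scl b g) h = scl a (rank1 f h) + scl b (rank1 g h)"
  "rank1 h (scl a f + scl b g) = scl a (rank1 h f) + scl b (rank1 h g)"
  by (auto simp: rank1_def fun_eq_iff pointwise algebra_simps split: list.split)

lemma rank1_scl: "rank1 (scl a f) h = scl a (rank1 f h)" "rank1 h (scl a f) = scl a (rank1 h f)"
  by (auto simp: rank1_def fun_eq_iff pointwise split: list.split)

context no_full
begin

text \<open>For each \<open>y\<close> independent of \<open>k\<close>, some nonzero element vanishes
  on the right at \<open>k\<close> and at \<open>y\<close>, so it has rank one. Varying
  \<open>y\<close> gives two independent right factors; independent left factors would produce a
  left null vector.\<close>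

lemma column_ideal:
  assumes k: "right_null (C 2) k" and nl: "\<nexists>k. left_null (C 2) k"
  obtains e f1 f2 where "e \<noteq> 0" "pr f1 k = 0" "pr f2 k = 0" "indep2 f1 f2" "rank1 e f1 \<in> C 2" "rank1 e f2 \<in> C 2"
proof -
  have k0: "k \<noteq> 0" and kn: "\<And>w v. w \<in> C 2 \<Longrightarrow> bl w v k = 0" using k by (auto simp: right_null_def)
  have ex: "\<exists>e f. e \<noteq> 0 \<and> f \<noteq> 0 \<and> pr f k = 0 \<and> pr f y = 0 \<and> rank1 e f \<in> C 2" if y: "indep2 k y" for y
  proof -
    obtain w where w: "w \<in> C 2" "w \<noteq> 0" "\<And>u. bl w u y = 0" using right_sing by blast
    obtain f e where f: "pr f k = 0" "pr f y = 0" "w = rank1 e f" "f \<noteq> 0"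
      by (rule rank1_of_columns[OF sol_tens[OF w(1)] y kn[OF w(1)] w(3)])
    then show ?thesis using w rank1_eq_0 by metis
  qed
  have ind: "indep2 k y" if "pr f k = 0" "pr f y \<noteq> 0" for f y unfolding indep2_def
  proof (intro allI impI)
    fix a b assume z: "scl a k + scl b y = 0"
    have "b * pr f y = 0" using arg_cong[OF z, of "pr f"] that by (simp add: pr_simps)
    then show "a = 0 \<and> b = 0" using that z k0 by auto
  qed
  obtain f0 where f0: "f0 \<noteq> 0" "pr f0 k = 0" using common_zero2[of k k] by (metis pr_commute)
  obtain y1 where y1: "pr f0 y1 \<noteq> 0" using pr_nz[OF f0(1)] by blast
  obtain e1 f1 where 1: "e1 \<noteq> 0" "f1 \<noteq> 0" "pr f1 k = 0" "rank1 e1 f1 \<in> C 2"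
    using ex[OF ind[OF f0(2) y1]] by blast
  obtain y2 where y2: "pr f1 y2 \<noteq> 0" using pr_nz[OF 1(2)] by blast
  obtain e2 f2 where 2: "e2 \<noteq> 0" "f2 \<noteq> 0" "pr f2 k = 0" "pr f2 y2 = 0" "rank1 e2 f2 \<in> C 2"
    using ex[OF ind[OF 1(3) y2]] by blast
  have i: "indep2 f1 f2" unfolding indep2_def
  proof (intro allI impI)
    fix a b assume z: "scl a f1 + scl b f2 = 0"
    have "a * pr f1 y2 = 0" using arg_cong[OF z, of "\<lambda>f. pr f y2"] 2 by (simp add: pr_simps)
    then show "a = 0 \<and> b = 0" using y2 z 2 by auto
  qed
  have "\<not> indep2 e1 e2" using left_null_of_rank1[OF 1(4) 2(5) 1(2) 2(2)] nl by blast
  then obtain l where l: "e2 = scl l e1" using not_indep2 1(1) by blast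
  then have "l \<noteq> 0" using 2(1) by auto
  have "rank1 e2 f2 = scl l (rank1 e1 f2)" unfolding l rank1_scl ..
  then have "rank1 e1 f2 = scl (inverse l) (rank1 e2 f2)" using \<open>l \<noteq> 0\<close> by simp
  then have "rank1 e1 f2 \<in> C 2" using C_scl[OF 2(5)] by simp
  then show thesis using that 1 2 i by blast
qed

text \<open>\<open>C 2\<close> contains \<open>e\<close> times every form vanishing at
  \<open>k\<close>. The first slot of a degree three tensor carries \<open>e\<close>, since
  otherwise rank one elements with independent left factors appear. The dimension of
  \<open>C 3\<close> forces \<open>pr e k = 0\<close>; then the middle slot carries \<open>e\<close>
  too, and \<open>rank1 e e\<close> lies in \<open>C 2\<close>.\<close>

lemma one_null_mid:
  assumes k: "right_null (C 2) k" and nl: "\<nexists>k. left_null (C 2) k" and d: "2 \<le> fs.dim (C 3)"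
  shows "\<forall>n\<ge>3. fs.dim (C n) = fs.dim (C 3)" "fs.dim (C 3) \<le> 4"
proof -
  have C3: "C 3 = C (Suc 2)" by simp
  obtain e f1 f2 where e: "e \<noteq> 0" and f: "pr f1 k = 0" "pr f2 k = 0" "indep2 f1 f2"
    and ef: "rank1 e f1 \<in> C 2" "rank1 e f2 \<in> C 2"
    by (rule column_ideal[OF k nl])
  have k0: "k \<noteq> 0" using k by (auto simp: right_null_def)
  obtain z where z: "pr e z = 1" using pr_nz'[OF e] by blast
  have ind: "indep2 (rank1 e f1) (rank1 e f2)" unfolding indep2_def
  proof (intro allI impI)
    fix a b assume "scl a (rank1 e f1) + scl b (rank1 e f2) = 0"
    then have "rank1 e (scl a f1 + scl b f2) = 0" by (simp add: rank1_comb)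
    then show "a = 0 \<and> b = 0" using e indep2D[OF f(3)] by (auto simp: rank1_eq_0)
  qed
  obtain w where w: "w \<in> C 2" "\<And>w'. w' \<in> C 2 \<Longrightarrow> \<exists>a b c. w' = scl a (rank1 e f1) + scl b (rank1 e f2) + scl c w"
    using basis3[OF subspace_sol fin_dim_sol dim_W ef ind] by metis
  have no_row: "n = 0" if "pr e n = 0" "row n w = 0" for n
  proof (rule ccontr)
    assume n: "n \<noteq> 0"
    have "bl w' n v = 0" if "w' \<in> C 2" for w' v
      using w(2)[OF that] \<open>pr e n = 0\<close> \<open>row n w = 0\<close> by (auto simp: bl_add bl_pr[of w] pr_simps)
    then show False using nl n by (auto simp: left_null_def)
  qed
  have A: "ctl n T = 0" if T: "T \<in> C 3" and n: "pr e n = 0" for T n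
  proof -
    have "\<exists>a b c. ctr (delta i) T = scl a (rank1 e f1) + scl b (rank1 e f2) + scl c w" for i
      using T unfolding C3 by (intro w ctr_sol)
    then obtain a b g where g: "\<And>i. ctr (delta i) T = scl (a i) (rank1 e f1) + scl (b i) (rank1 e f2) + scl (g i) w"
      by metis
    have s: "ctl n T \<in> C 2" for n using T unfolding C3 by (rule ctl_sol)
    \<comment> \<open>On vectors with \<open>pr e n = 0\<close> only the component along
      \<open>w\<close> survives.\<close>
    have r1: "ctl n T = rank1 (row n w) g" if "pr e n = 0" for n
    proof (rule tens2_eqI[OF sol_tens[OF s] rank1_tens])
      fix j i
      have "ctl n T [j, i] = ctl n (ctr (delta i) T) [j]" by (simp add: ctl_ctr)
      also have "\<dots> = bl (ctr (delta i) T) n (delta j)" by (simp add: ctl_single row_bl)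
      also have "\<dots> = g i * row n w j" unfolding g by (simp add: bl_add that row_bl)
      finally show "ctl n T [j, i] = rank1 (row n w) g [j, i]" by (simp add: mult.commute)
    qed
    have "g = 0"
    proof (rule ccontr)
      assume g0: "g \<noteq> 0"
      obtain n1 n2 where n: "pr e n1 = 0" "pr e n2 = 0" "indep2 n1 n2"
        using dim_ge_2E[OF dim_annihilator(2,3)[OF e]] dim_annihilator(1)[OF e]
        by (metis (mono_tags, lifting) mem_Collect_eq order_refl pr_commute)
      have "indep2 (row n1 w) (row n2 w)" unfolding indep2_def
      proof (intro allI impI)
        fix a b assume "scl a (row n1 w) + scl b (row n2 w) = 0"
        then have "row (scl a n1 + scl b n2) w = 0" unfolding row_vec .
        moreover have "pr e (scl a n1 + scl b n2) = 0" by (simp add: pr_simps n)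
        ultimately have "scl a n1 + scl b n2 = 0" by (rule no_row[rotated])
        then show "a = 0 \<and> b = 0" by (rule indep2D[OF n(3)])
      qed
      moreover have "rank1 (row n1 w) g \<in> C 2" "rank1 (row n2 w) g \<in> C 2"
        using r1[OF n(1)] r1[OF n(2)] s by metis+
      ultimately show False using left_null_of_rank1[OF _ _ g0 g0] nl by blast
    qed
    then show ?thesis using r1[OF n] by (simp add: rank1_eq_0)
  qed
  have cz: "ctl u T = scl (pr e u) (ctl z T)" if T: "T \<in> C 3" for T u
  proof -
    have "ctl (u + scl (- pr e u) z) T = 0" by (rule A[OF T]) (simp add: pr_simps z)
    then show ?thesis unfolding ctl_vec by simp
  qed
  have zT: "\<exists>a b s. ctl z T = scl a (rank1 e f1) + scl b (rank1 e f2) + scl s w" if T: "T \<in> C 3" for T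
    using T unfolding C3 by (intro w ctl_sol)
  have kz: "row k (ctl z T) = 0" if T: "T \<in> C 3" for T
  proof (rule bl_zero_row)
    have "ctl k (ctl z T) = 0" by (rule right_null_ctl[OF k, of _ "Suc 0"]) (use T in \<open>simp add: numeral_3_eq_3\<close>)
    then show "bl (ctl z T) k v = 0" for v by (simp add: bl_ctl lin_simps(3)[OF ctl_lin] pointwise)
  qed
  have ez: "T = 0" if T: "T \<in> C 3" and 0: "ctl z T = 0" for T
  proof (rule tens_eqI)
    show "T \<in> tens (Suc 2)" using sol_tens[OF T] by simp
    show "0 \<in> tens (Suc 2)" by (simp add: tensI pointwise)
  qed (subst cz[OF T], simp add: 0 lin_simps(3)[OF ctl_lin])
  have ek: "pr e k = 0"
  proof (rule ccontr)
    assume ek: "pr e k \<noteq> 0"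
    \<comment> \<open>With \<open>pr e k\<close> nonzero, a degree three tensor would be determined
      by its coefficient along \<open>w\<close>, leaving dimension at most one.\<close>
    have key: "T = 0" if T: "T \<in> C 3" and s: "ctl z T = scl a (rank1 e f1) + scl b (rank1 e f2)" for T a b
    proof -
      have "pr (scl a f1 + scl b f2) v = 0" for v
      proof -
        have "pr e k * pr (scl a f1 + scl b f2) v = bl (ctl z T) k v" by (simp add: s bl_add pr_simps algebra_simps)
        also have "\<dots> = 0" by (simp add: bl_pr kz[OF T] pr_simps)
        finally show ?thesis using ek by simp
      qed
      then have "scl a f1 + scl b f2 = 0" by (intro pr_eqI) (simp add: pr_simps)
      then have "a = 0" "b = 0" using indep2D[OF f(3)] by blast+
      then show ?thesis using ez[OF T] s by simp
    qed
    obtain T1 T2 where T: "T1 \<in> C 3" "T2 \<in> C 3" "indep2 T1 T2"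
      using dim_ge_2E[OF subspace_sol fin_dim_sol d] by blast
    obtain a1 b1 s1 where 1: "ctl z T1 = scl a1 (rank1 e f1) + scl b1 (rank1 e f2) + scl s1 w" using zT[OF T(1)] by blast
    obtain a2 b2 s2 where 2: "ctl z T2 = scl a2 (rank1 e f1) + scl b2 (rank1 e f2) + scl s2 w" using zT[OF T(2)] by blast
    show False
    proof (cases "s1 = 0")
      case True
      then have "T1 = 0" using 1 by (intro key[OF T(1)]) simp
      then show False using indep2_nz(1)[OF T(3)] by simp
    next
      case False
      have "ctl z (scl s2 T1 + scl (- s1) T2) = scl (s2 * a1 - s1 * a2) (rank1 e f1) + scl (s2 * b1 - s1 * b2) (rank1 e f2)"
        by (simp add: lin_simps(1,2,4,5)[OF ctl_lin] 1 2 fs.scale_right_distrib fs.scale_left_diff_distrib algebra_simps)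
      then have "scl s2 T1 + scl (- s1) T2 = 0" by (intro key C_add C_scl T)
      then show False using indep2D[OF T(3)] False by fastforce
    qed
  qed
  have form: "\<exists>m. ctl z T = rank1 e m" if T: "T \<in> C 3" for T
  proof -
    obtain a b s where s: "ctl z T = scl a (rank1 e f1) + scl b (rank1 e f2) + scl s w" using zT[OF T] by blast
    have "s * row k w j = 0" for j
    proof -
      have "s * row k w j = bl (ctl z T) k (delta j)" by (simp add: s bl_add ek row_bl)
      also have "\<dots> = 0" by (simp add: bl_pr kz[OF T] pointwise)
      finally show ?thesis .
    qed
    moreover have "row k w \<noteq> 0" using no_row[OF ek] k0 by blast
    ultimately have "s = 0" by (auto simp: fun_eq_iff pointwise)
    then have "ctl z T = rank1 e (scl a f1 + scl b f2)" using s by (simp add: rank1_comb)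
    then show ?thesis by blast
  qed
  have mid: "ctl v (ctl u T) = 0" if T: "T \<in> C 3" and v: "pr e v = 0" for T u v
  proof -
    obtain m where m: "ctl z T = rank1 e m" using form[OF T] by blast
    have "ctl v (rank1 e m) = 0"
    proof
      fix l show "ctl v (rank1 e m) l = 0 l"
      proof (cases "length l = 1")
        case True
        then obtain j where "l = [j]" by (auto simp: length_Suc_conv)
        then show ?thesis using v by (simp add: ctl_single row_bl pointwise)
      next
        case False
        have "ctl v (rank1 e m) \<in> tens 1" by (rule ctl_tens) (simp add: rank1_tens flip: numeral_2_eq_2)
        then show ?thesis using False by (simp add: tensD pointwise)
      qed
    qed
    then show ?thesis by (simp add: cz[OF T, of u] m lin_simps(2)[OF ctl_lin])
  qed
  obtain n where n: "n \<noteq> 0" "pr e n = 0" using common_zero2 by blast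
  show "fs.dim (C 3) \<le> 4"
    by (rule mid_dim_le_4[OF mid z n(1) k0 A[OF _ n(2)] right_null_ctr[OF k]])
  have "\<exists>a b. e = scl a f1 + scl b f2"
    using dim_le_2D[OF dim_annihilator(3)[OF k0] _ _ _ _ f(3), of e] dim_annihilator(1)[OF k0] f ek by simp
  then obtain a b where "e = scl a f1 + scl b f2" by blast
  then have "rank1 e e = scl a (rank1 e f1) + scl b (rank1 e f2)" using rank1_comb(2) by metis
  then have "rank1 e e \<in> C 2" using ef by (simp add: C_add C_scl)
  then show "\<forall>n\<ge>3. fs.dim (C n) = fs.dim (C 3)" using mid_dim[OF mid z] by blast
qed

end

section \<open>One relation between two generators\<close>

lemma hyperplane:
  fixes S :: "('a::finite \<Rightarrow> 'k::field) set"
  assumes S: "fs.subspace S" and d: "fs.dim S = card (UNIV :: 'a set) - 1"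
  obtains g where "g \<noteq> 0" "\<And>f. f \<in> S \<longleftrightarrow> (\<Sum>x\<in>UNIV. g x * f x) = 0"
proof -
  have SU: "S \<subseteq> supp_on UNIV" by (simp add: supp_on_def)
  have "0 < card (UNIV :: 'a set)" by (simp add: card_gt_0_iff)
  then have "fs.dim (perp UNIV S) = 1" using dim_perp[OF finite S SU] d by arith
  moreover have "fin_dim (perp UNIV S)"
    by (rule fin_dim_subset[OF fin_dim_supp_on[OF finite]]) (auto simp: perp_def)
  ultimately obtain A where A: "fs.independent A" "fs.span A = perp UNIV S" "card A = 1"
    using fin_dim_basis[OF subspace_perp] by metis
  then obtain g where g: "A = {g}" by (auto simp: card_1_singleton_iff)
  have "f \<in> S \<longleftrightarrow> (\<Sum>x\<in>UNIV. g x * f x) = 0" for f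
  proof -
    have "S = perp UNIV {g}" using perp_perp[OF finite S SU] perp_span[of UNIV A] A(2) g by simp
    then show ?thesis by (simp add: perp_def supp_on_def pair_def)
  qed
  moreover have "g \<noteq> 0" using A(1) g fs.dependent_zero by blast
  ultimately show thesis using that by blast
qed

text \<open>Words in the letters p (\<open>False\<close>) and q (\<open>True\<close>). This is the
  dual of the degree \<open>n\<close> component of the algebra with the one relation a p p + b p q +
  c q p = 0; the coefficient of q q is removed beforehand by a change of basis.\<close>

definition words2 :: "nat \<Rightarrow> 'k::field \<Rightarrow> 'k \<Rightarrow> 'k \<Rightarrow> (bool list \<Rightarrow> 'k) set" where
  "words2 n a b c = {s \<in> supp_on {w. length w = n}. \<forall>u v.
     a * s (u @ [False, False] @ v) + b * s (u @ [False, True] @ v) + c * s (u @ [True, False] @ v) = 0}"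

lemma words2D: "s \<in> words2 n a b c \<Longrightarrow>
    a * s (u @ [False, False] @ v) + b * s (u @ [False, True] @ v) + c * s (u @ [True, False] @ v) = 0"
  by (simp add: words2_def)

lemma words2_0: "s \<in> words2 n a b c \<Longrightarrow> length w \<noteq> n \<Longrightarrow> s w = 0"
  by (simp add: words2_def supp_on_def)

lemma words2I: "(\<And>w. length w \<noteq> n \<Longrightarrow> s w = 0) \<Longrightarrow>
    (\<And>u v. a * s (u @ [False, False] @ v) + b * s (u @ [False, True] @ v) + c * s (u @ [True, False] @ v) = 0)
    \<Longrightarrow> s \<in> words2 n a b c"
  by (simp add: words2_def supp_on_def)

lemma subspace_words2: "fs.subspace (words2 n a b c)"
proof -
  have "s + t \<in> words2 n a b c" if "s \<in> words2 n a b c" "t \<in> words2 n a b c" for s t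
  proof (rule words2I)
    fix u v
    have "a * (s + t) (u @ [False, False] @ v) + b * (s + t) (u @ [False, True] @ v) + c * (s + t) (u @ [True, False] @ v)
      = (a * s (u @ [False, False] @ v) + b * s (u @ [False, True] @ v) + c * s (u @ [True, False] @ v))
      + (a * t (u @ [False, False] @ v) + b * t (u @ [False, True] @ v) + c * t (u @ [True, False] @ v))"
      unfolding plus_fun_apply by (simp only: distrib_left add_ac)
    then show "a * (s + t) (u @ [False, False] @ v) + b * (s + t) (u @ [False, True] @ v) + c * (s + t) (u @ [True, False] @ v) = 0"
      unfolding words2D[OF that(1)] words2D[OF that(2)] by simp
  qed (simp add: pointwise words2_0[OF that(1)] words2_0[OF that(2)])
  moreover have "scl r s \<in> words2 n a b c" if "s \<in> words2 n a b c" for s r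
  proof (rule words2I)
    fix u v
    have "a * scl r s (u @ [False, False] @ v) + b * scl r s (u @ [False, True] @ v) + c * scl r s (u @ [True, False] @ v)
      = r * (a * s (u @ [False, False] @ v) + b * s (u @ [False, True] @ v) + c * s (u @ [True, False] @ v))"
      by (simp add: scl_apply algebra_simps)
    then show "a * scl r s (u @ [False, False] @ v) + b * scl r s (u @ [False, True] @ v) + c * scl r s (u @ [True, False] @ v) = 0"
      using words2D[OF that, of u v] by simp
  qed (simp add: scl_apply words2_0[OF that])
  moreover have "0 \<in> words2 n a b c" by (intro words2I) (simp_all add: pointwise)
  ultimately show ?thesis by (simp add: fs.subspace_def)
qed

lemma fin_dim_words2: "fin_dim (words2 n a b c)"
  by (rule fin_dim_subset[OF fin_dim_supp_on[OF finite_words[of n]]]) (auto simp: words2_def)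

lemma words2_Cons: "s \<in> words2 (Suc n) a b c \<Longrightarrow> (\<lambda>w. s (x # w)) \<in> words2 n a b c"
  using words2D[of s "Suc n" a b c "x # u" for u] words2_0[of s "Suc n" a b c]
  by (intro words2I) auto

text \<open>With \<open>c\<close> nonzero the relation rewrites q p, so a functional is determined
  by its values on the words p^i q^j. The induction strips a leading p and moves any later p to the
  front.\<close>

lemma words2_sorted_zero:
  assumes "c \<noteq> 0"
  shows "s \<in> words2 n a b c \<Longrightarrow> (\<And>i. i \<le> n \<Longrightarrow> s (replicate i False @ replicate (n - i) True) = 0) \<Longrightarrow> s = 0"
proof (induction n arbitrary: s)
  case 0
  have "s w = 0" for w using words2_0[OF 0(1)] 0(2)[of 0] by (cases w) auto
  then show ?case by (simp add: fun_eq_iff pointwise)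
next
  case (Suc n)
  note Suc_s = Suc.prems(1)
  have "(\<lambda>w. s (False # w)) = 0"
  proof (rule Suc.IH[OF words2_Cons[OF Suc.prems(1)]])
    fix i assume "i \<le> n"
    then show "s (False # replicate i False @ replicate (n - i) True) = 0" using Suc.prems(2)[of "Suc i"] by simp
  qed
  then have F: "s (False # w) = 0" for w by (simp add: fun_eq_iff pointwise)
  have TF: "s (replicate j True @ False # w) = 0" for j w
  proof (induction j arbitrary: w)
    case (Suc j)
    have "c * s (replicate j True @ [True, False] @ w) = 0"
      using words2D[OF Suc_s, of "replicate j True" w] Suc.IH by simp
    then show ?case using assms by (simp add: replicate_app_Cons_same)
  qed (simp add: F)
  have "s w = 0" for w
  proof (cases "False \<in> set w")
    case True
    then obtain u v where uv: "w = u @ False # v" "False \<notin> set u" by (meson split_list_first)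
    then have "u = replicate (length u) True" by (metis (full_types) replicate_length_same)
    then show ?thesis using TF uv by metis
  next
    case False
    then have w: "w = replicate (length w) True" by (metis (full_types) replicate_length_same)
    show ?thesis
    proof (cases "length w = Suc n")
      case True
      then show ?thesis using Suc.prems(2)[of 0] w by simp
    qed (rule words2_0[OF Suc.prems(1)])
  qed
  then show ?case by (simp add: fun_eq_iff pointwise)
qed

text \<open>The normal form of a word with respect to \<open>q p = a p\<^sup>2 + b p q\<close> (where \<open>q\<close> is \<open>True\<close>): the coefficient
  of \<open>p\<^sup>i q\<^sup>j\<close> is \<open>nf a b w i\<close>. Here \<open>q p\<^sup>i = lam a b i p\<^bsup>i+1\<^esup> + b\<^sup>i p\<^sup>i q\<close>.\<close>

primrec lam :: "'k::field \<Rightarrow> 'k \<Rightarrow> nat \<Rightarrow> 'k" where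
  "lam a b 0 = 0"
| "lam a b (Suc i) = a + b * lam a b i"

fun nf :: "'k::field \<Rightarrow> 'k \<Rightarrow> bool list \<Rightarrow> nat \<Rightarrow> 'k" where
  "nf a b [] i = (if i = 0 then 1 else 0)"
| "nf a b (False # w) i = (case i of 0 \<Rightarrow> 0 | Suc j \<Rightarrow> nf a b w j)"
| "nf a b (True # w) i = b ^ i * nf a b w i + (case i of 0 \<Rightarrow> 0 | Suc j \<Rightarrow> lam a b j * nf a b w j)"

text \<open>The rewriting is consistent because its leading word q p does not overlap
  itself.\<close>

lemma nf_relation: "nf a b (u @ [True, False] @ v) i =
    a * nf a b (u @ [False, False] @ v) i + b * nf a b (u @ [False, True] @ v) i"
proof (induction u arbitrary: i)
  case Nil
  then show ?case by (auto simp: algebra_simps split: nat.split)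
next
  case (Cons x u)
  have IH: "nf a b (u @ True # False # v) i =
    a * nf a b (u @ False # False # v) i + b * nf a b (u @ False # True # v) i" for i
    using Cons.IH by simp
  show ?case by (cases x) (auto simp: IH algebra_simps split: nat.split)
qed

lemma nf_sorted: "nf a b (replicate i False @ replicate j True) l = (if l = i then 1 else 0)"
proof (induction i arbitrary: l)
  case 0
  show ?case by (induction j arbitrary: l) (auto split: nat.split)
next
  case (Suc i)
  then show ?case by (auto split: nat.split)
qed

lemma dim_words2_sorted:
  assumes "c \<noteq> (0 :: 'k::field)"
  shows "fs.dim (words2 n a b c) = Suc n"
proof -
  let ?s = "\<lambda>i. replicate i False @ replicate (n - i) True"
  let ?F = "\<lambda>s :: bool list \<Rightarrow> 'k. (\<lambda>i. if i \<le> n then s (?s i) else 0)"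
  have lin: "lin ?F" by (rule linI) (auto simp: fun_eq_iff pointwise)
  have inj: "s = 0" if "s \<in> words2 n a b c" "?F s = 0" for s
    proof (rule words2_sorted_zero[OF assms that(1)])
    fix i assume "i \<le> n"
    then show "s (?s i) = 0" using fun_cong[OF that(2), of i] by (simp add: pointwise)
  qed
  have im: "?F ` words2 n a b c = supp_on {..n}"
  proof (intro equalityI subsetI)
    fix f :: "nat \<Rightarrow> 'k" assume f: "f \<in> supp_on {..n}"
    define s where "s w = (if length w = n then \<Sum>i\<le>n. f i * nf (- a / c) (- b / c) w i else 0)" for w
    have "s \<in> words2 n a b c"
    proof (rule words2I)
      fix u v :: "bool list"
      let ?N = "nf (- a / c) (- b / c)"
      have "c * nf (- a / c) (- b / c) (u @ [True, False] @ v) i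
         = - (a * nf (- a / c) (- b / c) (u @ [False, False] @ v) i + b * nf (- a / c) (- b / c) (u @ [False, True] @ v) i)" for i
        unfolding nf_relation using assms by (simp add: algebra_simps)
      then have "a * nf (- a / c) (- b / c) (u @ [False, False] @ v) i + b * nf (- a / c) (- b / c) (u @ [False, True] @ v) i
         + c * nf (- a / c) (- b / c) (u @ [True, False] @ v) i = 0" for i by simp
      then have "(\<Sum>i\<le>n. f i * (a * nf (- a / c) (- b / c) (u @ [False, False] @ v) i + b * nf (- a / c) (- b / c) (u @ [False, True] @ v) i
         + c * nf (- a / c) (- b / c) (u @ [True, False] @ v) i)) = 0" by simp
      also have "(\<Sum>i\<le>n. f i * (a * ?N (u @ [False, False] @ v) i + b * ?N (u @ [False, True] @ v) i + c * ?N (u @ [True, False] @ v) i))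
        = a * (\<Sum>i\<le>n. f i * ?N (u @ [False, False] @ v) i) + b * (\<Sum>i\<le>n. f i * ?N (u @ [False, True] @ v) i)
          + c * (\<Sum>i\<le>n. f i * ?N (u @ [True, False] @ v) i)"
        by (simp only: distrib_left sum.distrib sum_distrib_left mult.left_commute)
      finally show "a * s (u @ [False, False] @ v) + b * s (u @ [False, True] @ v) + c * s (u @ [True, False] @ v) = 0"
        by (simp add: s_def)
    qed (simp add: s_def)
    moreover have "?F s = f"
    proof
      fix i
      have "(\<Sum>l\<le>n. f l * (if l = i then 1 else 0)) = f i" if "i \<le> n"
        using that by (simp add: if_distrib cong: if_cong)
      then show "?F s i = f i" using f by (auto simp: s_def nf_sorted supp_on_def)
    qed
    ultimately show "f \<in> ?F ` words2 n a b c" by (intro image_eqI[of f ?F s]) simp_all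
  qed (auto simp: supp_on_def)
  have "fs.dim (words2 n a b c) = card {..n}"
    by (rule dim_coords[OF lin subspace_words2 finite_atMost _ im fin_dim_words2]) (rule inj)
  then show ?thesis by simp
qed

text \<open>Reversing words exchanges p q and q p, which reduces nonzero \<open>b\<close> to nonzero
  \<open>c\<close>.\<close>

lemma dim_words2_rev: "fs.dim (words2 n a b c) = fs.dim (words2 n a c b)"
proof -
  let ?F = "\<lambda>s :: bool list \<Rightarrow> 'a. (\<lambda>w. s (rev w))"
  have lin: "lin ?F" by (rule linI) (auto simp: fun_eq_iff pointwise)
  have sub: "?F s \<in> words2 n a c b" if "s \<in> words2 n a b c" for s a b c
  proof (rule words2I)
    fix u v
    show "a * ?F s (u @ [False, False] @ v) + c * ?F s (u @ [False, True] @ v) + b * ?F s (u @ [True, False] @ v) = 0"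
      using words2D[OF that, of "rev v" "rev u"] by (simp add: add_ac)
  qed (simp add: words2_0[OF that])
  have "?F ` words2 n a b c = words2 n a c b"
  proof (intro equalityI subsetI)
    fix s assume "s \<in> words2 n a c b"
    then have "?F s \<in> words2 n a b c" by (rule sub)
    then show "s \<in> ?F ` words2 n a b c" by (intro image_eqI[of s ?F "?F s"]) simp_all
  qed (use sub in auto)
  moreover have "s = 0" if "?F s = 0" for s
    using fun_cong[OF that, of "rev w" for w] by (auto simp: fun_eq_iff pointwise)
  ultimately show ?thesis
    using dim_inj_image[OF lin subspace_words2 fin_dim_words2, of n a b c] by simp
qed

fun no_square :: "bool list \<Rightarrow> bool" where
  "no_square (False # False # w) = False"
| "no_square (x # w) = no_square w"
| "no_square [] = True"

lemma no_square_iff: "no_square w \<longleftrightarrow> (\<nexists>u v. w = u @ [False, False] @ v)"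
proof (induction w rule: no_square.induct)
  case (1 w)
  then show ?case by (auto intro: exI[of _ "[]"])
next
  case ("2_1" w)
  then show ?case by (auto simp: Cons_eq_append_conv)
next
  case ("2_2" x)
  then show ?case by (auto simp: Cons_eq_append_conv)
next
  case ("2_3" x w)
  then show ?case by (auto simp: Cons_eq_append_conv)
qed simp

lemma dim_words2_square:
  assumes "a \<noteq> (0 :: 'k::field)"
  shows "fs.dim (words2 n a 0 0) = card {w. length w = n \<and> no_square w}"
proof -
  have "words2 n a 0 0 = supp_on {w. length w = n \<and> no_square w}"
    using assms by (auto simp: words2_def supp_on_def no_square_iff)
  moreover have "finite {w :: bool list. length w = n \<and> no_square w}"
    by (rule finite_subset[OF _ finite_words[of n]]) auto
  ultimately show ?thesis by (simp add: dim_supp_on)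
qed

text \<open>A word without p p starts with q or with p q.\<close>

lemma card_no_square:
  "card {w. length w = Suc (Suc n) \<and> no_square w} =
   card {w. length w = Suc n \<and> no_square w} + card {w. length w = n \<and> no_square w}"
proof -
  let ?A = "\<lambda>n. {w. length w = n \<and> no_square w}"
  have fin: "finite (?A n)" for n by (rule finite_subset[OF _ finite_words[of n]]) auto
  have "?A (Suc (Suc n)) = Cons True ` ?A (Suc n) \<union> (\<lambda>w. False # True # w) ` ?A n"
  proof (intro equalityI subsetI)
    fix w assume w: "w \<in> ?A (Suc (Suc n))"
    then obtain x y v where "w = x # y # v" by (auto simp: length_Suc_conv)
    then show "w \<in> Cons True ` ?A (Suc n) \<union> (\<lambda>w. False # True # w) ` ?A n"
      using w by (cases x; cases y) auto
  qed auto
  moreover have "card (Cons True ` ?A (Suc n) \<union> (\<lambda>w. False # True # w) ` ?A n) = card (?A (Suc n)) + card (?A n)"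
    by (subst card_Un_disjoint) (auto simp: fin card_image inj_on_def)
  ultimately show ?thesis by simp
qed

lemma card_no_square_3: "card {w. length w = 3 \<and> no_square w} = 5" "card {w. length w = 2 \<and> no_square w} = 3"
proof -
  have 0: "{w :: bool list. length w = 0 \<and> no_square w} = {[]}" by auto
  have 1: "{w. length w = Suc 0 \<and> no_square w} = {[True], [False]}" by (auto simp: length_Suc_conv)
  show 2: "card {w. length w = 2 \<and> no_square w} = 3"
    using card_no_square[of 0] 0 1 by (simp add: numeral_2_eq_2)
  show "card {w. length w = 3 \<and> no_square w} = 5"
    using card_no_square[of 1] 2 1 by (simp add: numeral_2_eq_2 numeral_3_eq_3)
qed

section \<open>Transfer between tensors in three variables and words in two letters\<close>

primrec ev :: "(bool \<Rightarrow> 3 \<Rightarrow> 'k::field) \<Rightarrow> bool list \<Rightarrow> 'k tens \<Rightarrow> 'k" where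
  "ev e [] t = t []"
| "ev e (b # bs) t = ev e bs (ctl (e b) t)"

lemma ev_lin: "ev e bs (t + s) = ev e bs t + ev e bs s" "ev e bs (scl c t) = c * ev e bs t"
  by (induction bs arbitrary: t s) (simp_all add: lin_simps(1,2)[OF ctl_lin] pointwise)

lemma ev_0: "ev e bs 0 = 0"
  using ev_lin(2)[of e bs 0 0] by (simp add: scl_def zero_fun_def)

lemma ev_append: "ev e (u @ v) t = ev e v (fold (\<lambda>b. ctl (e b)) u t)"
  by (induction u arbitrary: t) simp_all

text \<open>Pulls a functional on words back to a tensor along the coordinates \<open>P\<close> and
  \<open>Q\<close>: the entry at \<open>w\<close> sums \<open>s\<close> over all words of the same
  length, weighted by the product of the matching coordinates.\<close>

primrec mk :: "(3 \<Rightarrow> 'k::field) \<Rightarrow> (3 \<Rightarrow> 'k) \<Rightarrow> 3 list \<Rightarrow> (bool list \<Rightarrow> 'k) \<Rightarrow> 'k" where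
  "mk P Q [] s = s []"
| "mk P Q (i # w) s = P i * mk P Q w (\<lambda>b. s (False # b)) + Q i * mk P Q w (\<lambda>b. s (True # b))"

lemma mk_0: "(\<And>b. length b = length w \<Longrightarrow> s b = 0) \<Longrightarrow> mk P Q w s = 0"
  by (induction w arbitrary: s) simp_all

lemma mk_lin: "(\<And>v. a * s1 v + b * s2 v + c * s3 v = 0) \<Longrightarrow>
   a * mk P Q w s1 + b * mk P Q w s2 + c * mk P Q w s3 = 0"
proof (induction w arbitrary: s1 s2 s3)
  case (Cons i w)
  have F: "a * mk P Q w (\<lambda>v. s1 (False # v)) + b * mk P Q w (\<lambda>v. s2 (False # v)) + c * mk P Q w (\<lambda>v. s3 (False # v)) = 0"
    by (rule Cons.IH) (rule Cons.prems)
  have T: "a * mk P Q w (\<lambda>v. s1 (True # v)) + b * mk P Q w (\<lambda>v. s2 (True # v)) + c * mk P Q w (\<lambda>v. s3 (True # v)) = 0"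
    by (rule Cons.IH) (rule Cons.prems)
  have "a * mk P Q (i # w) s1 + b * mk P Q (i # w) s2 + c * mk P Q (i # w) s3
    = P i * (a * mk P Q w (\<lambda>v. s1 (False # v)) + b * mk P Q w (\<lambda>v. s2 (False # v)) + c * mk P Q w (\<lambda>v. s3 (False # v)))
    + Q i * (a * mk P Q w (\<lambda>v. s1 (True # v)) + b * mk P Q w (\<lambda>v. s2 (True # v)) + c * mk P Q w (\<lambda>v. s3 (True # v)))"
    by (simp add: algebra_simps)
  then show ?case unfolding F T by simp
qed simp

lemma ctl_mk: "ctl u (\<lambda>w. mk P Q w s) w =
    pr P u * mk P Q w (\<lambda>b. s (False # b)) + pr Q u * mk P Q w (\<lambda>b. s (True # b))"
  by (simp add: ctl_def pr_def distrib_left sum.distrib sum_distrib_right mult.assoc)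

text \<open>The vectors \<open>p\<close>, \<open>q\<close>, \<open>k\<close> form a basis; \<open>P\<close>, \<open>Q\<close> are the corresponding coordinates.\<close>

definition frame :: "(3 \<Rightarrow> 'k::field) \<Rightarrow> (3 \<Rightarrow> 'k) \<Rightarrow> (3 \<Rightarrow> 'k) \<Rightarrow> (3 \<Rightarrow> 'k) \<Rightarrow> (3 \<Rightarrow> 'k) \<Rightarrow> bool" where
  "frame k p q P Q \<longleftrightarrow> pr P p = 1 \<and> pr P q = 0 \<and> pr P k = 0 \<and> pr Q p = 0 \<and> pr Q q = 1 \<and> pr Q k = 0 \<and>
     (\<forall>v. \<exists>c. v = scl (pr P v) p + scl (pr Q v) q + scl c k)"

lemma frameD:
  assumes "frame k p q P Q"
  shows "pr P p = 1" "pr P q = 0" "pr P k = 0" "pr Q p = 0" "pr Q q = 1" "pr Q k = 0"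
    "\<exists>c. v = scl (pr P v) p + scl (pr Q v) q + scl c k"
  using assms unfolding frame_def by blast+

text \<open>At an index \<open>i\<close> with \<open>k i\<close> nonzero the unit vector is replaced
  by \<open>k\<close>. Subtracting multiples of the \<open>i\<close>-th coordinate from the other
  two makes them vanish at \<open>k\<close>.\<close>

lemma ex_frame:
  fixes k :: "3 \<Rightarrow> 'k::field"
  assumes "k \<noteq> 0"
  obtains p q P Q where "frame k p q P Q"
proof -
  obtain i where i: "k i \<noteq> 0" using assms by (auto simp: fun_eq_iff pointwise)
  have "\<exists>j l. {i, j, l} = (UNIV :: 3 set) \<and> i \<noteq> j \<and> i \<noteq> l \<and> j \<noteq> l"
  proof -
    have "i \<in> {0, 1, 2}" using UNIV_three by auto
    moreover have "(0::3) \<noteq> 1" "(0::3) \<noteq> 2" "(1::3) \<noteq> 2" by simp_all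
    ultimately show ?thesis unfolding UNIV_three by (metis insert_commute insertE singletonD)
  qed
  then obtain j l where u: "{i, j, l} = (UNIV :: 3 set)" and d: "i \<noteq> j" "i \<noteq> l" "j \<noteq> l" by blast
  define P where "P = delta j - scl (k j / k i) (delta i)"
  define Q where "Q = delta l - scl (k l / k i) (delta i)"
  have PQ: "pr P v = v j - k j / k i * v i" "pr Q v = v l - k l / k i * v i" for v
    by (simp_all add: P_def Q_def pr_simps)
  have "v x = (scl (pr P v) (delta j) + scl (pr Q v) (delta l) + scl (v i / k i) k) x" for v x
  proof -
    have "x = i \<or> x = j \<or> x = l" using u by auto
    then show ?thesis unfolding PQ using d i by (auto simp: pointwise delta_def field_simps)
  qed
  then have "v = scl (pr P v) (delta j) + scl (pr Q v) (delta l) + scl (v i / k i) k" for v by blast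
  moreover have "pr P (delta j) = 1 \<and> pr P (delta l) = 0 \<and> pr P k = 0 \<and> pr Q (delta j) = 0 \<and> pr Q (delta l) = 1 \<and> pr Q k = 0"
    unfolding PQ using d i by (auto simp: delta_def)
  ultimately have "frame k (delta j) (delta l) P Q" unfolding frame_def by blast
  then show thesis by (rule that)
qed

context three_rel
begin

text \<open>Bilinear forms on the plane modulo \<open>k\<close>. They form a space of dimension
  four, so \<open>C 2\<close> is a hyperplane in it; \<open>one_rel\<close> records the equation of
  this hyperplane, which is the relation of the algebra.\<close>

definition null2 :: "(3 \<Rightarrow> 'k) \<Rightarrow> 'k tens \<Rightarrow> bool" where
  "null2 k w \<longleftrightarrow> w \<in> tens 2 \<and> (\<forall>v. bl w k v = 0) \<and> (\<forall>v. bl w v k = 0)"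

definition one_rel :: "(3 \<Rightarrow> 'k) \<Rightarrow> (3 \<Rightarrow> 'k) \<Rightarrow> (3 \<Rightarrow> 'k) \<Rightarrow> 'k \<Rightarrow> 'k \<Rightarrow> 'k \<Rightarrow> 'k \<Rightarrow> bool" where
  "one_rel k p q a b c d \<longleftrightarrow>
     (\<forall>w. w \<in> C 2 \<longleftrightarrow> null2 k w \<and> a * bl w p p + b * bl w p q + c * bl w q p + d * bl w q q = 0)"

context
  fixes k :: "3 \<Rightarrow> 'k"
  assumes rk: "right_null (C 2) k" and lk: "left_null (C 2) k"
begin

lemma null2_C: "w \<in> C 2 \<Longrightarrow> null2 k w"
  using rk lk by (simp add: null2_def right_null_def left_null_def sol_tens)

lemma k_nz: "k \<noteq> 0"
  using rk by (simp add: right_null_def)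

lemma bl_frame:
  assumes "frame k p q P Q" "null2 k w"
  shows "bl w u v = pr P u * (pr P v * bl w p p + pr Q v * bl w p q) + pr Q u * (pr P v * bl w q p + pr Q v * bl w q q)"
proof -
  obtain c c' where u: "u = scl (pr P u) p + scl (pr Q u) q + scl c k" and v: "v = scl (pr P v) p + scl (pr Q v) q + scl c' k"
    using frameD(7)[OF assms(1)] by metis
  have "bl w u v = bl w (scl (pr P u) p + scl (pr Q u) q + scl c k) (scl (pr P v) p + scl (pr Q v) q + scl c' k)"
    using u v by simp
  then show ?thesis using assms(2) unfolding bl_add null2_def by (simp add: algebra_simps)
qed

lemma ex_one_rel:
  obtains p q P Q a b c d where "frame k p q P Q" "one_rel k p q a b c d" "a \<noteq> 0 \<or> b \<noteq> 0 \<or> c \<noteq> 0 \<or> d \<noteq> 0"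
proof -
  obtain p q P Q where fr: "frame k p q P Q" using ex_frame[OF k_nz] .
  define e where "e = (\<lambda>b :: bool. if b then q else p)"
  let ?F = "\<lambda>w. (\<lambda>(x, y). bl w (e x) (e y))"
  have lin: "lin ?F" by (rule linI) (auto simp: fun_eq_iff pointwise bl_add)
  have inj: "w = w'" if "null2 k w" "null2 k w'" "?F w = ?F w'" for w w'
  proof (rule bl_eqI)
    show "w \<in> tens 2" "w' \<in> tens 2" using that by (auto simp: null2_def)
    have "bl w (e x) (e y) = bl w' (e x) (e y)" for x y using fun_cong[OF that(3), of "(x, y)"] by simp
    from this[of True True] this[of True False] this[of False True] this[of False False]
    show "bl w u v = bl w' u v" for u v
      unfolding bl_frame[OF fr that(1), of u v] bl_frame[OF fr that(2), of u v] by (simp add: e_def)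
  qed
  have null0: "null2 k 0" by (rule null2_C[OF C0])
  have "fs.dim (?F ` C 2) = fs.dim (C 2)"
  proof (rule dim_inj_image[OF lin subspace_sol fin_dim_sol])
    fix w assume w: "w \<in> C 2" "?F w = 0"
    show "w = 0" by (rule inj[OF null2_C[OF w(1)] null0]) (unfold w(2) lin_simps(3)[OF lin], rule refl)
  qed
  then have "fs.dim (?F ` C 2) = card (UNIV :: (bool \<times> bool) set) - 1"
    by (simp add: dim_W card_UNIV_bool card_cartesian_product flip: UNIV_Times_UNIV)
  moreover have "fs.subspace (?F ` C 2)" by (rule fsp.linear_subspace_image[OF lin subspace_sol])
  ultimately obtain g where g: "g \<noteq> 0" "\<And>f. f \<in> ?F ` C 2 \<longleftrightarrow> (\<Sum>x\<in>UNIV. g x * f x) = 0"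
    using hyperplane[of "?F ` C 2"] by blast
  have gs: "(\<Sum>x\<in>UNIV. g x * f x) = g (False, False) * f (False, False) + g (False, True) * f (False, True)
      + g (True, False) * f (True, False) + g (True, True) * f (True, True)" for f
    by (simp add: UNIV_bool sum.cartesian_product[symmetric] add_ac flip: UNIV_Times_UNIV)
  have "one_rel k p q (g (False, False)) (g (False, True)) (g (True, False)) (g (True, True))"
    unfolding one_rel_def
  proof (intro allI iffI conjI)
    fix w assume w: "w \<in> C 2"
    then show "null2 k w" by (rule null2_C)
    have "?F w \<in> ?F ` C 2" using w by (rule imageI)
    then show "g (False, False) * bl w p p + g (False, True) * bl w p q + g (True, False) * bl w q p + g (True, True) * bl w q q = 0"
      unfolding g(2) gs by (simp add: e_def)
  next
    fix w assume w: "null2 k w \<and> g (False, False) * bl w p p + g (False, True) * bl w p q + g (True, False) * bl w q p + g (True, True) * bl w q q = 0"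
    then have "?F w \<in> ?F ` C 2" unfolding g(2) gs by (simp add: e_def)
    then obtain w' where w': "?F w = ?F w'" "w' \<in> C 2" by (rule imageE)
    have "w = w'" by (rule inj[OF _ null2_C[OF w'(2)] w'(1)]) (use w in simp)
    then show "w \<in> C 2" using w'(2) by simp
  qed
  moreover have "g (False, False) \<noteq> 0 \<or> g (False, True) \<noteq> 0 \<or> g (True, False) \<noteq> 0 \<or> g (True, True) \<noteq> 0"
  proof (rule ccontr)
    assume *: "\<not> ?thesis"
    have "g (x, y) = 0" for x y using * by (cases x; cases y) simp_all
    then show False using g(1) by (simp add: fun_eq_iff pointwise)
  qed
  ultimately show thesis using that[OF fr] by blast
qed

text \<open>Under the change of p to p + s q the coefficient of q q becomes a polynomial in
  \<open>s\<close> with leading coefficient \<open>a\<close>.\<close>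

lemma frame_shift:
  assumes "frame k p q P Q" "one_rel k p q a b c d"
  shows "frame k (p + scl s q) q P (Q - scl s P)"
    "one_rel k (p + scl s q) q a (b - s * a) (c - s * a) (d - s * (b + c) + s * s * a)"
proof -
  have "\<exists>c. v = scl (pr P v) (p + scl s q) + scl (pr (Q - scl s P) v) q + scl c k" for v
  proof -
    obtain c where "v = scl (pr P v) p + scl (pr Q v) q + scl c k" using frameD(7)[OF assms(1)] by blast
    moreover have "scl (pr P v) p + scl (pr Q v) q + scl c k = scl (pr P v) (p + scl s q) + scl (pr (Q - scl s P) v) q + scl c k"
      by (simp add: fun_eq_iff pointwise pr_simps algebra_simps)
    ultimately have "v = scl (pr P v) (p + scl s q) + scl (pr (Q - scl s P) v) q + scl c k" by simp
    then show ?thesis by blast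
  qed
  then show "frame k (p + scl s q) q P (Q - scl s P)"
    using frameD(1-6)[OF assms(1)] by (simp add: frame_def pr_simps)
  have "a * bl w (p + scl s q) (p + scl s q) + (b - s * a) * bl w (p + scl s q) q + (c - s * a) * bl w q (p + scl s q)
      + (d - s * (b + c) + s * s * a) * bl w q q = a * bl w p p + b * bl w p q + c * bl w q p + d * bl w q q" for w
    unfolding bl_add by (simp add: algebra_simps)
  then show "one_rel k (p + scl s q) q a (b - s * a) (c - s * a) (d - s * (b + c) + s * s * a)"
    using assms(2) unfolding one_rel_def by simp
qed

lemma frame_swap:
  assumes "frame k p q P Q" "one_rel k p q a b c d"
  shows "frame k q p Q P" "one_rel k q p d c b a"
proof -
  show "frame k q p Q P" using assms(1) unfolding frame_def by (metis add.commute)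
  show "one_rel k q p d c b a" using assms(2) unfolding one_rel_def by (simp add: add_ac)
qed

text \<open>A root of that polynomial removes the term q q; if \<open>a\<close> is zero, exchanging
  the two letters does.\<close>

lemma ex_one_rel_0:
  assumes root: "\<And>a b c :: 'k. a \<noteq> 0 \<Longrightarrow> \<exists>s. a * s * s + b * s + c = 0"
  obtains p q P Q a b c where "frame k p q P Q" "one_rel k p q a b c 0" "a \<noteq> 0 \<or> b \<noteq> 0 \<or> c \<noteq> 0"
proof -
  obtain p q P Q a b c d where 1: "frame k p q P Q" "one_rel k p q a b c d" "a \<noteq> 0 \<or> b \<noteq> 0 \<or> c \<noteq> 0 \<or> d \<noteq> 0"
    using ex_one_rel .
  show thesis
  proof (cases "a = 0")
    case True
    then show thesis using that[OF frame_swap(1)[OF 1(1,2)], of d c b] frame_swap(2)[OF 1(1,2)] 1(3) by auto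
  next
    case False
    then obtain s where "a * s * s + (- (b + c)) * s + d = 0" using root by blast
    then have "d - s * (b + c) + s * s * a = 0" by (simp add: algebra_simps)
    then show thesis using that[OF frame_shift(1)[OF 1(1,2), of s], of a "b - s * a" "c - s * a"]
        frame_shift(2)[OF 1(1,2), of s] False by simp
  qed
qed

text \<open>Evaluation on words in p and q is injective because \<open>k\<close> annihilates degree
  one from both sides, and \<open>mk\<close> inverts it. This begins in degree two; in degree one
  \<open>k\<close> is still visible.\<close>

lemma dim_words2:
  assumes fr: "frame k p q P Q" and rel: "one_rel k p q a b c 0" and n: "2 \<le> n"
  shows "fs.dim (C n) = fs.dim (words2 n a b c)"
proof -
  define e where "e = (\<lambda>b :: bool. if b then q else p)"
  note e = e_def[THEN fun_cong, of True, simplified] e_def[THEN fun_cong, of False, simplified]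
  define F where "F n t = (\<lambda>bs. if length bs = n then ev e bs t else 0)" for n and t :: "'k tens"
  have lin: "lin (F n)" for n by (rule linI) (auto simp: F_def fun_eq_iff pointwise ev_lin)
  have fold_C: "fold (\<lambda>b. ctl (e b)) u t \<in> C m" if "t \<in> C (length u + m)" for u t m
    using that by (induction u arbitrary: t) (simp_all add: ctl_sol)
  have into: "F n t \<in> words2 n a b c" if t: "t \<in> C n" for t n
  proof (rule words2I)
    fix u v
    show "a * F n t (u @ [False, False] @ v) + b * F n t (u @ [False, True] @ v) + c * F n t (u @ [True, False] @ v) = 0"
    proof (cases "n = length u + Suc (Suc (length v))")
      case True
      let ?T = "fold (\<lambda>b. ctl (e b)) u t"
      have T: "?T \<in> C (Suc (Suc (length v)))" using t True by (intro fold_C) simp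
      let ?R = "scl a (ctl p (ctl p ?T)) + scl b (ctl q (ctl p ?T)) + scl c (ctl p (ctl q ?T))"
      have "?R w = 0" for w
      proof (cases "length w = length v")
        case True
        have "(\<lambda>l. ?T (l @ w)) \<in> C 2" by (rule slice_sol[OF T True])
        then show ?thesis using rel unfolding one_rel_def by (simp add: pointwise ctl_ctl)
      next
        case False
        then show ?thesis using tensD[OF ctl_tens[OF ctl_tens[OF sol_tens[OF T]]]] by (simp add: pointwise)
      qed
      then have "?R = 0" by (simp add: fun_eq_iff pointwise)
      then have "ev e v ?R = 0" by (simp add: ev_0)
      moreover have "F n t (u @ [x, y] @ v) = ev e v (ctl (e y) (ctl (e x) ?T))" for x y
        using True by (simp add: F_def ev_append)
      ultimately show ?thesis by (simp add: ev_lin e del: append.simps)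
    qed (simp add: F_def)
  qed (simp add: F_def)
  have inj: "t \<in> C n \<Longrightarrow> F n t = 0 \<Longrightarrow> t = 0" for t using n
  proof (induction n arbitrary: t rule: dec_induct)
    case base
    show ?case
    proof (rule bl_eqI)
      show "t \<in> tens 2" "(0 :: 'k tens) \<in> tens 2" using sol_tens[OF base(1)] sol_tens[OF C0] by simp_all
      have "bl t (e x) (e y) = 0" for x y
        using fun_cong[OF base(2), of "[x, y]"] by (simp add: F_def pointwise bl_ctl)
      from this[of True True] this[of True False] this[of False True] this[of False False]
      show "bl t u v = bl 0 u v" for u v
        unfolding bl_frame[OF fr null2_C[OF base(1)], of u v] by (simp add: e bl_sum)
    qed
  next
    case (step n)
    have z: "ctl (e x) t = 0" for x
    proof (rule step.IH[OF ctl_sol[OF step.prems(1)]])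
      show "F n (ctl (e x) t) = 0"
      proof
        fix bs show "F n (ctl (e x) t) bs = 0 bs"
          using fun_cong[OF step.prems(2), of "x # bs"] by (auto simp: F_def pointwise)
      qed
    qed
    obtain m where m: "n = Suc m" using step.hyps(1) by (cases n) auto
    have zk: "ctl k t = 0" using left_null_ctl[OF lk, of t m] step.prems(1) m by simp
    have "ctl v t = 0" for v
    proof -
      obtain d where "v = scl (pr P v) p + scl (pr Q v) q + scl d k" using frameD(7)[OF fr] by blast
      then have "ctl v t = scl (pr P v) (ctl p t) + scl (pr Q v) (ctl q t) + scl d (ctl k t)"
        using ctl_vec by metis
      then show ?thesis using z[of True] z[of False] zk by (simp add: e)
    qed
    then show ?case
      by (intro tens_eqI[OF sol_tens[OF step.prems(1)] sol_tens[OF C0]]) (simp add: lin_simps(3)[OF ctl_lin])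
  qed
  have mkt: "(\<lambda>w. mk P Q w s) \<in> tens n" if "\<And>w. length w \<noteq> n \<Longrightarrow> s w = 0" for s n
    by (intro tensI mk_0) (use that in auto)
  have ctl_e: "ctl (e x) (\<lambda>w. mk P Q w s) = (\<lambda>w. mk P Q w (\<lambda>b. s (x # b)))" for x s
    using frameD(1-6)[OF fr] by (cases x) (auto simp: fun_eq_iff ctl_mk e)
  have ev_mk: "ev e bs (\<lambda>w. mk P Q w s) = s bs" for bs s
    by (induction bs arbitrary: s) (simp_all add: ctl_e)
  have mkC: "s \<in> words2 (Suc (Suc n)) a b c \<Longrightarrow> (\<lambda>w. mk P Q w s) \<in> C (Suc (Suc n))" for s n
  proof (induction n arbitrary: s rule: less_induct)
    case (less n)
    have s0: "length w \<noteq> Suc (Suc n) \<Longrightarrow> s w = 0" for w by (rule words2_0[OF less.prems])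
    let ?t = "\<lambda>w. mk P Q w s"
    show ?case
    proof (rule sol_Suc_I)
      show "?t \<in> tens (Suc (Suc n))" by (rule mkt) (rule s0)
      have sub: "(\<lambda>w. mk P Q w (\<lambda>b. s (x # b))) \<in> C (Suc n)" for x
      proof (cases n)
        case 0
        have "(\<lambda>w. mk P Q w (\<lambda>b. s (x # b))) \<in> tens (Suc n)" by (rule mkt) (rule s0, simp)
        then show ?thesis using 0 by (simp add: sol_small)
      next
        case (Suc m)
        then show ?thesis using less.IH[of m] words2_Cons[OF less.prems] by simp
      qed
      have "ctl v ?t = scl (pr P v) (\<lambda>w. mk P Q w (\<lambda>b. s (False # b))) + scl (pr Q v) (\<lambda>w. mk P Q w (\<lambda>b. s (True # b)))" for v
        by (simp add: fun_eq_iff pointwise ctl_mk)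
      then show "ctl (delta i) ?t \<in> C (Suc n)" for i using sub by (simp add: C_add C_scl)
      fix w :: "3 list" assume w: "length w = n"
      have B: "bl (\<lambda>l. ?t (l @ w)) u v = ctl v (ctl u ?t) w" for u v by (simp add: ctl_ctl)
      have cc: "ctl v (ctl u ?t) w = pr P u * (pr P v * mk P Q w (\<lambda>b. s (False # False # b)) + pr Q v * mk P Q w (\<lambda>b. s (False # True # b)))
          + pr Q u * (pr P v * mk P Q w (\<lambda>b. s (True # False # b)) + pr Q v * mk P Q w (\<lambda>b. s (True # True # b)))" for u v
      proof -
        have "ctl u ?t = scl (pr P u) (\<lambda>w. mk P Q w (\<lambda>b. s (False # b))) + scl (pr Q u) (\<lambda>w. mk P Q w (\<lambda>b. s (True # b)))"
          by (simp add: fun_eq_iff pointwise ctl_mk)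
        then show ?thesis by (simp add: lin_simps(1,2)[OF ctl_lin] pointwise ctl_mk)
      qed
      have "null2 k (\<lambda>l. ?t (l @ w))" unfolding null2_def B cc
      proof (intro conjI)
        show "(\<lambda>l. ?t (l @ w)) \<in> tens 2" by (intro tensI mk_0 s0) (use w in auto)
      qed (simp_all add: frameD(3,6)[OF fr])
      moreover have "a * mk P Q w (\<lambda>b. s (False # False # b)) + b * mk P Q w (\<lambda>b. s (False # True # b)) + c * mk P Q w (\<lambda>b. s (True # False # b)) = 0"
        by (rule mk_lin) (use words2D[OF less.prems, of "[]"] in simp)
      then have "a * bl (\<lambda>l. ?t (l @ w)) p p + b * bl (\<lambda>l. ?t (l @ w)) p q + c * bl (\<lambda>l. ?t (l @ w)) q p + 0 * bl (\<lambda>l. ?t (l @ w)) q q = 0"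
        unfolding B cc by (simp add: frameD(1-6)[OF fr])
      ultimately show "(\<lambda>l. ?t (l @ w)) \<in> C 2" using rel unfolding one_rel_def by blast
    qed
  qed
  obtain m where m: "n = Suc (Suc m)" using that[of "n - 2"] n by simp
  have "F n ` C n = words2 n a b c"
  proof (intro equalityI subsetI)
    fix s assume s: "s \<in> words2 n a b c"
    have "s = F n (\<lambda>w. mk P Q w s)" using words2_0[OF s] by (auto simp: F_def ev_mk)
    moreover have "(\<lambda>w. mk P Q w s) \<in> C n" using mkC s m by blast
    ultimately show "s \<in> F n ` C n" by (rule image_eqI)
  qed (use into in blast)
  then show ?thesis using dim_inj_image[OF lin subspace_sol fin_dim_sol inj] by metis
qed

theorem two_generators:
  assumes root: "\<And>a b c :: 'k. a \<noteq> 0 \<Longrightarrow> \<exists>s. a * s * s + b * s + c = 0"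
  shows "(\<forall>n\<ge>2. fs.dim (C n) = Suc n) \<or>
    (\<forall>n\<ge>2. fs.dim (C n) = card {w :: bool list. length w = n \<and> no_square w})"
proof -
  obtain p q P Q a b c where 1: "frame k p q P Q" "one_rel k p q a b c 0" "a \<noteq> 0 \<or> b \<noteq> 0 \<or> c \<noteq> 0"
    using ex_one_rel_0[OF root] .
  consider "c \<noteq> 0" | "c = 0" "b \<noteq> 0" | "c = 0" "b = 0" "a \<noteq> 0" using 1(3) by blast
  then show ?thesis
  proof cases
    case 1
    then show ?thesis using dim_words2[OF \<open>frame k p q P Q\<close> \<open>one_rel k p q a b c 0\<close>] dim_words2_sorted by metis
  next
    case 2
    then show ?thesis using dim_words2[OF 1(1,2)] dim_words2_sorted dim_words2_rev by metis
  next
    case 3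
    then show ?thesis using dim_words2[OF 1(1,2)] dim_words2_square by metis
  qed
qed

end

end

section \<open>The possible dimension sequences\<close>

text \<open>The coefficients of all eleven series, including those to be excluded; index 1 falls
  into the last branch.\<close>

definition hs :: "nat \<Rightarrow> nat \<Rightarrow> nat" where
  "hs j n = (if n = 0 then 1 else if n \<le> 2 then 3
     else if j = 2 then (if n = 3 then 1 else 0)
     else if j = 3 then 1
     else if j = 4 then (if n = 3 then 2 else 0)
     else if j = 5 then (if n = 3 then 2 else if n = 4 then 1 else 0)
     else if j = 6 then (if n = 3 then 2 else 1)
     else if j = 7 then 2
     else if j = 8 then 3
     else if j = 9 then 4
     else if j = 10 then Suc n
     else if j = 11 then card {w :: bool list. length w = n \<and> no_square w}
     else 0)"

text \<open>Coefficients in positive degrees of P(-t) H(t) = 1, where P is the generating series of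
  \<open>b\<close> and H that of \<open>d\<close>.\<close>

definition koszul_numbers :: "(nat \<Rightarrow> nat) \<Rightarrow> (nat \<Rightarrow> nat) \<Rightarrow> bool" where
  "koszul_numbers d b \<longleftrightarrow> (\<forall>n\<ge>1. (\<Sum>k\<le>n. (- 1) ^ k * int (b k) * int (d (n - k))) = 0)"

text \<open>Degree seven is reached because the sequence 1, 3, 3, 1, 1, ... leads to a negative rank
  only there.\<close>

lemma koszul_numbersD:
  assumes "koszul_numbers d b"
  shows "int (b 0) * int (d 1) - int (b 1) * int (d 0) = 0"
    "int (b 0) * int (d 2) - int (b 1) * int (d 1) + int (b 2) * int (d 0) = 0"
    "int (b 0) * int (d 3) - int (b 1) * int (d 2) + int (b 2) * int (d 1) - int (b 3) * int (d 0) = 0"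
    "int (b 0) * int (d 4) - int (b 1) * int (d 3) + int (b 2) * int (d 2) - int (b 3) * int (d 1) + int (b 4) * int (d 0) = 0"
    "int (b 0) * int (d 5) - int (b 1) * int (d 4) + int (b 2) * int (d 3) - int (b 3) * int (d 2) + int (b 4) * int (d 1) - int (b 5) * int (d 0) = 0"
    "int (b 0) * int (d 6) - int (b 1) * int (d 5) + int (b 2) * int (d 4) - int (b 3) * int (d 3) + int (b 4) * int (d 2) - int (b 5) * int (d 1) + int (b 6) * int (d 0) = 0"
    "int (b 0) * int (d 7) - int (b 1) * int (d 6) + int (b 2) * int (d 5) - int (b 3) * int (d 4) + int (b 4) * int (d 3) - int (b 5) * int (d 2) + int (b 6) * int (d 1) - int (b 7) * int (d 0) = 0"
  using assms[unfolded koszul_numbers_def, rule_format, of 1] assms[unfolded koszul_numbers_def, rule_format, of 2]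
    assms[unfolded koszul_numbers_def, rule_format, of 3] assms[unfolded koszul_numbers_def, rule_format, of 4]
    assms[unfolded koszul_numbers_def, rule_format, of 5] assms[unfolded koszul_numbers_def, rule_format, of 6]
    assms[unfolded koszul_numbers_def, rule_format, of 7]
  by (simp_all add: eval_nat_numeral)

lemma dim_tens: "fs.dim (tens n :: 'k::field tens set) = 3 ^ n"
proof -
  have "card {w :: 3 list. set w \<subseteq> UNIV \<and> length w = n} = CARD(3) ^ n" by (rule card_lists_length_eq) simp
  then show ?thesis by (simp add: tens_def dim_supp_on finite_words)
qed

text \<open>The relations \<open>dual y\<close> cancel a first factor \<open>x\<close>: a tensor
  \<open>x\<close> times t' that satisfies them has t' = 0. So a tensor is determined by its
  contractions with two vectors spanning the kernel of \<open>x\<close>, read as a linear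
  form.\<close>

lemma (in left_full) dual_dim_bound:
  assumes "1 \<le> k"
  shows "fs.dim (sol (Suc k) (C 2)) \<le> 2 * fs.dim (sol k (C 2))"
proof -
  have "x \<noteq> 0"
  proof
    assume "x = 0"
    then have "w = 0" if "w \<in> C 2" for w using full[OF that] by (simp add: bl_sum)
    then have "C 2 = {0}" using C0 by blast
    then show False using dim_W dim_zero[where 'a = "3 list" and 'k = 'k] by simp
  qed
  then obtain i where i: "x i \<noteq> 0" by (auto simp: fun_eq_iff pointwise)
  have "\<exists>j l. {i, j, l} = (UNIV :: 3 set)"
  proof -
    have "i \<in> {0, 1, 2}" using UNIV_three by auto
    then show ?thesis unfolding UNIV_three by (metis insert_commute insertE singletonD)
  qed
  then obtain j l where u: "{i, j, l} = (UNIV :: 3 set)" by blast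
  define xi where "xi y = delta y - scl (x y / x i) (delta i)" for y :: 3
  have ctl_xi: "ctl (xi y) t w = t (y # w) - x y / x i * t (i # w)" for y t w
    using ctl_vec(1)[of "delta y - scl (x y / x i) (delta i)" "scl (x y / x i) (delta i)" t]
    by (simp add: xi_def ctl_vec(2) fun_eq_iff pointwise)
  let ?S = "sol (Suc k) (C 2)"
  obtain m where m: "k = Suc m" using assms by (cases k) auto
  have inj: "t = 0" if t: "t \<in> ?S" "ctl (xi j) t = 0" "ctl (xi l) t = 0" for t
  proof -
    define t' where "t' w = t (i # w) / x i" for w
    have e: "t (y # w) = x y * t' w" for y w
    proof -
      have "y = i \<or> y = j \<or> y = l" using u by auto
      then show ?thesis
        using fun_cong[OF t(2), of w] fun_cong[OF t(3), of w] i by (auto simp: ctl_xi t'_def pointwise)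
    qed
    have "t' w = 0" for w
    proof (cases "length w = k")
      case False
      then show ?thesis using tensD[OF sol_tens[OF t(1)], of "i # w"] by (simp add: t'_def)
    next
      case True
      \<comment> \<open>The hypothesis \<open>1 \<le> k\<close> guarantees that \<open>t'\<close>
        has a first slot; the relation whose index is the entry \<open>y\<close> of that slot
        isolates this value of \<open>t'\<close>.\<close>
      then obtain y v where w: "w = y # v" using m by (cases w) auto
      have "0 = (\<Sum>p\<in>UNIV. \<Sum>q\<in>UNIV. dual y [p, q] * t (p # q # v))"
        using solD[OF t(1) dual(1)[of y], of "[]" v] by simp
      also have "\<dots> = (\<Sum>p\<in>UNIV. \<Sum>q\<in>UNIV. t' (q # v) * (x p * dual y [p, q]))"
        unfolding e by (simp add: mult_ac)
      also have "\<dots> = (\<Sum>q\<in>UNIV. t' (q # v) * row x (dual y) q)"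
        by (subst sum.swap) (simp add: row_def sum_distrib_left)
      also have "\<dots> = (\<Sum>q\<in>UNIV. if y = q then t' (q # v) else 0)"
        unfolding dual(2) by (intro sum.cong) (auto simp: delta_def)
      finally show ?thesis using w by simp
    qed
    then have "t w = 0" for w
      using e tensD[OF sol_tens[OF t(1)], of "[]"] by (cases w) auto
    then show ?thesis by (simp add: fun_eq_iff pointwise)
  qed
  let ?N = "{t \<in> ?S. ctl (xi j) t = 0}"
  have N: "fs.subspace ?N"
    using subspace_sol[of "Suc k" "C 2"]
    by (auto simp: fs.subspace_def lin_simps(1)[OF ctl_lin] lin_simps(2)[OF ctl_lin] lin_simps(3)[OF ctl_lin])
  have fN: "fin_dim ?N" by (rule fin_dim_subset[OF fin_dim_sol[of "Suc k" "C 2"]]) blast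
  have "fs.dim ?N = fs.dim (ctl (xi l) ` ?N)"
    by (rule dim_inj_image[OF ctl_lin N fN, symmetric]) (use inj in blast)
  also have "\<dots> \<le> fs.dim (sol k (C 2))"
    by (rule dim_subset[OF _ fin_dim_sol]) (use ctl_sol in blast)
  finally have 1: "fs.dim ?N \<le> fs.dim (sol k (C 2))" .
  have 2: "fs.dim (ctl (xi j) ` ?S) \<le> fs.dim (sol k (C 2))"
    by (rule dim_subset[OF _ fin_dim_sol]) (use ctl_sol in blast)
  show ?thesis using rank_nullity[OF ctl_lin[of "xi j"] subspace_sol[of "Suc k" "C 2"] fin_dim_sol] 1 2 by linarith
qed

section \<open>Elimination of the remaining sequences\<close>

context three_rel
begin

abbreviation d :: "nat \<Rightarrow> nat" where "d n \<equiv> fs.dim (C n)"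

lemma d_small: "d 0 = 1" "d (Suc 0) = 3" "d 2 = 3"
  by (simp_all add: sol_small dim_tens dim_W)

lemma hsI: "(\<And>n. n \<ge> 3 \<Longrightarrow> d n = hs j n) \<Longrightarrow> d n = hs j n"
proof (cases "n \<ge> 3")
  case False
  then have "n = 0 \<or> n = Suc 0 \<or> n = 2" by arith
  then show ?thesis using d_small by (auto simp: hs_def)
qed

context
  fixes b :: "nat \<Rightarrow> nat"
  assumes dual: "koszul_numbers d b"  and b0: "b 0 = 1"
begin

lemma b1_b2: "b (Suc 0) = 3" "b 2 = 6"
  using koszul_numbersD(1,2)[OF dual] b0 d_small by simp_all

text \<open>The recursion gives b_3, ..., b_6 = 9, 9, 0, -27.\<close>

lemma not_H1: "d 3 \<noteq> 0"
proof
  assume "d 3 = 0"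
  then have "d n = 0" if "n \<ge> 3" for n using dim_0_mono that by blast
  then show False using koszul_numbersD[OF dual] b0 b1_b2 d_small by simp
qed

text \<open>The recursion gives b_3, ..., b_7 = 10, 14, 16, 12, -4.\<close>

lemma not_H3: "\<exists>n\<ge>3. d n \<noteq> 1"
proof (rule ccontr)
  assume "\<not> ?thesis"
  then have "d n = 1" if "n \<ge> 3" for n using that by blast
  then show False using koszul_numbersD[OF dual] b0 b1_b2 d_small by simp
qed

lemma H2_of_dim_C3_one:
  assumes "d 3 = 1"
  shows "\<forall>n. d n = hs 2 n"
proof -
  have "\<forall>n\<ge>4. d n = 0" using dim_C3_one[OF assms] not_H3 by blast
  then have "d n = hs 2 n" if "n \<ge> 3" for n using assms that by (cases "n = 3") (auto simp: hs_def)
  then show ?thesis using hsI by blast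
qed

text \<open>The constant values 2, 3, 4 belong to the entries 7, 8, 9 of the table, hence the offset
  5.\<close>

lemma constant_cases:
  assumes "\<forall>n\<ge>3. d n = d 3" "2 \<le> d 3" "d 3 \<le> 4"
  shows "\<exists>j\<in>{2, 5, 6, 7, 8, 9, 10, 11}. \<forall>n. d n = hs j n"
proof -
  have c: "d 3 = 2 \<or> d 3 = 3 \<or> d 3 = 4" using assms(2,3) by arith
  have "\<forall>n. d n = hs (d 3 + 5) n"
  proof
    fix n
    show "d n = hs (d 3 + 5) n"
    proof (rule hsI)
      fix n :: nat assume n: "n \<ge> 3"
      then have "d n = d 3" using assms(1) by blast
      then show "d n = hs (d 3 + 5) n" using n c unfolding hs_def by auto
    qed
  qed
  moreover have "d 3 + 5 \<in> {2, 5, 6, 7, 8, 9, 10, 11}" using c by auto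
  ultimately show ?thesis by blast
qed

lemma left_full_cases:
  assumes "left_full R x" "b = (\<lambda>k. fs.dim (sol k (C 2)))"
  shows "\<exists>j\<in>{2, 5, 6, 7, 8, 9, 10, 11}. \<forall>n. d n = hs j n"
proof -
  interpret L: left_full R x by (rule assms(1))
  have const: "d n = d m" if "2 \<le> m" "d (Suc m) = d m" "m \<le> n" for m n
  proof -
    have "d n = d m \<and> d (Suc n) = d n" using that(3)
    proof (induction n rule: dec_induct)
      case (step n)
      then show ?case using L.dim_stable[of n] that(1) by simp
    qed (use that(2) in simp)
    then show ?thesis by simp
  qed
  have decr: "d 3 \<le> 3" "d 4 \<le> d 3" "d 5 \<le> d 4"
    using L.dim_decr[of 1] L.dim_decr[of 2] L.dim_decr[of 3] d_small by (simp_all add: eval_nat_numeral)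
  consider "d 3 = 0" | "d 3 = 1" | "d 3 = 2" "d 4 = 2" | "d 3 = 2" "d 4 = 0" | "d 3 = 2" "d 4 = 1" "d 5 = 0"
    | "d 3 = 2" "d 4 = 1" "d 5 = 1" | "d 3 = 3" using decr by linarith
  then show ?thesis
  proof cases
    case 1
    then show ?thesis using not_H1 by simp
  next
    case 2
    then show ?thesis using H2_of_dim_C3_one by blast
  next
    case 3
    have "\<forall>n\<ge>3. d n = d 3" using const[of 3] 3 by simp
    then show ?thesis using constant_cases 3 by simp
  next
    case 4
    then have "d n = 0" if "n \<ge> 4" for n using dim_0_mono that by blast
    \<comment> \<open>The value 85 exceeds twice 42 by one, against the growth bound in degree
      five.\<close>
    then have "b 5 = 42" "b 6 = 85" using koszul_numbersD[OF dual] b0 b1_b2 d_small 4 by simp_all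
    then show ?thesis using L.dual_dim_bound[of 5] assms(2) by simp
  next
    case 5
    then have z: "d n = 0" if "n \<ge> 5" for n using dim_0_mono that by blast
    have "d n = hs 5 n" if "n \<ge> 3" for n
    proof -
      have "n = 3 \<or> n = 4 \<or> n \<ge> 5" using that by arith
      then show ?thesis using z 5 by (auto simp: hs_def)
    qed
    then show ?thesis using hsI by blast
  next
    case 6
    then have z: "d n = 1" if "n \<ge> 4" for n using const[of 4 n] that by simp
    have "d n = hs 6 n" if "n \<ge> 3" for n
    proof -
      have "n = 3 \<or> n \<ge> 4" using that by arith
      then show ?thesis using z 6 by (auto simp: hs_def)
    qed
    then show ?thesis using hsI by blast
  next
    case 7
    have "\<forall>n\<ge>3. d n = d 3" using const[of 2] 7 d_small by simp
    then show ?thesis using constant_cases 7 by simp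
  qed
qed

text \<open>The cases are the existence of right and of left null vectors. When they are
  proportional, one vector has zero products on both sides and the problem becomes one in two
  variables.\<close>

lemma no_full_cases:
  assumes "no_full R" and root: "\<And>a b c :: 'k. a \<noteq> 0 \<Longrightarrow> \<exists>s. a * s * s + b * s + c = 0"
  shows "\<exists>j\<in>{2, 5, 6, 7, 8, 9, 10, 11}. \<forall>n. d n = hs j n"
proof -
  interpret N: no_full R by (rule assms(1))
  interpret N': no_full "rv ` R" by (rule N.no_full_rv)
  have W': "sol 2 (rv ` R) = rv ` C 2" by (rule rv_sol)
  consider "d 3 = 0" | "d 3 = 1" | "2 \<le> d 3" by linarith
  then show ?thesis
  proof cases
    case 1
    then show ?thesis using not_H1 by simp
  next
    case 2
    then show ?thesis using H2_of_dim_C3_one by blast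
  next
    case 3
    consider "\<nexists>k. right_null (C 2) k" "\<nexists>k. left_null (C 2) k"
      | k where "right_null (C 2) k" "\<nexists>k. left_null (C 2) k"
      | k where "left_null (C 2) k" "\<nexists>k. right_null (C 2) k"
      | k k' where "right_null (C 2) k" "left_null (C 2) k'" by blast
    then show ?thesis
    proof cases
      case 1
      then show ?thesis using N.dim_C3_le_1 3 by simp
    next
      case 2
      then show ?thesis using constant_cases[OF N.one_null_mid(1) 3 N.one_null_mid(2)] 3 by blast
    next
      case (3 k)
      have "right_null (sol 2 (rv ` R)) k" "\<nexists>k. left_null (sol 2 (rv ` R)) k"
        using 3 by (simp_all add: W' left_null_rv)
      note N'.one_null_mid[OF this, unfolded dim_rv_sol]
      then show ?thesis using constant_cases \<open>2 \<le> d 3\<close> by blast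
    next
      case (4 k k')
      show ?thesis
      proof (cases "indep2 k k'")
        case True
        then show ?thesis using constant_cases distinct_null_mid[OF 4 True 3] 3 by blast
      next
        case False
        have kn: "k \<noteq> 0" "k' \<noteq> 0" using 4 by (auto simp: right_null_def left_null_def)
        then obtain c where c: "k' = scl c k" using not_indep2[OF False] by blast
        then have "c \<noteq> 0" using kn by (auto simp: scl_def zero_fun_def)
        then have "left_null (C 2) k" using 4(2) kn unfolding c left_null_def bl_add by simp
        then have "(\<forall>n\<ge>2. d n = Suc n) \<or> (\<forall>n\<ge>2. d n = card {w :: bool list. length w = n \<and> no_square w})"
          using two_generators[OF 4(1) _ root] by blast
        then show ?thesis
        proof
          assume *: "\<forall>n\<ge>2. d n = Suc n"
          have "d n = hs 10 n" if "n \<ge> 3" for n using * that by (simp add: hs_def)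
          then show ?thesis using hsI by blast
        next
          assume *: "\<forall>n\<ge>2. d n = card {w :: bool list. length w = n \<and> no_square w}"
          have "d n = hs 11 n" if "n \<ge> 3" for n using * that by (simp add: hs_def)
          then show ?thesis using hsI by blast
        qed
      qed
    qed
  qed
qed

end

theorem dim_sequences:
  assumes inf: "infinite (UNIV :: 'k set)" and root: "\<And>a b c :: 'k. a \<noteq> 0 \<Longrightarrow> \<exists>s. a * s * s + b * s + c = 0"
    and dual: "koszul_numbers d (\<lambda>k. fs.dim (sol k (C 2)))"
  shows "\<exists>j\<in>{2, 5, 6, 7, 8, 9, 10, 11}. \<forall>n. d n = hs j n"
proof -
  have b0: "fs.dim (sol 0 G) = 1" for G :: "'k tens set" by (simp add: sol_small dim_tens)
  consider x where "left_full R x" | x where "left_full (rv ` R) x" | "no_full R"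
  proof (cases "\<exists>x. left_full R x \<or> left_full (rv ` R) x")
    case False
    interpret R: three_rel "rv ` R" by (rule three_rel_rv)
    have "no_full R"
    proof
      fix x
      show "\<exists>w\<in>C 2. w \<noteq> 0 \<and> (\<forall>v. bl w x v = 0)"
        using False left_full.intro[OF three_rel_axioms] left_full_axioms.intro by blast
      have "\<exists>w\<in>rv ` C 2. w \<noteq> 0 \<and> (\<forall>v. bl w x v = 0)"
        using False left_full.intro[OF R.three_rel_axioms] left_full_axioms.intro[of "rv ` R" x] unfolding rv_sol by blast
      then show "\<exists>w\<in>C 2. w \<noteq> 0 \<and> (\<forall>u. bl w u x = 0)" by (auto simp: bl_rv rv_eq_0)
    qed (rule inf)
    then show thesis by (rule that(3))
  qed (use that in blast)
  then show ?thesis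
  proof cases
    case 1
    then show ?thesis using left_full_cases[OF dual b0 1] by simp
  next
    case (2 x)
    interpret R: three_rel "rv ` R" by (rule three_rel_rv)
    \<comment> \<open>The quadratic dual of the opposite algebra is the opposite of the quadratic
      dual, so the ranks agree.\<close>
    have b: "fs.dim (sol k (sol 2 (rv ` R))) = fs.dim (sol k (C 2))" for k
      unfolding rv_sol[of 2 R] by (rule dim_rv_sol)
    have "koszul_numbers R.d (\<lambda>k. fs.dim (sol k (sol 2 (rv ` R))))"
      unfolding b dim_rv_sol by (rule dual)
    from R.left_full_cases[OF this b0 2 refl] show ?thesis unfolding dim_rv_sol .
  next
    case 3
    then show ?thesis using no_full_cases[OF dual b0] root by blast
  qed
qed

end

section \<open>Extension of the ground field\<close>

lemma sol_mono: "G \<subseteq> G' \<Longrightarrow> sol n G' \<subseteq> sol n G"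
  by (auto simp: sol_def)

lemma sol_span: "sol n (fs.span G) = sol n G"
proof
  show "sol n (fs.span G) \<subseteq> sol n G" by (rule sol_mono) (rule fs.span_superset)
  show "sol n G \<subseteq> sol n (fs.span G)"
  proof
    fix t assume t: "t \<in> sol n G"
    show "t \<in> sol n (fs.span G)"
    proof (rule solI)
      fix g u v assume "g \<in> fs.span G"
      then show "(\<Sum>i\<in>UNIV. \<Sum>j\<in>UNIV. g [i, j] * t (u @ [i, j] @ v)) = 0"
      proof (induction rule: fs.span_induct_alt)
        case base
        then show ?case by (simp add: pointwise)
      next
        case (step c x y)
        have "(\<Sum>i\<in>UNIV. \<Sum>j\<in>UNIV. (scl c x + y) [i, j] * t (u @ [i, j] @ v))
          = c * (\<Sum>i\<in>UNIV. \<Sum>j\<in>UNIV. x [i, j] * t (u @ [i, j] @ v)) + (\<Sum>i\<in>UNIV. \<Sum>j\<in>UNIV. y [i, j] * t (u @ [i, j] @ v))"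
          by (simp add: pointwise distrib_right sum.distrib sum_distrib_left mult.assoc)
        then show ?case using solD[OF t step(1)] step(2) by (simp del: append.simps)
      qed
    qed (rule sol_tens[OF t])
  qed
qed

locale field_ext =
  fixes h :: "'k::field \<Rightarrow> 'l::field"
  assumes h_add: "h (x + y) = h x + h y" and h_mult: "h (x * y) = h x * h y" and h_1: "h 1 = 1"
begin

lemma h_0: "h 0 = 0"
  using h_add[of 0 0] by (metis add_0 add_right_imp_eq)

lemma h_inj: "h x = 0 \<Longrightarrow> x = 0"
  using h_mult[of x "inverse x"] h_1 by (cases "x = 0") auto

lemma h_sum: "h (\<Sum>i\<in>I. f i) = (\<Sum>i\<in>I. h (f i))"
  by (induction I rule: infinite_finite_induct) (simp_all add: h_0 h_add)

text \<open>The larger field is a vector space over the smaller one, with scalars acting through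
  \<open>h\<close>; \<open>B\<close> is a basis of the span of the finite set
  \<open>S\<close>.\<close>

lemma coordinates:
  fixes S :: "'l set"
  assumes "finite S"
  obtains B :: "'l set" and c where "finite B" "\<And>x. x \<in> S \<Longrightarrow> x = (\<Sum>e\<in>B. h (c x e) * e)"
    "\<And>a e. (\<Sum>e\<in>B. h (a e) * e) = 0 \<Longrightarrow> e \<in> B \<Longrightarrow> a e = 0"
proof -
  interpret V: vector_space "\<lambda>c x. h c * x"
    by standard (simp_all add: h_add h_mult h_1 algebra_simps)
  obtain B where B: "B \<subseteq> S" "V.independent B" "S \<subseteq> V.span B" using V.maximal_independent_subset by blast
  have fB: "finite B" using B(1) assms finite_subset by blast
  have "\<forall>x\<in>S. \<exists>u. x = (\<Sum>e\<in>B. h (u e) * e)" using B(3) V.span_finite[OF fB] by auto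
  then obtain c where "\<forall>x\<in>S. x = (\<Sum>e\<in>B. h (c x e) * e)" using bchoice by metis
  moreover have "a e = 0" if "(\<Sum>e\<in>B. h (a e) * e) = 0" "e \<in> B" for a e
    by (rule V.independentD[OF B(2) fB subset_refl that])
  ultimately show thesis using that[OF fB] by blast
qed

text \<open>Expanding the coefficients of a dependency in a basis over the smaller field splits it
  into dependencies over that field.\<close>

lemma comp_independent:
  assumes A: "finite A" "fs.independent (A :: ('a \<Rightarrow> 'k) set)"
  shows "fs.independent ((\<circ>) h ` A)" "card ((\<circ>) h ` A) = card A"
proof -
  have inj: "inj ((\<circ>) h :: ('a \<Rightarrow> 'k) \<Rightarrow> 'a \<Rightarrow> 'l)"
  proof (rule injI)
    fix f g :: "'a \<Rightarrow> 'k" assume e: "h \<circ> f = h \<circ> g"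
    have "h (f x - g x) = 0" for x
    proof -
      have "h (f x) = h ((f x - g x) + g x)" by simp
      then show ?thesis unfolding h_add using fun_cong[OF e, of x] by simp
    qed
    then have "f x = g x" for x using h_inj[of "f x - g x"] by simp
    then show "f = g" by (rule ext)
  qed
  then have injA: "inj_on ((\<circ>) h) A" by (rule inj_on_subset) simp
  then show "card ((\<circ>) h ` A) = card A" by (rule card_image)
  show "fs.independent ((\<circ>) h ` A)"
  proof (rule fs.independent_if_scalars_zero)
    fix u y assume u: "(\<Sum>x\<in>(\<circ>) h ` A. scl (u x) x) = 0" and y: "y \<in> (\<circ>) h ` A"
    obtain B c where B: "finite B" "\<And>x. x \<in> u ` ((\<circ>) h ` A) \<Longrightarrow> x = (\<Sum>e\<in>B. h (c x e) * e)"
      "\<And>a e. (\<Sum>e\<in>B. h (a e) * e) = 0 \<Longrightarrow> e \<in> B \<Longrightarrow> a e = 0"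
      by (rule coordinates[of "u ` ((\<circ>) h ` A)"]) (use A in auto)
    let ?c = "\<lambda>b e. c (u (h \<circ> b)) e"
    have "?c b e = 0" if b: "b \<in> A" and e: "e \<in> B" for b e
    proof -
      have "(\<Sum>b\<in>A. ?c b e * b x) = 0" for x
      proof (rule B(3)[OF _ e])
        have "0 = (\<Sum>b\<in>A. u (h \<circ> b) * h (b x))"
          using fun_cong[OF u, of x] injA by (simp add: sum.reindex pointwise)
        also have "\<dots> = (\<Sum>b\<in>A. (\<Sum>e\<in>B. h (?c b e) * e) * h (b x))"
          using B(2) by (intro sum.cong) auto
        also have "\<dots> = (\<Sum>b\<in>A. \<Sum>e\<in>B. h (?c b e * b x) * e)"
          by (simp add: sum_distrib_right sum_distrib_left h_mult mult_ac)
        also have "\<dots> = (\<Sum>e\<in>B. \<Sum>b\<in>A. h (?c b e * b x) * e)" by (rule sum.swap)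
        also have "\<dots> = (\<Sum>e\<in>B. h (\<Sum>b\<in>A. ?c b e * b x) * e)"
          by (simp add: sum_distrib_right h_sum)
        finally show "(\<Sum>e\<in>B. h (\<Sum>b\<in>A. ?c b e * b x) * e) = 0" by simp
      qed
      then have "(\<Sum>b\<in>A. scl (?c b e) b) = 0" by (simp add: fun_eq_iff pointwise)
      then show ?thesis using fs.independentD[OF A(2) A(1) subset_refl _ b, of "\<lambda>b. ?c b e"] by simp
    qed
    moreover obtain b where b: "b \<in> A" "y = h \<circ> b" using y by auto
    moreover have "u y = (\<Sum>e\<in>B. h (?c b e) * e)" using B(2)[of "u y"] b by auto
    ultimately show "u y = 0" by (simp add: h_0)
  qed (use A in auto)
qed

text \<open>The equations have coefficients in the smaller field, so each coordinate of a solution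
  is a solution over the smaller field.\<close>

lemma sol_comp: "sol n ((\<circ>) h ` G) = fs.span ((\<circ>) h ` sol n G)"
proof
  show "fs.span ((\<circ>) h ` sol n G) \<subseteq> sol n ((\<circ>) h ` G)"
  proof (rule fs.span_minimal[OF _ subspace_sol], rule image_subsetI)
    fix t assume t: "t \<in> sol n G"
    show "h \<circ> t \<in> sol n ((\<circ>) h ` G)"
    proof (rule solI)
      fix g' u v assume "g' \<in> (\<circ>) h ` G"
      then obtain g where g: "g \<in> G" "g' = h \<circ> g" by auto
      have "(\<Sum>i\<in>UNIV. \<Sum>j\<in>UNIV. g' [i, j] * (h \<circ> t) (u @ [i, j] @ v))
         = h (\<Sum>i\<in>UNIV. \<Sum>j\<in>UNIV. g [i, j] * t (u @ [i, j] @ v))" by (simp add: g(2) h_sum h_mult)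
      then show "(\<Sum>i\<in>UNIV. \<Sum>j\<in>UNIV. g' [i, j] * (h \<circ> t) (u @ [i, j] @ v)) = 0"
        unfolding solD[OF t g(1)] h_0 .
    qed (auto intro!: tensI simp: tensD[OF sol_tens[OF t]] h_0)
  qed
  show "sol n ((\<circ>) h ` G) \<subseteq> fs.span ((\<circ>) h ` sol n G)"
  proof
    fix s assume s: "s \<in> sol n ((\<circ>) h ` G)"
    have "finite (s ` {w. length w = n})" by (intro finite_imageI finite_words)
    then obtain B c where B: "finite B" "\<And>x. x \<in> s ` {w. length w = n} \<Longrightarrow> x = (\<Sum>e\<in>B. h (c x e) * e)"
      "\<And>a e. (\<Sum>e\<in>B. h (a e) * e) = 0 \<Longrightarrow> e \<in> B \<Longrightarrow> a e = 0"
      using coordinates[of "s ` {w. length w = n}"] by blast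
    define t where "t e w = (if length w = n then c (s w) e else 0)" for e w
    have st: "s w = (\<Sum>e\<in>B. h (t e w) * e)" for w
    proof (cases "length w = n")
      case True
      then show ?thesis using B(2)[of "s w"] by (simp add: t_def)
    next
      case False
      then show ?thesis using tensD[OF sol_tens[OF s]] by (simp add: t_def h_0)
    qed
    have "t e \<in> sol n G" if e: "e \<in> B" for e
    proof (rule solI)
      fix g u v assume g: "g \<in> G"
      show "(\<Sum>i\<in>UNIV. \<Sum>j\<in>UNIV. g [i, j] * t e (u @ [i, j] @ v)) = 0"
      proof (rule B(3)[OF _ e])
        have "(\<Sum>e\<in>B. h (\<Sum>i\<in>UNIV. \<Sum>j\<in>UNIV. g [i, j] * t e (u @ [i, j] @ v)) * e)
          = (\<Sum>e\<in>B. \<Sum>i\<in>UNIV. \<Sum>j\<in>UNIV. h (g [i, j]) * (h (t e (u @ [i, j] @ v)) * e))"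
          by (simp add: h_sum h_mult sum_distrib_right mult.assoc)
        also have "\<dots> = (\<Sum>i\<in>UNIV. \<Sum>j\<in>UNIV. \<Sum>e\<in>B. h (g [i, j]) * (h (t e (u @ [i, j] @ v)) * e))"
          by (subst sum.swap) (intro sum.cong refl sum.swap)
        also have "\<dots> = (\<Sum>i\<in>UNIV. \<Sum>j\<in>UNIV. (h \<circ> g) [i, j] * s (u @ [i, j] @ v))"
          unfolding st by (simp add: sum_distrib_left)
        also have "\<dots> = 0" by (rule solD[OF s imageI[OF g]])
        finally show "(\<Sum>e\<in>B. h (\<Sum>i\<in>UNIV. \<Sum>j\<in>UNIV. g [i, j] * t e (u @ [i, j] @ v)) * e) = 0" .
      qed
    qed (simp add: tensI t_def)
    then have "(\<Sum>e\<in>B. scl e (h \<circ> t e)) \<in> fs.span ((\<circ>) h ` sol n G)"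
      by (intro fs.span_sum fs.span_scale fs.span_base) auto
    moreover have "(\<Sum>e\<in>B. scl e (h \<circ> t e)) = s"
      by (simp add: fun_eq_iff pointwise st mult.commute)
    ultimately show "s \<in> fs.span ((\<circ>) h ` sol n G)" by simp
  qed
qed

lemma dim_sol_comp: "fs.dim (sol n ((\<circ>) h ` G)) = fs.dim (sol n G)"
proof -
  obtain A where A: "A \<subseteq> sol n G" "finite A" "fs.independent A" "fs.span A = sol n G" "card A = fs.dim (sol n G)"
    by (rule fin_dim_basis[OF subspace_sol fin_dim_sol])
  have "h \<circ> f \<in> fs.span ((\<circ>) h ` A)" if "f \<in> fs.span A" for f
    using that
  proof (induction rule: fs.span_induct_alt)
    case base
    have "h \<circ> 0 = (0 :: 3 list \<Rightarrow> 'l)" by (simp add: fun_eq_iff pointwise h_0)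
    then show ?case using fs.span_zero by simp
  next
    case (step c x y)
    have "h \<circ> (scl c x + y) = scl (h c) (h \<circ> x) + (h \<circ> y)" by (simp add: fun_eq_iff pointwise h_add h_mult)
    moreover have "scl (h c) (h \<circ> x) + (h \<circ> y) \<in> fs.span ((\<circ>) h ` A)"
      by (rule fs.span_add[OF fs.span_scale[OF fs.span_base[OF imageI[OF step(1)]]] step(2)])
    ultimately show ?case by (simp only:)
  qed
  then have "fs.span ((\<circ>) h ` sol n G) = fs.span ((\<circ>) h ` A)"
    using A(1,4) by (intro antisym fs.span_minimal fs.subspace_span fs.span_mono) auto
  then have "fs.dim (sol n ((\<circ>) h ` G)) = fs.dim (fs.span ((\<circ>) h ` A))" by (simp add: sol_comp)
  also have "\<dots> = card A" using comp_independent[OF A(2,3)] by (metis fs.dim_span_eq_card_independent)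
  finally show ?thesis using A(5) by simp
qed

end

text \<open>If the field were finite, adding 1 to the product of all x - a would give a polynomial
  of positive degree without roots.\<close>

lemma infinite_alg_closed: "infinite (UNIV :: 'a::alg_closed_field set)"
proof
  assume fin: "finite (UNIV :: 'a set)"
  let ?p = "\<Prod>a\<in>(UNIV :: 'a set). [:- a, 1:]"
  have deg: "degree ?p = card (UNIV :: 'a set)" by (subst degree_prod_eq_sum_degree) auto
  have "card (UNIV :: 'a set) > 0" using fin by (simp add: card_gt_0_iff)
  then have "degree (?p + 1) > 0" using deg by (subst degree_add_eq_left) auto
  then obtain x where "poly (?p + 1) x = 0" using alg_closed_imp_poly_has_root by blast
  moreover have "poly ?p x = 0" using fin by (simp add: poly_prod)
  ultimately show False by simp
qed

lemma quadratic_root: "a \<noteq> 0 \<Longrightarrow> \<exists>s. a * s * s + b * s + c = (0 :: 'a::alg_closed_field)"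
  using alg_closed_imp_poly_has_root[of "[:c, b, a:]"] by (auto simp: algebra_simps)

text \<open>The ranks are preserved too: the annihilator of the extended relations is the span of
  the extended annihilator.\<close>

theorem (in three_rel) dim_sequences_any_field:
  assumes dual: "koszul_numbers d (\<lambda>k. fs.dim (sol k (C 2)))"
  shows "\<exists>j\<in>{2, 5, 6, 7, 8, 9, 10, 11}. \<forall>n. d n = hs j n"
proof -
  interpret field_ext "to_ac :: 'k \<Rightarrow> 'k alg_closure" by standard simp_all
  let ?R = "(\<circ>) to_ac ` R"
  interpret E: three_rel ?R by standard (simp add: dim_sol_comp dim_W)
  have "sol k (E.C 2) = sol k ((\<circ>) to_ac ` C 2)" for k by (simp only: sol_comp sol_span)
  then have "koszul_numbers E.d (\<lambda>k. fs.dim (sol k (E.C 2)))" using dual by (simp add: dim_sol_comp)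
  then show ?thesis using E.dim_sequences[OF infinite_alg_closed quadratic_root] by (simp add: dim_sol_comp)
qed

section \<open>Graded quotients of the free algebra\<close>

definition pmul :: "'k::field ncpoly \<Rightarrow> 'k ncpoly \<Rightarrow> 'k ncpoly" where
  "pmul f g = (\<lambda>w. \<Sum>i\<le>length w. f (take i w) * g (drop i w))"

definition polys :: "nat \<Rightarrow> 'k::field ncpoly set" where
  "polys n = {f. finite {w. f w \<noteq> 0} \<and> (\<forall>w. f w \<noteq> 0 \<longrightarrow> set w \<subseteq> {..<n})}"

lemma free_algebra_fold:
  "carrier (free_algebra n) = polys n" "mult (free_algebra n) f g = pmul f g"
  "one (free_algebra n) = const_poly 1" "zero (free_algebra n) = (0 :: 'k::field ncpoly)"
  "add (free_algebra n) f g = f + g" for f g :: "'k::field ncpoly"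
  by (auto simp: free_algebra_def polys_def pmul_def const_poly_def fun_eq_iff pointwise)

definition nwords :: "nat \<Rightarrow> nat \<Rightarrow> nat list set" where
  "nwords n j = {w. set w \<subseteq> {..<n} \<and> length w = j}"

lemma finite_nwords: "finite (nwords n j)"
  unfolding nwords_def by (rule finite_lists_length_eq) simp

lemma free_comp_eq: "free_comp n j = supp_on (nwords n j)"
proof (intro equalityI subsetI)
  fix f :: "'a ncpoly" assume "f \<in> supp_on (nwords n j)"
  then have f: "w \<in> nwords n j" if "f w \<noteq> 0" for w using that by (auto simp: supp_on_def)
  then have "{w. f w \<noteq> 0} \<subseteq> nwords n j" by blast
  then have "finite {w. f w \<noteq> 0}" by (rule finite_subset[OF _ finite_nwords])
  then show "f \<in> free_comp n j" using f
    by (auto simp: free_comp_def free_algebra_fold polys_def nwords_def)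
qed (auto simp: free_comp_def free_algebra_fold polys_def nwords_def supp_on_def)

lemma free_comp_polys: "f \<in> free_comp n j \<Longrightarrow> f \<in> polys n"
  by (simp add: free_comp_def free_algebra_fold)

lemma free_comp_len: "f \<in> free_comp n j \<Longrightarrow> length w \<noteq> j \<Longrightarrow> f w = 0"
  by (auto simp: free_comp_def)

lemma polysD: "f \<in> polys n \<Longrightarrow> f w \<noteq> 0 \<Longrightarrow> set w \<subseteq> {..<n}"
  by (simp add: polys_def)

lemma pmul_lin: "pmul (f + g) h = pmul f h + pmul g h" "pmul h (f + g) = pmul h f + pmul h g"
  "pmul (scl c f) h = scl c (pmul f h)" "pmul h (scl c f) = scl c (pmul h f)"
  "pmul 0 h = 0" "pmul h 0 = 0"
  "pmul (f - g) h = pmul f h - pmul g h" "pmul h (f - g) = pmul h f - pmul h g"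
  by (auto simp: pmul_def fun_eq_iff pointwise algebra_simps sum.distrib sum_distrib_left sum_subtractf)

lemma pmul_sum: "pmul (\<Sum>i\<in>I. f i) h = (\<Sum>i\<in>I. pmul (f i) h)" "pmul h (\<Sum>i\<in>I. f i) = (\<Sum>i\<in>I. pmul h (f i))"
  by (induction I rule: infinite_finite_induct) (simp_all add: pmul_lin)

lemma pmul_assoc: "pmul (pmul f g) h = pmul f (pmul g h)"
  unfolding pmul_def by (rule ext, rule ncpoly_mult_assoc)

lemma pmul_letter_left:
  "pmul (delta [j]) h w = (case w of [] \<Rightarrow> 0 | i # w' \<Rightarrow> if i = j then h w' else 0)"
proof (cases w)
  case (Cons i w')
  have "pmul (delta [j]) h w = (\<Sum>k\<le>length w. if k = 1 then (if i = j then h w' else 0) else 0)"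
    unfolding pmul_def
  proof (rule sum.cong[OF refl])
    fix k assume "k \<in> {..length w}"
    then have "take k w = [j] \<longleftrightarrow> k = 1 \<and> i = j" using Cons by (cases k) (auto simp: take_eq_Nil)
    then show "delta [j] (take k w) * h (drop k w) = (if k = 1 then (if i = j then h w' else 0) else 0)"
      using Cons by (auto simp: delta_def)
  qed
  also have "\<dots> = (if i = j then h w' else 0)" by (simp add: Cons del: sum.atMost_Suc)
  finally show ?thesis using Cons by simp
qed (simp add: pmul_def delta_def)

lemma pmul_letter_right:
  "pmul h (delta [j]) w = (if w \<noteq> [] \<and> last w = j then h (butlast w) else 0)"
proof (cases w rule: rev_cases)
  case (snoc v i)
  have "pmul h (delta [j]) w = (\<Sum>k\<le>length w. if k = length v then (if i = j then h v else 0) else 0)"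
    unfolding pmul_def
  proof (rule sum.cong[OF refl])
    fix k assume "k \<in> {..length w}"
    then have "k < length v \<or> k = length v \<or> k = Suc (length v)" using snoc by auto
    then show "h (take k w) * delta [j] (drop k w) = (if k = length v then (if i = j then h v else 0) else 0)"
      using snoc by (auto simp: delta_def append_eq_Cons_conv)
  qed
  also have "\<dots> = (if i = j then h v else 0)" by (simp add: snoc del: sum.atMost_Suc)
  finally show ?thesis using snoc by simp
qed (simp add: pmul_def delta_def)

lemma pmul_const: "pmul (const_poly c) g = scl c g" "pmul g (const_poly c) = scl c g"
  unfolding pmul_def const_mult mult_const by (simp_all add: fun_eq_iff scl_apply mult.commute)

lemma pmul_polys: "f \<in> polys n \<Longrightarrow> g \<in> polys n \<Longrightarrow> pmul f g \<in> polys n"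
proof -
  interpret F: ring "free_algebra n :: 'a ncpoly ring" by (rule free_algebra_ring)
  show "f \<in> polys n \<Longrightarrow> g \<in> polys n \<Longrightarrow> pmul f g \<in> polys n"
    using F.m_closed[of f g] by (simp add: free_algebra_fold)
qed

lemma pmul_hom:
  assumes "\<And>w. length w \<noteq> b \<Longrightarrow> g w = 0"
  shows "hom_part m (pmul f g) = (if b \<le> m then pmul (hom_part (m - b) f) g else 0)"
proof
  fix w
  have "(\<Sum>i\<le>length w. f (take i w) * g (drop i w)) = (if b \<le> m then \<Sum>i\<le>length w. hom_part (m - b) f (take i w) * g (drop i w) else 0)"
    if "length w = m"
  proof -
    have "f (take i w) * g (drop i w) = (if b \<le> m then hom_part (m - b) f (take i w) * g (drop i w) else 0)" if i: "i \<le> length w" for i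
      using assms[of "drop i w"] i \<open>length w = m\<close> by (cases "length w - i = b") (auto simp: hom_part_def)
    then show ?thesis by (simp add: sum.neutral)
  qed
  moreover have "(\<Sum>i\<le>length w. hom_part (m - b) f (take i w) * g (drop i w)) = 0" if "length w \<noteq> m" "b \<le> m"
  proof (rule sum.neutral, rule ballI)
    fix i assume "i \<in> {..length w}"
    then show "hom_part (m - b) f (take i w) * g (drop i w) = 0"
      using assms[of "drop i w"] that by (cases "length w - i = b") (auto simp: hom_part_def)
  qed
  ultimately show "hom_part m (pmul f g) w = (if b \<le> m then pmul (hom_part (m - b) f) g else 0) w"
    by (auto simp: hom_part_def[of m] pmul_def zero_fun_apply)
qed

lemma hom_part_eq: "(\<And>w. length w \<noteq> m \<Longrightarrow> f w = 0) \<Longrightarrow> hom_part m f = f"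
  by (auto simp: hom_part_def)

lemma hom_part_lin: "hom_part m (f + g) = hom_part m f + hom_part m g" "hom_part m (f - g) = hom_part m f - hom_part m g"
  "hom_part m (scl c f) = scl c (hom_part m f)" "hom_part m 0 = 0"
  by (auto simp: hom_part_def fun_eq_iff pointwise)

lemma hom_part_sum: "hom_part m (\<Sum>i\<in>I. f i) = (\<Sum>i\<in>I. hom_part m (f i))"
  by (induction I rule: infinite_finite_induct) (simp_all add: hom_part_lin)

lemma hom_part_comp: "f \<in> polys n \<Longrightarrow> hom_part m f \<in> free_comp n m"
  by (auto simp: free_comp_def free_algebra_fold hom_part_def polys_def elim: rev_finite_subset)

lemma pmul_comp: "f \<in> free_comp n a \<Longrightarrow> g \<in> free_comp n b \<Longrightarrow> pmul f g \<in> free_comp n (a + b)"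
proof -
  assume f: "f \<in> free_comp n a" and g: "g \<in> free_comp n b"
  have "hom_part (a + b) (pmul f g) = pmul f g"
    using pmul_hom[of b g "a + b" f] free_comp_len[OF g] hom_part_eq[of a f] free_comp_len[OF f] by simp
  then show ?thesis using hom_part_comp[OF pmul_polys[OF free_comp_polys[OF f] free_comp_polys[OF g]], of "a + b"] by simp
qed

lemma const_comp: "const_poly c \<in> free_comp n 0"
  by (auto simp: free_comp_eq supp_on_def nwords_def const_poly_def)

lemma const_polys: "const_poly c \<in> polys n"
  using const_in[of c n] by (simp add: free_algebra_fold)

lemma comp_0: "f \<in> free_comp n 0 \<Longrightarrow> f = const_poly (f [])"
  by (auto simp: free_comp_eq supp_on_def nwords_def const_poly_def fun_eq_iff)

lemma subspace_free_comp: "fs.subspace (free_comp n j)"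
  by (simp add: free_comp_eq subspace_supp_on)

lemma polys_subspace: "fs.subspace (polys n :: 'k::field ncpoly set)"
proof -
  have "f + g \<in> polys n" if "f \<in> polys n" "g \<in> polys n" for f g :: "'k ncpoly"
  proof -
    interpret F: ring "free_algebra n :: 'k ncpoly ring" by (rule free_algebra_ring)
    show ?thesis using F.a_closed[of f g] that by (simp add: free_algebra_fold)
  qed
  moreover have "scl c f \<in> polys n" if "f \<in> polys n" for c and f :: "'k ncpoly"
    using pmul_polys[OF const_polys that] by (simp add: pmul_const)
  moreover have "0 \<in> polys n" by (simp add: polys_def pointwise)
  ultimately show ?thesis by (simp add: fs.subspace_def)
qed

section \<open>The quotient by a proper graded ideal\<close>

locale graded_ideal =
  fixes n :: nat and I :: "'k::field ncpoly set"
  assumes pgi: "proper_graded_ideal n I"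
begin

abbreviation "F \<equiv> free_algebra n :: 'k ncpoly ring"
abbreviation "A \<equiv> graded_algebra n I"

definition q :: "'k ncpoly \<Rightarrow> 'k ncpoly set" where
  "q f = I +>\<^bsub>F\<^esub> f"

sublocale F: ring F by (rule free_algebra_ring)
sublocale I: ideal I F using pgi by (simp add: proper_graded_ideal_def)
sublocale A: ring A unfolding graded_algebra_def by (rule I.quotient_is_ring)

lemma I_pmul: "f \<in> I \<Longrightarrow> g \<in> polys n \<Longrightarrow> pmul f g \<in> I" "f \<in> I \<Longrightarrow> g \<in> polys n \<Longrightarrow> pmul g f \<in> I"
  using I.I_r_closed[of f g] I.I_l_closed[of f g] by (simp_all add: free_algebra_fold)

lemma I_subspace: "fs.subspace I"
proof -
  have "scl c f \<in> I" if "f \<in> I" for c f using I_pmul(2)[OF that const_polys] by (simp add: pmul_const)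
  moreover have "f + g \<in> I" if "f \<in> I" "g \<in> I" for f g
    using I.a_closed[OF that] by (simp add: free_algebra_fold)
  moreover have "0 \<in> I" using I.zero_closed by (simp add: free_algebra_fold)
  ultimately show ?thesis by (simp add: fs.subspace_def)
qed

lemmas I_closed = fs.subspace_add[OF I_subspace] fs.subspace_diff[OF I_subspace] fs.subspace_scale[OF I_subspace]
  fs.subspace_0[OF I_subspace] fs.subspace_neg[OF I_subspace]

lemma I_sum: "(\<And>i. i \<in> S \<Longrightarrow> f i \<in> I) \<Longrightarrow> (\<Sum>i\<in>S. f i) \<in> I"
  by (rule fs.subspace_sum[OF I_subspace])

lemma I_hom: "f \<in> I \<Longrightarrow> hom_part m f \<in> I"
  using pgi by (simp add: proper_graded_ideal_def)

lemma I_const: "const_poly c \<in> I \<Longrightarrow> c = 0"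
proof (rule ccontr)
  assume "const_poly c \<in> I" "c \<noteq> 0"
  then have "pmul (const_poly (1 / c)) (const_poly c) \<in> I" using I_pmul(2) const_polys by blast
  moreover have "pmul (const_poly (1 / c)) (const_poly c) = const_poly 1"
    unfolding pmul_const using \<open>c \<noteq> 0\<close> by (simp add: fun_eq_iff scl_apply const_poly_def)
  ultimately have "\<one>\<^bsub>F\<^esub> \<in> I" by (simp add: free_algebra_fold)
  then have "I = carrier F" by (rule I.one_imp_carrier)
  then show False using pgi by (simp add: proper_graded_ideal_def)
qed

lemma q_image: "q f = (\<lambda>i. i + f) ` I"
  by (auto simp: q_def a_r_coset_def' free_algebra_fold)

lemma q_eq: "q f = q g \<longleftrightarrow> f - g \<in> I"
proof
  assume "q f = q g"
  then have "0 + f \<in> q g" using I_closed(4) by (metis q_image image_eqI)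
  then obtain i where "i \<in> I" "f = i + g" by (auto simp: q_image)
  then show "f - g \<in> I" by simp
next
  assume *: "f - g \<in> I"
  have "(\<lambda>i. i + f) ` I \<subseteq> (\<lambda>i. i + g) ` I"
  proof (rule image_subsetI)
    fix i assume "i \<in> I"
    then have "i + (f - g) \<in> I" using * I_closed(1) by blast
    then show "i + f \<in> (\<lambda>i. i + g) ` I" by (rule rev_image_eqI) simp
  qed
  moreover have "(\<lambda>i. i + g) ` I \<subseteq> (\<lambda>i. i + f) ` I"
  proof (rule image_subsetI)
    fix i assume "i \<in> I"
    then have "i - (f - g) \<in> I" using * I_closed(2) by blast
    then show "i + g \<in> (\<lambda>i. i + f) ` I" by (rule rev_image_eqI) simp
  qed
  ultimately show "q f = q g" by (simp add: q_image)
qed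

lemma q_hom: "q \<in> ring_hom F A"
  unfolding q_def graded_algebra_def by (rule I.rcos_ring_hom)

lemma q_add: "f \<in> polys n \<Longrightarrow> g \<in> polys n \<Longrightarrow> q f \<oplus>\<^bsub>A\<^esub> q g = q (f + g)"
  using ring_hom_add[OF q_hom, of f g] by (simp add: free_algebra_fold)

lemma q_mult: "f \<in> polys n \<Longrightarrow> g \<in> polys n \<Longrightarrow> q f \<otimes>\<^bsub>A\<^esub> q g = q (pmul f g)"
  using ring_hom_mult[OF q_hom, of f g] by (simp add: free_algebra_fold)

lemma q_0: "q 0 = \<zero>\<^bsub>A\<^esub>"
  using ring_hom_zero[OF q_hom F.ring_axioms A.ring_axioms] by (simp add: free_algebra_fold)

lemma q_1: "q (const_poly 1) = \<one>\<^bsub>A\<^esub>"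
  using ring_hom_one[OF q_hom] by (simp add: free_algebra_fold)

lemma q_eq_0: "q f = \<zero>\<^bsub>A\<^esub> \<longleftrightarrow> f \<in> I"
  using q_eq[of f 0] by (simp add: q_0)

lemma carrier_A: "carrier A = q ` polys n"
  by (auto simp: graded_algebra_def FactRing_def A_RCOSETS_def' q_def free_algebra_fold)

lemma q_carrier: "f \<in> polys n \<Longrightarrow> q f \<in> carrier A"
  by (simp add: carrier_A)

lemma alg_comp_eq: "alg_comp n I j = q ` free_comp n j"
  by (simp add: alg_comp_def q_def)

lemma scalars_eq: "scalars n I = range (\<lambda>c. q (const_poly c))"
  by (simp add: scalars_def q_def)

lemma q_scl: "f \<in> polys n \<Longrightarrow> q (const_poly c) \<otimes>\<^bsub>A\<^esub> q f = q (scl c f)"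
  using q_mult[OF const_polys] by (simp add: pmul_const)

text \<open>\<open>psi\<close> presents the component as an image of \<open>T\<close>, and
  \<open>phi\<close>, having the same kernel modulo the ideal, identifies it with the functions on
  \<open>Y\<close>. The dimension over the embedded scalars is built up by adjoining one element of
  \<open>Y\<close> at a time.\<close>

lemma comp_dim_eqI:
  assumes psi: "lin psi" "psi ` T \<subseteq> free_comp n j" "\<And>f. f \<in> free_comp n j \<Longrightarrow> \<exists>t\<in>T. f - psi t \<in> I"
    and T: "fs.subspace T"
    and phi: "lin phi" "\<And>t. t \<in> T \<Longrightarrow> phi t = 0 \<longleftrightarrow> psi t \<in> I" "phi ` T = supp_on Y" and Y: "finite Y"
  shows "comp_dim n I j = card Y"
proof -
  note sf = scalars_subfield[OF pgi]
  have psi_p: "t \<in> T \<Longrightarrow> psi t \<in> polys n" for t using psi(2) free_comp_polys by blast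
  have D: "A.dimension (card Z) (scalars n I) (q ` psi ` {t \<in> T. phi t \<in> supp_on Z})" if "Z \<subseteq> Y" for Z
    using finite_subset[OF that Y] that
  proof (induction Z rule: finite_induct)
    case empty
    have "0 \<in> T" by (rule fs.subspace_0[OF T])
    then have "q ` psi ` {t \<in> T. phi t \<in> supp_on {}} = {\<zero>\<^bsub>A\<^esub>}"
    proof (intro equalityI subsetI)
      fix x assume "x \<in> q ` psi ` {t \<in> T. phi t \<in> supp_on {}}"
      then obtain t where t: "t \<in> T" "phi t \<in> supp_on {}" "x = q (psi t)" by auto
      then have "phi t = 0" by (simp add: supp_on_def fun_eq_iff pointwise)
      then show "x \<in> {\<zero>\<^bsub>A\<^esub>}" using phi(2)[OF t(1)] t(3) by (simp add: q_eq_0)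
    next
      fix x assume "x \<in> {\<zero>\<^bsub>A\<^esub>}"
      then have "x = q (psi 0)" by (simp add: lin_simps(3)[OF psi(1)] q_0)
      moreover have "phi 0 \<in> supp_on {}" by (simp add: lin_simps(3)[OF phi(1)] supp_on_def pointwise)
      ultimately show "x \<in> q ` psi ` {t \<in> T. phi t \<in> supp_on {}}" using \<open>0 \<in> T\<close> by blast
    qed
    then show ?case by simp
  next
    case (insert y Z)
    let ?E = "\<lambda>Z. q ` psi ` {t \<in> T. phi t \<in> supp_on Z}"
    have "delta y \<in> supp_on Y" using insert.prems by (auto simp: supp_on_def delta_def)
    then obtain s where s: "s \<in> T" "phi s = delta y" using phi(3) by (metis imageE)
    have s_carrier: "q (psi s) \<in> carrier A" using q_carrier psi_p s by blast
    have notin: "q (psi s) \<notin> ?E Z"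
    proof
      assume "q (psi s) \<in> ?E Z"
      then obtain t where t: "t \<in> T" "phi t \<in> supp_on Z" "q (psi s) = q (psi t)" by auto
      then have "psi (s - t) \<in> I" by (simp add: q_eq lin_simps(5)[OF psi(1)])
      then have "phi (s - t) = 0" using phi(2)[OF fs.subspace_diff[OF T s(1) t(1)]] by simp
      then have "phi t = delta y" by (simp add: lin_simps(5)[OF phi(1)] s(2))
      then show False using t(2) insert.hyps(2) by (auto simp: supp_on_def delta_def)
    qed
    have "A.line_extension (scalars n I) (q (psi s)) (?E Z) = ?E (insert y Z)"
    proof (intro equalityI subsetI)
      fix x assume "x \<in> A.line_extension (scalars n I) (q (psi s)) (?E Z)"
      then obtain c t where t: "t \<in> T" "phi t \<in> supp_on Z" "x = q (const_poly c) \<otimes>\<^bsub>A\<^esub> q (psi s) \<oplus>\<^bsub>A\<^esub> q (psi t)"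
        by (auto simp: A.line_extension_mem_iff scalars_eq)
      have "x = q (psi (scl c s + t))"
        unfolding t(3) q_scl[OF psi_p[OF s(1)]]
        using q_add[OF fs.subspace_scale[OF polys_subspace psi_p[OF s(1)]] psi_p[OF t(1)], of c]
        by (simp add: lin_simps(1,2)[OF psi(1)])
      moreover have "scl c s + t \<in> T" using s(1) t(1) T by (simp add: fs.subspace_add fs.subspace_scale)
      moreover have "phi (scl c s + t) \<in> supp_on (insert y Z)"
        using t(2) by (auto simp: lin_simps(1,2)[OF phi(1)] s(2) supp_on_def pointwise delta_def)
      ultimately show "x \<in> ?E (insert y Z)" by blast
    next
      fix x assume "x \<in> ?E (insert y Z)"
      then obtain t where t: "t \<in> T" "phi t \<in> supp_on (insert y Z)" "x = q (psi t)" by auto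
      define t' where "t' = t - scl (phi t y) s"
      have t': "t' \<in> T" unfolding t'_def using s(1) t(1) T by (simp add: fs.subspace_diff fs.subspace_scale)
      have "phi t' \<in> supp_on Z"
        using t(2) by (auto simp: t'_def lin_simps(2,5)[OF phi(1)] s(2) supp_on_def pointwise delta_def)
      moreover have "psi t = scl (phi t y) (psi s) + psi t'"
        by (simp add: t'_def lin_simps(2,5)[OF psi(1)])
      then have "x = q (const_poly (phi t y)) \<otimes>\<^bsub>A\<^esub> q (psi s) \<oplus>\<^bsub>A\<^esub> q (psi t')"
        unfolding t(3) q_scl[OF psi_p[OF s(1)]]
        using q_add[OF fs.subspace_scale[OF polys_subspace psi_p[OF s(1)]] psi_p[OF t'], of "phi t y"] by simp
      ultimately show "x \<in> A.line_extension (scalars n I) (q (psi s)) (?E Z)"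
        using t' unfolding A.line_extension_mem_iff scalars_eq by blast
    qed
    then show ?case
      using A.Suc_dim[OF s_carrier notin insert.IH] insert by simp
  qed
  have "q ` psi ` {t \<in> T. phi t \<in> supp_on Y} = alg_comp n I j"
  proof (intro equalityI subsetI)
    fix x assume "x \<in> alg_comp n I j"
    then obtain f where f: "f \<in> free_comp n j" "x = q f" by (auto simp: alg_comp_eq)
    then obtain t where "t \<in> T" "f - psi t \<in> I" using psi(3) by blast
    then have "t \<in> T" "x = q (psi t)" using f by (simp_all add: q_eq)
    moreover have "phi t \<in> supp_on Y" using phi(3) \<open>t \<in> T\<close> by blast
    ultimately show "x \<in> q ` psi ` {t \<in> T. phi t \<in> supp_on Y}" by blast
  qed (use psi(2) in \<open>auto simp: alg_comp_eq\<close>)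
  then have "A.dimension (card Y) (scalars n I) (alg_comp n I j)" using D[of Y] by simp
  then show ?thesis unfolding comp_dim_def using A.dimI[OF sf] by (simp add: over_def)
qed

end

section \<open>Multiplication of tensors by linear forms and its adjoint\<close>

abbreviation words :: "nat \<Rightarrow> 3 list set" where "words n \<equiv> {w. length w = n}"

lemma sum_lists_left:
  "(\<Sum>w | set w \<subseteq> Q \<and> length w = Suc n. F w) = (\<Sum>i\<in>Q. \<Sum>w | set w \<subseteq> Q \<and> length w = n. F (i # w))"
proof -
  have "{w. set w \<subseteq> Q \<and> length w = Suc n} = (\<lambda>(i, w). i # w) ` (Q \<times> {w. set w \<subseteq> Q \<and> length w = n})"
    by (auto simp: length_Suc_conv)
  moreover have "inj_on (\<lambda>(i, w). i # w) (Q \<times> {w. set w \<subseteq> Q \<and> length w = n})" by (auto simp: inj_on_def)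
  ultimately show ?thesis by (simp add: sum.reindex sum.cartesian_product case_prod_unfold)
qed

lemma sum_lists_right:
  "(\<Sum>w | set w \<subseteq> Q \<and> length w = Suc n. F w) = (\<Sum>i\<in>Q. \<Sum>w | set w \<subseteq> Q \<and> length w = n. F (w @ [i]))"
proof -
  have "{w. set w \<subseteq> Q \<and> length w = Suc n} = (\<lambda>(i, w). w @ [i]) ` (Q \<times> {w. set w \<subseteq> Q \<and> length w = n})"
    by (auto simp: length_Suc_conv_rev)
  moreover have "inj_on (\<lambda>(i, w). w @ [i]) (Q \<times> {w. set w \<subseteq> Q \<and> length w = n})" by (auto simp: inj_on_def)
  ultimately show ?thesis by (simp add: sum.reindex sum.cartesian_product case_prod_unfold)
qed

lemmas sum_words_left = sum_lists_left[where Q = UNIV, simplified]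
  and sum_words_right = sum_lists_right[where Q = UNIV, simplified]

definition rm :: "'k::field tens \<Rightarrow> (3 \<Rightarrow> 'k) \<Rightarrow> 'k tens" where
  "rm f v = (\<lambda>w. if w = [] then 0 else f (butlast w) * v (last w))"

definition lm :: "(3 \<Rightarrow> 'k::field) \<Rightarrow> 'k tens \<Rightarrow> 'k tens" where
  "lm v f = (\<lambda>w. if w = [] then 0 else v (hd w) * f (tl w))"

lemma rm_simps [simp]: "rm f v [] = 0" "rm f v (w @ [i]) = f w * v i"
  by (simp_all add: rm_def)

lemma lm_simps [simp]: "lm v f [] = 0" "lm v f (i # w) = v i * f w"
  by (simp_all add: lm_def)

lemma rm_lin: "rm (f + g) v = rm f v + rm g v" "rm (scl c f) v = scl c (rm f v)" "rm (f - g) v = rm f v - rm g v"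
  "rm f (u + v) = rm f u + rm f v" "rm f (scl c v) = scl c (rm f v)" "rm f 0 = 0" "rm 0 v = 0"
  by (auto simp: rm_def fun_eq_iff pointwise algebra_simps)

lemma rm_sum: "rm (\<Sum>i\<in>I. f i) v = (\<Sum>i\<in>I. rm (f i) v)" "rm g (\<Sum>i\<in>I. u i) = (\<Sum>i\<in>I. rm g (u i))"
  by (induction I rule: infinite_finite_induct) (simp_all add: rm_lin)

lemma rm_tens: "f \<in> tens m \<Longrightarrow> rm f v \<in> tens (Suc m)"
  by (rule tensI) (auto simp: rm_def intro!: tensD)

text \<open>Multiplication by a linear form and contraction are adjoint, which carries statements on
  ideals to statements on functionals.\<close>

lemma pair_rm: "pair (words (Suc m)) (rm f v) t = pair (words m) f (ctr v t)"
  unfolding pair_def sum_words_right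
  by (subst sum.swap) (simp add: ctr_def sum_distrib_left mult.assoc)

lemma pair_lm: "pair (words (Suc m)) (lm v f) t = pair (words m) f (ctl v t)"
  unfolding pair_def sum_words_left
  by (subst sum.swap) (simp add: ctl_def sum_distrib_left mult_ac)

lemma tens_rm_expand: "f \<in> tens (Suc m) \<Longrightarrow> f = (\<Sum>i\<in>UNIV. rm (ctr (delta i) f) (delta i))"
proof
  fix w assume f: "f \<in> tens (Suc m)"
  show "f w = (\<Sum>i\<in>UNIV. rm (ctr (delta i) f) (delta i)) w"
  proof (cases w rule: rev_cases)
    case (snoc u j)
    have "(\<Sum>i\<in>UNIV. f (u @ [i]) * delta i j) = (\<Sum>i\<in>UNIV. if j = i then f (u @ [i]) else 0)"
      by (intro sum.cong) (auto simp: delta_def)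
    then show ?thesis using snoc by (simp add: pointwise)
  qed (use tensD[OF f, of "[]"] in \<open>simp add: pointwise\<close>)
qed

lemma sol_2: "sol 2 G = {t \<in> tens 2. \<forall>g\<in>G. (\<Sum>i\<in>UNIV. \<Sum>j\<in>UNIV. g [i, j] * t [i, j]) = 0}"
proof (intro equalityI subsetI)
  fix t assume t: "t \<in> sol 2 G"
  then show "t \<in> {t \<in> tens 2. \<forall>g\<in>G. (\<Sum>i\<in>UNIV. \<Sum>j\<in>UNIV. g [i, j] * t [i, j]) = 0}"
    using solD[OF t, of _ "[]" "[]"] sol_tens[OF t] by simp
next
  fix t assume t: "t \<in> {t \<in> tens 2. \<forall>g\<in>G. (\<Sum>i\<in>UNIV. \<Sum>j\<in>UNIV. g [i, j] * t [i, j]) = 0}"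
  show "t \<in> sol 2 G"
  proof (rule solI)
    fix g u v assume "g \<in> G"
    then show "(\<Sum>i\<in>UNIV. \<Sum>j\<in>UNIV. g [i, j] * t (u @ [i, j] @ v)) = 0"
      using t tensD[of t 2] by (cases "u = [] \<and> v = []") auto
  qed (use t in blast)
qed

lemma pair_words_2: "pair (words 2) g t = (\<Sum>i\<in>UNIV. \<Sum>j\<in>UNIV. g [i, j] * t [i, j])"
  unfolding pair_def numeral_2_eq_2 sum_words_left by simp

lemma sol_2_perp: "sol 2 G = perp (words 2) G"
  by (simp add: sol_2 perp_def pair_words_2 tens_def)

text \<open>In degree at least three every adjacent pair avoids the first slot or the last
  slot.\<close>

lemma sol_3_I:
  assumes t: "t \<in> tens (Suc (Suc (Suc n)))" and l: "\<And>i. ctl (delta i) t \<in> sol (Suc (Suc n)) G"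
    and r: "\<And>i. ctr (delta i) t \<in> sol (Suc (Suc n)) G"
  shows "t \<in> sol (Suc (Suc (Suc n))) G"
proof (rule solI)
  fix g u v assume g: "g \<in> G"
  show "(\<Sum>i\<in>UNIV. \<Sum>j\<in>UNIV. g [i, j] * t (u @ [i, j] @ v)) = 0"
  proof (cases u)
    case u: Nil
    show ?thesis
    proof (cases v rule: rev_cases)
      case Nil
      then show ?thesis using u tensD[OF t] by simp
    next
      case (snoc v' l)
      then show ?thesis using solD[OF r[of l] g, of u v'] by simp
    qed
  next
    case (Cons a u')
    then show ?thesis using solD[OF l[of a] g, of u' v] by simp
  qed
qed (rule t)

section \<open>Linear resolutions\<close>

definition vec1 :: "(3 \<Rightarrow> 'k::field) \<Rightarrow> 'k tens" where
  "vec1 v = (\<lambda>w. case w of [i] \<Rightarrow> v i | _ \<Rightarrow> 0)"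

lemma vec1_simps [simp]: "vec1 v [i] = v i" "vec1 v [] = 0"
  by (simp_all add: vec1_def)

lemma vec1_tens: "vec1 v \<in> tens (Suc 0)"
  by (rule tensI) (auto simp: vec1_def split: list.split)

lemma rm_vec1: "rm (vec1 u) v = rank1 u v"
proof
  fix w :: "3 list"
  show "rm (vec1 u) v w = rank1 u v w"
  proof (cases w rule: rev_cases)
    case (snoc x j)
    then have "rm (vec1 u) v w = vec1 u x * v j" by simp
    then show ?thesis using snoc by (cases x; cases "tl x") (auto simp: vec1_def rank1_def split: list.split)
  qed (simp add: rank1_def)
qed

text \<open>In terms of coordinates for the degree one part of a graded algebra, \<open>J m\<close> consists of the relations of
  degree \<open>m\<close>, and the differential sends the basis element \<open>b \<in> B (Suc k)\<close> to \<open>\<Sum>b'. L k b b' e\<^sub>b\<^sub>'\<close>.\<close>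

locale resolution =
  fixes J :: "nat \<Rightarrow> 'k::field tens set" and B :: "nat \<Rightarrow> nat set" and L :: "nat \<Rightarrow> nat \<Rightarrow> nat \<Rightarrow> 3 \<Rightarrow> 'k"
  assumes J_sub: "fs.subspace (J m)" and J_tens: "J m \<subseteq> tens m"
    and J_0: "J 0 = {0}" and J_1: "J (Suc 0) = {0}"
    and J_rm: "t \<in> J m \<Longrightarrow> rm t v \<in> J (Suc m)" and J_lm: "t \<in> J m \<Longrightarrow> lm v t \<in> J (Suc m)"
    and B_0: "B 0 = {0}"
    and L_supp: "L k b b' \<noteq> 0 \<Longrightarrow> b \<in> B (Suc k) \<and> b' \<in> B k"
    and complex: "(\<Sum>b | L (Suc k) c b \<noteq> 0. rank1 (L (Suc k) c b) (L k b b')) \<in> J 2"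
    and exact_0: "t \<in> tens (Suc m) \<Longrightarrow>
      \<exists>S g. finite S \<and> S \<subseteq> B (Suc 0) \<and> (\<forall>c. g c \<in> tens m) \<and> t - (\<Sum>c\<in>S. rm (g c) (L 0 c 0)) \<in> J (Suc m)"
    and inject: "finite S \<Longrightarrow> S \<subseteq> B (Suc k) \<Longrightarrow> (\<And>b'. (\<Sum>b\<in>S. scl (u b) (L k b b')) = 0) \<Longrightarrow> b \<in> S \<Longrightarrow> u b = 0"
    and exact: "finite S \<Longrightarrow> S \<subseteq> B (Suc k) \<Longrightarrow> (\<And>b. f b \<in> tens (Suc m)) \<Longrightarrow> (\<And>b. b \<notin> S \<Longrightarrow> f b = 0) \<Longrightarrow>
      (\<And>b'. (\<Sum>b\<in>S. rm (f b) (L k b b')) \<in> J (Suc (Suc m))) \<Longrightarrow>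
      \<exists>T g. finite T \<and> T \<subseteq> B (Suc (Suc k)) \<and> (\<forall>c. g c \<in> tens m) \<and>
        (\<forall>b. f b - (\<Sum>c\<in>T. rm (g c) (L (Suc k) c b)) \<in> J (Suc m))"
begin

text \<open>Scalar combinations of the basis inject under the differential into families of linear
  forms indexed by the previous basis, so the rank grows by a factor of at most three.\<close>

lemma finite_B: "finite (B k)"
proof (induction k)
  case 0
  then show ?case by (simp add: B_0)
next
  case (Suc k)
  let ?Y = "(UNIV :: 3 set) \<times> B k"
  have "card S \<le> card ?Y" if S: "S \<subseteq> B (Suc k)" "finite S" for S
  proof -
    let ?F = "\<lambda>u (i, b'). \<Sum>b\<in>S. u b * L k b b' i"
    have lin: "lin ?F"
      by (rule linI) (auto simp: fun_eq_iff pointwise distrib_right sum.distrib sum_distrib_left mult.assoc)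
    have "fs.dim (supp_on S :: (nat \<Rightarrow> 'k) set) = fs.dim (?F ` supp_on S)"
    proof (rule dim_inj_image[OF lin subspace_supp_on fin_dim_supp_on[OF S(2)], symmetric])
      fix u :: "nat \<Rightarrow> 'k" assume u: "u \<in> supp_on S" "?F u = 0"
      have "(\<Sum>b\<in>S. scl (u b) (L k b b')) = 0" for b'
      proof
        fix i show "(\<Sum>b\<in>S. scl (u b) (L k b b')) i = 0 i"
          using fun_cong[OF u(2), of "(i, b')"] by (simp add: pointwise)
      qed
      then have "u b = 0" if "b \<in> S" for b using inject[OF S(2,1)] that by blast
      then show "u = 0" using u(1) by (auto simp: supp_on_def fun_eq_iff pointwise)
    qed
    also have "\<dots> \<le> fs.dim (supp_on ?Y :: (3 \<times> nat \<Rightarrow> 'k) set)"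
    proof (rule dim_subset[OF _ fin_dim_supp_on])
      have "L k b b' = 0" if "b' \<notin> B k" for b b' using L_supp that by blast
      then show "?F ` supp_on S \<subseteq> supp_on ?Y" by (auto simp: supp_on_def pointwise)
    qed (use Suc in simp)
    finally show ?thesis using S(2) Suc by (simp add: dim_supp_on)
  qed
  then show ?case using finite_if_finite_subsets_card_bdd by blast
qed

lemma L_0: "b \<notin> B (Suc k) \<Longrightarrow> L k b b' = 0" "b' \<notin> B k \<Longrightarrow> L k b b' = 0"
  using L_supp by blast+

lemma complex_B: "(\<Sum>b\<in>B (Suc k). rank1 (L (Suc k) c b) (L k b b')) \<in> J 2"
proof -
  have "(\<Sum>b | L (Suc k) c b \<noteq> 0. rank1 (L (Suc k) c b) (L k b b')) = (\<Sum>b\<in>B (Suc k). rank1 (L (Suc k) c b) (L k b b'))"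
    by (rule sum.mono_neutral_left[OF finite_B]) (auto simp: rank1_eq_0 L_0 dest: L_supp)
  then show ?thesis using complex[of k c b'] by simp
qed

lemma inject_B:
  assumes "u \<in> supp_on (B (Suc k))" "\<And>b'. (\<Sum>b\<in>B (Suc k). scl (u b) (L k b b')) = 0"
  shows "u = 0"
proof -
  have "u b = 0" if "b \<in> B (Suc k)" for b by (rule inject[OF finite_B subset_refl assms(2) that])
  then show ?thesis using assms(1) by (auto simp: supp_on_def fun_eq_iff zero_fun_apply)
qed

lemma sum_B_extend:
  assumes "finite T" "T \<subseteq> B (Suc k)"
  shows "(\<Sum>c\<in>T. rm (g c) (L k c b)) = (\<Sum>c\<in>B (Suc k). rm (if c \<in> T then g c else 0) (L k c b))"
proof -
  have "(\<Sum>c\<in>B (Suc k). rm (if c \<in> T then g c else 0) (L k c b)) = (\<Sum>c\<in>T. rm (if c \<in> T then g c else 0) (L k c b))"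
    by (rule sum.mono_neutral_right[OF finite_B assms(2)]) (auto simp: rm_lin)
  then show ?thesis by simp
qed

lemma exact_B:
  assumes "\<And>b. f b \<in> tens (Suc m)" "\<And>b. b \<notin> B (Suc k) \<Longrightarrow> f b = 0"
    "\<And>b'. (\<Sum>b\<in>B (Suc k). rm (f b) (L k b b')) \<in> J (Suc (Suc m))"
  obtains g where "\<And>c. g c \<in> tens m" "\<And>c. c \<notin> B (Suc (Suc k)) \<Longrightarrow> g c = 0"
    "\<And>b. f b - (\<Sum>c\<in>B (Suc (Suc k)). rm (g c) (L (Suc k) c b)) \<in> J (Suc m)"
proof -
  obtain T g where g: "finite T" "T \<subseteq> B (Suc (Suc k))" "\<And>c. g c \<in> tens m"
    "\<And>b. f b - (\<Sum>c\<in>T. rm (g c) (L (Suc k) c b)) \<in> J (Suc m)"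
    using exact[OF finite_B subset_refl assms] by blast
  let ?g = "\<lambda>c. if c \<in> T then g c else 0"
  show thesis
  proof (rule that)
    show "?g c \<in> tens m" for c using g(3) by (simp add: tens_def supp_on_def zero_fun_apply)
    show "c \<notin> B (Suc (Suc k)) \<Longrightarrow> ?g c = 0" for c using g(2) by auto
    show "f b - (\<Sum>c\<in>B (Suc (Suc k)). rm (?g c) (L (Suc k) c b)) \<in> J (Suc m)" for b
      using g(4)[of b] unfolding sum_B_extend[OF g(1,2)] .
  qed
qed

lemma exact_0_B:
  assumes "f \<in> tens (Suc m)"
  obtains g where "\<And>c. g c \<in> tens m" "\<And>c. c \<notin> B (Suc 0) \<Longrightarrow> g c = 0"
    "f - (\<Sum>c\<in>B (Suc 0). rm (g c) (L 0 c 0)) \<in> J (Suc m)"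
proof -
  obtain T g where g: "finite T" "T \<subseteq> B (Suc 0)" "\<And>c. g c \<in> tens m"
    "f - (\<Sum>c\<in>T. rm (g c) (L 0 c 0)) \<in> J (Suc m)"
    using exact_0[OF assms] by blast
  let ?g = "\<lambda>c. if c \<in> T then g c else 0"
  show thesis
  proof (rule that)
    show "?g c \<in> tens m" for c using g(3) by (simp add: tens_def supp_on_def zero_fun_apply)
    show "c \<notin> B (Suc 0) \<Longrightarrow> ?g c = 0" for c using g(2) by auto
    show "f - (\<Sum>c\<in>B (Suc 0). rm (?g c) (L 0 c 0)) \<in> J (Suc m)"
      using g(4) unfolding sum_B_extend[OF g(1,2)] .
  qed
qed

lemma perp_J: "perp (words m) (perp (words m) (J m)) = J m"
  by (rule perp_perp[OF finite_words J_sub]) (use J_tens in \<open>simp add: tens_def\<close>)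

lemma J2_I:
  assumes "r \<in> tens 2" "\<And>g. g \<in> sol 2 (J 2) \<Longrightarrow> (\<Sum>i\<in>UNIV. \<Sum>j\<in>UNIV. g [i, j] * r [i, j]) = 0"
  shows "r \<in> J 2"
proof -
  have "r \<in> perp (words 2) (sol 2 (J 2))" using assms by (simp add: perp_def pair_words_2 tens_def)
  then show ?thesis by (simp add: sol_2_perp perp_J)
qed

subsection \<open>The ranks of the free modules\<close>

definition trans :: "nat \<Rightarrow> (nat \<Rightarrow> 'k) \<Rightarrow> 3 \<Rightarrow> nat \<Rightarrow> 'k" where
  "trans k u i = (\<lambda>b'. \<Sum>b\<in>B (Suc k). u b * L k b b' i)"

text \<open>Applies all differentials in turn to a combination \<open>u\<close> of basis elements
  and records the products of linear forms along all paths. This places the span of the basis of the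
  \<open>k\<close>-th module inside the tensors of degree \<open>k\<close>.\<close>

primrec io :: "nat \<Rightarrow> (nat \<Rightarrow> 'k) \<Rightarrow> 'k tens" where
  "io 0 u = (\<lambda>w. if w = [] then u 0 else 0)"
| "io (Suc k) u = (\<lambda>w. case w of [] \<Rightarrow> 0 | i # w' \<Rightarrow> io k (trans k u i) w')"

lemma trans_supp: "trans k u i \<in> supp_on (B k)"
  by (auto simp: supp_on_def trans_def L_0 zero_fun_apply)

lemma trans_lin: "trans k (u + v) i = trans k u i + trans k v i" "trans k (scl c u) i = scl c (trans k u i)"
  by (auto simp: trans_def fun_eq_iff pointwise distrib_right sum.distrib sum_distrib_left mult.assoc)

lemma io_lin: "lin (io k)"
proof -
  have "io k (u + v) = io k u + io k v \<and> io k (scl c u) = scl c (io k u)" for u v c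
    by (induction k arbitrary: u v) (auto simp: fun_eq_iff pointwise trans_lin split: list.split)
  then show ?thesis by (intro linI) blast+
qed

lemma io_tens: "io k u \<in> tens k"
proof (induction k arbitrary: u)
  case (Suc k)
  show ?case
  proof (rule tensI)
    fix w :: "3 list" assume "length w \<noteq> Suc k"
    then show "io (Suc k) u w = 0" using tensD[OF Suc.IH] by (cases w) auto
  qed
qed (simp add: tens_def supp_on_def)

lemma io_ctl: "ctl (delta i) (io (Suc k) u) = io k (trans k u i)"
  by (simp add: fun_eq_iff)

lemma io_inj: "u \<in> supp_on (B k) \<Longrightarrow> io k u = 0 \<Longrightarrow> u = 0"
proof (induction k arbitrary: u)
  case 0
  have "u 0 = 0" using fun_cong[OF 0(2), of "[]"] by (simp add: zero_fun_apply)
  then have "u b = 0" for b using 0(1) by (cases "b = 0") (auto simp: B_0 supp_on_def)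
  then show ?case by (simp add: fun_eq_iff zero_fun_apply)
next
  case (Suc k)
  have "trans k u i = 0" for i
  proof (rule Suc.IH[OF trans_supp])
    show "io k (trans k u i) = 0" unfolding io_ctl[symmetric] Suc.prems(2) by (rule lin_simps(3)[OF ctl_lin])
  qed
  then have "(\<Sum>b\<in>B (Suc k). scl (u b) (L k b b')) = 0" for b'
    by (simp add: trans_def fun_eq_iff pointwise)
  then show ?case by (rule inject_B[OF Suc.prems(1)])
qed

lemma trans_trans: "trans k (trans (Suc k) u i) j b' =
   (\<Sum>c\<in>B (Suc (Suc k)). u c * (\<Sum>b\<in>B (Suc k). rank1 (L (Suc k) c b) (L k b b')) [i, j])"
proof -
  have "trans k (trans (Suc k) u i) j b' = (\<Sum>b\<in>B (Suc k). \<Sum>c\<in>B (Suc (Suc k)). u c * (L (Suc k) c b i * L k b b' j))"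
    by (simp add: trans_def sum_distrib_right mult.assoc)
  also have "\<dots> = (\<Sum>c\<in>B (Suc (Suc k)). \<Sum>b\<in>B (Suc k). u c * (L (Suc k) c b i * L k b b' j))" by (rule sum.swap)
  finally show ?thesis by (simp add: sum_distrib_left sum_fun_apply)
qed

lemma io_sum_trans:
  "(\<Sum>i\<in>UNIV. \<Sum>j\<in>UNIV. G i j * io k (h i j) w) = io k (\<lambda>b. \<Sum>i\<in>UNIV. \<Sum>j\<in>UNIV. G i j * h i j b) w"
proof -
  have "(\<lambda>b. \<Sum>i\<in>UNIV. \<Sum>j\<in>UNIV. G i j * h i j b) = (\<Sum>i\<in>UNIV. \<Sum>j\<in>UNIV. scl (G i j) (h i j))"
    by (simp add: fun_eq_iff pointwise)
  then show ?thesis by (simp add: lin_simps(6)[OF io_lin] lin_simps(2)[OF io_lin] pointwise)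
qed

text \<open>The right side consists of the tensors whose adjacent slices are all relations. It
  contains the image because consecutive differentials compose to zero. Conversely, the contractions
  of such a tensor are known by induction, and exactness with coefficients of degree one assembles
  them into a combination of basis elements.\<close>

lemma io_image: "io k ` supp_on (B k) = sol k (sol 2 (J 2))"
proof (induction k rule: nat_less_induct)
  case (1 k)
  note IH = this
  let ?W = "sol 2 (J 2)"
  consider "k = 0" | "k = Suc 0" | m where "k = Suc (Suc m)" by (metis not0_implies_Suc)
  then show ?case
  proof cases
    case 1
    have "t \<in> io 0 ` supp_on (B 0)" if t: "t \<in> tens 0" for t
    proof (rule image_eqI)
      show "t = io 0 (\<lambda>b. if b = 0 then t [] else 0)" using tensD[OF t] by (auto simp: fun_eq_iff)
    qed (simp add: B_0 supp_on_def)
    then show ?thesis using 1 io_tens by (auto simp: sol_small simp del: io.simps)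
  next
    case 2
    have "t \<in> io (Suc 0) ` supp_on (B (Suc 0))" if t: "t \<in> tens (Suc 0)" for t
    proof -
      obtain g where g: "\<And>c. g c \<in> tens 0" "\<And>c. c \<notin> B (Suc 0) \<Longrightarrow> g c = 0"
        "t - (\<Sum>c\<in>B (Suc 0). rm (g c) (L 0 c 0)) \<in> J (Suc 0)" using exact_0_B[OF t] by blast
      then have tg: "t = (\<Sum>c\<in>B (Suc 0). rm (g c) (L 0 c 0))" by (simp add: J_1)
      let ?u = "\<lambda>c. g c []"
      have "t = io (Suc 0) ?u"
      proof (rule tens_eqI[OF t io_tens])
        fix i
        have "t (i # w) = io 0 (trans 0 ?u i) w" for w
        proof (cases w)
          case Nil
          have "rm (g c) v [i] = g c [] * v i" for c v using rm_simps(2)[of "g c" v "[]" i] by simp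
          then show ?thesis using Nil by (simp add: tg sum_fun_apply trans_def)
        next
          case (Cons a v)
          then show ?thesis using tensD[OF t, of "i # a # v"] by simp
        qed
        then show "ctl (delta i) t = ctl (delta i) (io (Suc 0) ?u)" by (simp add: fun_eq_iff)
      qed
      moreover have "?u \<in> supp_on (B (Suc 0))" using g(2) by (simp add: supp_on_def zero_fun_apply)
      ultimately show ?thesis by (rule image_eqI)
    qed
    then show ?thesis using 2 io_tens[of "Suc 0"] by (auto simp: sol_small simp del: io.simps)
  next
    case (3 m)
    have IH1: "io (Suc m) ` supp_on (B (Suc m)) = sol (Suc m) ?W" using IH 3 by (simp del: io.simps)
    have "io k u \<in> sol k ?W" for u unfolding 3
    proof (rule sol_Suc_I[OF io_tens])
      show "ctl (delta i) (io (Suc (Suc m)) u) \<in> sol (Suc m) ?W" for i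
        unfolding io_ctl IH1[symmetric] by (rule imageI[OF trans_supp])
      fix w :: "3 list" assume w: "length w = m"
      show "(\<lambda>l. io (Suc (Suc m)) u (l @ w)) \<in> sol 2 ?W"
        unfolding sol_2[of ?W]
      proof (intro CollectI conjI ballI)
        show "(\<lambda>l. io (Suc (Suc m)) u (l @ w)) \<in> tens 2"
          using w by (intro tensI tensD[OF io_tens]) simp
        fix g assume g: "g \<in> ?W"
        have "(\<Sum>i\<in>UNIV. \<Sum>j\<in>UNIV. g [i, j] * trans m (trans (Suc m) u i) j b) = 0" for b
        proof -
          have "(\<Sum>i\<in>UNIV. \<Sum>j\<in>UNIV. g [i, j] * trans m (trans (Suc m) u i) j b)
            = (\<Sum>c\<in>B (Suc (Suc m)). u c * (\<Sum>i\<in>UNIV. \<Sum>j\<in>UNIV. (\<Sum>b'\<in>B (Suc m). rank1 (L (Suc m) c b') (L m b' b)) [i, j] * g [i, j]))"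
            unfolding trans_trans sum_distrib_left
            unfolding sum.swap[where A = UNIV and B = "B (Suc (Suc m))"] by (intro sum.cong refl) (simp only: mult_ac)
          also have "\<dots> = 0"
            using g complex_B by (intro sum.neutral) (auto simp: sol_2)
          finally show ?thesis .
        qed
        then have "(\<lambda>b. \<Sum>i\<in>UNIV. \<Sum>j\<in>UNIV. g [i, j] * trans m (trans (Suc m) u i) j b) = 0" by (simp add: fun_eq_iff zero_fun_apply)
        then have "(\<Sum>i\<in>UNIV. \<Sum>j\<in>UNIV. g [i, j] * io m (trans m (trans (Suc m) u i) j) w) = 0"
          unfolding io_sum_trans by (simp add: lin_simps(3)[OF io_lin] zero_fun_apply)
        then show "(\<Sum>i\<in>UNIV. \<Sum>j\<in>UNIV. g [i, j] * io (Suc (Suc m)) u ([i, j] @ w)) = 0" by simp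
      qed
    qed
    moreover have "t \<in> io k ` supp_on (B k)" if t: "t \<in> sol (Suc (Suc m)) ?W" for t
    proof -
      have "\<exists>u. u \<in> supp_on (B (Suc m)) \<and> ctl (delta i) t = io (Suc m) u" for i
        using ctl_sol[OF t, of "delta i"] unfolding IH1[symmetric] by blast
      then obtain u where u: "\<And>i. u i \<in> supp_on (B (Suc m))" "\<And>i. ctl (delta i) t = io (Suc m) (u i)" by metis
      have tu: "t (i # j # w) = io m (trans m (u i) j) w" for i j w
        using fun_cong[OF u(2)[of i], of "j # w"] unfolding ctl_delta io.simps list.case .
      \<comment> \<open>The coordinates of the first contractions, collected over the first index,
        are the degree one coefficients of a cycle.\<close>
      let ?f = "\<lambda>b. vec1 (\<lambda>i. u i b)"
      have f0: "?f b = 0" if "b \<notin> B (Suc m)" for b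
        using u(1) that by (auto simp: vec1_def fun_eq_iff supp_on_def zero_fun_apply split: list.split)
      have "(\<Sum>b\<in>B (Suc m). rm (?f b) (L m b b')) \<in> J 2" for b'
      proof (rule J2_I)
        have "(\<Sum>b\<in>B (Suc m). rank1 (\<lambda>i. u i b) (L m b b')) \<in> tens 2"
          unfolding tens_def by (intro fs.subspace_sum[OF subspace_supp_on]) (use rank1_tens in \<open>simp add: tens_def\<close>)
        then show "(\<Sum>b\<in>B (Suc m). rm (?f b) (L m b b')) \<in> tens 2" by (simp add: rm_vec1)
        fix g assume g: "g \<in> ?W"
        let ?h = "\<lambda>b. \<Sum>i\<in>UNIV. \<Sum>j\<in>UNIV. g [i, j] * trans m (u i) j b"
        have "?h = 0"
        proof (rule io_inj)
          show "?h \<in> supp_on (B m)" using trans_supp by (auto simp: supp_on_def)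
          have "io m ?h w = 0" for w
            unfolding io_sum_trans[symmetric] tu[symmetric] using solD[OF t g, of "[]" w] by simp
          then show "io m ?h = 0" by (simp add: fun_eq_iff zero_fun_apply)
        qed
        then have "?h b' = 0 b'" by (rule fun_cong)
        then have "?h b' = 0" by (simp only: zero_fun_apply)
        then show "(\<Sum>i\<in>UNIV. \<Sum>j\<in>UNIV. g [i, j] * (\<Sum>b\<in>B (Suc m). rm (?f b) (L m b b')) [i, j]) = 0"
          by (simp add: rm_vec1 sum_fun_apply trans_def)
      qed
      then obtain g where g: "\<And>c. g c \<in> tens 0" "\<And>c. c \<notin> B (Suc (Suc m)) \<Longrightarrow> g c = 0"
        "\<And>b. ?f b - (\<Sum>c\<in>B (Suc (Suc m)). rm (g c) (L (Suc m) c b)) \<in> J (Suc 0)"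
        using exact_B[of ?f 0 m, OF vec1_tens f0] unfolding numeral_2_eq_2 by blast
      let ?u = "\<lambda>c. g c []"
      have "trans (Suc m) ?u i = u i" for i
      proof
        fix b
        have e: "?f b = (\<Sum>c\<in>B (Suc (Suc m)). rm (g c) (L (Suc m) c b))"
          using g(3)[of b] by (simp add: J_1)
        have "u i b = (\<Sum>c\<in>B (Suc (Suc m)). rm (g c) (L (Suc m) c b)) [i]"
          using fun_cong[OF e, of "[i]"] by simp
        moreover have "rm (g c) v [i] = g c [] * v i" for c v using rm_simps(2)[of "g c" v "[]" i] by simp
        ultimately show "trans (Suc m) ?u i b = u i b" by (simp add: trans_def sum_fun_apply)
      qed
      then have "t = io k ?u" unfolding 3
        by (intro tens_eqI[OF sol_tens[OF t] io_tens]) (simp only: io_ctl u(2))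
      moreover have "?u \<in> supp_on (B k)" using g(2) 3 by (simp add: supp_on_def zero_fun_apply)
      ultimately show ?thesis by (rule image_eqI)
    qed
    ultimately show ?thesis using 3 by blast
  qed
qed

lemma card_B: "fs.dim (sol k (sol 2 (J 2))) = card (B k)"
  unfolding io_image[symmetric]
  using dim_inj_image[OF io_lin subspace_supp_on fin_dim_supp_on[OF finite_B] io_inj] by (simp add: dim_supp_on finite_B)

subsection \<open>Relations are generated in degree two\<close>

text \<open>The easy inclusion: an ideal contains all multiples of its part of degree two.\<close>

lemma perp_J_sub: "t \<in> perp (words m) (J m) \<Longrightarrow> t \<in> sol m (J 2)"
proof (induction m arbitrary: t)
  case 0
  then show ?case by (simp add: sol_small perp_def tens_def)
next
  case (Suc m)
  have t: "t \<in> tens (Suc m)" using Suc.prems by (simp add: perp_def tens_def)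
  consider "m = 0" | "m = Suc 0" | l where "m = Suc (Suc l)" by (metis not0_implies_Suc)
  then show ?case
  proof cases
    case 1
    then show ?thesis using t by (simp add: sol_small)
  next
    case 2
    then show ?thesis using Suc.prems sol_2_perp[of "J 2"] by (simp add: numeral_2_eq_2)
  next
    case (3 l)
    show ?thesis unfolding 3
    proof (rule sol_3_I)
      show "t \<in> tens (Suc (Suc (Suc l)))" using t 3 by simp
      have l: "ctl v t \<in> perp (words m) (J m)" and r: "ctr v t \<in> perp (words m) (J m)" for v
        using Suc.prems J_lm[of _ m v] J_rm[of _ m v] ctl_tens[OF t] ctr_tens[OF t]
        by (auto simp: perp_def tens_def simp flip: pair_lm pair_rm)
      show "ctl (delta i) t \<in> sol (Suc (Suc l)) (J 2)" "ctr (delta i) t \<in> sol (Suc (Suc l)) (J 2)" for i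
        using Suc.IH l r 3 by blast+
    qed
  qed
qed

text \<open>The composite of two differentials is a relation of degree two, which the last two slots
  of \<open>t\<close> annihilate.\<close>

lemma relation_ctr:
  assumes "t \<in> sol m (J 2)"
  shows "(\<Sum>b\<in>B (Suc k). ctr (L (Suc k) c b) (ctr (L k b b') t)) = 0"
proof
  fix w
  have "(\<Sum>b\<in>B (Suc k). ctr (L (Suc k) c b) (ctr (L k b b') t)) w
    = (\<Sum>i\<in>UNIV. \<Sum>j\<in>UNIV. (\<Sum>b\<in>B (Suc k). rank1 (L (Suc k) c b) (L k b b')) [i, j] * t (w @ [i, j] @ []))"
    unfolding sum_fun_apply ctr_def sum_distrib_right sum_distrib_left
    by (subst sum.swap, rule sum.cong[OF refl], subst sum.swap) (simp add: mult.assoc)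
  also have "\<dots> = 0" by (rule solD[OF assms complex_B])
  finally show "(\<Sum>b\<in>B (Suc k). ctr (L (Suc k) c b) (ctr (L k b b') t)) w = 0 w" by (simp add: zero_fun_apply)
qed

text \<open>Exactness at the first module shows that degree two generates. An element
  \<open>f\<close> of the ideal is a sum of \<open>F b\<close> times a linear form, and modulo
  relations of lower degree \<open>F b\<close> comes from the second differential; so the pairing
  with \<open>t\<close> reduces to a composite of two differentials.\<close>

lemma sol_sub_perp_J: "t \<in> sol m (J 2) \<Longrightarrow> t \<in> perp (words m) (J m)"
proof (induction m arbitrary: t)
  case 0
  then show ?case using sol_tens[OF 0] by (simp add: perp_def tens_def J_0 pair_lin)
next
  case (Suc m)
  have "pair (words (Suc m)) f t = 0" if f: "f \<in> J (Suc m)" for f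
  proof (cases m)
    case 0
    then show ?thesis using f by (simp add: J_1 pair_lin)
  next
    case (Suc m')
    have fT: "f \<in> tens (Suc m)" using f J_tens by blast
    \<comment> \<open>The forms \<open>L 0 b 0\<close> span degree one, so the unit vectors are
      combinations of them.\<close>
    have "\<exists>a. (\<forall>c. c \<notin> B (Suc 0) \<longrightarrow> a c = 0) \<and> delta i = (\<Sum>b\<in>B (Suc 0). scl (a b) (L 0 b 0))" for i
    proof -
      obtain g where g: "\<And>c. c \<notin> B (Suc 0) \<Longrightarrow> g c = 0"
        "vec1 (delta i) - (\<Sum>c\<in>B (Suc 0). rm (g c) (L 0 c 0)) \<in> J (Suc 0)"
        by (rule exact_0_B[OF vec1_tens[of "delta i"]]) (rule that)
      then have e: "vec1 (delta i) = (\<Sum>c\<in>B (Suc 0). rm (g c) (L 0 c 0))" by (simp add: J_1)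
      have "rm (g c) v [j] = g c [] * v j" for c v j using rm_simps(2)[of "g c" v "[]" j] by simp
      then have "delta i j = (\<Sum>b\<in>B (Suc 0). scl (g b []) (L 0 b 0)) j" for j
        using fun_cong[OF e, of "[j]"] by (simp add: pointwise)
      then show ?thesis using g(1) by (intro exI[of _ "\<lambda>b. g b []"]) (auto simp: zero_fun_apply)
    qed
    then obtain a where a: "\<And>i c. c \<notin> B (Suc 0) \<Longrightarrow> a i c = 0" "\<And>i. delta i = (\<Sum>b\<in>B (Suc 0). scl (a i b) (L 0 b 0))"
      by metis
    define F where "F b = (\<Sum>i\<in>UNIV. scl (a i b) (ctr (delta i) f))" for b
    have F_t: "F b \<in> tens (Suc m')" for b
      unfolding F_def tens_def
      by (intro fs.subspace_sum[OF subspace_supp_on] fs.subspace_scale[OF subspace_supp_on])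
        (use ctr_tens[OF fT] Suc in \<open>simp add: tens_def\<close>)
    have F0: "F b = 0" if "b \<notin> B (Suc 0)" for b
      using a(1)[OF that] by (simp add: F_def fun_eq_iff pointwise)
    have f_eq: "f = (\<Sum>b\<in>B (Suc 0). rm (F b) (L 0 b 0))"
    proof -
      have "f = (\<Sum>i\<in>UNIV. rm (ctr (delta i) f) (\<Sum>b\<in>B (Suc 0). scl (a i b) (L 0 b 0)))"
        unfolding a(2)[symmetric] by (rule tens_rm_expand[OF fT])
      also have "\<dots> = (\<Sum>i\<in>UNIV. \<Sum>b\<in>B (Suc 0). rm (scl (a i b) (ctr (delta i) f)) (L 0 b 0))"
        by (simp add: rm_sum rm_lin)
      also have "\<dots> = (\<Sum>b\<in>B (Suc 0). rm (F b) (L 0 b 0))"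
        by (subst sum.swap) (simp add: F_def rm_sum)
      finally show ?thesis .
    qed
    have "(\<Sum>b\<in>B (Suc 0). rm (F b) (L 0 b b')) \<in> J (Suc (Suc m'))" for b'
    proof (cases "b' = 0")
      case True
      then show ?thesis using f f_eq Suc by simp
    next
      case False
      then have "L 0 b b' = 0" for b by (simp add: L_0 B_0)
      then show ?thesis using fs.subspace_0[OF J_sub] by (simp add: rm_lin)
    qed
    then obtain g where g: "\<And>c. g c \<in> tens m'"
      "\<And>b. F b - (\<Sum>c\<in>B (Suc (Suc 0)). rm (g c) (L (Suc 0) c b)) \<in> J (Suc m')"
      using exact_B[of F m' 0] F_t F0 by metis
    have ctr_t: "ctr v t \<in> sol m (J 2)" for v by (rule ctr_sol[OF Suc.prems])
    have "pair (words m) (F b) (ctr (L 0 b 0) t)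
        = (\<Sum>c\<in>B (Suc (Suc 0)). pair (words m') (g c) (ctr (L (Suc 0) c b) (ctr (L 0 b 0) t)))" for b
    proof -
      have "pair (words m) (F b - (\<Sum>c\<in>B (Suc (Suc 0)). rm (g c) (L (Suc 0) c b))) (ctr (L 0 b 0) t) = 0"
        using Suc.IH[OF ctr_t] g(2)[of b] Suc by (simp add: perp_def)
      then show ?thesis by (simp add: pair_lin pair_sum Suc pair_rm)
    qed
    then have "pair (words (Suc m)) f t
        = (\<Sum>b\<in>B (Suc 0). \<Sum>c\<in>B (Suc (Suc 0)). pair (words m') (g c) (ctr (L (Suc 0) c b) (ctr (L 0 b 0) t)))"
      using f_eq by (metis (no_types, lifting) pair_rm pair_sum(1) sum.cong)
    also have "\<dots> = (\<Sum>c\<in>B (Suc (Suc 0)). pair (words m') (g c) (\<Sum>b\<in>B (Suc 0). ctr (L (Suc 0) c b) (ctr (L 0 b 0) t)))"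
      by (subst sum.swap) (simp add: pair_sum)
    also have "\<dots> = 0" by (simp add: relation_ctr[OF Suc.prems[unfolded Suc]] pair_lin)
    finally show ?thesis .
  qed
  then show ?case using sol_tens[OF Suc.prems] by (simp add: perp_def tens_def)
qed

lemma perp_J_eq: "perp (words m) (J m) = sol m (J 2)"
  using perp_J_sub sol_sub_perp_J by blast

lemma J_eq: "J m = perp (words m) (sol m (J 2))"
  using perp_J perp_J_eq by metis

end

subsection \<open>The Euler characteristic of a strand\<close>

lemma tens_sum: "(\<And>i. i \<in> I \<Longrightarrow> f i \<in> tens n) \<Longrightarrow> (\<Sum>i\<in>I. f i) \<in> tens n"
  unfolding tens_def by (rule fs.subspace_sum[OF subspace_supp_on])

lemma alternating_telescope:
  fixes e :: "nat \<Rightarrow> nat"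
  assumes "\<And>k. k \<le> n \<Longrightarrow> e k = r k + r (Suc k)" "r 0 = 0"
  shows "(\<Sum>k\<le>n. (- 1) ^ k * int (e k)) = (- 1) ^ n * int (r (Suc n))"
  using assms(1)
proof (induction n)
  case 0
  then show ?case using assms(2) by simp
next
  case (Suc n)
  have IH: "(\<Sum>k\<le>n. (- 1) ^ k * int (e k)) = (- 1) ^ n * int (r (Suc n))" using Suc by simp
  show ?case using Suc.prems[of "Suc n"] unfolding sum.atMost_Suc IH by (simp add: algebra_simps)
qed

context resolution
begin

text \<open>Coefficients of degree \<open>m\<close> on the basis of the \<open>k\<close>-th module;
  the internal degree is k + m.\<close>

definition strand :: "nat \<Rightarrow> nat \<Rightarrow> (nat \<times> 3 list \<Rightarrow> 'k) set" where
  "strand k m = supp_on (B k \<times> words m)"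

definition coef :: "(nat \<times> 3 list \<Rightarrow> 'k) \<Rightarrow> nat \<Rightarrow> 'k tens" where
  "coef x b = (\<lambda>w. x (b, w))"

definition diff :: "nat \<Rightarrow> (nat \<times> 3 list \<Rightarrow> 'k) \<Rightarrow> (nat \<times> 3 list \<Rightarrow> 'k)" where
  "diff k x = (\<lambda>(b', w). (\<Sum>b\<in>B (Suc k). rm (coef x b) (L k b b')) w)"

lemma coef_lin: "coef (x + y) b = coef x b + coef y b" "coef (scl c x) b = scl c (coef x b)" "coef 0 b = 0"
  by (simp_all add: coef_def fun_eq_iff pointwise)

lemma coef_diff: "coef (diff k x) b' = (\<Sum>b\<in>B (Suc k). rm (coef x b) (L k b b'))"
  by (simp add: coef_def[where x = "diff k x"]) (simp add: diff_def)

lemma strand_iff: "x \<in> strand k m \<longleftrightarrow> (\<forall>b. coef x b \<in> tens m) \<and> (\<forall>b. b \<notin> B k \<longrightarrow> coef x b = 0)"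
  by (auto simp: strand_def supp_on_def tens_def coef_def fun_eq_iff zero_fun_apply)

lemma diff_strand: "x \<in> strand (Suc k) m \<Longrightarrow> diff k x \<in> strand k (Suc m)"
  unfolding strand_iff coef_diff
  by (auto simp: L_0 rm_lin intro!: tens_sum rm_tens)

lemma diff_lin: "lin (diff k)"
proof (rule linI)
  fix x y :: "nat \<times> 3 list \<Rightarrow> 'k" and c
  have "coef (diff k (x + y)) = coef (diff k x + diff k y)"
    by (rule ext) (simp add: coef_lin coef_diff rm_lin sum.distrib)
  then show "diff k (x + y) = diff k x + diff k y" by (simp add: coef_def fun_eq_iff)
  have "coef (diff k (scl c x)) = coef (scl c (diff k x))"
    by (rule ext) (simp add: coef_lin coef_diff rm_lin fs.scale_sum_right)
  then show "diff k (scl c x) = scl c (diff k x)" by (simp add: coef_def fun_eq_iff)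
qed

context
  fixes A :: "nat \<Rightarrow> 'k tens set"
  assumes A: "\<And>m. finite (A m)" "\<And>m. fs.independent (A m)" "\<And>m. fs.span (A m) = sol m (J 2)"
begin

lemma A_sub: "A m \<subseteq> supp_on (words m)"
  using fs.span_superset[of "A m"] A(3)[of m] sol_tens unfolding tens_def by blast

lemma A_J: "t \<in> tens m \<Longrightarrow> (\<forall>a\<in>A m. pair (words m) a t = 0) \<longleftrightarrow> t \<in> J m"
  using J_eq[of m] perp_span[of "words m" "A m"] A(3)[of m] by (auto simp: perp_def tens_def)

text \<open>Passage to the quotient by the relations: pairing with a basis of the annihilator of
  \<open>J m\<close> gives coordinates there.\<close>

definition proj :: "nat \<Rightarrow> nat \<Rightarrow> (nat \<times> 3 list \<Rightarrow> 'k) \<Rightarrow> nat \<times> 'k tens \<Rightarrow> 'k" where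
  "proj k m x = (\<lambda>(b, a). if b \<in> B k \<and> a \<in> A m then pair (words m) a (coef x b) else 0)"

lemma proj_lin: "lin (proj k m)"
  by (rule linI) (auto simp: proj_def fun_eq_iff pointwise coef_lin pair_lin)

lemma proj_0: "x \<in> strand k m \<Longrightarrow> proj k m x = 0 \<longleftrightarrow> (\<forall>b. coef x b \<in> J m)"
proof -
  assume x: "x \<in> strand k m"
  have "proj k m x = 0 \<longleftrightarrow> (\<forall>b\<in>B k. \<forall>a\<in>A m. pair (words m) a (coef x b) = 0)"
    by (auto simp: proj_def fun_eq_iff zero_fun_apply)
  also have "\<dots> \<longleftrightarrow> (\<forall>b\<in>B k. coef x b \<in> J m)" using A_J x by (simp add: strand_iff)
  also have "\<dots> \<longleftrightarrow> (\<forall>b. coef x b \<in> J m)" using x fs.subspace_0[OF J_sub] unfolding strand_iff by metis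
  finally show ?thesis .
qed

lemma proj_image: "proj k m ` strand k m = supp_on (B k \<times> A m)"
proof (intro equalityI subsetI)
  fix h :: "nat \<times> 'k tens \<Rightarrow> 'k" assume h: "h \<in> supp_on (B k \<times> A m)"
  have "\<exists>t. t \<in> tens m \<and> (\<lambda>a. if a \<in> A m then h (b, a) else 0) = (\<lambda>a. if a \<in> A m then pair (words m) a t else 0)" for b
  proof -
    have "(\<lambda>a. if a \<in> A m then h (b, a) else 0) \<in> supp_on (A m)" by (simp add: supp_on_def)
    then show ?thesis using pairing_surj[OF finite_words A(1) A_sub A(2), of m] unfolding tens_def by auto
  qed
  then have "\<exists>t. \<forall>b. t b \<in> tens m \<and> (\<lambda>a. if a \<in> A m then h (b, a) else 0) = (\<lambda>a. if a \<in> A m then pair (words m) a (t b) else 0)"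
    by (intro choice allI)
  then obtain t where t: "\<And>b. t b \<in> tens m"
    "\<And>b. (\<lambda>a. if a \<in> A m then h (b, a) else 0) = (\<lambda>a. if a \<in> A m then pair (words m) a (t b) else 0)"
    by blast
  define x where "x = (\<lambda>(b, w). if b \<in> B k then t b w else 0)"
  have cx: "coef x b = (if b \<in> B k then t b else 0)" for b
    by (simp add: coef_def x_def fun_eq_iff zero_fun_apply)
  have "x \<in> strand k m" using t(1) by (simp add: strand_iff cx tens_def supp_on_def zero_fun_apply)
  moreover have "h = proj k m x"
  proof
    fix z show "h z = proj k m x z"
    proof (cases z)
      case (Pair b a)
      show ?thesis using h fun_cong[OF t(2)[of b], of a] unfolding Pair
        by (cases "b \<in> B k \<and> a \<in> A m") (auto simp: proj_def cx supp_on_def)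
    qed
  qed
  ultimately show "h \<in> proj k m ` strand k m" by blast
qed (auto simp: proj_def supp_on_def)

lemma fin_strand: "fin_dim (strand k m)" "fs.subspace (strand k m)"
  unfolding strand_def by (auto simp: subspace_supp_on finite_B finite_words intro!: fin_dim_supp_on)

text \<open>Rank of the differential leaving the \<open>k\<close>-th module in internal degree
  \<open>n\<close>. The value 0 for \<open>k = 0\<close> and for \<open>n < k\<close> closes the
  complex at both ends.\<close>

definition rk :: "nat \<Rightarrow> nat \<Rightarrow> nat" where
  "rk n k = (if k = 0 \<or> n < k then 0 else fs.dim (proj (k - 1) (Suc (n - k)) ` diff (k - 1) ` strand k (n - k)))"

text \<open>Cycles and boundaries are compared after \<open>proj\<close>, because a family of
  tensors is a cycle only modulo the relations.\<close>

lemma proj_exact: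
  "proj (Suc k) (Suc m) ` {x \<in> strand (Suc k) (Suc m). proj k (Suc (Suc m)) (diff k x) = 0}
   = proj (Suc k) (Suc m) ` diff (Suc k) ` strand (Suc (Suc k)) m"
proof (intro equalityI subsetI)
  fix z assume "z \<in> proj (Suc k) (Suc m) ` {x \<in> strand (Suc k) (Suc m). proj k (Suc (Suc m)) (diff k x) = 0}"
  then obtain x where x: "x \<in> strand (Suc k) (Suc m)" "proj k (Suc (Suc m)) (diff k x) = 0" "z = proj (Suc k) (Suc m) x" by blast
  have "\<forall>b. coef (diff k x) b \<in> J (Suc (Suc m))" using x(2) proj_0[OF diff_strand[OF x(1)]] by blast
  then obtain g where g: "\<And>c. g c \<in> tens m" "\<And>c. c \<notin> B (Suc (Suc k)) \<Longrightarrow> g c = 0"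
    "\<And>b. coef x b - (\<Sum>c\<in>B (Suc (Suc k)). rm (g c) (L (Suc k) c b)) \<in> J (Suc m)"
    using exact_B[of "coef x" m k] x(1) unfolding strand_iff coef_diff by blast
  define y where "y = (\<lambda>(c, w). g c w)"
  have cy: "coef y c = g c" for c by (simp add: y_def coef_def)
  have y: "y \<in> strand (Suc (Suc k)) m" using g(1,2) by (simp add: strand_iff cy)
  have "x - diff (Suc k) y \<in> strand (Suc k) (Suc m)"
    by (rule fs.subspace_diff[OF fin_strand(2) x(1) diff_strand[OF y]])
  moreover have "coef (x - diff (Suc k) y) b \<in> J (Suc m)" for b
  proof -
    have "coef (x - diff (Suc k) y) b = coef x b - coef (diff (Suc k) y) b" by (simp add: coef_def fun_eq_iff pointwise)
    then show ?thesis using g(3)[of b] by (simp add: coef_diff cy)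
  qed
  ultimately have "proj (Suc k) (Suc m) (x - diff (Suc k) y) = 0" using proj_0 by blast
  then have "z = proj (Suc k) (Suc m) (diff (Suc k) y)" using x(3) by (simp add: lin_simps(5)[OF proj_lin])
  then show "z \<in> proj (Suc k) (Suc m) ` diff (Suc k) ` strand (Suc (Suc k)) m" using y by blast
next
  fix z assume "z \<in> proj (Suc k) (Suc m) ` diff (Suc k) ` strand (Suc (Suc k)) m"
  then obtain y where y: "y \<in> strand (Suc (Suc k)) m" "z = proj (Suc k) (Suc m) (diff (Suc k) y)" by blast
  have "coef (diff k (diff (Suc k) y)) b' \<in> J (Suc (Suc m))" for b'
  proof -
    have "coef (diff k (diff (Suc k) y)) b'
      = (\<Sum>c\<in>B (Suc (Suc k)). \<Sum>b\<in>B (Suc k). rm (rm (coef y c) (L (Suc k) c b)) (L k b b'))"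
      by (subst sum.swap) (simp add: coef_diff rm_sum)
    also have "\<dots> \<in> J (Suc (Suc m))"
    proof (rule fs.subspace_sum[OF J_sub])
      fix c
      have "(\<Sum>b\<in>B (Suc k). rm (rm (coef y c) (L (Suc k) c b)) (L k b b')) \<in> perp (words (Suc (Suc m))) (sol (Suc (Suc m)) (J 2))"
        unfolding perp_def
      proof (intro CollectI conjI ballI)
        show "(\<Sum>b\<in>B (Suc k). rm (rm (coef y c) (L (Suc k) c b)) (L k b b')) \<in> supp_on (words (Suc (Suc m)))"
          by (intro fs.subspace_sum[OF subspace_supp_on]) (use y(1) in \<open>simp add: strand_iff rm_tens flip: tens_def\<close>)
        fix t assume t: "t \<in> sol (Suc (Suc m)) (J 2)"
        have "pair (words (Suc (Suc m))) t (\<Sum>b\<in>B (Suc k). rm (rm (coef y c) (L (Suc k) c b)) (L k b b'))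
           = pair (words m) (coef y c) (\<Sum>b\<in>B (Suc k). ctr (L (Suc k) c b) (ctr (L k b b') t))"
          by (simp add: pair_commute[of _ t] pair_sum pair_rm)
        also have "(\<Sum>b\<in>B (Suc k). ctr (L (Suc k) c b) (ctr (L k b b') t)) = 0"
          by (rule relation_ctr[OF t])
        finally show "pair (words (Suc (Suc m))) t (\<Sum>b\<in>B (Suc k). rm (rm (coef y c) (L (Suc k) c b)) (L k b b')) = 0"
          by (simp add: pair_lin)
      qed
      then show "(\<Sum>b\<in>B (Suc k). rm (rm (coef y c) (L (Suc k) c b)) (L k b b')) \<in> J (Suc (Suc m))"
        using J_eq by blast
    qed
    finally show ?thesis .
  qed
  then have "proj k (Suc (Suc m)) (diff k (diff (Suc k) y)) = 0"
    using proj_0[OF diff_strand[OF diff_strand[OF y(1)]]] by blast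
  then show "z \<in> proj (Suc k) (Suc m) ` {x \<in> strand (Suc k) (Suc m). proj k (Suc (Suc m)) (diff k x) = 0}"
    using y diff_strand by blast
qed

lemma proj_exact_0: "proj 0 (Suc m) ` strand 0 (Suc m) = proj 0 (Suc m) ` diff 0 ` strand (Suc 0) m"
proof (intro equalityI subsetI)
  fix z assume "z \<in> proj 0 (Suc m) ` strand 0 (Suc m)"
  then obtain x where x: "x \<in> strand 0 (Suc m)" "z = proj 0 (Suc m) x" by blast
  obtain g where g: "\<And>c. g c \<in> tens m" "\<And>c. c \<notin> B (Suc 0) \<Longrightarrow> g c = 0"
    "coef x 0 - (\<Sum>c\<in>B (Suc 0). rm (g c) (L 0 c 0)) \<in> J (Suc m)"
    using exact_0_B[of "coef x 0" m] x(1) unfolding strand_iff by blast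
  define y where "y = (\<lambda>(c, w). g c w)"
  have cy: "coef y c = g c" for c by (simp add: y_def coef_def)
  have y: "y \<in> strand (Suc 0) m" using g(1,2) by (simp add: strand_iff cy)
  have xy: "x - diff 0 y \<in> strand 0 (Suc m)"
    by (rule fs.subspace_diff[OF fin_strand(2) x(1) diff_strand[OF y]])
  moreover have "coef (x - diff 0 y) b \<in> J (Suc m)" for b
  proof (cases "b = 0")
    case True
    have "coef (x - diff 0 y) b = coef x b - coef (diff 0 y) b" by (simp add: coef_def fun_eq_iff pointwise)
    then show ?thesis using g(3) True by (simp add: coef_diff cy)
  next
    case False
    then show ?thesis using xy fs.subspace_0[OF J_sub] by (simp add: strand_iff B_0)
  qed
  ultimately have "proj 0 (Suc m) (x - diff 0 y) = 0" using proj_0 by blast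
  then have "z = proj 0 (Suc m) (diff 0 y)" using x(2) by (simp add: lin_simps(5)[OF proj_lin])
  then show "z \<in> proj 0 (Suc m) ` diff 0 ` strand (Suc 0) m" using y by blast
qed (use diff_strand in blast)

text \<open>Rank and nullity of the outgoing map, where exactness identifies the nullity with the
  rank of the incoming map. For \<open>k = n\<close> the coefficients are scalars, and there the
  nullity is 0.\<close>

lemma rank_split:
  assumes "1 \<le> n" "k \<le> n"
  shows "card (B k) * card (A (n - k)) = rk n k + rk n (Suc k)"
proof -
  have im: "fs.dim (proj k m ` strand k m) = card (B k) * card (A m)" for k m
    by (simp add: proj_image dim_supp_on finite_B A(1) card_cartesian_product)
  show ?thesis
  proof (cases k)
    case 0
    obtain m where m: "n = Suc m" using assms(1) by (cases n) auto
    show ?thesis using im[of 0 n] proj_exact_0[of m] 0 m by (simp add: rk_def)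
  next
    case (Suc k')
    let ?m = "n - k"
    let ?S = "strand k ?m"
    let ?f = "\<lambda>x. proj k' (Suc ?m) (diff k' x)"
    have f: "lin ?f" using lin_comp[OF proj_lin diff_lin] by (simp add: o_def)
    let ?Z = "{x \<in> ?S. ?f x = 0}"
    have Z: "fs.subspace ?Z" "fin_dim ?Z"
      using fin_strand(2)[of k ?m] fin_dim_subset[OF fin_strand(1)[of k ?m]]
      by (auto simp: fs.subspace_def lin_simps(1)[OF f] lin_simps(2)[OF f] lin_simps(3)[OF f])
    have Kf: "?f x = 0" if "x \<in> ?S" "proj k ?m x = 0" for x
    proof -
      have "\<forall>b. coef x b \<in> J ?m" using that proj_0 by blast
      then have "\<forall>b. coef (diff k' x) b \<in> J (Suc ?m)"
        unfolding coef_diff by (intro allI fs.subspace_sum[OF J_sub] J_rm) blast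
      then show ?thesis using proj_0[of "diff k' x" k' "Suc ?m"] diff_strand that(1) Suc by simp
    qed
    have ker: "{x \<in> ?Z. proj k ?m x = 0} = {x \<in> ?S. proj k ?m x = 0}" using Kf by blast
    have rk_k: "fs.dim (?f ` ?S) = rk n k" using Suc assms(2) by (simp add: rk_def image_image)
    have "fs.dim (proj k ?m ` ?Z) = rk n (Suc k)"
    proof (cases "?m")
      case 0
      have "x = 0" if x: "x \<in> ?Z" for x
      proof -
        have xs: "x \<in> strand (Suc k') 0" using x Suc 0 by simp
        have "\<forall>b'. coef (diff k' x) b' \<in> J (Suc 0)" using x proj_0[OF diff_strand[OF xs]] 0 Suc by simp
        then have c: "(\<Sum>b\<in>B (Suc k'). rm (coef x b) (L k' b b')) = 0" for b' by (simp add: coef_diff J_1)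
        have "(\<lambda>b. coef x b []) = 0"
        proof (rule inject_B)
          show "(\<lambda>b. coef x b []) \<in> supp_on (B (Suc k'))" using xs by (auto simp: strand_iff supp_on_def zero_fun_apply)
          fix b'
          have "rm (coef x b) v [i] = coef x b [] * v i" for b v i using rm_simps(2)[of "coef x b" v "[]" i] by simp
          then show "(\<Sum>b\<in>B (Suc k'). scl (coef x b []) (L k' b b')) = 0"
            using fun_cong[OF c[of b'], of "[i]" for i] by (simp add: fun_eq_iff pointwise)
        qed
        then have "x (b, w) = 0" for b w
          using xs fun_cong[of "\<lambda>b. coef x b []" 0 b]
          by (cases w) (auto simp: strand_iff zero_fun_apply coef_def tens_def supp_on_def)
        then show ?thesis by (simp add: fun_eq_iff zero_fun_apply)
      qed
      then have "proj k ?m ` ?Z = {0}"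
        using lin_simps(3)[OF proj_lin] fs.subspace_0[OF Z(1)] by (auto intro!: image_eqI[of _ _ 0])
      moreover have "n < Suc k" using 0 by simp
      ultimately show ?thesis using dim_zero by (simp add: rk_def)
    next
      case (Suc m)
      have nk: "n - Suc k = m" "\<not> n < Suc k" using Suc assms(2) by auto
      show ?thesis using proj_exact[of k' m] Suc nk \<open>k = Suc k'\<close> by (simp add: rk_def)
    qed
    then show ?thesis
      using rank_nullity[OF f fin_strand(2,1)[of k ?m]] rank_nullity[OF proj_lin[of k ?m] Z] rank_nullity[OF proj_lin[of k ?m] fin_strand(2,1)[of k ?m]]
        im[of k ?m] rk_k unfolding ker by linarith
  qed
qed

end

theorem euler_characteristic:
  "koszul_numbers (\<lambda>m. fs.dim (sol m (J 2))) (\<lambda>k. fs.dim (sol k (sol 2 (J 2))))"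
proof -
  have "\<exists>A. finite A \<and> fs.independent A \<and> fs.span A = sol m (J 2) \<and> card A = fs.dim (sol m (J 2))" for m
    using fin_dim_basis[OF subspace_sol fin_dim_sol] by metis
  then obtain A where A: "\<And>m. finite (A m)" "\<And>m. fs.independent (A m)" "\<And>m. fs.span (A m) = sol m (J 2)"
    "\<And>m. card (A m) = fs.dim (sol m (J 2))" by metis
  have "(\<Sum>k\<le>n. (- 1) ^ k * int (card (B k)) * int (card (A (n - k)))) = 0" if "1 \<le> n" for n
  proof -
    have "rk A n 0 = 0" "rk A n (Suc n) = 0" by (simp_all add: rk_def[OF A(1-3)])
    then show ?thesis
      using alternating_telescope[of n "\<lambda>k. card (B k) * card (A (n - k))" "rk A n", OF rank_split[OF A(1-3) that]]
      by (simp add: mult.assoc)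
  qed
  then show ?thesis unfolding koszul_numbers_def card_B A(4) by blast
qed

end

section \<open>Koszul algebras in coordinates\<close>

lemma (in graded_ideal) free_module_simps:
  "x \<in> carrier (free_module n I k B) \<longleftrightarrow>
    (\<forall>b. x b \<in> carrier A) \<and> (\<forall>b. b \<notin> B \<longrightarrow> x b = \<zero>\<^bsub>A\<^esub>) \<and> finite {b. x b \<noteq> \<zero>\<^bsub>A\<^esub>}"
  "zero (free_module n I k B) = (\<lambda>b. \<zero>\<^bsub>A\<^esub>)"
  "add (free_module n I k B) x y = (\<lambda>b. x b \<oplus>\<^bsub>A\<^esub> y b)"
  "module.smult (free_module n I k B) a x = (\<lambda>b. a \<otimes>\<^bsub>A\<^esub> x b)"
  "x \<in> grade (free_module n I k B) j \<longleftrightarrow> x \<in> carrier (free_module n I k B) \<and>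
    (\<forall>b. x b \<in> (if k \<le> j then alg_comp n I (j - k) else {\<zero>\<^bsub>A\<^esub>}))"
  by (auto simp: free_module_def Let_def)

text \<open>The maps \<open>D k\<close> are the differentials of a linear resolution, coordinatewise, with the algebra itself as
  the free module on \<open>B 0 = {0}\<close>.\<close>

locale linear_resolution = graded_ideal n I for n and I :: "'k::field ncpoly set" +
  fixes B :: "nat \<Rightarrow> nat set" and D :: "nat \<Rightarrow> (nat \<Rightarrow> 'k ncpoly set) \<Rightarrow> nat \<Rightarrow> 'k ncpoly set"
  assumes B_0: "B 0 = {0}"
    and D_carrier: "x \<in> carrier (free_module n I (Suc k) (B (Suc k))) \<Longrightarrow> D k x \<in> carrier (free_module n I k (B k))"
    and D_add: "x \<in> carrier (free_module n I (Suc k) (B (Suc k))) \<Longrightarrow> y \<in> carrier (free_module n I (Suc k) (B (Suc k))) \<Longrightarrow>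
      D k (\<lambda>b. x b \<oplus>\<^bsub>graded_algebra n I\<^esub> y b) b' = D k x b' \<oplus>\<^bsub>graded_algebra n I\<^esub> D k y b'"
    and D_smult: "a \<in> carrier (graded_algebra n I) \<Longrightarrow> x \<in> carrier (free_module n I (Suc k) (B (Suc k))) \<Longrightarrow>
      D k (\<lambda>b. a \<otimes>\<^bsub>graded_algebra n I\<^esub> x b) b' = a \<otimes>\<^bsub>graded_algebra n I\<^esub> D k x b'"
    and D_grade: "x \<in> grade (free_module n I (Suc k) (B (Suc k))) (Suc k) \<Longrightarrow> D k x b' \<in> alg_comp n I 1"
    and D_exact: "x \<in> carrier (free_module n I (Suc k) (B (Suc k))) \<Longrightarrow>
      (\<forall>b'. D k x b' = \<zero>\<^bsub>graded_algebra n I\<^esub>) \<longleftrightarrow> x \<in> D (Suc k) ` carrier (free_module n I (Suc (Suc k)) (B (Suc (Suc k))))"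
    and D_0: "f \<in> polys n \<Longrightarrow> f [] = 0 \<Longrightarrow> \<exists>y\<in>carrier (free_module n I (Suc 0) (B (Suc 0))). D 0 y 0 = q f"

lemma (in graded_ideal) zero_alg_comp: "\<zero>\<^bsub>A\<^esub> \<in> alg_comp n I j"
  unfolding alg_comp_eq using q_0 fs.subspace_0[OF subspace_free_comp] by (metis imageI)

text \<open>The algebra becomes the free module on the basis element 0, so that \<open>e\<close> and
  the maps \<open>d k\<close> can be treated uniformly.\<close>

lemma (in graded_ideal) koszul_linear_resolution:
  assumes "koszul n I"
  obtains B D where "linear_resolution n I B D"
proof -
  define A' where "A' = regular_module n I"
  obtain B e d where K: "e \<in> graded_module_hom A (free_module n I 1 (B 1)) A'"
    "\<And>k. k \<ge> 1 \<Longrightarrow> d k \<in> graded_module_hom A (free_module n I (k + 1) (B (k + 1))) (free_module n I k (B k))"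
    "exact_at (free_module n I 1 (B 1)) e A' augmentation trivial_module"
    "exact_at (free_module n I 2 (B 2)) (d 1) (free_module n I 1 (B 1)) e A'"
    "\<And>k. k \<ge> 1 \<Longrightarrow> exact_at (free_module n I (k + 2) (B (k + 2))) (d (k + 1)) (free_module n I (k + 1) (B (k + 1))) (d k) (free_module n I k (B k))"
    using assms unfolding koszul_def Let_def A'_def[symmetric] by blast
  define B' where "B' k = (if k = 0 then {0} else B k)" for k
  define D where "D k x = (if k = 0 then (\<lambda>b. if b = 0 then e x else \<zero>\<^bsub>A\<^esub>) else d k x)" for k and x :: "nat \<Rightarrow> 'k ncpoly set"
  let ?M = "\<lambda>k. free_module n I k (B' k)"
  have A': "carrier A' = carrier A" "zero A' = \<zero>\<^bsub>A\<^esub>" "add A' = add A" "module.smult A' = mult A" "grade A' = alg_comp n I"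
    by (simp_all add: A'_def regular_module_def)
  have d: "d (Suc k) \<in> graded_module_hom A (?M (Suc (Suc k))) (?M (Suc k))" for k
    using K(2)[of "Suc k"] by (simp add: B'_def)
  have e: "e \<in> graded_module_hom A (?M (Suc 0)) A'" using K(1) by (simp add: B'_def)
  have "linear_resolution n I B' D"
  proof (unfold_locales)
    show "B' 0 = {0}" by (simp add: B'_def)
    fix k x assume x: "x \<in> carrier (?M (Suc k))"
    show "D k x \<in> carrier (?M k)"
    proof (cases k)
      case 0
      have "e x \<in> carrier A" using e x 0 by (auto simp: graded_module_hom_def A')
      moreover have "finite {b::nat. (if b = 0 then e x else \<zero>\<^bsub>A\<^esub>) \<noteq> \<zero>\<^bsub>A\<^esub>}"
        by (rule finite_subset[of _ "{0}"]) auto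
      ultimately show ?thesis using 0 by (auto simp: free_module_simps D_def B'_def)
    next
      case (Suc m)
      then show ?thesis using d[of m] x by (auto simp: graded_module_hom_def D_def)
    qed
    show "D k (\<lambda>b. x b \<oplus>\<^bsub>A\<^esub> y b) b' = D k x b' \<oplus>\<^bsub>A\<^esub> D k y b'" if "y \<in> carrier (?M (Suc k))" for y b'
      using e d[of "k - 1"] x that A.zero_closed
      by (cases k) (auto simp: graded_module_hom_def D_def free_module_simps(3) A')
    show "D k (\<lambda>b. a \<otimes>\<^bsub>A\<^esub> x b) b' = a \<otimes>\<^bsub>A\<^esub> D k x b'" if "a \<in> carrier A" for a b'
      using e d[of "k - 1"] x that
      by (cases k) (auto simp: graded_module_hom_def D_def free_module_simps(4) A')
    show "(\<forall>b'. D k x b' = \<zero>\<^bsub>A\<^esub>) \<longleftrightarrow> x \<in> D (Suc k) ` carrier (?M (Suc (Suc k)))"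
    proof (cases k)
      case 0
      have "(\<forall>b'. D k x b' = \<zero>\<^bsub>A\<^esub>) \<longleftrightarrow> e x = \<zero>\<^bsub>A\<^esub>" using 0 by (auto simp: D_def)
      also have "\<dots> \<longleftrightarrow> x \<in> d 1 ` carrier (?M 2)"
        using K(4) x 0 by (auto simp: exact_at_def B'_def a_kernel_def' A')
      finally show ?thesis using 0 by (simp add: D_def numeral_2_eq_2)
    next
      case (Suc m)
      have "(\<forall>b'. D k x b' = \<zero>\<^bsub>A\<^esub>) \<longleftrightarrow> d k x = zero (?M k)"
        using Suc by (auto simp: D_def free_module_simps fun_eq_iff)
      also have "\<dots> \<longleftrightarrow> x \<in> d (Suc k) ` carrier (?M (Suc (Suc k)))"
        using K(5)[of k] x Suc by (auto simp: exact_at_def B'_def a_kernel_def')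
      finally show ?thesis using Suc by (simp add: D_def)
    qed
  next
    fix k x b' assume x: "x \<in> grade (?M (Suc k)) (Suc k)"
    show "D k x b' \<in> alg_comp n I 1"
    proof (cases k)
      case 0
      then have "e x \<in> grade A' (Suc 0)" using e x unfolding graded_module_hom_def by blast
      then show ?thesis using 0 zero_alg_comp by (auto simp: D_def A')
    next
      case (Suc m)
      then have "d k x \<in> grade (?M k) (Suc k)" using d[of m] x unfolding graded_module_hom_def by blast
      then show ?thesis using Suc by (auto simp: D_def free_module_simps)
    qed
  next
    fix f :: "'k ncpoly" assume f: "f \<in> polys n" "f [] = 0"
    have "augmentation (q f) = 0"
      unfolding q_def using augmentation_coset[OF pgi] f by (simp add: free_algebra_fold)
    then have "q f \<in> a_kernel A' trivial_module augmentation"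
      using q_carrier[OF f(1)] by (simp add: a_kernel_def' A' trivial_module_def)
    then have "q f \<in> e ` carrier (?M (Suc 0))" using K(3) by (simp add: exact_at_def B'_def)
    then show "\<exists>y\<in>carrier (?M (Suc 0)). D 0 y 0 = q f" by (auto simp: D_def)
  qed
  then show thesis by (rule that)
qed

section \<open>The differentials as matrices of linear forms\<close>

context linear_resolution
begin

abbreviation "M k \<equiv> free_module n I k (B k)"

definition unit :: "nat \<Rightarrow> nat \<Rightarrow> 'k ncpoly set" where
  "unit b = (\<lambda>c. if c = b then \<one>\<^bsub>A\<^esub> else \<zero>\<^bsub>A\<^esub>)"

definition elem :: "nat set \<Rightarrow> (nat \<Rightarrow> 'k ncpoly) \<Rightarrow> nat \<Rightarrow> 'k ncpoly set" where
  "elem S f = (\<lambda>b. if b \<in> S then q (f b) else \<zero>\<^bsub>A\<^esub>)"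

lemma elem_carrier:
  assumes "finite S" "S \<subseteq> B k" "\<And>b. b \<in> S \<Longrightarrow> f b \<in> polys n"
  shows "elem S f \<in> carrier (M k)"
proof -
  have "finite {b. elem S f b \<noteq> \<zero>\<^bsub>A\<^esub>}" by (rule finite_subset[OF _ assms(1)]) (auto simp: elem_def)
  then show ?thesis using assms by (auto simp: free_module_simps elem_def q_carrier)
qed

lemma unit_elem: "unit b = elem {b} (\<lambda>_. const_poly 1)"
  unfolding unit_def elem_def q_1 by simp

lemma unit_carrier: "b \<in> B k \<Longrightarrow> unit b \<in> carrier (M k)"
  unfolding unit_elem by (rule elem_carrier) (auto simp: const_polys)

lemma elem_cases:
  assumes "y \<in> carrier (M k)"
  obtains T g where "finite T" "T \<subseteq> B k" "\<And>c. g c \<in> polys n" "y = elem T g"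
proof -
  let ?T = "{b. y b \<noteq> \<zero>\<^bsub>A\<^esub>}"
  have "\<forall>b. \<exists>f. f \<in> polys n \<and> y b = q f" using assms unfolding free_module_simps carrier_A by blast
  then obtain g where g: "\<And>b. g b \<in> polys n" "\<And>b. y b = q (g b)" by metis
  have "y = elem ?T g" unfolding elem_def by (rule ext) (simp flip: g(2))
  moreover have "finite ?T" "?T \<subseteq> B k" using assms by (auto simp: free_module_simps)
  ultimately show thesis using that g(1) by blast
qed

text \<open>Matrix entries of the differential, lifted to linear polynomials. A zero entry is lifted
  to 0, which keeps each row finite.\<close>

definition lam :: "nat \<Rightarrow> nat \<Rightarrow> nat \<Rightarrow> 'k ncpoly" where
  "lam k b b' = (if b \<in> B (Suc k) \<and> D k (unit b) b' \<noteq> \<zero>\<^bsub>A\<^esub>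
     then (SOME f. f \<in> free_comp n 1 \<and> q f = D k (unit b) b') else 0)"

lemma lam_prop: "lam k b b' \<in> free_comp n 1 \<and> (b \<in> B (Suc k) \<longrightarrow> q (lam k b b') = D k (unit b) b')"
proof (cases "b \<in> B (Suc k) \<and> D k (unit b) b' \<noteq> \<zero>\<^bsub>A\<^esub>")
  case True
  have "unit b \<in> grade (M (Suc k)) (Suc k)"
    using True unit_carrier imageI[OF const_comp[of 1 n], of q] zero_alg_comp[of 0]
    by (simp add: free_module_simps(5) unit_def alg_comp_eq q_1)
  then have "D k (unit b) b' \<in> q ` free_comp n 1" unfolding alg_comp_eq[symmetric] by (rule D_grade)
  then have "\<exists>f. f \<in> free_comp n 1 \<and> q f = D k (unit b) b'" by (metis imageE)
  then have "lam k b b' \<in> free_comp n 1 \<and> q (lam k b b') = D k (unit b) b'"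
    unfolding lam_def if_P[OF True] by (rule someI_ex)
  then show ?thesis by blast
next
  case False
  then show ?thesis using fs.subspace_0[OF subspace_free_comp] q_0 by (auto simp: lam_def)
qed

lemma lam_comp: "lam k b b' \<in> free_comp n 1" and lam_q: "b \<in> B (Suc k) \<Longrightarrow> q (lam k b b') = D k (unit b) b'"
  using lam_prop by blast+

lemma lam_polys: "lam k b b' \<in> polys n"
  by (rule free_comp_polys[OF lam_comp])

lemma lam_supp: "lam k b b' \<noteq> 0 \<Longrightarrow> b \<in> B (Suc k) \<and> b' \<in> B k"
  using D_carrier[OF unit_carrier] by (auto simp: lam_def free_module_simps split: if_splits)

lemma lam_fin: "finite {b'. lam k b b' \<noteq> 0}"
proof (cases "b \<in> B (Suc k)")
  case True
  then have "finite {b'. D k (unit b) b' \<noteq> \<zero>\<^bsub>A\<^esub>}" using D_carrier[OF unit_carrier] by (auto simp: free_module_simps)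
  then show ?thesis by (rule rev_finite_subset) (auto simp: lam_def)
qed (simp add: lam_def)

lemma D_elem:
  assumes "finite S" "S \<subseteq> B (Suc k)" "\<And>b. b \<in> S \<Longrightarrow> f b \<in> polys n"
  shows "D k (elem S f) b' = q (\<Sum>b\<in>S. pmul (f b) (lam k b b'))"
  using assms
proof (induction S rule: finite_induct)
  case empty
  have z: "elem {} f \<in> carrier (M (Suc k))" by (rule elem_carrier) auto
  have "D k (\<lambda>b. \<zero>\<^bsub>A\<^esub> \<otimes>\<^bsub>A\<^esub> elem {} f b) b' = \<zero>\<^bsub>A\<^esub> \<otimes>\<^bsub>A\<^esub> D k (elem {} f) b'"
    by (rule D_smult[OF A.zero_closed z])
  moreover have "(\<lambda>b. \<zero>\<^bsub>A\<^esub> \<otimes>\<^bsub>A\<^esub> elem {} f b) = elem {} f" by (simp add: elem_def)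
  moreover have "D k (elem {} f) b' \<in> carrier A" using D_carrier[OF z] by (simp add: free_module_simps)
  ultimately show ?case by (simp add: q_0)
next
  case (insert b S)
  have fp: "f b \<in> polys n" "\<And>c. c \<in> S \<Longrightarrow> f c \<in> polys n" and b: "b \<in> B (Suc k)" using insert.prems by auto
  have S: "elem S f \<in> carrier (M (Suc k))" by (rule elem_carrier) (use insert in auto)
  have u: "(\<lambda>c. q (f b) \<otimes>\<^bsub>A\<^esub> unit b c) \<in> carrier (M (Suc k))"
  proof -
    have "(\<lambda>c. q (f b) \<otimes>\<^bsub>A\<^esub> unit b c) = elem {b} f"
      using A.r_one[OF q_carrier[OF fp(1)]] A.r_null[OF q_carrier[OF fp(1)]]
      unfolding unit_def elem_def by (intro ext) simp
    then show ?thesis using elem_carrier[of "{b}" "Suc k" f] b fp by simp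
  qed
  have "elem (insert b S) f = (\<lambda>c. q (f b) \<otimes>\<^bsub>A\<^esub> unit b c \<oplus>\<^bsub>A\<^esub> elem S f c)"
    using q_carrier[OF fp(1)] q_carrier[OF fp(2)] insert.hyps(2) by (auto simp: unit_def elem_def fun_eq_iff)
  then have "D k (elem (insert b S) f) b' = D k (\<lambda>c. q (f b) \<otimes>\<^bsub>A\<^esub> unit b c) b' \<oplus>\<^bsub>A\<^esub> D k (elem S f) b'"
    using D_add[OF u S] by simp
  also have "\<dots> = q (f b) \<otimes>\<^bsub>A\<^esub> q (lam k b b') \<oplus>\<^bsub>A\<^esub> q (\<Sum>b\<in>S. pmul (f b) (lam k b b'))"
    using D_smult[OF q_carrier[OF fp(1)] unit_carrier[OF b]] insert.IH fp insert.prems lam_q[OF b] by simp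
  also have "\<dots> = q (pmul (f b) (lam k b b') + (\<Sum>b\<in>S. pmul (f b) (lam k b b')))"
    using q_mult[OF fp(1) lam_polys] q_add pmul_polys[OF fp(1) lam_polys]
      fs.subspace_sum[OF polys_subspace, of S "\<lambda>b. pmul (f b) (lam k b b')"] pmul_polys[OF fp(2) lam_polys] by simp
  finally show ?case using insert.hyps by simp
qed

lemma lam_complex: "(\<Sum>b | lam (Suc k) c b \<noteq> 0. pmul (lam (Suc k) c b) (lam k b b')) \<in> I"
proof (cases "c \<in> B (Suc (Suc k))")
  case True
  let ?S = "{b. lam (Suc k) c b \<noteq> 0}"
  have S: "finite ?S" "?S \<subseteq> B (Suc k)" using lam_fin lam_supp by auto
  have e: "D (Suc k) (unit c) = elem ?S (lam (Suc k) c)"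
    unfolding elem_def lam_q[OF True] by (rule ext) (simp flip: lam_q[OF True] add: q_0)
  have "\<forall>b'. D k (D (Suc k) (unit c)) b' = \<zero>\<^bsub>A\<^esub>"
    by (rule D_exact[OF D_carrier[OF unit_carrier[OF True]], THEN iffD2]) (rule imageI[OF unit_carrier[OF True]])
  then have "D k (elem ?S (lam (Suc k) c)) b' = \<zero>\<^bsub>A\<^esub>" unfolding e by blast
  then show ?thesis using D_elem[OF S, of "lam (Suc k) c" b'] lam_polys by (simp add: q_eq_0)
next
  case False
  then have "lam (Suc k) c b = 0" for b using lam_supp by blast
  then show ?thesis using I_closed(4) by simp
qed

lemma lam_exact_0:
  assumes "f \<in> polys n" "f [] = 0"
  obtains T g where "finite T" "T \<subseteq> B (Suc 0)" "\<And>c. g c \<in> polys n" "f - (\<Sum>c\<in>T. pmul (g c) (lam 0 c 0)) \<in> I"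
proof -
  obtain y where y: "y \<in> carrier (M (Suc 0))" "D 0 y 0 = q f" using D_0[OF assms] by blast
  obtain T g where T: "finite T" "T \<subseteq> B (Suc 0)" "\<And>c. g c \<in> polys n" "y = elem T g" using elem_cases[OF y(1)] by blast
  have "q f = q (\<Sum>c\<in>T. pmul (g c) (lam 0 c 0))"
    unfolding y(2)[symmetric] T(4) by (rule D_elem[OF T(1-3)])
  then show thesis using that[OF T(1-3)] by (simp add: q_eq)
qed

lemma lam_exact:
  assumes S: "finite S" "S \<subseteq> B (Suc k)" "\<And>b. f b \<in> polys n" "\<And>b. b \<notin> S \<Longrightarrow> f b = 0"
    "\<And>b'. (\<Sum>b\<in>S. pmul (f b) (lam k b b')) \<in> I"
  obtains T g where "finite T" "T \<subseteq> B (Suc (Suc k))" "\<And>c. g c \<in> polys n"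
    "\<And>b. f b - (\<Sum>c\<in>T. pmul (g c) (lam (Suc k) c b)) \<in> I"
proof -
  have "\<forall>b'. D k (elem S f) b' = \<zero>\<^bsub>A\<^esub>" using D_elem[OF S(1-3)] S(5) by (simp add: q_eq_0)
  then have "elem S f \<in> D (Suc k) ` carrier (M (Suc (Suc k)))"
    using D_exact[OF elem_carrier[OF S(1,2)]] S(3) by blast
  then obtain y where y: "y \<in> carrier (M (Suc (Suc k)))" "elem S f = D (Suc k) y" by blast
  obtain T g where T: "finite T" "T \<subseteq> B (Suc (Suc k))" "\<And>c. g c \<in> polys n" "y = elem T g" using elem_cases[OF y(1)] by blast
  have "q (f b) = elem S f b" for b using S(4) q_0 by (simp add: elem_def)
  then have "q (f b) = q (\<Sum>c\<in>T. pmul (g c) (lam (Suc k) c b))" for b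
    using y(2) D_elem[OF T(1-3)] T(4) by simp
  then have "f b - (\<Sum>c\<in>T. pmul (g c) (lam (Suc k) c b)) \<in> I" for b by (simp add: q_eq)
  then show thesis by (rule that[OF T(1-3)])
qed

end

lemma tens_diff: "s \<in> tens n \<Longrightarrow> t \<in> tens n \<Longrightarrow> s - t \<in> tens n"
  unfolding tens_def by (rule fs.subspace_diff[OF subspace_supp_on])

lemma lm_tens: "f \<in> tens m \<Longrightarrow> lm v f \<in> tens (Suc m)"
  by (rule tensI) (auto simp: lm_def intro!: tensD)

section \<open>Three generators for the degree one component\<close>

context linear_resolution
begin

text \<open>The generators \<open>V\<close> are chosen dual to a basis \<open>E\<close> of those
  functionals on linear polynomials that vanish on the ideal; \<open>E\<close> has three elements by
  the dimension hypothesis.\<close>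

lemma ex_coordinates:
  assumes "comp_dim n I 1 = 3"
  obtains V :: "3 \<Rightarrow> 'k ncpoly" and cf :: "'k ncpoly \<Rightarrow> 3 \<Rightarrow> 'k" where
    "lin cf" "\<And>i. V i \<in> free_comp n 1" "\<And>f. f \<in> free_comp n 1 \<Longrightarrow> f - (\<Sum>i\<in>UNIV. scl (cf f i) (V i)) \<in> I"
    "\<And>c. (\<Sum>i\<in>UNIV. scl (c i) (V i)) \<in> I \<Longrightarrow> c = 0"
proof -
  let ?Y = "nwords n 1"
  let ?S = "I \<inter> free_comp n 1"
  have S: "fs.subspace ?S" by (rule fs.subspace_inter[OF I_subspace subspace_free_comp])
  have SY: "?S \<subseteq> supp_on ?Y" by (simp add: free_comp_eq)
  have fp: "fin_dim (perp ?Y ?S)" by (rule fin_dim_subset[OF fin_dim_supp_on[OF finite_nwords]]) (auto simp: perp_def)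
  obtain E where E: "E \<subseteq> perp ?Y ?S" "finite E" "fs.independent E" "fs.span E = perp ?Y ?S"
    by (rule fin_dim_basis[OF subspace_perp fp])
  have EY: "E \<subseteq> supp_on ?Y" using E(1) by (auto simp: perp_def)
  let ?phi = "\<lambda>f a. if a \<in> E then pair ?Y a f else 0"
  have phi: "lin ?phi" by (rule linI) (auto simp: fun_eq_iff pointwise pair_lin)
  have phi_0: "?phi f = 0 \<longleftrightarrow> f \<in> I" if "f \<in> free_comp n 1" for f
  proof -
    have "?phi f = 0 \<longleftrightarrow> f \<in> perp ?Y E" using that by (auto simp: perp_def fun_eq_iff zero_fun_apply free_comp_eq)
    also have "perp ?Y E = perp ?Y (perp ?Y ?S)" using perp_span[of ?Y E] E(4) by simp
    also have "\<dots> = ?S" by (rule perp_perp[OF finite_nwords S SY])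
    finally show ?thesis using that by simp
  qed
  have im: "?phi ` free_comp n 1 = supp_on E"
    unfolding free_comp_eq by (rule pairing_surj[OF finite_nwords E(2) EY E(3)])
  have "comp_dim n I 1 = card E"
    by (rule comp_dim_eqI[where psi = "\<lambda>f. f" and T = "free_comp n 1" and phi = ?phi])
      (use phi phi_0 im E(2) subspace_free_comp I_closed(4) in \<open>auto intro!: linI bexI[of _ f for f]\<close>)
  then have "card E = card (UNIV :: 3 set)" using assms by simp
  then obtain h where h: "bij_betw h (UNIV :: 3 set) E" using finite_same_card_bij[of "UNIV :: 3 set" E] E(2) by auto
  have hE: "h i \<in> E" for i using h by (auto simp: bij_betw_def)
  have hinj: "h i = h j \<longleftrightarrow> i = j" for i j using h by (auto simp: bij_betw_def inj_on_def)
  have "\<exists>v. v \<in> free_comp n 1 \<and> ?phi v = delta (h i)" for i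
  proof -
    have "delta (h i) \<in> ?phi ` free_comp n 1" unfolding im using hE by (auto simp: supp_on_def delta_def)
    then show ?thesis by (metis (no_types, lifting) imageE)
  qed
  then have "\<exists>V. \<forall>i. V i \<in> free_comp n 1 \<and> ?phi (V i) = delta (h i)" by (intro choice allI)
  then obtain V where V: "\<And>i. V i \<in> free_comp n 1" "\<And>i. ?phi (V i) = delta (h i)" by blast
  have Vs: "(\<Sum>i\<in>UNIV. scl (c i) (V i)) \<in> free_comp n 1" for c
    by (intro fs.subspace_sum[OF subspace_free_comp] fs.subspace_scale[OF subspace_free_comp] V)
  have phiV: "?phi (\<Sum>i\<in>UNIV. scl (c i) (V i)) = (\<Sum>i\<in>UNIV. scl (c i) (delta (h i)))" for c
    unfolding lin_simps(6)[OF phi] lin_simps(2)[OF phi] V(2) ..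
  have phis: "(\<Sum>i\<in>UNIV. scl (c i) (delta (h i))) (h j) = c j" for c j
  proof -
    have "(\<Sum>i\<in>UNIV. scl (c i) (delta (h i))) (h j) = (\<Sum>i\<in>UNIV. if j = i then c i else 0)"
      unfolding sum_fun_apply scl_apply by (intro sum.cong) (auto simp: delta_def hinj)
    then show ?thesis by simp
  qed
  show thesis
  proof (rule that)
    let ?cf = "\<lambda>f i. ?phi f (h i)"
    show "lin ?cf" by (rule linI) (auto simp: fun_eq_iff pointwise pair_lin)
    show "V i \<in> free_comp n 1" for i by (rule V)
    show "c = 0" if "(\<Sum>i\<in>UNIV. scl (c i) (V i)) \<in> I" for c
    proof
      fix j
      have "?phi (\<Sum>i\<in>UNIV. scl (c i) (V i)) = 0" using phi_0[OF Vs] that by blast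
      then show "c j = 0 j" using phis[of c j] unfolding phiV by (simp add: zero_fun_apply)
    qed
    show "f - (\<Sum>i\<in>UNIV. scl (?cf f i) (V i)) \<in> I" if f: "f \<in> free_comp n 1" for f
    proof -
      let ?g = "f - (\<Sum>i\<in>UNIV. scl (?cf f i) (V i))"
      have "?phi f = (\<Sum>i\<in>UNIV. scl (?cf f i) (delta (h i)))"
      proof
        fix a
        show "?phi f a = (\<Sum>i\<in>UNIV. scl (?cf f i) (delta (h i))) a"
        proof (cases "a \<in> E")
          case True
          then obtain j where "a = h j" using h by (auto simp: bij_betw_def)
          then show ?thesis using phis[of "?cf f" j] by simp
        next
          case False
          then have "a \<noteq> h i" for i using hE by blast
          then show ?thesis using False by (simp add: pointwise delta_def)
        qed
      qed
      then have "?phi ?g = 0" unfolding lin_simps(5)[OF phi] phiV by simp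
      moreover have "?g \<in> free_comp n 1" by (rule fs.subspace_diff[OF subspace_free_comp f Vs])
      ultimately show ?thesis using phi_0 by blast
    qed
  qed
qed

context
  fixes V :: "3 \<Rightarrow> 'k ncpoly" and cf :: "'k ncpoly \<Rightarrow> 3 \<Rightarrow> 'k"
  assumes cf: "lin cf" and V: "\<And>i. V i \<in> free_comp n 1"
    and cf_V: "\<And>f. f \<in> free_comp n 1 \<Longrightarrow> f - (\<Sum>i\<in>UNIV. scl (cf f i) (V i)) \<in> I"
    and V_indep: "\<And>c. (\<Sum>i\<in>UNIV. scl (c i) (V i)) \<in> I \<Longrightarrow> c = 0"
begin

definition lf :: "(3 \<Rightarrow> 'k) \<Rightarrow> 'k ncpoly" where
  "lf v = (\<Sum>i\<in>UNIV. scl (v i) (V i))"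

primrec mon :: "3 list \<Rightarrow> 'k ncpoly" where
  "mon [] = const_poly 1"
| "mon (i # w) = pmul (V i) (mon w)"

text \<open>Substitutes the generators \<open>V\<close> into a tensor; \<open>rels\<close> consists
  of the tensors sent into the ideal.\<close>

definition psi :: "nat \<Rightarrow> 'k tens \<Rightarrow> 'k ncpoly" where
  "psi m t = (\<Sum>w\<in>words m. scl (t w) (mon w))"

definition rels :: "nat \<Rightarrow> 'k tens set" where
  "rels m = {t \<in> tens m. psi m t \<in> I}"

lemma lf_comp: "lf v \<in> free_comp n 1"
  unfolding lf_def by (intro fs.subspace_sum[OF subspace_free_comp] fs.subspace_scale[OF subspace_free_comp] V)

lemma lf_lam: "lam k b b' - lf (cf (lam k b b')) \<in> I"
  unfolding lf_def by (rule cf_V[OF lam_comp])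

lemma mon_comp: "mon w \<in> free_comp n (length w)"
proof (induction w)
  case (Cons i w)
  then show ?case using pmul_comp[OF V[of i]] by simp
qed (simp add: const_comp)

lemma mon_snoc: "mon (w @ [i]) = pmul (mon w) (V i)"
  by (induction w) (simp_all add: pmul_const pmul_assoc)

lemma psi_lin: "lin (psi m)"
  by (rule linI) (simp_all add: psi_def pointwise fs.scale_left_distrib sum.distrib fs.scale_sum_right)

lemma psi_comp: "psi m t \<in> free_comp n m"
  unfolding psi_def using mon_comp
  by (intro fs.subspace_sum[OF subspace_free_comp] fs.subspace_scale[OF subspace_free_comp]) auto

lemma psi_rm: "psi (Suc m) (rm t v) = pmul (psi m t) (lf v)"
proof -
  have "psi (Suc m) (rm t v) = (\<Sum>i\<in>UNIV. \<Sum>w\<in>words m. pmul (scl (t w) (mon w)) (scl (v i) (V i)))"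
    unfolding psi_def sum_words_right by (simp add: mon_snoc pmul_lin fs.scale_scale mult.commute)
  then show ?thesis by (simp add: psi_def lf_def pmul_sum)
qed

lemma psi_lm: "psi (Suc m) (lm v t) = pmul (lf v) (psi m t)"
proof -
  have "psi (Suc m) (lm v t) = (\<Sum>i\<in>UNIV. \<Sum>w\<in>words m. pmul (scl (v i) (V i)) (scl (t w) (mon w)))"
    unfolding psi_def sum_words_left by (simp add: pmul_lin fs.scale_scale mult.commute)
  then show ?thesis by (subst (asm) sum.swap) (simp add: psi_def lf_def pmul_sum)
qed

lemma psi_1: "psi (Suc 0) (vec1 v) = lf v"
  unfolding psi_def lf_def sum_words_left by (simp add: pmul_const)

lemma psi_0: "psi 0 t = const_poly (t [])"
  by (simp add: psi_def const_poly_def fun_eq_iff scl_apply)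

text \<open>Modulo the ideal each variable is a combination of the generators, so polynomials are
  rewritten one letter at a time.\<close>

lemma psi_onto: "f \<in> free_comp n m \<Longrightarrow> \<exists>t\<in>tens m. f - psi m t \<in> I"
proof (induction m arbitrary: f)
  case 0
  let ?t = "\<lambda>w. if w = [] then f [] else 0 :: 'k"
  have "psi 0 ?t = const_poly (f [])" by (simp add: psi_0)
  then have "f - psi 0 ?t = 0" using comp_0[OF 0, symmetric] by simp
  moreover have "?t \<in> tens 0" by (simp add: tens_def supp_on_def)
  ultimately show ?case using I_closed(4) by metis
next
  case (Suc m)
  define g where "g j = (\<lambda>w. f (j # w))" for j
  have g: "g j \<in> free_comp n m" for j using Suc.prems by (auto simp: g_def free_comp_eq supp_on_def nwords_def)
  define var :: "nat \<Rightarrow> 'k ncpoly" where "var j = delta [j]" for j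
  have var: "var j \<in> free_comp n 1" if "j < n" for j
    using that by (auto simp: var_def free_comp_eq supp_on_def nwords_def delta_def)
  have pv: "pmul (var j) h w = (case w of [] \<Rightarrow> 0 | i # w' \<Rightarrow> if i = j then h w' else 0)" for j h w
    unfolding var_def by (rule pmul_letter_left)
  have f_eq: "f = (\<Sum>j<n. pmul (var j) (g j))"
  proof
    fix w show "f w = (\<Sum>j<n. pmul (var j) (g j)) w"
    proof (cases w)
      case Nil
      then show ?thesis using free_comp_len[OF Suc.prems, of w] by (simp add: sum_fun_apply pv)
    next
      case (Cons i w')
      have "(\<Sum>j<n. pmul (var j) (g j)) w = (\<Sum>j<n. if i = j then g j w' else 0)"
        by (simp add: sum_fun_apply pv Cons)
      also have "\<dots> = (if i < n then f w else 0)" by (simp add: g_def Cons)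
      also have "\<dots> = f w" using polysD[OF free_comp_polys[OF Suc.prems], of w] Cons by auto
      finally show ?thesis by simp
    qed
  qed
  have "\<forall>j. \<exists>t. t \<in> tens m \<and> g j - psi m t \<in> I" using Suc.IH[OF g] by blast
  then obtain t where t: "\<And>j. t j \<in> tens m" "\<And>j. g j - psi m (t j) \<in> I" by metis
  let ?t = "\<Sum>j<n. lm (cf (var j)) (t j)"
  have "?t \<in> tens (Suc m)"
    using t(1) by (intro tens_sum lm_tens)
  moreover have "f - psi (Suc m) ?t \<in> I"
  proof -
    have "pmul (var j) (g j) - psi (Suc m) (lm (cf (var j)) (t j)) \<in> I" if "j < n" for j
    proof -
      have "pmul (var j) (g j) - psi (Suc m) (lm (cf (var j)) (t j))
        = pmul (var j - lf (cf (var j))) (g j) + pmul (lf (cf (var j))) (g j - psi m (t j))"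
        by (simp add: psi_lm pmul_lin)
      moreover have "var j - lf (cf (var j)) \<in> I" using cf_V[OF var[OF that]] by (simp add: lf_def)
      ultimately show ?thesis
        using I_pmul(1)[OF _ free_comp_polys[OF g]] I_pmul(2)[OF t(2) free_comp_polys[OF lf_comp]] I_closed(1) by simp
    qed
    then have "(\<Sum>j<n. pmul (var j) (g j) - psi (Suc m) (lm (cf (var j)) (t j))) \<in> I" by (intro I_sum) auto
    then show ?thesis using f_eq by (simp add: lin_simps(6)[OF psi_lin] sum_subtractf)
  qed
  ultimately show ?case by blast
qed

definition lc :: "nat \<Rightarrow> nat \<Rightarrow> nat \<Rightarrow> 3 \<Rightarrow> 'k" where
  "lc k b b' = cf (lam k b b')"

lemma pmul_cong: "f - f' \<in> I \<Longrightarrow> g - g' \<in> I \<Longrightarrow> f \<in> polys n \<Longrightarrow> g' \<in> polys n \<Longrightarrow> pmul f g - pmul f' g' \<in> I"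
proof -
  assume *: "f - f' \<in> I" "g - g' \<in> I" "f \<in> polys n" "g' \<in> polys n"
  have "pmul f g - pmul f' g' = pmul f (g - g') + pmul (f - f') g'" by (simp add: pmul_lin)
  then show ?thesis using I_pmul(1)[OF *(1,4)] I_pmul(2)[OF *(2,3)] I_closed(1) by simp
qed

lemma I_cong: "f - g \<in> I \<Longrightarrow> f \<in> I \<longleftrightarrow> g \<in> I"
  using I_closed(1)[of "f - g" g] I_closed(2)[of f "f - g"] by auto

lemma sum_cong_I: "(\<And>i. i \<in> S \<Longrightarrow> f i - g i \<in> I) \<Longrightarrow> (\<Sum>i\<in>S. f i) - (\<Sum>i\<in>S. g i) \<in> I"
  using I_sum[of S "\<lambda>i. f i - g i"] by (simp add: sum_subtractf)

lemma lc_lam: "lf (lc k b b') - lam k b b' \<in> I"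
  using I_closed(5)[OF lf_lam[of k b b']] by (simp add: lc_def)

lemma psi_polys: "psi m t \<in> polys n"
  by (rule free_comp_polys[OF psi_comp])

lemma psi_rm_lc: "psi m t - f \<in> I \<Longrightarrow> psi (Suc m) (rm t (lc k b b')) - pmul f (lam k b b') \<in> I"
  unfolding psi_rm by (rule pmul_cong[OF _ lc_lam psi_polys lam_polys])

lemma hom_pmul_lam: "hom_part (Suc m) (pmul f (lam k b b')) = pmul (hom_part m f) (lam k b b')"
  "hom_part 0 (pmul f (lam k b b')) = 0"
  using pmul_hom[of 1 "lam k b b'" "Suc m" f] pmul_hom[of 1 "lam k b b'" 0 f] free_comp_len[OF lam_comp] by simp_all

text \<open>Exactness of the modules gives inhomogeneous coefficients. Taking homogeneous parts,
  which stay in the ideal, yields coefficients of the correct degree, and \<open>psi_onto\<close>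
  replaces them by tensors.\<close>

lemma resolution_coordinates: "resolution rels B lc"
proof
  have V0: "psi m 0 = 0" for m by (rule lin_simps(3)[OF psi_lin])
  show "fs.subspace (rels m)" for m
  proof -
    have "rels m = tens m \<inter> {t. psi m t \<in> I}" by (auto simp: rels_def)
    moreover have "fs.subspace {t. psi m t \<in> I}" by (rule fsp.linear_subspace_vimage[OF psi_lin I_subspace, unfolded vimage_def])
    moreover have "fs.subspace (tens m)" unfolding tens_def by (rule subspace_supp_on)
    ultimately show ?thesis using fs.subspace_inter by metis
  qed
  show "rels m \<subseteq> tens m" for m by (auto simp: rels_def)
  have "t = 0" if t: "t \<in> rels 0" for t
  proof -
    have "t [] = 0" using t I_const by (simp add: rels_def psi_0)
    then have "t w = 0" for w using t tensD[of t 0 w] by (cases w) (auto simp: rels_def)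
    then show ?thesis by (simp add: fun_eq_iff zero_fun_apply)
  qed
  moreover have "0 \<in> rels m" for m using I_closed(4) by (simp add: rels_def V0 tensI zero_fun_apply)
  ultimately show "rels 0 = {0}" by blast
  have "t = 0" if t: "t \<in> rels (Suc 0)" for t
  proof -
    have tt: "t \<in> tens (Suc 0)" using t by (simp add: rels_def)
    have "t = vec1 (\<lambda>i. t [i])"
      using tensD[OF tt] by (auto simp: vec1_def fun_eq_iff split: list.split)
    then have "lf (\<lambda>i. t [i]) \<in> I" using t psi_1 by (metis (mono_tags, lifting) mem_Collect_eq rels_def)
    then have "(\<lambda>i. t [i]) = 0" unfolding lf_def by (rule V_indep)
    then have "t [i] = 0" for i by (simp add: fun_eq_iff zero_fun_apply)
    then have "t w = 0" for w using tensD[OF tt, of w] by (cases "length w = Suc 0") (auto simp: length_Suc_conv)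
    then show ?thesis by (simp add: fun_eq_iff zero_fun_apply)
  qed
  then show "rels (Suc 0) = {0}" using \<open>\<And>m. 0 \<in> rels m\<close> by blast
  show "rm t v \<in> rels (Suc m)" "lm v t \<in> rels (Suc m)" if "t \<in> rels m" for t v m
    using that I_pmul[of "psi m t" "lf v"] free_comp_polys[OF lf_comp]
    by (simp_all add: rels_def psi_rm psi_lm rm_tens lm_tens)
  show "B 0 = {0}" by (rule B_0)
  have cf0: "cf 0 = 0" by (rule lin_simps(3)[OF cf])
  show "b \<in> B (Suc k) \<and> b' \<in> B k" if "lc k b b' \<noteq> 0" for k b b'
  proof (rule lam_supp)
    show "lam k b b' \<noteq> 0" using that cf0 by (metis lc_def)
  qed
  show "(\<Sum>b | lc (Suc k) c b \<noteq> 0. rank1 (lc (Suc k) c b) (lc k b b')) \<in> rels 2" for k c b'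
  proof -
    let ?S = "{b. lam (Suc k) c b \<noteq> 0}"
    have "(\<Sum>b | lc (Suc k) c b \<noteq> 0. rank1 (lc (Suc k) c b) (lc k b b')) = (\<Sum>b\<in>?S. rank1 (lc (Suc k) c b) (lc k b b'))"
      by (rule sum.mono_neutral_left[OF lam_fin]) (auto simp: rank1_eq_0 lc_def cf0)
    moreover have "(\<Sum>b\<in>?S. rank1 (lc (Suc k) c b) (lc k b b')) \<in> tens 2" by (intro tens_sum rank1_tens)
    moreover have "psi 2 (\<Sum>b\<in>?S. rank1 (lc (Suc k) c b) (lc k b b')) - (\<Sum>b\<in>?S. pmul (lam (Suc k) c b) (lam k b b')) \<in> I"
      unfolding lin_simps(6)[OF psi_lin] rm_vec1[symmetric] numeral_2_eq_2
      by (intro sum_cong_I psi_rm_lc) (simp add: psi_1 lc_lam)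
    ultimately show ?thesis using I_cong lam_complex by (simp add: rels_def)
  qed
  show "\<exists>S g. finite S \<and> S \<subseteq> B (Suc 0) \<and> (\<forall>c. g c \<in> tens m) \<and> t - (\<Sum>c\<in>S. rm (g c) (lc 0 c 0)) \<in> rels (Suc m)"
    if t: "t \<in> tens (Suc m)" for t m
  proof -
    obtain T g where T: "finite T" "T \<subseteq> B (Suc 0)" "\<And>c. g c \<in> polys n"
      "psi (Suc m) t - (\<Sum>c\<in>T. pmul (g c) (lam 0 c 0)) \<in> I"
      by (rule lam_exact_0[OF psi_polys[of "Suc m" t]]) (use free_comp_len[OF psi_comp] in auto)
    obtain s where s: "\<And>c. s c \<in> tens m" "\<And>c. hom_part m (g c) - psi m (s c) \<in> I"
      using psi_onto[OF hom_part_comp[OF T(3)]] by metis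
    have "hom_part (Suc m) (psi (Suc m) t - (\<Sum>c\<in>T. pmul (g c) (lam 0 c 0))) \<in> I" by (rule I_hom[OF T(4)])
    then have 1: "psi (Suc m) t - (\<Sum>c\<in>T. pmul (hom_part m (g c)) (lam 0 c 0)) \<in> I"
      using free_comp_len[OF psi_comp, of _ "Suc m" t]
      by (simp add: hom_part_lin hom_part_sum hom_pmul_lam hom_part_eq)
    have 2: "psi (Suc m) (\<Sum>c\<in>T. rm (s c) (lc 0 c 0)) - (\<Sum>c\<in>T. pmul (hom_part m (g c)) (lam 0 c 0)) \<in> I"
      unfolding lin_simps(6)[OF psi_lin] using I_closed(5)[OF s(2)] by (intro sum_cong_I psi_rm_lc) simp
    have "psi (Suc m) (t - (\<Sum>c\<in>T. rm (s c) (lc 0 c 0))) \<in> I"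
      using I_closed(2)[OF 1 2] by (simp add: lin_simps(5)[OF psi_lin])
    moreover have "t - (\<Sum>c\<in>T. rm (s c) (lc 0 c 0)) \<in> tens (Suc m)"
      by (intro tens_diff t tens_sum rm_tens s)
    ultimately show ?thesis using T(1,2) s(1) by (auto simp: rels_def)
  qed
  \<comment> \<open>Exactness writes the scalars, modulo the ideal, as combinations of linear
    entries; the part of degree zero then puts the constant \<open>u b\<close> into the
    ideal.\<close>
  show "u b = 0" if S: "finite S" "S \<subseteq> B (Suc k)" and z: "\<And>b'. (\<Sum>b\<in>S. scl (u b) (lc k b b')) = 0" and b: "b \<in> S" for S k u b
  proof -
    let ?f = "\<lambda>b. if b \<in> S then const_poly (u b) else 0 :: 'k ncpoly"
    have fp: "?f b \<in> polys n" for b using const_polys fs.subspace_0[OF polys_subspace] by auto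
    have "(\<Sum>b\<in>S. pmul (?f b) (lam k b b')) \<in> I" for b'
    proof -
      have "(\<Sum>b\<in>S. scl (u b) (lf (lc k b b'))) = lf (\<Sum>b\<in>S. scl (u b) (lc k b b'))"
        unfolding lf_def by (simp add: sum_fun_apply scl_apply fs.scale_sum_left fs.scale_sum_right fs.scale_scale) (rule sum.swap)
      then have "(\<Sum>b\<in>S. scl (u b) (lf (lc k b b'))) = 0" unfolding z by (simp add: lf_def zero_fun_apply)
      moreover have "(\<Sum>b\<in>S. scl (u b) (lf (lc k b b'))) - (\<Sum>b\<in>S. pmul (?f b) (lam k b b')) \<in> I"
        using I_closed(3)[OF lc_lam] by (intro sum_cong_I) (simp add: pmul_const fs.scale_right_diff_distrib)
      ultimately show ?thesis using I_closed(5) by fastforce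
    qed
    then have zI: "\<And>b'. (\<Sum>b\<in>S. pmul (?f b) (lam k b b')) \<in> I" .
    have f0: "\<And>b. b \<notin> S \<Longrightarrow> ?f b = 0" by simp
    obtain T g where g: "finite T" "T \<subseteq> B (Suc (Suc k))" "\<And>c. g c \<in> polys n"
      "\<And>b. ?f b - (\<Sum>c\<in>T. pmul (g c) (lam (Suc k) c b)) \<in> I"
      by (rule lam_exact[OF S fp f0 zI]) (assumption, rule that, assumption+)
    have "hom_part 0 (?f b - (\<Sum>c\<in>T. pmul (g c) (lam (Suc k) c b))) \<in> I" by (rule I_hom[OF g(4)])
    moreover have "hom_part 0 (const_poly (u b)) = const_poly (u b)" by (rule hom_part_eq) (simp add: const_poly_def)
    ultimately have "const_poly (u b) \<in> I" using b by (simp add: hom_part_lin hom_part_sum hom_pmul_lam)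
    then show ?thesis by (rule I_const)
  qed
  show "\<exists>T g. finite T \<and> T \<subseteq> B (Suc (Suc k)) \<and> (\<forall>c. g c \<in> tens m) \<and>
        (\<forall>b. f b - (\<Sum>c\<in>T. rm (g c) (lc (Suc k) c b)) \<in> rels (Suc m))"
    if S: "finite S" "S \<subseteq> B (Suc k)" and f: "\<And>b. f b \<in> tens (Suc m)" "\<And>b. b \<notin> S \<Longrightarrow> f b = 0"
      and z: "\<And>b'. (\<Sum>b\<in>S. rm (f b) (lc k b b')) \<in> rels (Suc (Suc m))" for S k f m
  proof -
    let ?F = "\<lambda>b. psi (Suc m) (f b)"
    have zI: "(\<Sum>b\<in>S. pmul (?F b) (lam k b b')) \<in> I" for b'
    proof -
      have "psi (Suc (Suc m)) (\<Sum>b\<in>S. rm (f b) (lc k b b')) - (\<Sum>b\<in>S. pmul (?F b) (lam k b b')) \<in> I"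
        unfolding lin_simps(6)[OF psi_lin] by (intro sum_cong_I psi_rm_lc) (simp add: I_closed(4))
      then show ?thesis using z I_cong by (auto simp: rels_def)
    qed
    obtain T g where T: "finite T" "T \<subseteq> B (Suc (Suc k))" "\<And>c. g c \<in> polys n"
      "\<And>b. ?F b - (\<Sum>c\<in>T. pmul (g c) (lam (Suc k) c b)) \<in> I"
      by (rule lam_exact[OF S, of ?F]) (use psi_polys f(2) V0 zI in auto)
    obtain s where s: "\<And>c. s c \<in> tens m" "\<And>c. hom_part m (g c) - psi m (s c) \<in> I"
      using psi_onto[OF hom_part_comp[OF T(3)]] by metis
    have "f b - (\<Sum>c\<in>T. rm (s c) (lc (Suc k) c b)) \<in> rels (Suc m)" for b
    proof -
      have "hom_part (Suc m) (?F b - (\<Sum>c\<in>T. pmul (g c) (lam (Suc k) c b))) \<in> I" by (rule I_hom[OF T(4)])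
      then have 1: "?F b - (\<Sum>c\<in>T. pmul (hom_part m (g c)) (lam (Suc k) c b)) \<in> I"
        using free_comp_len[OF psi_comp, of _ "Suc m" "f b"]
        by (simp add: hom_part_lin hom_part_sum hom_pmul_lam hom_part_eq)
      have 2: "psi (Suc m) (\<Sum>c\<in>T. rm (s c) (lc (Suc k) c b)) - (\<Sum>c\<in>T. pmul (hom_part m (g c)) (lam (Suc k) c b)) \<in> I"
        unfolding lin_simps(6)[OF psi_lin] using I_closed(5)[OF s(2)] by (intro sum_cong_I psi_rm_lc) simp
      have "psi (Suc m) (f b - (\<Sum>c\<in>T. rm (s c) (lc (Suc k) c b))) \<in> I"
        using I_closed(2)[OF 1 2] by (simp add: lin_simps(5)[OF psi_lin])
      moreover have "f b - (\<Sum>c\<in>T. rm (s c) (lc (Suc k) c b)) \<in> tens (Suc m)"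
        by (intro tens_diff f(1) tens_sum rm_tens s)
      ultimately show ?thesis by (simp add: rels_def)
    qed
    then show ?thesis using T(1,2) s(1) by blast
  qed
qed

text \<open>Relations of degree \<open>m\<close> are exactly the annihilator of
  \<open>sol m (rels 2)\<close>, so a basis of the latter gives coordinates on the
  component.\<close>

lemma comp_dim_coordinates: "comp_dim n I m = fs.dim (sol m (rels 2))"
proof -
  interpret R: resolution rels B lc by (rule resolution_coordinates)
  obtain E where E: "E \<subseteq> sol m (rels 2)" "finite E" "fs.independent E" "fs.span E = sol m (rels 2)" "card E = fs.dim (sol m (rels 2))"
    by (rule fin_dim_basis[OF subspace_sol fin_dim_sol])
  let ?phi = "\<lambda>f a. if a \<in> E then pair (words m) a f else 0"
  have "comp_dim n I m = card E"
  proof (rule comp_dim_eqI[where psi = "psi m" and T = "tens m" and phi = ?phi])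
    show "lin ?phi" by (rule linI) (auto simp: fun_eq_iff pointwise pair_lin)
    show "psi m ` tens m \<subseteq> free_comp n m" using psi_comp by blast
    show "fs.subspace (tens m)" unfolding tens_def by (rule subspace_supp_on)
    show "?phi t = 0 \<longleftrightarrow> psi m t \<in> I" if t: "t \<in> tens m" for t
    proof -
      have "?phi t = 0 \<longleftrightarrow> t \<in> perp (words m) E" using t by (auto simp: perp_def fun_eq_iff zero_fun_apply tens_def)
      also have "perp (words m) E = perp (words m) (sol m (rels 2))" using perp_span[of "words m" E] E(4) by simp
      also have "\<dots> = rels m" by (rule R.J_eq[symmetric])
      finally show ?thesis using t by (simp add: rels_def)
    qed
    show "?phi ` tens m = supp_on E"
      unfolding tens_def by (rule pairing_surj[OF finite_words E(2) _ E(3)]) (use E(1) sol_tens in \<open>auto simp: tens_def\<close>)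
  qed (use psi_lin psi_onto E(2) in auto)
  then show ?thesis using E(5) by simp
qed

lemma comp_dim_sequence:
  assumes "comp_dim n I 2 = 3"
  shows "\<exists>j\<in>{2, 5, 6, 7, 8, 9, 10, 11}. \<forall>m. comp_dim n I m = hs j m"
proof -
  interpret R: resolution rels B lc by (rule resolution_coordinates)
  interpret T: three_rel "rels 2" by standard (use assms in \<open>simp add: comp_dim_coordinates\<close>)
  show ?thesis unfolding comp_dim_coordinates by (rule T.dim_sequences_any_field[OF R.euler_characteristic])
qed

end

end

theorem koszul_comp_dim:
  fixes I :: "'k::field ncpoly set"
  assumes "koszul n I" "comp_dim n I 1 = 3" "comp_dim n I 2 = 3"
  shows "\<exists>j\<in>{2, 5, 6, 7, 8, 9, 10, 11}. \<forall>m. comp_dim n I m = hs j m"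
proof -
  interpret graded_ideal n I by standard (use assms(1) in \<open>simp add: koszul_def\<close>)
  obtain B D where "linear_resolution n I B D" by (rule koszul_linear_resolution[OF assms(1)])
  then interpret linear_resolution n I B D .
  obtain V :: "3 \<Rightarrow> 'k ncpoly" and cf where V: "lin cf" "\<And>i. V i \<in> free_comp n 1"
    "\<And>f. f \<in> free_comp n 1 \<Longrightarrow> f - (\<Sum>i\<in>UNIV. scl (cf f i) (V i)) \<in> I"
    "\<And>c. (\<Sum>i\<in>UNIV. scl (c i) (V i)) \<in> I \<Longrightarrow> c = 0"
    by (rule ex_coordinates[OF assms(2)]) (rule that, assumption+)
  show ?thesis by (rule comp_dim_sequence[of cf V, OF V assms(3)])
qed

section \<open>The Hilbert series\<close>

definition hser :: "nat \<Rightarrow> rat fps" where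
  "hser j = Abs_fps (\<lambda>m. of_nat (hs j m))"

lemma hser_nth: "fps_nth (hser j) m = of_nat (hs j m)"
  by (simp add: hser_def)

lemma small_cases: "(m::nat) = 0 \<or> m = 1 \<or> m = 2 \<or> m = 3 \<or> m = 4 \<or> (\<exists>l. m = Suc (Suc (Suc (Suc (Suc l)))))"
  by presburger

lemma fps_quotient: "S * b = c \<Longrightarrow> b \<noteq> 0 \<Longrightarrow> S = c / b" for S :: "rat fps"
  by auto

lemma one_minus_X: "1 - fps_X \<noteq> (0 :: rat fps)"
proof
  assume "1 - fps_X = (0 :: rat fps)"
  then have "fps_nth (1 - fps_X) 0 = (0 :: rat)" by simp
  then show False by simp
qed

lemma mult_one_minus_X: "fps_nth (S * (1 - fps_X)) m = fps_nth S m - (if m = 0 then 0 else fps_nth S (m - 1))"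
  for S :: "rat fps"
  by (simp add: right_diff_distrib fps_X_mult_right_nth)

lemma X_nth: "fps_nth (fps_X :: rat fps) m = (if m = 1 then 1 else 0)" "fps_nth (fps_X ^ k :: rat fps) m = (if m = k then 1 else 0)"
  "fps_nth (1 :: rat fps) m = (if m = 0 then 1 else 0)"
  "fps_nth (numeral a * F :: rat fps) m = numeral a * fps_nth F m"
  "fps_nth (numeral a :: rat fps) m = (if m = 0 then numeral a else 0)"
  by (simp_all add: fps_X_power_nth fps_numeral_fps_const)

lemma hs_3_Fib: "hs 11 3 = 5" "hs 11 4 = 8"
  using card_no_square_3 card_no_square[of 2] by (simp_all add: hs_def numeral_eq_Suc)

text \<open>The quotients are compared coefficientwise after multiplication by the denominator; for
  index 11 this is the Fibonacci recursion.\<close>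

lemma hser_H: "j \<in> {1, 2, 3, 4, 5, 6, 7, 8, 9, 10, 11} \<Longrightarrow> hser j = H j"
proof -
  have P: "hser 1 = H 1" "hser 4 = H 4" "hser 5 = H 5"
    by (rule fps_ext, auto simp: H_def Let_def hser_nth hs_def X_nth)+
  have cube: "(1 + fps_X :: rat fps) ^ 3 = 1 + 3 * fps_X + 3 * fps_X ^ 2 + fps_X ^ 3"
    by (simp add: power2_eq_square power3_eq_cube algebra_simps)
  have P2: "hser 2 = H 2"
    unfolding H_def Let_def cube by (rule fps_ext) (auto simp: hser_nth hs_def X_nth)
  have Q: "hser 3 * (1 - fps_X) = 1 + 2 * fps_X - 2 * fps_X ^ 3"
    "hser 6 * (1 - fps_X) = 1 + 2 * fps_X - fps_X ^ 3 - fps_X ^ 4"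
    "hser 7 * (1 - fps_X) = 1 + 2 * fps_X - fps_X ^ 3"
    "hser 8 * (1 - fps_X) = 1 + 2 * fps_X"
    "hser 9 * (1 - fps_X) = 1 + 2 * fps_X + fps_X ^ 3"
    by (rule fps_ext, unfold mult_one_minus_X, auto simp: hser_nth hs_def X_nth)+
  have Q': "hser 3 = H 3" "hser 6 = H 6" "hser 7 = H 7" "hser 8 = H 8" "hser 9 = H 9"
    using Q[THEN fps_quotient, OF one_minus_X] by (simp_all add: H_def Let_def)
  have P10: "hser 10 = H 10"
  proof -
    have "hser 10 * (1 - fps_X) * (1 - fps_X) = 1 + fps_X - 2 * fps_X ^ 2 + fps_X ^ 3"
      by (rule fps_ext, unfold mult_one_minus_X, auto simp: hser_nth hs_def X_nth)
    then have "hser 10 = (1 + fps_X - 2 * fps_X ^ 2 + fps_X ^ 3) / (1 - fps_X) ^ 2"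
      by (intro fps_quotient) (simp_all add: power2_eq_square mult.assoc one_minus_X)
    then show ?thesis by (simp add: H_def Let_def)
  qed
  have P11: "hser 11 = H 11"
  proof -
    have "hser 11 * (1 - fps_X - fps_X ^ 2) = 1 + 2 * fps_X - fps_X ^ 2 - fps_X ^ 3"
    proof (rule fps_ext)
      fix m
      have e: "fps_nth (hser 11 * (1 - fps_X - fps_X ^ 2)) m =
        fps_nth (hser 11) m - (if m = 0 then 0 else fps_nth (hser 11) (m - 1)) - (if m < 2 then 0 else fps_nth (hser 11) (m - 2))"
        by (simp add: right_diff_distrib fps_X_mult_right_nth fps_X_power_mult_right_nth)
      show "fps_nth (hser 11 * (1 - fps_X - fps_X ^ 2)) m = fps_nth (1 + 2 * fps_X - fps_X ^ 2 - fps_X ^ 3) m"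
        unfolding e using small_cases[of m]
      proof (elim disjE exE)
        fix l assume m: "m = Suc (Suc (Suc (Suc (Suc l))))"
        have "hs 11 m = hs 11 (m - 1) + hs 11 (m - 2)"
          unfolding m using card_no_square[of "Suc (Suc (Suc l))"] by (simp add: hs_def)
        then show "fps_nth (hser 11) m - (if m = 0 then 0 else fps_nth (hser 11) (m - 1)) - (if m < 2 then 0 else fps_nth (hser 11) (m - 2))
          = fps_nth (1 + 2 * fps_X - fps_X ^ 2 - fps_X ^ 3) m"
          using m by (simp add: hser_nth X_nth)
      qed (simp_all add: hser_nth X_nth hs_3_Fib, simp_all add: hs_def)
    qed
    moreover have "1 - fps_X - fps_X ^ 2 \<noteq> (0 :: rat fps)"
    proof
      assume *: "1 - fps_X - fps_X ^ 2 = (0 :: rat fps)"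
      have "fps_nth (1 - fps_X - fps_X ^ 2) 0 = (0 :: rat)" unfolding * by simp
      then show False by (simp only: fps_sub_nth X_nth) simp
    qed
    ultimately have "hser 11 = (1 + 2 * fps_X - fps_X ^ 2 - fps_X ^ 3) / (1 - fps_X - fps_X ^ 2)" by (rule fps_quotient)
    then show ?thesis by (simp add: H_def Let_def)
  qed
  show "j \<in> {1, 2, 3, 4, 5, 6, 7, 8, 9, 10, 11} \<Longrightarrow> hser j = H j" using P P2 Q' P10 P11 by blast
qed

lemma hilbert_series_hs:
  assumes "j \<in> {1, 2, 3, 4, 5, 6, 7, 8, 9, 10, 11}"
  shows "hilbert_series n I = H j \<longleftrightarrow> (\<forall>m. comp_dim n I m = hs j m)"
  unfolding hser_H[OF assms, symmetric] by (simp add: hilbert_series_def fps_eq_iff hser_nth)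

text \<open>Degrees three and four already separate the excluded sequences from the listed
  ones.\<close>

lemma hs_distinct: "i \<in> {1, 3, 4} \<Longrightarrow> j \<in> {2, 5, 6, 7, 8, 9, 10, 11} \<Longrightarrow> \<exists>m. hs i m \<noteq> hs j m"
proof -
  assume ij: "i \<in> {1, 3, 4}" "j \<in> {2, 5, 6, 7, 8, 9, 10, 11}"
  have "hs i 3 \<noteq> hs j 3 \<or> hs i 4 \<noteq> hs j 4"
    using ij by (elim insertE emptyE) (simp_all add: hs_3_Fib, simp_all add: hs_def)
  then show ?thesis by blast
qed

theorem not_koszul:
  assumes "i \<in> {1, 3, 4}" "hilbert_series n I = H i"
  shows "\<not> koszul n I"
proof
  assume K: "koszul n I"
  have c: "comp_dim n I m = hs i m" for m
    using assms hilbert_series_hs[of i n I] by auto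
  have "comp_dim n I 1 = 3" "comp_dim n I 2 = 3" unfolding c by (simp_all add: hs_def)
  then obtain j where "j \<in> {2, 5, 6, 7, 8, 9, 10, 11}" "\<forall>m. comp_dim n I m = hs j m"
    using koszul_comp_dim[OF K] by blast
  then show False using hs_distinct[OF assms(1)] c by metis
qed

section \<open>A criterion for Koszulness\<close>

text \<open>Iterating the annihilators of the linear forms \<open>l i\<close>, which are generated by such forms again, produces
  a resolution whose free modules have bases of words in the indices.\<close>

declare list_encode.simps [simp del]

locale koszul_forms = graded_ideal n I for n and I :: "'k::field ncpoly set" +
  fixes S :: "nat set" and P0 :: "nat set" and P :: "nat \<Rightarrow> nat set" and l :: "nat \<Rightarrow> 'k ncpoly"
  assumes P_S: "finite S" "P0 \<subseteq> S" "j \<in> S \<Longrightarrow> P j \<subseteq> S"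
    and l_comp: "i \<in> S \<Longrightarrow> l i \<in> free_comp n 1"
    and generate: "f \<in> polys n \<Longrightarrow> f [] = 0 \<Longrightarrow>
      \<exists>a. (\<forall>i. a i \<in> polys n) \<and> f - (\<Sum>i\<in>P0. pmul (a i) (l i)) \<in> I"
    and annihilator: "j \<in> S \<Longrightarrow> f \<in> polys n \<Longrightarrow> pmul f (l j) \<in> I \<Longrightarrow>
      \<exists>a. (\<forall>i. a i \<in> polys n) \<and> f - (\<Sum>i\<in>P j. pmul (a i) (l i)) \<in> I"
    and product: "j \<in> S \<Longrightarrow> i \<in> P j \<Longrightarrow> pmul (l i) (l j) \<in> I"
    and direct_0: "(\<And>i. a i \<in> polys n) \<Longrightarrow> (\<Sum>i\<in>P0. pmul (a i) (l i)) \<in> I \<Longrightarrow> i \<in> P0 \<Longrightarrow> pmul (a i) (l i) \<in> I"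
    and direct: "j \<in> S \<Longrightarrow> (\<And>i. a i \<in> polys n) \<Longrightarrow> (\<Sum>i\<in>P j. pmul (a i) (l i)) \<in> I \<Longrightarrow> i \<in> P j \<Longrightarrow> pmul (a i) (l i) \<in> I"
begin

text \<open>The letters that may be put in front of \<open>w\<close>: they index generators of the
  left annihilator of the form at its first letter, or of the augmentation ideal when
  \<open>w\<close> is empty.\<close>

definition pred :: "nat list \<Rightarrow> nat set" where
  "pred w = (case w of [] \<Rightarrow> P0 | j # _ \<Rightarrow> P j)"

primrec Wd :: "nat \<Rightarrow> nat list set" where
  "Wd 0 = {[]}"
| "Wd (Suc k) = {i # w |i w. w \<in> Wd k \<and> i \<in> pred w}"

definition B :: "nat \<Rightarrow> nat set" where "B k = list_encode ` Wd k"

abbreviation "M k \<equiv> free_module n I k (B k)"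

definition rep :: "'k ncpoly set \<Rightarrow> 'k ncpoly" where
  "rep Z = (SOME f. f \<in> polys n \<and> q f = Z)"

text \<open>The component at \<open>w\<close> of the differential that sends the basis element at i
  w to \<open>l i\<close> times the basis element at w. It is computed with representatives;
  \<open>D_eq\<close> shows that their choice does not matter.\<close>

definition D :: "(nat \<Rightarrow> 'k ncpoly set) \<Rightarrow> nat list \<Rightarrow> 'k ncpoly set" where
  "D x w = q (\<Sum>i\<in>pred w. pmul (rep (x (list_encode (i # w)))) (l i))"

definition dd :: "nat \<Rightarrow> (nat \<Rightarrow> 'k ncpoly set) \<Rightarrow> nat \<Rightarrow> 'k ncpoly set" where
  "dd k x = (\<lambda>b. if b \<in> B k then D x (list_decode b) else \<zero>\<^bsub>A\<^esub>)"

lemma Wd_S: "w \<in> Wd k \<Longrightarrow> set w \<subseteq> S"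
proof (induction k arbitrary: w)
  case (Suc k)
  then obtain i v where v: "w = i # v" "v \<in> Wd k" "i \<in> pred v" by auto
  then have "pred v \<subseteq> S" using Suc.IH[of v] P_S(2,3) by (cases v) (auto simp: pred_def)
  then show ?case using v Suc.IH by auto
qed simp

lemma pred_S: "w \<in> Wd k \<Longrightarrow> pred w \<subseteq> S"
  using Wd_S[of w k] P_S by (cases w) (auto simp: pred_def)

lemma finite_B: "finite (B k)"
proof -
  have "finite (Wd k)"
  proof (induction k)
    case (Suc k)
    have "Wd (Suc k) \<subseteq> (\<lambda>(i, w). i # w) ` (S \<times> Wd k)" using pred_S by auto
    then show ?case using Suc P_S(1) finite_subset by blast
  qed simp
  then show ?thesis by (simp add: B_def)
qed

lemma B_encode: "list_encode w \<in> B k \<longleftrightarrow> w \<in> Wd k"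
  by (auto simp: B_def dest: list_encode_eq[THEN iffD1])

lemma B_decode: "b \<in> B k \<Longrightarrow> list_decode b \<in> Wd k"
  by (auto simp: B_def)

lemma carrier_rep: "Z \<in> carrier A \<Longrightarrow> rep Z \<in> polys n \<and> q (rep Z) = Z"
  unfolding rep_def carrier_A by (rule someI_ex[where P = "\<lambda>f. f \<in> polys n \<and> q f = Z"]) blast

lemma l_polys: "i \<in> S \<Longrightarrow> l i \<in> polys n"
  using l_comp free_comp_polys by blast

lemma sum_polys: "(\<And>i. i \<in> T \<Longrightarrow> f i \<in> polys n) \<Longrightarrow> (\<Sum>i\<in>T. f i) \<in> polys n"
  by (rule fs.subspace_sum[OF polys_subspace])

lemma D_eq:
  assumes "w \<in> Wd k" "\<And>i. i \<in> pred w \<Longrightarrow> f i \<in> polys n" "\<And>i. i \<in> pred w \<Longrightarrow> q (f i) = x (list_encode (i # w))"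
  shows "D x w = q (\<Sum>i\<in>pred w. pmul (f i) (l i))"
proof -
  have "pmul (rep (x (list_encode (i # w)))) (l i) - pmul (f i) (l i) \<in> I" if i: "i \<in> pred w" for i
  proof -
    have "x (list_encode (i # w)) \<in> carrier A" using q_carrier[OF assms(2)[OF i]] assms(3)[OF i] by simp
    then have "q (rep (x (list_encode (i # w)))) = q (f i)" using carrier_rep assms(3)[OF i] by simp
    then have "rep (x (list_encode (i # w))) - f i \<in> I" by (simp add: q_eq)
    then show ?thesis using I_pmul(1) l_polys pred_S[OF assms(1)] i by (metis pmul_lin(7) subsetD)
  qed
  then show ?thesis unfolding D_def q_eq sum_subtractf[symmetric] by (rule I_sum)
qed

lemma M_carrier: "x \<in> carrier (M k) \<longleftrightarrow> (\<forall>b. x b \<in> carrier A) \<and> (\<forall>b. b \<notin> B k \<longrightarrow> x b = \<zero>\<^bsub>A\<^esub>)"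
proof -
  have "finite {b. x b \<noteq> \<zero>\<^bsub>A\<^esub>}" if "\<forall>b. b \<notin> B k \<longrightarrow> x b = \<zero>\<^bsub>A\<^esub>"
    by (rule finite_subset[OF _ finite_B[of k]]) (use that in auto)
  then show ?thesis by (auto simp: free_module_simps)
qed

lemma D_rep:
  assumes "w \<in> Wd k" "x \<in> carrier (M m)"
  shows "D x w = q (\<Sum>i\<in>pred w. pmul (rep (x (list_encode (i # w)))) (l i))"
    "(\<Sum>i\<in>pred w. pmul (rep (x (list_encode (i # w)))) (l i)) \<in> polys n"
    "rep (x b) \<in> polys n" "q (rep (x b)) = x b"
  using assms carrier_rep l_polys pred_S[OF assms(1)]
  by (auto simp: D_def M_carrier intro!: sum_polys pmul_polys)

lemma D_hom:
  assumes w: "w \<in> Wd k"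
  shows "x \<in> carrier (M m) \<Longrightarrow> D x w \<in> carrier A"
    "x \<in> carrier (M m) \<Longrightarrow> y \<in> carrier (M m) \<Longrightarrow> D (\<lambda>b. x b \<oplus>\<^bsub>A\<^esub> y b) w = D x w \<oplus>\<^bsub>A\<^esub> D y w"
    "a \<in> carrier A \<Longrightarrow> x \<in> carrier (M m) \<Longrightarrow> D (\<lambda>b. a \<otimes>\<^bsub>A\<^esub> x b) w = a \<otimes>\<^bsub>A\<^esub> D x w"
proof -
  note R = D_rep[OF w]
  let ?r = "\<lambda>x i. rep (x (list_encode (i # w)))"
  show "x \<in> carrier (M m) \<Longrightarrow> D x w \<in> carrier A"
    unfolding D_def by (rule q_carrier[OF R(2)])
  show "D (\<lambda>b. x b \<oplus>\<^bsub>A\<^esub> y b) w = D x w \<oplus>\<^bsub>A\<^esub> D y w" if x: "x \<in> carrier (M m)" and y: "y \<in> carrier (M m)"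
  proof -
    have "D (\<lambda>b. x b \<oplus>\<^bsub>A\<^esub> y b) w = q (\<Sum>i\<in>pred w. pmul (?r x i + ?r y i) (l i))"
      using R(3,4)[OF x] R(3,4)[OF y] q_add
      by (intro D_eq[OF w] fs.subspace_add[OF polys_subspace]) (simp_all flip: q_add)
    also have "\<dots> = q ((\<Sum>i\<in>pred w. pmul (?r x i) (l i)) + (\<Sum>i\<in>pred w. pmul (?r y i) (l i)))"
      by (simp add: pmul_lin sum.distrib)
    finally show ?thesis using R(1,2)[OF x] R(1,2)[OF y] q_add by simp
  qed
  show "D (\<lambda>b. a \<otimes>\<^bsub>A\<^esub> x b) w = a \<otimes>\<^bsub>A\<^esub> D x w" if a: "a \<in> carrier A" and x: "x \<in> carrier (M m)"
  proof -
    obtain c where c: "c \<in> polys n" "a = q c" using a by (auto simp: carrier_A)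
    have "D (\<lambda>b. a \<otimes>\<^bsub>A\<^esub> x b) w = q (\<Sum>i\<in>pred w. pmul (pmul c (?r x i)) (l i))"
      using R(3,4)[OF x] c q_mult by (intro D_eq[OF w] pmul_polys) (simp_all flip: q_mult)
    also have "\<dots> = q (pmul c (\<Sum>i\<in>pred w. pmul (?r x i) (l i)))" by (simp add: pmul_sum pmul_assoc)
    finally show ?thesis using R(1,2)[OF x] c q_mult by simp
  qed
qed

lemma D_grade:
  assumes w: "w \<in> Wd k" and x: "x \<in> grade (M (Suc k)) j"
  shows "D x w \<in> (if k \<le> j then alg_comp n I (j - k) else {\<zero>\<^bsub>A\<^esub>})"
proof (cases "Suc k \<le> j")
  case True
  have "\<forall>b. \<exists>f. f \<in> free_comp n (j - Suc k) \<and> q f = x b"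
    using x True by (auto simp: free_module_simps(5) alg_comp_eq image_iff) metis
  then obtain f where f: "\<And>b. f b \<in> free_comp n (j - Suc k)" "\<And>b. q (f b) = x b" by metis
  have "D x w = q (\<Sum>i\<in>pred w. pmul (f (list_encode (i # w))) (l i))"
    by (rule D_eq[OF w free_comp_polys[OF f(1)] f(2)])
  moreover have "(\<Sum>i\<in>pred w. pmul (f (list_encode (i # w))) (l i)) \<in> free_comp n (j - k)"
  proof (rule fs.subspace_sum[OF subspace_free_comp])
    fix i assume "i \<in> pred w"
    then have "l i \<in> free_comp n 1" using l_comp pred_S[OF w] by blast
    then show "pmul (f (list_encode (i # w))) (l i) \<in> free_comp n (j - k)"
      using pmul_comp[OF f(1)] True by (metis Suc_diff_Suc Suc_eq_plus1 Suc_le_lessD)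
  qed
  ultimately show ?thesis using True by (simp add: alg_comp_eq)
next
  case False
  have "D x w = q (\<Sum>i\<in>pred w. pmul 0 (l i))"
    by (rule D_eq[OF w]) (use x False q_0 fs.subspace_0[OF polys_subspace] in \<open>auto simp: free_module_simps(5)\<close>)
  then have "D x w = \<zero>\<^bsub>A\<^esub>" by (simp add: pmul_lin q_0)
  then show ?thesis using zero_alg_comp by simp
qed

lemma dd_hom: "dd k \<in> graded_module_hom A (M (Suc k)) (M k)"
proof -
  have c: "dd k x \<in> carrier (M k)" if "x \<in> carrier (M (Suc k))" for x
    using D_hom(1)[OF B_decode that] A.zero_closed by (simp add: M_carrier dd_def)
  have g: "dd k x \<in> grade (M k) j" if x: "x \<in> grade (M (Suc k)) j" for x j
    using c x D_grade[OF B_decode x] zero_alg_comp unfolding free_module_simps(5) by (auto simp: dd_def)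
  have "dd k (\<lambda>b. x b \<oplus>\<^bsub>A\<^esub> y b) = (\<lambda>b. dd k x b \<oplus>\<^bsub>A\<^esub> dd k y b)"
    if "x \<in> carrier (M (Suc k))" "y \<in> carrier (M (Suc k))" for x y
    using D_hom(2)[OF B_decode that] by (intro ext) (simp add: dd_def)
  moreover have "dd k (\<lambda>b. a \<otimes>\<^bsub>A\<^esub> x b) = (\<lambda>b. a \<otimes>\<^bsub>A\<^esub> dd k x b)"
    if "a \<in> carrier A" "x \<in> carrier (M (Suc k))" for a x
    using D_hom(3)[OF B_decode that] that(1) by (intro ext) (simp add: dd_def)
  ultimately show ?thesis unfolding graded_module_hom_def free_module_simps(3,4) using c g by auto
qed

text \<open>Directness makes every term of a vanishing sum vanish by itself. Each coefficient is
  then annihilated by a single form, hence is a combination of the generators of its annihilator,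
  and these index the words longer by one letter.\<close>

lemma D_exact:
  assumes x: "x \<in> carrier (M (Suc k))"
  shows "(\<forall>w\<in>Wd k. D x w = \<zero>\<^bsub>A\<^esub>) \<longleftrightarrow> x \<in> dd (Suc k) ` carrier (M (Suc (Suc k)))"
proof
  assume *: "\<forall>w\<in>Wd k. D x w = \<zero>\<^bsub>A\<^esub>"
  have "\<exists>a. (\<forall>j. a j \<in> polys n) \<and> rep (x (list_encode v)) - (\<Sum>j\<in>pred v. pmul (a j) (l j)) \<in> I"
    if "v \<in> Wd (Suc k)" for v
  proof -
    obtain i w where v: "v = i # w" "w \<in> Wd k" "i \<in> pred w" using \<open>v \<in> Wd (Suc k)\<close> by auto
    note R = D_rep[OF v(2) x]
    have "D x w = \<zero>\<^bsub>A\<^esub>" using * v(2) by blast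
    then have "(\<Sum>i\<in>pred w. pmul (rep (x (list_encode (i # w)))) (l i)) \<in> I" unfolding R(1) q_eq_0 .
    then have "pmul (rep (x (list_encode v))) (l i) \<in> I"
      using direct_0[of "\<lambda>i. rep (x (list_encode (i # w)))" i] direct[of "hd w" "\<lambda>i. rep (x (list_encode (i # w)))" i] R(3) v Wd_S[OF v(2)]
      by (cases w) (auto simp: pred_def)
    moreover have "i \<in> S" using v pred_S by blast
    ultimately show ?thesis using annihilator[of i "rep (x (list_encode v))"] R(3) v(1) by (simp add: pred_def)
  qed
  then have "\<exists>a. \<forall>v\<in>Wd (Suc k). (\<forall>j. a v j \<in> polys n) \<and> rep (x (list_encode v)) - (\<Sum>j\<in>pred v. pmul (a v j) (l j)) \<in> I"
    by (intro bchoice ballI)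
  then obtain a where a: "\<And>v j. v \<in> Wd (Suc k) \<Longrightarrow> a v j \<in> polys n"
    "\<And>v. v \<in> Wd (Suc k) \<Longrightarrow> rep (x (list_encode v)) - (\<Sum>j\<in>pred v. pmul (a v j) (l j)) \<in> I" by blast
  define y where "y b = (if b \<in> B (Suc (Suc k)) then q (a (tl (list_decode b)) (list_decode b ! 0)) else \<zero>\<^bsub>A\<^esub>)" for b
  have y: "y (list_encode (j # v)) = q (a v j)" if "v \<in> Wd (Suc k)" "j \<in> pred v" for j v
    using that by (auto simp: y_def B_encode)
  have "y \<in> carrier (M (Suc (Suc k)))"
    unfolding M_carrier
  proof (intro conjI allI impI)
    fix b show "y b \<in> carrier A"
      using B_decode[of b "Suc (Suc k)"] by (auto simp: y_def intro!: q_carrier a(1))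
  qed (simp add: y_def)
  moreover have "x = dd (Suc k) y"
  proof
    fix b show "x b = dd (Suc k) y b"
    proof (cases "b \<in> B (Suc k)")
      case True
      then have v: "list_decode b \<in> Wd (Suc k)" by (rule B_decode)
      have "D y (list_decode b) = q (\<Sum>j\<in>pred (list_decode b). pmul (a (list_decode b) j) (l j))"
        by (rule D_eq[OF v]) (use a(1)[OF v] y[OF v] in auto)
      also have "\<dots> = q (rep (x b))" using a(2)[OF v] by (simp flip: q_eq)
      also have "\<dots> = x b" using carrier_rep x by (simp add: M_carrier)
      finally show ?thesis using True by (simp add: dd_def)
    next
      case False
      then show ?thesis using x by (simp add: M_carrier dd_def)
    qed
  qed
  ultimately show "x \<in> dd (Suc k) ` carrier (M (Suc (Suc k)))" by blast
next
  assume "x \<in> dd (Suc k) ` carrier (M (Suc (Suc k)))"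
  then obtain y where y: "y \<in> carrier (M (Suc (Suc k)))" "x = dd (Suc k) y" by blast
  show "\<forall>w\<in>Wd k. D x w = \<zero>\<^bsub>A\<^esub>"
  proof
    fix w assume w: "w \<in> Wd k"
    let ?f = "\<lambda>i. \<Sum>j\<in>P i. pmul (rep (y (list_encode (j # i # w)))) (l j)"
    have iw: "i # w \<in> Wd (Suc k)" "i \<in> S" if "i \<in> pred w" for i using that w pred_S by auto
    have "D x w = q (\<Sum>i\<in>pred w. pmul (?f i) (l i))"
    proof (rule D_eq[OF w])
      fix i assume i: "i \<in> pred w"
      show "?f i \<in> polys n" using D_rep(2)[OF iw(1)[OF i] y(1)] by (simp add: pred_def)
      show "q (?f i) = x (list_encode (i # w))"
        using D_rep(1)[OF iw(1)[OF i] y(1)] iw(1)[OF i] unfolding y(2) by (simp add: dd_def B_encode pred_def)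
    qed
    moreover have "(\<Sum>i\<in>pred w. pmul (?f i) (l i)) \<in> I"
    proof (rule I_sum)
      fix i assume i: "i \<in> pred w"
      have "pmul (?f i) (l i) = (\<Sum>j\<in>P i. pmul (rep (y (list_encode (j # i # w)))) (pmul (l j) (l i)))"
        by (simp add: pmul_sum pmul_assoc)
      also have "\<dots> \<in> I"
        by (rule I_sum, rule I_pmul(2)[OF product[OF iw(2)[OF i]] D_rep(3)[OF w y(1)]])
      finally show "pmul (?f i) (l i) \<in> I" .
    qed
    ultimately show "D x w = \<zero>\<^bsub>A\<^esub>" by (simp add: q_eq_0)
  qed
qed

lemma regular_simps:
  "carrier (regular_module n I) = carrier A" "zero (regular_module n I) = \<zero>\<^bsub>A\<^esub>"
  "add (regular_module n I) = add A" "module.smult (regular_module n I) = mult A" "grade (regular_module n I) = alg_comp n I"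
  by (simp_all add: regular_module_def)

lemma augmentation_q: "f \<in> polys n \<Longrightarrow> augmentation (q f) = f []"
  unfolding q_def using augmentation_coset[OF pgi] by (simp add: free_algebra_fold)

lemma augmentation_hom: "augmentation \<in> graded_module_hom A (regular_module n I) trivial_module"
proof -
  have "augmentation (Z \<oplus>\<^bsub>A\<^esub> Y) = augmentation Z + augmentation Y" if ZY: "Z \<in> carrier A" "Y \<in> carrier A" for Z Y
  proof -
    obtain f g where "f \<in> polys n" "g \<in> polys n" "Z = q f" "Y = q g" using ZY by (auto simp: carrier_A)
    then show ?thesis using fs.subspace_add[OF polys_subspace, of f n g] by (simp add: q_add augmentation_q plus_fun_apply)
  qed
  moreover have "augmentation (Z \<otimes>\<^bsub>A\<^esub> Y) = augmentation Z * augmentation Y" if ZY: "Z \<in> carrier A" "Y \<in> carrier A" for Z Y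
  proof -
    obtain f g where "f \<in> polys n" "g \<in> polys n" "Z = q f" "Y = q g" using ZY by (auto simp: carrier_A)
    then show ?thesis using pmul_polys[of f n g] by (simp add: q_mult augmentation_q) (simp add: pmul_def)
  qed
  moreover have "augmentation ` alg_comp n I j \<subseteq> (if j = 0 then UNIV else {0})" for j
    using free_comp_len[of _ n j "[]"] by (auto simp: alg_comp_eq augmentation_q[OF free_comp_polys])
  ultimately show ?thesis
    unfolding graded_module_hom_def regular_simps by (auto simp: trivial_module_def)
qed

theorem koszul: "koszul n I"
proof -
  let ?A' = "regular_module n I"
  let ?e = "\<lambda>x. D x []"
  have W0: "[] \<in> Wd 0" by simp
  have e_hom: "?e \<in> graded_module_hom A (M 1) ?A'"
    unfolding graded_module_hom_def regular_simps free_module_simps(3,4)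
    using D_hom[OF W0, where m = 1] D_grade[OF W0] by auto
  have ex_aug: "exact_at (M 1) ?e ?A' augmentation trivial_module"
    unfolding exact_at_def
  proof (intro equalityI subsetI)
    fix Z assume "Z \<in> ?e ` carrier (M 1)"
    then obtain x where x: "x \<in> carrier (M 1)" "Z = D x []" by blast
    have "l i [] = 0" if "i \<in> P0" for i using free_comp_len[OF l_comp, of i "[]"] P_S(2) that by auto
    then have "(\<Sum>i\<in>pred []. pmul (rep (x (list_encode [i]))) (l i)) [] = 0"
      by (simp add: sum_fun_apply pmul_def pred_def)
    then have "augmentation Z = 0" using D_rep(1,2)[OF W0 x(1)] x(2) augmentation_q by simp
    then show "Z \<in> a_kernel ?A' trivial_module augmentation"
      using D_hom(1)[OF W0 x(1)] x(2) by (simp add: a_kernel_def' regular_simps) (simp add: trivial_module_def)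
  next
    fix Z assume "Z \<in> a_kernel ?A' trivial_module augmentation"
    then have Z: "Z \<in> carrier A" "augmentation Z = 0" by (simp_all add: a_kernel_def' regular_simps) (simp add: trivial_module_def)
    then obtain f where f: "f \<in> polys n" "Z = q f" by (auto simp: carrier_A)
    then obtain a where a: "\<And>i. a i \<in> polys n" "f - (\<Sum>i\<in>P0. pmul (a i) (l i)) \<in> I"
      using generate[OF f(1)] Z(2) augmentation_q by auto
    define y where "y b = (if b \<in> B 1 then q (a (list_decode b ! 0)) else \<zero>\<^bsub>A\<^esub>)" for b
    have y: "y \<in> carrier (M 1)" using a(1) q_carrier by (simp add: M_carrier y_def)
    have "D y [] = q (\<Sum>i\<in>pred []. pmul (a i) (l i))"
    proof (rule D_eq[OF W0 a(1)])
      fix i assume "i \<in> pred []"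
      then have "[i] \<in> Wd 1" by simp
      then show "q (a i) = y (list_encode [i])" by (simp add: y_def B_encode)
    qed
    moreover have "Z = q (\<Sum>i\<in>P0. pmul (a i) (l i))" using a(2) f(2) by (simp add: q_eq)
    ultimately have "D y [] = Z" by (simp add: pred_def)
    then show "Z \<in> ?e ` carrier (M 1)" using y by blast
  qed
  have ex_1: "exact_at (M 2) (dd 1) (M 1) ?e ?A'"
    using D_exact[of _ 0] dd_hom[of 1] unfolding exact_at_def a_kernel_def' regular_simps
    by (auto simp: numeral_2_eq_2 graded_module_hom_def)
  have ex_k: "exact_at (M (k + 2)) (dd (k + 1)) (M (k + 1)) (dd k) (M k)" for k
  proof -
    have "dd k x = (\<lambda>b. \<zero>\<^bsub>A\<^esub>) \<longleftrightarrow> (\<forall>w\<in>Wd k. D x w = \<zero>\<^bsub>A\<^esub>)" for x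
    proof
      assume *: "dd k x = (\<lambda>b. \<zero>\<^bsub>A\<^esub>)"
      show "\<forall>w\<in>Wd k. D x w = \<zero>\<^bsub>A\<^esub>"
      proof
        fix w assume "w \<in> Wd k"
        then show "D x w = \<zero>\<^bsub>A\<^esub>" using fun_cong[OF *, of "list_encode w"] by (simp add: dd_def B_encode)
      qed
    next
      assume "\<forall>w\<in>Wd k. D x w = \<zero>\<^bsub>A\<^esub>"
      then show "dd k x = (\<lambda>b. \<zero>\<^bsub>A\<^esub>)" using B_decode by (simp add: dd_def fun_eq_iff)
    qed
    then show ?thesis
      using D_exact[of _ k] dd_hom[of "Suc k"] unfolding exact_at_def a_kernel_def' free_module_simps(2)
      by (auto simp: graded_module_hom_def)
  qed
  have aug_surj: "augmentation ` carrier ?A' = UNIV"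
  proof -
    have "c = augmentation (q (const_poly c))" for c
      using augmentation_q[OF const_polys, of c] by (simp add: const_poly_def)
    moreover have "q (const_poly c) \<in> carrier A" for c by (rule q_carrier[OF const_polys])
    ultimately show ?thesis unfolding regular_simps by blast
  qed
  show ?thesis unfolding koszul_def Let_def
    using pgi e_hom dd_hom augmentation_hom aug_surj ex_aug ex_1 ex_k
    by (intro conjI exI[of _ B] exI[of _ ?e] exI[of _ dd]) simp_all
qed

end

section \<open>Algebras with a multiplicative basis of words\<close>

text \<open>The basis consists of the words in \<open>N\<close>. A product of a basis word with a letter on the right is a basis word
  or zero, and it is the concatenation except that \<open>e\<close>, unless empty, is rewritten to \<open>t\<close>; \<open>ls\<close> is the
  multiplication with a letter on the left.\<close>

locale presentation =
  fixes N :: "nat list set" and e t :: "nat list" and ls :: "nat \<Rightarrow> nat list \<Rightarrow> nat list option"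
  assumes N_nil: "[] \<in> N" and N_letters: "w \<in> N \<Longrightarrow> set w \<subseteq> {..<3}" and N_prefix: "w @ [i] \<in> N \<Longrightarrow> w \<in> N"
    and exception: "e \<noteq> [] \<Longrightarrow> e \<notin> N \<and> butlast e \<in> N \<and> t \<in> N \<and> length t = length e \<and> last t = last e"
    and ls_nil: "i < 3 \<Longrightarrow> ls i [] = (if [i] \<in> N then Some [i] else if [i] = e then Some t else None)"
    and ls_comm: "w \<in> N \<Longrightarrow> i < 3 \<Longrightarrow> j < 3 \<Longrightarrow>
      Option.bind (ls i w) (\<lambda>v. if v @ [j] \<in> N then Some (v @ [j]) else if v @ [j] = e then Some t else None) =
      Option.bind (if w @ [j] \<in> N then Some (w @ [j]) else if w @ [j] = e then Some t else None) (ls i)"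
    and ls_N: "w \<in> N \<Longrightarrow> i < 3 \<Longrightarrow> ls i w = Some v \<Longrightarrow> length v = Suc (length w)"
begin

section \<open>Normal forms of words and polynomials\<close>

definition rs :: "nat list \<Rightarrow> nat \<Rightarrow> nat list option" where
  "rs w i = (if w @ [i] \<in> N then Some (w @ [i]) else if w @ [i] = e then Some t else None)"

text \<open>Multiplies the letters one after another onto the empty word from the right;
  \<open>None\<close> stands for the product zero.\<close>

definition nf :: "nat list \<Rightarrow> nat list option" where
  "nf w = foldl (\<lambda>s i. Option.bind s (\<lambda>v. rs v i)) (Some []) w"

lemma nf_simps: "nf [] = Some []" "nf (w @ [i]) = Option.bind (nf w) (\<lambda>v. rs v i)"
  by (simp_all add: nf_def)

lemma rs_N: "rs w i = Some v \<Longrightarrow> v \<in> N \<and> length v = Suc (length w)"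
proof (cases "w @ [i] \<in> N")
  case False
  assume "rs w i = Some v"
  then have "w @ [i] = e" "v = t" using False by (auto simp: rs_def split: if_splits)
  then have "e \<noteq> []" "length e = Suc (length w)" by auto
  then show ?thesis using exception \<open>v = t\<close> by auto
qed (auto simp: rs_def)

lemma nf_N: "nf w = Some v \<Longrightarrow> v \<in> N \<and> length v = length w"
proof (induction w arbitrary: v rule: rev_induct)
  case (snoc i w)
  then obtain u where "nf w = Some u" "rs u i = Some v" by (auto simp: nf_simps bind_eq_Some_conv)
  then show ?case using snoc.IH rs_N by auto
qed (simp add: nf_simps N_nil)

lemma nf_fix: "v \<in> N \<Longrightarrow> nf v = Some v"
proof (induction v rule: rev_induct)
  case (snoc i w)
  then show ?case using N_prefix by (simp add: nf_simps rs_def)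
qed (simp add: nf_simps)

text \<open>Left and right multiplication by letters commute by \<open>ls_comm\<close>. This
  associativity is what makes the kernel of the normal form map a two-sided ideal.\<close>

lemma nf_Cons: "i < 3 \<Longrightarrow> set w \<subseteq> {..<3} \<Longrightarrow> nf (i # w) = Option.bind (nf w) (ls i)"
proof (induction w rule: rev_induct)
  case Nil
  then show ?case using nf_simps(2)[of "[]" i] ls_nil by (simp add: nf_simps(1) rs_def)
next
  case (snoc j w)
  have "nf (i # w @ [j]) = Option.bind (nf (i # w)) (\<lambda>v. rs v j)" using nf_simps(2)[of "i # w" j] by simp
  also have "\<dots> = Option.bind (Option.bind (nf w) (ls i)) (\<lambda>v. rs v j)" using snoc by simp
  also have "\<dots> = Option.bind (nf w) (\<lambda>v. Option.bind (ls i v) (\<lambda>v. rs v j))" by simp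
  also have "\<dots> = Option.bind (nf w) (\<lambda>v. Option.bind (rs v j) (ls i))"
  proof (cases "nf w")
    case (Some u)
    then have "u \<in> N" using nf_N by blast
    then show ?thesis using ls_comm[of u i j] snoc.prems Some by (simp add: rs_def)
  qed simp
  finally show ?case by (simp add: nf_simps)
qed

text \<open>The linear extension of \<open>nf\<close>. Normal forms preserve length, so the finite
  sum over words of one length is complete.\<close>

definition phi :: "'k::field ncpoly \<Rightarrow> 'k ncpoly" where
  "phi f w = (\<Sum>v\<in>nwords 3 (length w). if nf v = Some w then f v else 0)"

lemma phi_lin: "lin phi"
proof (rule linI)
  fix f g :: "'a ncpoly" and c
  have "phi (f + g) w = phi f w + phi g w" for w
    unfolding phi_def sum.distrib[symmetric] by (rule sum.cong) (auto simp: pointwise)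
  then show "phi (f + g) = phi f + phi g" by (simp add: fun_eq_iff pointwise)
  have "phi (scl c f) w = c * phi f w" for w
    unfolding phi_def sum_distrib_left by (rule sum.cong) (auto simp: pointwise)
  then show "phi (scl c f) = scl c (phi f)" by (simp add: fun_eq_iff pointwise)
qed

lemma phi_off: "w \<notin> N \<Longrightarrow> phi f w = 0"
  unfolding phi_def using nf_N by (intro sum.neutral) auto

lemma phi_normal:
  assumes "\<And>w. w \<notin> N \<Longrightarrow> f w = 0"
  shows "phi f = f"
proof
  fix w
  have "phi f w = (\<Sum>v\<in>nwords 3 (length w). if w = v then f v else 0)"
    unfolding phi_def
  proof (rule sum.cong[OF refl])
    fix v show "(if nf v = Some w then f v else 0) = (if w = v then f v else 0)"
      using assms[of v] nf_fix[of v] by (cases "v \<in> N") auto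
  qed
  also have "\<dots> = (if w \<in> nwords 3 (length w) then f w else 0)" by (simp add: finite_nwords)
  finally show "phi f w = f w" using assms[of w] N_letters[of w] by (auto simp: nwords_def)
qed

lemma phi_nonzero: "phi f w \<noteq> 0 \<Longrightarrow> \<exists>v. f v \<noteq> 0 \<and> nf v = Some w"
proof (rule ccontr)
  assume *: "phi f w \<noteq> 0" "\<nexists>v. f v \<noteq> 0 \<and> nf v = Some w"
  then have "(if nf v = Some w then f v else 0) = 0" for v by auto
  then have "phi f w = 0" unfolding phi_def by (intro sum.neutral ballI)
  then show False using *(1) by simp
qed

lemma phi_polys: "f \<in> polys 3 \<Longrightarrow> phi f \<in> polys 3"
proof -
  assume f: "f \<in> polys 3"
  have "{w. phi f w \<noteq> 0} \<subseteq> (\<lambda>v. the (nf v)) ` {v. f v \<noteq> 0}" using phi_nonzero by force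
  then have "finite {w. phi f w \<noteq> 0}" using f finite_subset by (fastforce simp: polys_def)
  then show ?thesis using phi_off N_letters by (auto simp: polys_def)
qed

lemmas sum_nwords_left = sum_lists_left[where Q = "{..<3::nat}", folded nwords_def]
  and sum_nwords_right = sum_lists_right[where Q = "{..<3::nat}", folded nwords_def]

text \<open>The computation common to both sides: \<open>st\<close> is the effect on normal forms of
  the operation \<open>s\<close> on words.\<close>

lemma phi_step:
  assumes "\<And>v. v \<in> nwords 3 m \<Longrightarrow> nf (s v) = Option.bind (nf v) st"
  shows "(\<Sum>v\<in>nwords 3 m. if nf (s v) = Some w then f v else 0)
    = (\<Sum>x\<in>nwords 3 m. if x \<in> N \<and> st x = Some w then phi f x else 0)"
proof -
  have "(\<Sum>v\<in>nwords 3 m. if nf (s v) = Some w then f v else 0)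
      = (\<Sum>v\<in>nwords 3 m. \<Sum>x\<in>nwords 3 m. if x \<in> N \<and> st x = Some w then (if nf v = Some x then f v else 0) else 0)"
  proof (rule sum.cong[OF refl])
    fix v assume v: "v \<in> nwords 3 m"
    have "(\<Sum>x\<in>nwords 3 m. if x \<in> N \<and> st x = Some w then (if nf v = Some x then f v else 0) else 0)
        = (\<Sum>x\<in>nwords 3 m. if nf v = Some x then (if st x = Some w then f v else 0) else 0)"
      using nf_N[of v] by (intro sum.cong) auto
    also have "\<dots> = (if nf (s v) = Some w then f v else 0)"
    proof (cases "nf v")
      case None
      then show ?thesis using assms[OF v] by simp
    next
      case (Some y)
      then have "y \<in> nwords 3 m" using nf_N[OF Some] N_letters v by (auto simp: nwords_def)
      moreover have "(\<Sum>x\<in>nwords 3 m. if nf v = Some x then (if st x = Some w then f v else 0) else 0)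
        = (\<Sum>x\<in>nwords 3 m. if y = x then (if st x = Some w then f v else 0) else 0)" using Some by simp
      ultimately show ?thesis using assms[OF v] Some by (simp add: finite_nwords)
    qed
    finally show "(if nf (s v) = Some w then f v else 0)
      = (\<Sum>x\<in>nwords 3 m. if x \<in> N \<and> st x = Some w then (if nf v = Some x then f v else 0) else 0)" by simp
  qed
  also have "\<dots> = (\<Sum>x\<in>nwords 3 m. \<Sum>v\<in>nwords 3 m. if x \<in> N \<and> st x = Some w then (if nf v = Some x then f v else 0) else 0)"
    by (rule sum.swap)
  also have "\<dots> = (\<Sum>x\<in>nwords 3 m. if x \<in> N \<and> st x = Some w then phi f x else 0)"
    by (intro sum.cong) (auto simp: phi_def nwords_def)
  finally show ?thesis .
qed

lemma phi_right:
  assumes "i < 3" "length w = Suc m"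
  shows "phi (pmul f (delta [i])) w = (\<Sum>x\<in>nwords 3 m. if x \<in> N \<and> rs x i = Some w then phi f x else 0)"
proof -
  have "phi (pmul f (delta [i])) w = (\<Sum>v\<in>nwords 3 m. \<Sum>j<3. if i = j then (if nf (v @ [j]) = Some w then f v else 0) else 0)"
    unfolding phi_def assms(2) sum_nwords_right
    by (subst sum.swap) (intro sum.cong refl, auto simp: pmul_letter_right)
  also have "\<dots> = (\<Sum>v\<in>nwords 3 m. if nf (v @ [i]) = Some w then f v else 0)" using assms(1) by simp
  finally show ?thesis using phi_step[of m "\<lambda>v. v @ [i]" "\<lambda>v. rs v i" w f] by (simp add: nf_simps)
qed

lemma phi_left:
  assumes "i < 3" "length w = Suc m"
  shows "phi (pmul (delta [i]) f) w = (\<Sum>x\<in>nwords 3 m. if x \<in> N \<and> ls i x = Some w then phi f x else 0)"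
proof -
  have "phi (pmul (delta [i]) f) w = (\<Sum>v\<in>nwords 3 m. \<Sum>j<3. if i = j then (if nf (j # v) = Some w then f v else 0) else 0)"
    unfolding phi_def assms(2) sum_nwords_left
    by (subst sum.swap) (intro sum.cong refl, auto simp: pmul_letter_left)
  also have "\<dots> = (\<Sum>v\<in>nwords 3 m. if nf (i # v) = Some w then f v else 0)" using assms(1) by simp
  finally show ?thesis using phi_step[of m "\<lambda>v. i # v" "ls i" w f] nf_Cons[OF assms(1)] by (simp add: nwords_def)
qed

lemma phi_nil: "phi f [] = f []"
proof -
  have "nwords 3 0 = {[]}" by (auto simp: nwords_def)
  then show ?thesis by (simp add: phi_def nf_simps)
qed

lemma phi_right_0: "phi f = 0 \<Longrightarrow> i < 3 \<Longrightarrow> phi (pmul f (delta [i])) = 0"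
proof
  fix w assume *: "phi f = 0" "i < 3"
  show "phi (pmul f (delta [i])) w = 0 w"
    using phi_right[OF *(2), of w "length w - 1" f, unfolded *(1) zero_fun_apply]
    by (cases "w = []") (simp_all add: phi_nil pmul_letter_right zero_fun_apply)
qed

lemma phi_left_0: "phi f = 0 \<Longrightarrow> i < 3 \<Longrightarrow> phi (pmul (delta [i]) f) = 0"
proof
  fix w assume *: "phi f = 0" "i < 3"
  show "phi (pmul (delta [i]) f) w = 0 w"
    using phi_left[OF *(2), of w "length w - 1" f, unfolded *(1) zero_fun_apply]
    by (cases "w = []") (simp_all add: phi_nil pmul_letter_left zero_fun_apply)
qed

lemma delta_word: "delta (i # w) = pmul (delta [i]) (delta w)" "delta (w @ [i]) = pmul (delta w) (delta [i])"
  "(delta [] :: 'k::field ncpoly) = const_poly 1"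
proof -
  show "delta (i # w) = pmul (delta [i]) (delta w)"
  proof
    fix v show "delta (i # w) v = pmul (delta [i]) (delta w) v"
      unfolding pmul_letter_left by (cases v) (simp_all add: delta_def)
  qed
  show "delta (w @ [i]) = pmul (delta w) (delta [i])"
  proof
    fix v show "delta (w @ [i]) v = pmul (delta w) (delta [i]) v"
      unfolding pmul_letter_right by (cases v rule: rev_cases) (simp_all add: delta_def)
  qed
  show "(delta [] :: 'k ncpoly) = const_poly 1" by (simp add: fun_eq_iff delta_def const_poly_def)
qed

lemma phi_word_0:
  "set v \<subseteq> {..<3} \<Longrightarrow> phi f = 0 \<Longrightarrow> phi (pmul f (delta v)) = 0"
  "set v \<subseteq> {..<3} \<Longrightarrow> phi f = 0 \<Longrightarrow> phi (pmul (delta v) f) = 0"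
proof -
  show "set v \<subseteq> {..<3} \<Longrightarrow> phi f = 0 \<Longrightarrow> phi (pmul f (delta v)) = 0"
  proof (induction v rule: rev_induct)
    case (snoc i v)
    then show ?case by (simp add: delta_word(2) phi_right_0 flip: pmul_assoc)
  qed (simp add: delta_word(3) pmul_const)
  show "set v \<subseteq> {..<3} \<Longrightarrow> phi f = 0 \<Longrightarrow> phi (pmul (delta v) f) = 0"
  proof (induction v)
    case (Cons i v)
    then show ?case by (simp add: delta_word(1)[of i v] phi_left_0 pmul_assoc)
  qed (simp add: delta_word(3) pmul_const)
qed

definition rel_ideal :: "'k::field ncpoly set" where
  "rel_ideal = {f \<in> polys 3. phi f = 0}"

lemma phi_mult_0:
  assumes "phi f = 0" "g \<in> polys 3"
  shows "phi (pmul f g) = 0" "phi (pmul g f) = 0"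
proof -
  have fin: "finite {w. g w \<noteq> 0}" and s: "\<And>w. g w \<noteq> 0 \<Longrightarrow> set w \<subseteq> {..<3}" using assms(2) by (auto simp: polys_def)
  have g: "g = (\<Sum>v | g v \<noteq> 0. scl (g v) (delta v))"
    by (rule supp_on_expand[OF fin]) (simp add: supp_on_def)
  show "phi (pmul f g) = 0"
    by (subst g) (simp add: pmul_sum pmul_lin lin_simps(6)[OF phi_lin] lin_simps(2)[OF phi_lin] phi_word_0(1)[OF s assms(1)])
  show "phi (pmul g f) = 0"
    by (subst g) (simp add: pmul_sum pmul_lin lin_simps(6)[OF phi_lin] lin_simps(2)[OF phi_lin] phi_word_0(2)[OF s assms(1)])
qed

lemma rel_ideal_pgi: "proper_graded_ideal 3 (rel_ideal :: 'k::field ncpoly set)"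
  unfolding proper_graded_ideal_def
proof (intro conjI ballI allI)
  let ?F = "free_algebra 3 :: 'k ncpoly ring"
  interpret F: ring ?F by (rule free_algebra_ring)
  have p0: "phi (0 :: 'k ncpoly) = 0" by (rule lin_simps(3)[OF phi_lin])
  have sub: "fs.subspace (rel_ideal :: 'k ncpoly set)"
    using polys_subspace[of 3] p0
    by (auto simp: rel_ideal_def fs.subspace_def lin_simps(1)[OF phi_lin] lin_simps(2)[OF phi_lin])
  show "ideal (rel_ideal :: 'k ncpoly set) ?F"
  proof (rule idealI[OF F.ring_axioms])
    show "subgroup (rel_ideal :: 'k ncpoly set) (add_monoid ?F)"
    proof (rule F.add.subgroupI)
      show "(rel_ideal :: 'k ncpoly set) \<subseteq> carrier ?F" by (auto simp: rel_ideal_def free_algebra_fold)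
      show "(rel_ideal :: 'k ncpoly set) \<noteq> {}" using fs.subspace_0[OF sub] by blast
      fix f :: "'k ncpoly" assume f: "f \<in> rel_ideal"
      have "- f \<in> rel_ideal" using fs.subspace_neg[OF sub f] .
      moreover have "\<ominus>\<^bsub>?F\<^esub> f = - f"
      proof (rule F.minus_equality)
        show "f \<in> carrier ?F" "- f \<in> carrier ?F" using f \<open>- f \<in> rel_ideal\<close> by (auto simp: rel_ideal_def free_algebra_fold)
      qed (simp add: free_algebra_fold)
      ultimately show "\<ominus>\<^bsub>?F\<^esub> f \<in> rel_ideal" by simp
    qed (use fs.subspace_add[OF sub] in \<open>simp add: free_algebra_fold\<close>)
    show "g \<otimes>\<^bsub>?F\<^esub> f \<in> rel_ideal" "f \<otimes>\<^bsub>?F\<^esub> g \<in> rel_ideal" if "f \<in> rel_ideal" "g \<in> carrier ?F" for f g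
      using that phi_mult_0[of f g] by (auto simp: rel_ideal_def free_algebra_fold pmul_polys)
  qed
  have "phi (const_poly 1 :: 'k ncpoly) [] = 1" by (simp add: phi_nil const_poly_def)
  then have "const_poly 1 \<notin> (rel_ideal :: 'k ncpoly set)" by (auto simp: rel_ideal_def zero_fun_apply)
  then show "(rel_ideal :: 'k ncpoly set) \<noteq> carrier ?F" using const_polys[of 1 3] by (auto simp: free_algebra_fold)
  fix f :: "'k ncpoly" and j assume f: "f \<in> rel_ideal"
  have "phi (hom_part j f) w = 0" for w
  proof -
    have "phi (hom_part j f) w = (if length w = j then phi f w else 0)"
      unfolding phi_def by (auto simp: hom_part_def nwords_def intro!: sum.cong sum.neutral)
    then show ?thesis using f by (simp add: rel_ideal_def zero_fun_apply)
  qed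
  then show "hom_part j f \<in> rel_ideal"
    using f hom_part_comp[THEN free_comp_polys] by (auto simp: rel_ideal_def fun_eq_iff zero_fun_apply)
qed

lemma comp_dim_rel_ideal: "comp_dim 3 (rel_ideal :: 'k::field ncpoly set) m = card {w \<in> N. length w = m}"
proof -
  interpret graded_ideal 3 "rel_ideal :: 'k ncpoly set" by standard (rule rel_ideal_pgi)
  have sub: "{w \<in> N. length w = m} \<subseteq> nwords 3 m" using N_letters by (auto simp: nwords_def)
  show ?thesis
  proof (rule comp_dim_eqI[where psi = "\<lambda>f. f" and T = "free_comp 3 m" and phi = phi])
    show "lin (\<lambda>f :: 'k ncpoly. f)" by (rule linI) simp_all
    show "(phi :: 'k ncpoly \<Rightarrow> _) ` free_comp 3 m = supp_on {w \<in> N. length w = m}"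
    proof (intro equalityI subsetI)
      fix g :: "'k ncpoly" assume "g \<in> phi ` free_comp 3 m"
      then obtain f where f: "f \<in> free_comp 3 m" "g = phi f" by blast
      have "g w = 0" if "w \<notin> {w \<in> N. length w = m}" for w
      proof (rule ccontr)
        assume *: "g w \<noteq> 0"
        then obtain v where v: "f v \<noteq> 0" "nf v = Some w" using phi_nonzero f(2) by blast
        then show False using that nf_N[OF v(2)] free_comp_len[OF f(1), of v] by auto
      qed
      then show "g \<in> supp_on {w \<in> N. length w = m}" by (simp add: supp_on_def)
    next
      fix g :: "'k ncpoly" assume g: "g \<in> supp_on {w \<in> N. length w = m}"
      then have "phi g = g" by (intro phi_normal) (auto simp: supp_on_def)
      moreover have "g \<in> free_comp 3 m" using g sub by (auto simp: free_comp_eq supp_on_def)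
      ultimately show "g \<in> phi ` free_comp 3 m" by (metis imageI)
    qed
    show "finite {w \<in> N. length w = m}" by (rule finite_subset[OF sub finite_nwords])
    show "f \<in> free_comp 3 m \<Longrightarrow> \<exists>s\<in>free_comp 3 m. f - s \<in> rel_ideal" for f :: "'k ncpoly"
      using I_closed(4) by (intro bexI[of _ f]) simp_all
    show "f \<in> free_comp 3 m \<Longrightarrow> phi f = 0 \<longleftrightarrow> f \<in> rel_ideal" for f :: "'k ncpoly"
      using free_comp_polys by (auto simp: rel_ideal_def)
  qed (use phi_lin subspace_free_comp in auto)
qed

text \<open>Right multiplication by the letter \<open>i\<close> on normal forms. A basis word ending
  in \<open>i\<close> arises by appending \<open>i\<close>; the word \<open>t\<close> arises a
  second time, through the rewriting of \<open>e\<close>.\<close>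

definition act :: "nat \<Rightarrow> 'k::field ncpoly \<Rightarrow> 'k ncpoly" where
  "act i a w = (if w \<in> N \<and> w \<noteq> [] \<and> last w = i
     then a (butlast w) + (if e \<noteq> [] \<and> w = t then a (butlast e) else 0) else 0)"

lemma phi_act: "i < 3 \<Longrightarrow> phi (pmul f (delta [i])) = act i (phi f)"
proof
  fix w assume i: "i < 3"
  show "phi (pmul f (delta [i])) w = act i (phi f) w"
  proof (cases "w \<in> N \<and> w \<noteq> []")
    case False
    then have "phi (pmul f (delta [i])) w = 0"
      using phi_off[of w] phi_nil[of "pmul f (delta [i])"] by (cases "w = []") (simp_all add: pmul_letter_right)
    moreover have "act i (phi f) w = 0" unfolding act_def using False by (intro if_not_P) blast
    ultimately show ?thesis by simp
  next
    case True
    then obtain v j where w: "w = v @ [j]" by (metis rev_exhaust)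
    have vN: "v \<in> N" using True N_prefix w by blast
    have rs: "x \<in> N \<and> rs x i = Some w \<longleftrightarrow> (i = j \<and> x = v) \<or> (e \<noteq> [] \<and> i = j \<and> w = t \<and> x = butlast e)" for x
    proof
      assume *: "x \<in> N \<and> rs x i = Some w"
      show "(i = j \<and> x = v) \<or> (e \<noteq> [] \<and> i = j \<and> w = t \<and> x = butlast e)"
      proof (cases "x @ [i] \<in> N")
        case False
        then have x: "x @ [i] = e" "w = t" using * by (auto simp: rs_def split: if_splits)
        have xe: "e \<noteq> []" "last e = i" "butlast e = x" using x(1)[symmetric] by simp_all
        then have "last t = i" using exception by blast
        then have "i = j" using x(2) w by (metis last_snoc)
        then show ?thesis using x(2) xe by blast
      qed (use * w in \<open>auto simp: rs_def\<close>)
    next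
      assume "(i = j \<and> x = v) \<or> (e \<noteq> [] \<and> i = j \<and> w = t \<and> x = butlast e)"
      then show "x \<in> N \<and> rs x i = Some w"
      proof
        assume *: "e \<noteq> [] \<and> i = j \<and> w = t \<and> x = butlast e"
        then have "x @ [i] = e" using exception w by (metis append_butlast_last_id snoc_eq_iff_butlast)
        then show ?thesis using * exception by (auto simp: rs_def)
      qed (use vN True w in \<open>auto simp: rs_def\<close>)
    qed
    have vm: "v \<in> nwords 3 (length v)" using N_letters[OF vN] by (simp add: nwords_def)
    have ne: "e \<noteq> [] \<Longrightarrow> w = t \<Longrightarrow> butlast e \<noteq> v \<and> butlast e \<in> nwords 3 (length v)"
      using exception N_letters[of "butlast e"] True w
      by (auto simp: nwords_def)
    have "phi (pmul f (delta [i])) w = (\<Sum>x\<in>nwords 3 (length v). if x \<in> N \<and> rs x i = Some w then phi f x else 0)"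
      by (rule phi_right[OF i]) (simp add: w)
    also have "\<dots> = (\<Sum>x\<in>nwords 3 (length v). (if v = x then (if i = j then phi f x else 0) else 0)
        + (if butlast e = x then (if e \<noteq> [] \<and> i = j \<and> w = t then phi f x else 0) else 0))"
      unfolding rs using ne by (intro sum.cong) auto
    also have "\<dots> = (if i = j then phi f v else 0) + (if e \<noteq> [] \<and> i = j \<and> w = t then phi f (butlast e) else 0)"
      using vm ne by (auto simp: sum.distrib finite_nwords)
    finally show ?thesis using True w by (auto simp: act_def)
  qed
qed

definition shift :: "nat \<Rightarrow> 'k::field ncpoly \<Rightarrow> 'k ncpoly" where
  "shift i a = (\<lambda>v. a (v @ [i]))"

lemma shift_polys: "a \<in> polys 3 \<Longrightarrow> shift i a \<in> polys 3"
proof -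
  assume a: "a \<in> polys 3"
  have "(\<lambda>v. v @ [i]) ` {v. shift i a v \<noteq> 0} \<subseteq> {w. a w \<noteq> 0}" by (auto simp: shift_def)
  then have "finite ((\<lambda>v. v @ [i]) ` {v. shift i a v \<noteq> 0})" using a finite_subset by (auto simp: polys_def)
  then have "finite {v. shift i a v \<noteq> 0}" by (rule finite_imageD) (simp add: inj_on_def)
  then show ?thesis using polysD[OF a] by (fastforce simp: polys_def shift_def)
qed

text \<open>Stripping the last letter inverts right multiplication. The additional term at
  \<open>t\<close> is the coefficient of \<open>e\<close>, which is 0 because \<open>e\<close> is
  not a basis word.\<close>

lemma act_expand:
  assumes "\<And>w. w \<notin> N \<Longrightarrow> a w = 0" "a [] = 0"
  shows "a = (\<Sum>i<3. act i (shift i a))"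
proof
  fix w show "a w = (\<Sum>i<3. act i (shift i a)) w"
  proof (cases "w \<in> N \<and> w \<noteq> []")
    case False
    then show ?thesis using assms by (auto simp: sum_fun_apply act_def)
  next
    case True
    then obtain v j where w: "w = v @ [j]" by (metis rev_exhaust)
    have j: "j < 3" using True N_letters[of w] w by simp
    have "act i (shift i a) w = (if j = i then a w else 0)" for i
    proof -
      have "a (butlast e @ [j]) = 0" if "e \<noteq> []" "w = t"
      proof -
        have "butlast e @ [j] = e" using exception that w by (metis append_butlast_last_id last_snoc)
        then show ?thesis using exception that assms(1) by metis
      qed
      then show ?thesis using True w by (auto simp: act_def shift_def)
    qed
    then show ?thesis using j by (simp add: sum_fun_apply)
  qed
qed

end

section \<open>Linear forms acting on normal forms\<close>

context presentation
begin

definition form :: "(nat \<Rightarrow> 'k::field) \<Rightarrow> 'k ncpoly" where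
  "form c = (\<Sum>m<3. scl (c m) (delta [m]))"

definition actl :: "(nat \<Rightarrow> 'k::field) \<Rightarrow> 'k ncpoly \<Rightarrow> 'k ncpoly" where
  "actl c a = (\<Sum>m<3. scl (c m) (act m a))"

lemma actl_apply: "actl c a w = c 0 * act 0 a w + c 1 * act 1 a w + c 2 * act 2 a w"
  by (simp add: actl_def pointwise lessThan_Suc numeral_3_eq_3 numeral_2_eq_2 add_ac)

lemma form_apply: "form c w = c 0 * delta [0] w + c 1 * delta [1] w + c 2 * delta [2] w"
  by (simp add: form_def pointwise lessThan_Suc numeral_3_eq_3 numeral_2_eq_2 add_ac)

lemma phi_form: "phi (pmul f (form c)) = actl c (phi f)"
  by (simp add: form_def actl_def pmul_sum pmul_lin lin_simps(6)[OF phi_lin] lin_simps(2)[OF phi_lin] phi_act)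

lemma letter_comp: "m < 3 \<Longrightarrow> delta [m] \<in> free_comp 3 1"
  by (auto simp: free_comp_eq supp_on_def nwords_def delta_def)

lemma form_comp: "form c \<in> free_comp 3 1"
  unfolding form_def using letter_comp
  by (intro fs.subspace_sum[OF subspace_free_comp] fs.subspace_scale[OF subspace_free_comp]) auto

lemma actl_letter: "i < 3 \<Longrightarrow> actl (\<lambda>m. if m = i then 1 else 0) a = act i a"
proof
  fix w assume "i < 3"
  then have "i = 0 \<or> i = 1 \<or> i = 2" by arith
  then show "actl (\<lambda>m. if m = i then 1 else 0) a w = act i a w" by (auto simp: actl_apply)
qed

lemma act_off: "w \<notin> N \<Longrightarrow> act i a w = 0"
  by (simp add: act_def)

lemma act_expand_on:
  assumes "\<And>w. w \<notin> N \<Longrightarrow> a w = 0" "a [] = 0" "P \<subseteq> {..<3}" "\<And>i v. i < 3 \<Longrightarrow> i \<notin> P \<Longrightarrow> v @ [i] \<in> N \<Longrightarrow> a (v @ [i]) = 0"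
  shows "a = (\<Sum>i\<in>P. act i (shift i a))"
proof -
  have "act i (shift i a) = 0" if "i \<in> {..<3} - P" for i
  proof -
    have "shift i a = 0" using assms(1) assms(4)[of i] that by (force simp: shift_def fun_eq_iff zero_fun_apply)
    then show ?thesis by (simp add: act_def fun_eq_iff zero_fun_apply)
  qed
  then have "(\<Sum>i<3. act i (shift i a)) = (\<Sum>i\<in>P. act i (shift i a))"
    using assms(3) by (intro sum.mono_neutral_right) auto
  moreover have "a = (\<Sum>i<3. act i (shift i a))" by (rule act_expand) (simp_all add: assms(1,2))
  ultimately show ?thesis by simp
qed

text \<open>Meant for annihilators: an equation a l = 0 restricts the last letters of the words in
  \<open>a\<close>, and stripping those letters exhibits \<open>a\<close> as a combination of the
  letters in \<open>P\<close>.\<close>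

lemma letter_annihilator:
  assumes a: "a \<in> polys 3" "\<And>w. w \<notin> N \<Longrightarrow> a w = 0" "a [] = 0" and P: "P \<subseteq> {..<3}"
    "\<And>i v. i < 3 \<Longrightarrow> i \<notin> P \<Longrightarrow> v @ [i] \<in> N \<Longrightarrow> a (v @ [i]) = 0"
    and c: "\<And>i. i < 3 \<Longrightarrow> c i = (\<lambda>m. if m = i then 1 else 0)"
  shows "\<exists>b. (\<forall>i. b i \<in> polys 3 \<and> (\<forall>w. w \<notin> N \<longrightarrow> b i w = 0)) \<and> a = (\<Sum>i\<in>P. actl (c i) (b i))"
proof -
  have "a = (\<Sum>i\<in>P. act i (shift i a))" by (rule act_expand_on) (use a P in auto)
  also have "\<dots> = (\<Sum>i\<in>P. actl (c i) (shift i a))"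
    using P(1) by (intro sum.cong refl) (auto simp: c actl_letter)
  finally have "a = (\<Sum>i\<in>P. actl (c i) (shift i a))" .
  moreover have "w \<notin> N \<Longrightarrow> shift i a w = 0" for i w using a(2) N_prefix by (auto simp: shift_def)
  ultimately show ?thesis using shift_polys[OF a(1)] by (intro exI[of _ "\<lambda>i. shift i a"]) auto
qed

end

text \<open>Disjoint letter supports of the forms in each \<open>P j\<close> replace the directness
  conditions of \<open>koszul_forms\<close>. Indices below 3 are the letters; larger ones are
  available for additional linear forms.\<close>

locale koszul_presentation = presentation N e t ls for N e t ls +
  fixes S :: "nat set" and P :: "nat \<Rightarrow> nat set" and c :: "nat \<Rightarrow> nat \<Rightarrow> 'k::field"
  assumes letters: "i < 3 \<Longrightarrow> [i] \<in> N"
    and S: "finite S" "{..<3} \<subseteq> S" "j \<in> S \<Longrightarrow> P j \<subseteq> S"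
    and c_letter: "i < 3 \<Longrightarrow> c i = (\<lambda>m. if m = i then 1 else 0)"
    and disjoint: "j \<in> S \<Longrightarrow> i \<in> P j \<Longrightarrow> i' \<in> P j \<Longrightarrow> i \<noteq> i' \<Longrightarrow> m < 3 \<Longrightarrow> c i m = 0 \<or> c i' m = 0"
    and products: "j \<in> S \<Longrightarrow> i \<in> P j \<Longrightarrow> presentation.actl N e t (c j) (presentation.form (c i)) = 0"
    and annihilators: "j \<in> S \<Longrightarrow> a \<in> polys 3 \<Longrightarrow> (\<And>w. w \<notin> N \<Longrightarrow> a w = 0) \<Longrightarrow> presentation.actl N e t (c j) a = 0 \<Longrightarrow>
      \<exists>b. (\<forall>i. b i \<in> polys 3 \<and> (\<forall>w. w \<notin> N \<longrightarrow> b i w = 0)) \<and> a = (\<Sum>i\<in>P j. presentation.actl N e t (c i) (b i))"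
begin

text \<open>A product with a form is supported on words ending in a letter of that form, so the
  summands have disjoint supports.\<close>

lemma direct_sum:
  assumes "finite T" and T: "\<And>i i' m. i \<in> T \<Longrightarrow> i' \<in> T \<Longrightarrow> i \<noteq> i' \<Longrightarrow> m < 3 \<Longrightarrow> c i m = 0 \<or> c i' m = 0"
    and z: "(\<Sum>i\<in>T. actl (c i) (b i)) = 0" and i: "i \<in> T"
  shows "actl (c i) (b i) = 0"
proof
  fix w
  show "actl (c i) (b i) w = 0 w"
  proof (cases "w \<in> N \<and> w \<noteq> [] \<and> c i (last w) \<noteq> 0")
    case True
    then have w3: "last w < 3" using N_letters[of w] last_in_set[of w] by (meson lessThan_iff subsetD)
    have other: "actl (c i') (b i') w = 0" if "i' \<in> T" "i' \<noteq> i" for i'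
    proof -
      have "c i' (last w) = 0" using T[OF i that(1) _ w3] that True by blast
      then have "c i' m * act m (b i') w = 0" for m by (cases "m = last w") (simp_all add: act_def)
      then show ?thesis by (simp only: actl_apply) simp
    qed
    have "(\<Sum>i\<in>T. actl (c i) (b i)) w = (\<Sum>i'\<in>T. if i' = i then actl (c i) (b i) w else 0)"
      unfolding sum_fun_apply using other by (intro sum.cong) auto
    also have "\<dots> = actl (c i) (b i) w" using i assms(1) by simp
    finally have "(\<Sum>i\<in>T. actl (c i) (b i)) w = actl (c i) (b i) w" .
    then show ?thesis unfolding z by simp
  next
    case False
    then have "c i m * act m (b i) w = 0" for m by (cases "m = last w") (auto simp: act_def)
    then show ?thesis by (simp only: actl_apply zero_fun_apply) simp
  qed
qed

lemma koszul_rel_ideal: "koszul 3 (rel_ideal :: 'k ncpoly set)"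
proof -
  interpret graded_ideal 3 "rel_ideal :: 'k ncpoly set" by standard (rule rel_ideal_pgi)
  let ?l = "\<lambda>i. form (c i)"
  have form_polys: "form d \<in> polys 3" for d :: "nat \<Rightarrow> 'k" by (rule free_comp_polys[OF form_comp])
  have mem: "f \<in> polys 3 \<Longrightarrow> f \<in> rel_ideal \<longleftrightarrow> phi f = 0" for f :: "'k ncpoly" by (simp add: rel_ideal_def)
  have sum_p: "(\<Sum>i\<in>T. pmul (a i) (?l i)) \<in> polys 3" if "\<And>i. a i \<in> polys 3" for T a
    by (intro fs.subspace_sum[OF polys_subspace] pmul_polys that form_polys)
  have lift: "\<exists>b. (\<forall>i. b i \<in> polys 3) \<and> f - (\<Sum>i\<in>T. pmul (b i) (?l i)) \<in> rel_ideal"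
    if f: "f \<in> polys 3" and b: "\<And>i. b i \<in> polys 3" "\<And>i w. w \<notin> N \<Longrightarrow> b i w = 0" "phi f = (\<Sum>i\<in>T. actl (c i) (b i))" for f b T
  proof -
    have "phi (f - (\<Sum>i\<in>T. pmul (b i) (?l i))) = 0"
      using phi_normal[OF b(2)]
      by (simp add: lin_simps(5)[OF phi_lin] lin_simps(6)[OF phi_lin] phi_form b(3))
    then show ?thesis using b(1) mem[OF fs.subspace_diff[OF polys_subspace f sum_p[of b, OF b(1)]]] by blast
  qed
  have direct_T: "pmul (a i) (?l i) \<in> rel_ideal"
    if "finite T" "\<And>i i' m. i \<in> T \<Longrightarrow> i' \<in> T \<Longrightarrow> i \<noteq> i' \<Longrightarrow> m < 3 \<Longrightarrow> c i m = 0 \<or> c i' m = 0"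
      and a: "\<And>i. a i \<in> polys 3" and z: "(\<Sum>i\<in>T. pmul (a i) (?l i)) \<in> rel_ideal" and i: "i \<in> T" for T a i
  proof -
    have "phi (\<Sum>i\<in>T. pmul (a i) (?l i)) = 0" using z by (simp add: rel_ideal_def)
    then have "(\<Sum>i\<in>T. actl (c i) (phi (a i))) = 0" by (simp add: lin_simps(6)[OF phi_lin] phi_form)
    then have "actl (c i) (phi (a i)) = 0" using direct_sum[of T "\<lambda>i. phi (a i)" i] that(1,2) i by blast
    then show ?thesis using mem[OF pmul_polys[OF a form_polys]] by (simp add: phi_form)
  qed
  have finP: "finite (P j)" if "j \<in> S" for j using S that finite_subset by blast
  interpret K: koszul_forms 3 "rel_ideal :: 'k ncpoly set" S "{..<3}" P ?l
  proof
    show "form (c i) \<in> free_comp 3 1" for i by (rule form_comp)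
    show "\<exists>a. (\<forall>i. a i \<in> polys 3) \<and> f - (\<Sum>i<3. pmul (a i) (?l i)) \<in> rel_ideal" if f: "f \<in> polys 3" "f [] = 0" for f
    proof (rule lift[OF f(1)])
      show "shift i (phi f) \<in> polys 3" for i by (rule shift_polys[OF phi_polys[OF f(1)]])
      show "w \<notin> N \<Longrightarrow> shift i (phi f) w = 0" for i w using phi_off N_prefix by (auto simp: shift_def)
      have "phi f = (\<Sum>i<3. act i (shift i (phi f)))"
        by (rule act_expand) (simp_all add: phi_off phi_nil f(2))
      also have "\<dots> = (\<Sum>i<3. actl (c i) (shift i (phi f)))"
        by (intro sum.cong refl) (simp add: c_letter actl_letter)
      finally show "phi f = (\<Sum>i<3. actl (c i) (shift i (phi f)))" .
    qed
    show "\<exists>a. (\<forall>i. a i \<in> polys 3) \<and> f - (\<Sum>i\<in>P j. pmul (a i) (?l i)) \<in> rel_ideal"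
      if j: "j \<in> S" and f: "f \<in> polys 3" "pmul f (?l j) \<in> rel_ideal" for j f
    proof -
      have "actl (c j) (phi f) = 0" using f(2) by (simp add: rel_ideal_def phi_form)
      then obtain b where "\<forall>i. b i \<in> polys 3 \<and> (\<forall>w. w \<notin> N \<longrightarrow> b i w = 0)" "phi f = (\<Sum>i\<in>P j. actl (c i) (b i))"
        using annihilators[OF j phi_polys[OF f(1)]] phi_off by blast
      then show ?thesis by (intro lift[OF f(1)]) auto
    qed
    show "pmul (?l i) (?l j) \<in> rel_ideal" if "j \<in> S" "i \<in> P j" for i j
    proof -
      have "phi (?l i) = ?l i"
      proof (rule phi_normal)
        fix w assume "w \<notin> N"
        then have "w \<noteq> [m]" if "m < 3" for m using letters that by blast
        then show "form (c i) w = 0" by (simp add: form_apply delta_def)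
      qed
      then have "phi (pmul (?l i) (?l j)) = 0" using products[OF that] by (simp add: phi_form)
      then show ?thesis using mem[OF pmul_polys[OF form_polys form_polys]] by blast
    qed
    show "(\<And>i. a i \<in> polys 3) \<Longrightarrow> (\<Sum>i<3. pmul (a i) (?l i)) \<in> rel_ideal \<Longrightarrow> i \<in> {..<3} \<Longrightarrow> pmul (a i) (?l i) \<in> rel_ideal" for a i
      by (rule direct_T[of "{..<3}"]) (auto simp: c_letter)
    show "j \<in> S \<Longrightarrow> (\<And>i. a i \<in> polys 3) \<Longrightarrow> (\<Sum>i\<in>P j. pmul (a i) (?l i)) \<in> rel_ideal \<Longrightarrow> i \<in> P j \<Longrightarrow> pmul (a i) (?l i) \<in> rel_ideal" for j a i
      by (rule direct_T[of "P j"]) (auto simp: finP disjoint)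
  qed (use S in auto)
  show ?thesis by (rule K.koszul)
qed

end

subsection \<open>Monomial algebras\<close>

definition walks :: "(nat \<Rightarrow> nat \<Rightarrow> bool) \<Rightarrow> nat list set" where
  "walks E = {w. set w \<subseteq> {..<3} \<and> successively E w}"

lemma walks_Cons: "i # w \<in> walks E \<longleftrightarrow> i < 3 \<and> w \<in> walks E \<and> (w \<noteq> [] \<longrightarrow> E i (hd w))"
  by (cases w) (auto simp: walks_def)

lemma walks_snoc: "w @ [i] \<in> walks E \<longleftrightarrow> i < 3 \<and> w \<in> walks E \<and> (w \<noteq> [] \<longrightarrow> E (last w) i)"
  by (auto simp: walks_def successively_append_iff)

lemma presentation_walks: "presentation (walks E) [] [] (\<lambda>i w. if i # w \<in> walks E then Some (i # w) else None)"
proof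
  fix w i j
  show "Option.bind (if i # w \<in> walks E then Some (i # w) else None)
      (\<lambda>v. if v @ [j] \<in> walks E then Some (v @ [j]) else if v @ [j] = [] then Some [] else None)
    = Option.bind (if w @ [j] \<in> walks E then Some (w @ [j]) else if w @ [j] = [] then Some [] else None)
      (\<lambda>w. if i # w \<in> walks E then Some (i # w) else None)"
    using walks_Cons[of i w E] walks_snoc[of w j E] walks_snoc[of "i # w" j E] walks_Cons[of i "w @ [j]" E]
    by (cases w) (auto simp: walks_Cons[of i "[]"])
qed (auto simp: walks_snoc split: if_splits, auto simp: walks_def)

text \<open>The left annihilator of the letter \<open>j\<close> is generated by the letters without
  an edge to \<open>j\<close>: whether \<open>j\<close> may be appended depends on the last letter
  only, and appending is injective on words.\<close>

lemma koszul_walks: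
  "\<exists>I :: 'k::field ncpoly set. koszul 3 I \<and> (\<forall>m. comp_dim 3 I m = card {w \<in> walks E. length w = m})"
proof -
  interpret presentation "walks E" "[]" "[]" "\<lambda>i w. if i # w \<in> walks E then Some (i # w) else None"
    by (rule presentation_walks)
  let ?c = "\<lambda>i m. if m = i then 1 else 0 :: 'k"
  let ?P = "\<lambda>j. {i. i < 3 \<and> \<not> E i j}"
  interpret koszul_presentation "walks E" "[]" "[]" "\<lambda>i w. if i # w \<in> walks E then Some (i # w) else None" "{..<3}" ?P ?c
  proof
    show "i < 3 \<Longrightarrow> [i] \<in> walks E" for i by (simp add: walks_def)
    show "actl (?c j) (form (?c i)) = 0" if "j \<in> {..<3}" "i \<in> ?P j" for i j
    proof -
      have fi: "form (?c i) = delta [i]"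
      proof
        fix w
        have "i = 0 \<or> i = 1 \<or> i = 2" using that(2) by auto
        then show "form (?c i) w = delta [i] w" by (auto simp: form_apply)
      qed
      have "act j (delta [i] :: 'k ncpoly) w = 0" for w
        using that(2) walks_snoc[of "[i]" j E] by (cases w rule: rev_cases) (auto simp: act_def delta_def)
      then have "act j (delta [i] :: 'k ncpoly) = 0" by (simp add: fun_eq_iff zero_fun_apply)
      then show ?thesis unfolding fi using that(1) by (simp add: actl_letter)
    qed
    show "\<exists>b. (\<forall>i. b i \<in> polys 3 \<and> (\<forall>w. w \<notin> walks E \<longrightarrow> b i w = 0)) \<and> a = (\<Sum>i\<in>?P j. actl (?c i) (b i))"
      if j: "j \<in> {..<3}" and a: "a \<in> polys 3" "\<And>w. w \<notin> walks E \<Longrightarrow> a w = 0" "actl (?c j) a = 0" for j a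
    proof -
      have z: "act j a w = 0" for w using a(3) j by (simp add: actl_letter fun_eq_iff zero_fun_apply)
      have aj: "a v = 0" if "v @ [j] \<in> walks E" for v using z[of "v @ [j]"] that by (simp add: act_def)
      show ?thesis
      proof (rule letter_annihilator[OF a(1,2)])
        show "a [] = 0" using aj[of "[]"] j by (simp add: walks_def)
        show "a (v @ [i]) = 0" if "i < 3" "i \<notin> ?P j" "v @ [i] \<in> walks E" for i v
          using aj[of "v @ [i]"] that j walks_snoc[of "v @ [i]" j E] by simp
      qed auto
    qed
  qed auto
  show ?thesis using koszul_rel_ideal comp_dim_rel_ideal[where 'k = 'k] by blast
qed

section \<open>Counting walks, and the monomial examples\<close>

primrec walk_count :: "(nat \<Rightarrow> nat \<Rightarrow> bool) \<Rightarrow> nat \<Rightarrow> nat \<Rightarrow> nat" where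
  "walk_count E 0 i = 1"
| "walk_count E (Suc m) i = (\<Sum>j<3. if E i j then walk_count E m j else 0)"

lemma finite_walks: "finite {w \<in> walks E. length w = m}"
  by (rule finite_subset[OF _ finite_nwords[of 3 m]]) (auto simp: walks_def nwords_def)

lemma card_by_first:
  assumes "\<And>j. j < 3 \<Longrightarrow> finite (Q j)" "T = (\<Union>j<3. Cons j ` Q j)"
  shows "card T = (\<Sum>j<(3::nat). card (Q j))"
proof -
  have "card T = (\<Sum>j<3. card (Cons j ` Q j))"
    unfolding assms(2) by (rule card_UN_disjoint) (use assms(1) in auto)
  then show ?thesis by (simp add: card_image)
qed

lemma card_walks_from: "i < 3 \<Longrightarrow> card {w. i # w \<in> walks E \<and> length w = m} = walk_count E m i"
proof (induction m arbitrary: i)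
  case 0
  then have "{w. i # w \<in> walks E \<and> length w = 0} = {[]}" by (auto simp: walks_def)
  then show ?case by simp
next
  case (Suc m)
  let ?Q = "\<lambda>j. if E i j then {w. j # w \<in> walks E \<and> length w = m} else {}"
  have "card {w. i # w \<in> walks E \<and> length w = Suc m} = (\<Sum>j<3. card (?Q j))"
  proof (rule card_by_first)
    show "finite (?Q j)" for j
      by (rule finite_subset[OF _ finite_walks[of E m]]) (auto simp: walks_Cons)
    show "{w. i # w \<in> walks E \<and> length w = Suc m} = (\<Union>j<3. Cons j ` ?Q j)"
    proof (intro equalityI subsetI)
      fix w assume "w \<in> {w. i # w \<in> walks E \<and> length w = Suc m}"
      then obtain j v where w: "w = j # v" "length v = m" "E i j" "j # v \<in> walks E" "j < 3"
        by (cases w) (auto simp: walks_Cons)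
      then have "v \<in> ?Q j" by simp
      then show "w \<in> (\<Union>j<3. Cons j ` ?Q j)" using w by blast
    qed (use Suc.prems in \<open>auto simp: walks_Cons split: if_splits\<close>)
  qed
  also have "\<dots> = (\<Sum>j<3. if E i j then walk_count E m j else 0)"
    using Suc.IH by (intro sum.cong) auto
  finally show ?case by simp
qed

lemma card_walks: "card {w \<in> walks E. length w = Suc m} = (\<Sum>i<3. walk_count E m i)"
proof -
  have "card {w \<in> walks E. length w = Suc m} = (\<Sum>i<3. card {w. i # w \<in> walks E \<and> length w = m})"
  proof (rule card_by_first)
    show "finite {w. i # w \<in> walks E \<and> length w = m}" for i
      by (rule finite_subset[OF _ finite_walks[of E m]]) (auto simp: walks_Cons)
    show "{w \<in> walks E. length w = Suc m} = (\<Union>i<3. Cons i ` {w. i # w \<in> walks E \<and> length w = m})"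
      by (auto simp: walks_Cons length_Suc_conv)
  qed
  then show ?thesis by (simp add: card_walks_from)
qed

lemma sum_3: "(\<Sum>i<3. F i) = F 0 + F (Suc 0) + F (2::nat)" for F :: "nat \<Rightarrow> nat"
  by (simp add: numeral_3_eq_3 numeral_2_eq_2)

lemma koszul_monomial:
  assumes "(\<Sum>i<3. walk_count E (Suc 0) i) = 3"
    and "\<And>m. (\<Sum>i<3. walk_count E (Suc (Suc m)) i) = hs j (Suc (Suc (Suc m)))"
    and j: "j \<in> {1, 2, 3, 4, 5, 6, 7, 8, 9, 10, 11}"
  shows "\<exists>n (I :: 'k::field ncpoly set). koszul n I \<and> hilbert_series n I = H j"
proof -
  obtain I :: "'k ncpoly set" where I: "koszul 3 I" "\<And>m. comp_dim 3 I m = card {w \<in> walks E. length w = m}"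
    using koszul_walks by blast
  have "comp_dim 3 I m = hs j m" for m
  proof -
    have nil: "{w \<in> walks E. length w = 0} = {[]}" by (auto simp: walks_def)
    consider "m = 0" | "m = Suc 0" | "m = Suc (Suc 0)" | l where "m = Suc (Suc (Suc l))" by (metis not0_implies_Suc)
    then show ?thesis
    proof cases
      case 1
      then show ?thesis unfolding I(2) 1 nil by (simp add: hs_def)
    next
      case 2
      then show ?thesis unfolding I(2) 2 card_walks by (simp add: hs_def)
    next
      case 3
      then show ?thesis unfolding I(2) 3 card_walks assms(1) by (simp add: hs_def)
    next
      case (4 l)
      show ?thesis unfolding I(2) 4 card_walks by (rule assms(2))
    qed
  qed
  then show ?thesis using I(1) hilbert_series_hs[OF j] by blast
qed

abbreviation edges :: "(nat \<times> nat) set \<Rightarrow> nat \<Rightarrow> nat \<Rightarrow> bool" where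
  "edges T i j \<equiv> (i, j) \<in> T"

lemma koszul_H2: "\<exists>n (I :: 'k::field ncpoly set). koszul n I \<and> hilbert_series n I = H 2"
proof (rule koszul_monomial[of "edges {(0, 1), (1, 2), (0, 2)}"])
  fix m
  show "(\<Sum>i<3. walk_count (edges {(0, 1), (1, 2), (0, 2)}) (Suc (Suc m)) i) = hs 2 (Suc (Suc (Suc m)))"
    by (cases m) (simp_all add: sum_3 hs_def)
qed (simp_all add: sum_3)

lemma koszul_H7: "\<exists>n (I :: 'k::field ncpoly set). koszul n I \<and> hilbert_series n I = H 7"
proof (rule koszul_monomial[of "edges {(0, 0), (0, 1), (2, 1)}"])
  fix m
  let ?w = "walk_count (edges {(0, 0), (0, 1), (2, 1)})"
  have "?w (Suc (Suc m)) 0 = 2 \<and> ?w (Suc (Suc m)) (Suc 0) = 0 \<and> ?w (Suc (Suc m)) 2 = 0"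
    by (induction m) (simp_all add: sum_3)
  then show "(\<Sum>i<3. ?w (Suc (Suc m)) i) = hs 7 (Suc (Suc (Suc m)))" unfolding sum_3 by (simp add: hs_def)
qed (simp_all add: sum_3)

lemma koszul_H8: "\<exists>n (I :: 'k::field ncpoly set). koszul n I \<and> hilbert_series n I = H 8"
proof (rule koszul_monomial[of "edges {(0, 0), (1, 1), (2, 2)}"])
  fix m
  let ?w = "walk_count (edges {(0, 0), (1, 1), (2, 2)})"
  have "?w m 0 = 1 \<and> ?w m (Suc 0) = 1 \<and> ?w m 2 = 1" for m by (induction m) (simp_all add: sum_3)
  then show "(\<Sum>i<3. ?w (Suc (Suc m)) i) = hs 8 (Suc (Suc (Suc m)))" unfolding sum_3 by (simp add: hs_def)
qed (simp_all add: sum_3)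

lemma koszul_H9: "\<exists>n (I :: 'k::field ncpoly set). koszul n I \<and> hilbert_series n I = H 9"
proof (rule koszul_monomial[of "edges {(1, 0), (0, 0), (0, 2)}"])
  fix m
  let ?w = "walk_count (edges {(1, 0), (0, 0), (0, 2)})"
  have "?w (Suc (Suc m)) 0 = 2 \<and> ?w (Suc (Suc m)) (Suc 0) = 2 \<and> ?w (Suc (Suc m)) 2 = 0"
    by (induction m) (simp_all add: sum_3)
  then show "(\<Sum>i<3. ?w (Suc (Suc m)) i) = hs 9 (Suc (Suc (Suc m)))" unfolding sum_3 by (simp add: hs_def)
qed (simp_all add: sum_3)

lemma koszul_H10: "\<exists>n (I :: 'k::field ncpoly set). koszul n I \<and> hilbert_series n I = H 10"
proof (rule koszul_monomial[of "edges {(0, 0), (0, 1), (1, 1)}"])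
  fix m
  let ?w = "walk_count (edges {(0, 0), (0, 1), (1, 1)})"
  have "?w (Suc m) 0 = Suc (Suc m) \<and> ?w (Suc m) (Suc 0) = 1 \<and> ?w (Suc m) 2 = 0" for m
    by (induction m) (simp_all add: sum_3)
  then show "(\<Sum>i<3. ?w (Suc (Suc m)) i) = hs 10 (Suc (Suc (Suc m)))" unfolding sum_3 by (simp add: hs_def)
qed (simp_all add: sum_3)

lemma koszul_H11: "\<exists>n (I :: 'k::field ncpoly set). koszul n I \<and> hilbert_series n I = H 11"
proof (rule koszul_monomial[of "edges {(0, 0), (0, 1), (1, 0)}"])
  fix m
  let ?w = "walk_count (edges {(0, 0), (0, 1), (1, 0)})"
  let ?F = "\<lambda>m. card {w. length w = m \<and> no_square w}"
  have F2: "?F (Suc (Suc 0)) = 3" "?F (Suc (Suc (Suc 0))) = 5"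
    using card_no_square_3 by (simp_all add: numeral_2_eq_2 numeral_3_eq_3)
  \<comment> \<open>Vertices 0 and 1 correspond to the letters q and p of the words without p p;
    vertex 2 is isolated.\<close>
  have "?w (Suc m) 0 + ?w (Suc m) (Suc 0) = ?F (Suc (Suc m)) \<and> ?w (Suc m) 0 = ?F (Suc m) \<and> ?w (Suc m) 2 = 0" for m
  proof (induction m)
    case 0
    have "?F (Suc 0) = 2" using card_no_square[of "Suc 0"] F2 by simp
    then show ?case using F2 by (simp add: sum_3)
  next
    case (Suc m)
    have "?w (Suc (Suc m)) 0 = ?w (Suc m) 0 + ?w (Suc m) (Suc 0)" "?w (Suc (Suc m)) (Suc 0) = ?w (Suc m) 0"
      "?w (Suc (Suc m)) 2 = 0"
      unfolding walk_count.simps(2)[of _ "Suc m"] sum_3 by simp_all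
    then show ?case using Suc card_no_square[of "Suc m"] by simp
  qed
  from this[of "Suc m"] show "(\<Sum>i<3. ?w (Suc (Suc m)) i) = hs 11 (Suc (Suc (Suc m)))"
    unfolding sum_3 by (simp add: hs_def)
qed (simp_all add: sum_3)

subsection \<open>The two exceptional algebras\<close>

lemma less_3: "i < 3 \<longleftrightarrow> i = 0 \<or> i = 1 \<or> i = (2::nat)"
  by arith

lemma less_4: "i < 4 \<longleftrightarrow> i = 0 \<or> i = 1 \<or> i = 2 \<or> i = (3::nat)"
  by arith

text \<open>The relations are \<open>x z = z z\<close> and \<open>x x = x y = y y = y z = z x = 0\<close> for the letters \<open>x, y, z = 0, 1, 2\<close>.
  The left annihilators of the letters involve the linear form \<open>x - z\<close>, which has index \<open>3\<close>.\<close>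

definition N5 :: "nat list set" where
  "N5 = {[], [0], [1], [2], [2, 2], [1, 0], [2, 1], [2, 2, 1], [2, 1, 0], [2, 2, 1, 0]}"

lemma N5_iff: "w \<in> N5 \<longleftrightarrow> w = [] \<or> w = [0] \<or> w = [1] \<or> w = [2] \<or> w = [2, 2] \<or> w = [1, 0] \<or> w = [2, 1] \<or>
    w = [2, 2, 1] \<or> w = [2, 1, 0] \<or> w = [2, 2, 1, 0]"
  by (simp add: N5_def)

text \<open>The rule x z = z z, read from the left, applies to every basis word that begins with a
  single z.\<close>

definition ls5 :: "nat \<Rightarrow> nat list \<Rightarrow> nat list option" where
  "ls5 i w = (if i # w \<in> N5 then Some (i # w) else if i = 0 \<and> w \<in> {[2], [2, 1], [2, 1, 0]} then Some (2 # w) else None)"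

lemma presentation_5: "presentation N5 [0, 2] [2, 2] ls5"
proof
  show "w @ [i] \<in> N5 \<Longrightarrow> w \<in> N5" for w i by (cases w rule: rev_cases) (auto simp: N5_iff append_eq_Cons_conv)
  show "Option.bind (ls5 i w) (\<lambda>v. if v @ [j] \<in> N5 then Some (v @ [j]) else if v @ [j] = [0, 2] then Some [2, 2] else None) =
      Option.bind (if w @ [j] \<in> N5 then Some (w @ [j]) else if w @ [j] = [0, 2] then Some [2, 2] else None) (ls5 i)"
    if w: "w \<in> N5" and ij: "i < 3" "j < 3" for w i j
    using w ij unfolding less_3 by (subst (asm) N5_iff) (elim disjE; simp add: ls5_def N5_iff)
qed (auto simp: N5_iff ls5_def less_3 split: if_splits)

text \<open>The underlying zero products are x x = z x = 0, x y = y y = 0, y z = (x - z) z = 0 and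
  (x - z) (x - z) = - x z + z z = 0.\<close>

definition P5 :: "nat \<Rightarrow> nat set" where
  "P5 j = (if j = 0 then {0, 2} else if j = 1 then {0, 1} else if j = 2 then {1, 3} else {3})"

definition c5 :: "nat \<Rightarrow> nat \<Rightarrow> 'k::field" where
  "c5 i m = (if i = 3 then (if m = 0 then 1 else if m = 2 then - 1 else 0) else if m = i then 1 else 0)"

lemma finite_support_polys: "finite N \<Longrightarrow> (\<And>w. w \<in> N \<Longrightarrow> set w \<subseteq> {..<n}) \<Longrightarrow> (\<And>w. w \<notin> N \<Longrightarrow> b w = 0) \<Longrightarrow> b \<in> polys n"
  unfolding polys_def by (auto intro: finite_subset[of _ N])

lemma koszul_presentation_5: "koszul_presentation N5 [0, 2] [2, 2] ls5 {..<4} P5 (c5 :: nat \<Rightarrow> nat \<Rightarrow> 'k::field)"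
proof -
  interpret presentation N5 "[0, 2]" "[2, 2]" ls5 by (rule presentation_5)
  have act_off': "w \<notin> N5 \<Longrightarrow> act i a w = 0" for i w and a :: "'k ncpoly" by (rule act_off)
  have cl: "c5 i = (\<lambda>m. if m = i then 1 else 0 :: 'k)" if "i < 3" for i
    using that by (auto simp: c5_def fun_eq_iff)
  have polys_N5: "b \<in> polys 3" if "\<And>w. w \<notin> N5 \<Longrightarrow> b w = 0" for b :: "'k ncpoly"
  proof (rule finite_support_polys[of N5])
    show "finite N5" by (simp add: N5_def)
  qed (use that N_letters in auto)
  have by_form: "\<exists>b. (\<forall>i. b i \<in> polys 3 \<and> (\<forall>w. w \<notin> N5 \<longrightarrow> b i w = 0)) \<and> a = (\<Sum>i\<in>P. actl (c5 i) (b i))"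
    if a: "\<And>w. w \<notin> N5 \<Longrightarrow> a w = 0" "a [] = 0" "a [2] + a [0] = 0"
      and P: "P = {1, 3} \<or> P = {3} \<and> a [1] = 0 \<and> a [2, 1] = 0 \<and> a [2, 2, 1] = 0" for a :: "'k ncpoly" and P
  proof -
    \<comment> \<open>The coefficient of x - z at \<open>v\<close> is read off from the word v x.
      Only for v = z, where z x = 0, it is read off from z z, with a sign.\<close>
    define b where "b i = (if i = 1 then shift 1 a
      else (\<lambda>v. if v = [2] then - a [2, 2] else if v \<in> N5 then a (v @ [0]) else 0))" for i :: nat
    have b0: "w \<notin> N5 \<Longrightarrow> b i w = 0" for i w
      using a(1)[of "w @ [1]"] N_prefix[of w 1] by (auto simp: b_def shift_def) (simp_all add: N5_iff)
    have a2: "a [2] = - a [0]" using a(3) by (simp add: add_eq_0_iff)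
    have e: "a w = actl (c5 1) (b 1) w + actl (c5 3) (b 3) w" for w
    proof (cases "w \<in> N5")
      case True
      then show ?thesis
        by (subst (asm) N5_iff) (elim disjE; simp add: actl_apply act_def c5_def b_def shift_def N5_iff a(1,2) a2)
    qed (simp add: actl_apply act_off' a(1))
    have "a = (\<Sum>i\<in>P. actl (c5 i) (b i))"
      using P
    proof
      assume "P = {1, 3}"
      then show ?thesis using e by (simp add: fun_eq_iff pointwise)
    next
      assume P: "P = {3} \<and> a [1] = 0 \<and> a [2, 1] = 0 \<and> a [2, 2, 1] = 0"
      have "actl (c5 1) (b 1) w = 0" for w
      proof (cases "w \<in> N5")
        case True
        then show ?thesis using P
          by (subst (asm) N5_iff) (elim disjE; simp add: actl_apply act_def c5_def b_def shift_def N5_iff)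
      qed (simp add: actl_apply act_off')
      then show ?thesis using P e by (simp add: fun_eq_iff)
    qed
    then show ?thesis using b0 polys_N5 by (intro exI[of _ b]) auto
  qed
  show ?thesis
  proof
    show "i < 3 \<Longrightarrow> [i] \<in> N5" for i by (auto simp: N5_iff less_3)
    show "j \<in> {..<4} \<Longrightarrow> P5 j \<subseteq> {..<4}" for j by (auto simp: P5_def)
    show "i < 3 \<Longrightarrow> c5 i = (\<lambda>m. if m = i then 1 else 0 :: 'k)" for i by (rule cl)
    show "j \<in> {..<4} \<Longrightarrow> i \<in> P5 j \<Longrightarrow> i' \<in> P5 j \<Longrightarrow> i \<noteq> i' \<Longrightarrow> m < 3 \<Longrightarrow> c5 i m = 0 \<or> c5 i' m = (0 :: 'k)" for j i i' m
      by (auto simp: P5_def c5_def split: if_splits)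
    show "actl (c5 j) (form (c5 i)) = (0 :: 'k ncpoly)" if "j \<in> {..<4}" "i \<in> P5 j" for i j
    proof
      fix w
      show "actl (c5 j) (form (c5 i)) w = (0 :: 'k ncpoly) w"
      proof (cases "w \<in> N5")
        case True
        have "(j, i) \<in> {(0, 0), (0, 2), (1, 0), (1, 1), (2, 1), (2, 3), (3, 3)}"
          using that by (auto simp: P5_def less_4 split: if_splits)
        then show ?thesis using True
          unfolding N5_iff insert_iff empty_iff by (elim disjE FalseE; simp add: actl_apply act_def c5_def form_apply delta_def N5_iff zero_fun_apply)
      qed (simp add: actl_apply act_off' zero_fun_apply)
    qed
    show "\<exists>b. (\<forall>i. b i \<in> polys 3 \<and> (\<forall>w. w \<notin> N5 \<longrightarrow> b i w = 0)) \<and> a = (\<Sum>i\<in>P5 j. actl (c5 i) (b i))"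
      if j: "j \<in> {..<4}" and a: "a \<in> polys 3" "\<And>w. w \<notin> N5 \<Longrightarrow> a w = 0" "actl (c5 j) a = 0" for j and a :: "'k ncpoly"
    proof -
      have z: "actl (c5 j) a w = 0" for w using a(3) by (simp add: zero_fun_apply)
      note s = actl_apply act_def c5_def N5_iff a(2)
      have off: "[0, 2, 2] \<notin> N5" by (simp add: N5_iff)
      consider "j = 0" | "j = 1" | "j = 2" | "j = 3" using j by (auto simp: less_4)
      then show ?thesis
      proof cases
        case 1
        have "a [] = 0" "a [1] = 0" "a [2, 1] = 0" "a [2, 2, 1] = 0"
          using z[of "[0]"] z[of "[1, 0]"] z[of "[2, 1, 0]"] z[of "[2, 2, 1, 0]"] 1 by (simp_all add: s)
        then show ?thesis using 1 by (intro letter_annihilator[OF a(1,2) _ _ _ cl]) (auto simp: P5_def N5_iff append_eq_Cons_conv less_3)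
      next
        case 2
        have "a [] = 0" "a [2] = 0" "a [2, 2] = 0"
          using z[of "[1]"] z[of "[2, 1]"] z[of "[2, 2, 1]"] 2 by (simp_all add: s)
        then show ?thesis using 2 by (intro letter_annihilator[OF a(1,2) _ _ _ cl]) (auto simp: P5_def N5_iff append_eq_Cons_conv less_3)
      next
        case 3
        have "a [] = 0" "a [2] + a [0] = 0"
          using z[of "[2]"] z[of "[2, 2]"] 3 by (simp_all add: s)
        then show ?thesis using 3 by (intro by_form[OF a(2)]) (auto simp: P5_def)
      next
        case 4
        have "a [] = 0" "a [2] + a [0] = 0" "a [1] = 0" "a [2, 1] = 0" "a [2, 2, 1] = 0"
          using z[of "[0]"] z[of "[2, 2]"] z[of "[1, 0]"] z[of "[2, 1, 0]"] z[of "[2, 2, 1, 0]"] 4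
          by (simp_all add: s add_eq_0_iff)
        then show ?thesis using 4 by (intro by_form[OF a(2)]) (auto simp: P5_def)
      qed
    qed
  qed (simp_all add: lessThan_subset_iff)
qed

lemma koszul_H5: "\<exists>n (I :: 'k::field ncpoly set). koszul n I \<and> hilbert_series n I = H 5"
proof -
  interpret koszul_presentation N5 "[0, 2]" "[2, 2]" ls5 "{..<4}" P5 "c5 :: nat \<Rightarrow> nat \<Rightarrow> 'k" by (rule koszul_presentation_5)
  have card: "card {w \<in> N5. length w = m} = hs 5 m" for m
  proof -
    have N: "{w \<in> N5. length w = m} = set (filter (\<lambda>w. length w = m) [[], [0], [1], [2], [2, 2], [1, 0], [2, 1], [2, 2, 1], [2, 1, 0], [2, 2, 1, 0]])"
      by (auto simp: N5_iff)
    consider "m = 0" | "m = 1" | "m = 2" | "m = 3" | "m = 4" | "m > 4" by linarith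
    then show ?thesis unfolding N by cases (simp_all add: hs_def)
  qed
  have "hilbert_series 3 (rel_ideal :: 'k ncpoly set) = H 5"
    by (subst hilbert_series_hs) (simp_all add: comp_dim_rel_ideal card)
  then show ?thesis using koszul_rel_ideal by blast
qed

text \<open>The relations are \<open>y z = x z\<close> and \<open>x x = x y = y x = z y = z z = 0\<close>; the linear form of index \<open>3\<close> is \<open>x - y\<close>.\<close>

definition N6 :: "nat list set" where
  "N6 = {[0], [2], [0, 2], [2, 0], [0, 2, 0]} \<union> {w. set w \<subseteq> {1}}"

lemma N6_iff: "w \<in> N6 \<longleftrightarrow> w = [0] \<or> w = [2] \<or> w = [0, 2] \<or> w = [2, 0] \<or> w = [0, 2, 0] \<or> set w \<subseteq> {1}"
  by (auto simp: N6_def)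

definition ls6 :: "nat \<Rightarrow> nat list \<Rightarrow> nat list option" where
  "ls6 i w = (if i # w \<in> N6 then Some (i # w) else if i = 1 \<and> w \<in> {[2], [2, 0]} then Some (0 # w) else None)"

lemma N6_snoc: "w @ [i] \<in> N6 \<longleftrightarrow> (i = 0 \<and> w \<in> {[], [2], [0, 2]}) \<or> (i = 1 \<and> set w \<subseteq> {1}) \<or> (i = 2 \<and> w \<in> {[], [0]})"
  by (auto simp: N6_iff append_eq_Cons_conv)

lemma presentation_6: "presentation N6 [Suc 0, 2] [0, 2] ls6"
proof
  show "w @ [i] \<in> N6 \<Longrightarrow> w \<in> N6" for w i by (auto simp: N6_snoc) (auto simp: N6_iff)
  show "Option.bind (ls6 i w) (\<lambda>v. if v @ [j] \<in> N6 then Some (v @ [j]) else if v @ [j] = [Suc 0, 2] then Some [0, 2] else None) =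
      Option.bind (if w @ [j] \<in> N6 then Some (w @ [j]) else if w @ [j] = [Suc 0, 2] then Some [0, 2] else None) (ls6 i)"
    if w: "w \<in> N6" and ij: "i < 3" "j < 3" for w i j
  proof (cases "w \<in> {[0], [2], [0, 2], [2, 0], [0, 2, 0], [], [1]}")
    case True
    then show ?thesis using ij unfolding less_3 by (elim insertE emptyE disjE) (simp_all add: ls6_def N6_iff)
  next
    case False
    then have "set w \<subseteq> {1}" "w \<noteq> []" using w by (auto simp: N6_iff)
    then obtain v where v: "w = 1 # v" "set v \<subseteq> {1}" "v \<noteq> []" using False by (cases w) auto
    then obtain u where u: "v = 1 # u" "set u \<subseteq> {1}" by (cases v) auto
    show ?thesis using ij u unfolding less_3 v(1) by (elim disjE) (auto simp: ls6_def N6_iff)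
  qed
qed (auto simp: N6_iff ls6_def less_3 split: if_splits)

text \<open>The underlying zero products are x x = y x = 0, x y = z y = 0, z z = (x - y) z = 0 and x
  (x - y) = 0.\<close>

definition P6 :: "nat \<Rightarrow> nat set" where
  "P6 j = (if j = 0 then {0, 1} else if j = 1 then {0, 2} else if j = 2 then {2, 3} else {0})"

definition c6 :: "nat \<Rightarrow> nat \<Rightarrow> 'k::field" where
  "c6 i m = (if i = 3 then (if m = 0 then 1 else if m = 1 then - 1 else 0) else if m = i then 1 else 0)"

lemma N6_cases:
  assumes "w \<in> N6"
  obtains "w = []" | "w = [0]" | "w = [1]" | "w = [2]" | "w = [0, 2]" | "w = [2, 0]" | "w = [0, 2, 0]"
    | v where "w = v @ [1]" "v \<noteq> []" "set v \<subseteq> {1}"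
proof (cases w rule: rev_cases)
  case (snoc v i)
  then show thesis using assms[unfolded snoc N6_snoc] that by (cases "v = []") auto
qed (rule that)

lemma koszul_presentation_6: "koszul_presentation N6 [Suc 0, 2] [0, 2] ls6 {..<4} P6 (c6 :: nat \<Rightarrow> nat \<Rightarrow> 'k::field)"
proof -
  interpret presentation N6 "[Suc 0, 2]" "[0, 2]" ls6 by (rule presentation_6)
  have act6: "act i a w = (if w \<in> N6 \<and> w \<noteq> [] \<and> last w = i
     then a (butlast w) + (if w = [0, 2] then a [1] else 0) else 0)" for i w and a :: "'k ncpoly"
    by (simp add: act_def)
  have cl: "c6 i = (\<lambda>m. if m = i then 1 else 0 :: 'k)" if "i < 3" for i
    using that by (auto simp: c6_def fun_eq_iff)
  show ?thesis
  proof
    show "i < 3 \<Longrightarrow> [i] \<in> N6" for i by (auto simp: N6_iff less_3)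
    show "j \<in> {..<4} \<Longrightarrow> P6 j \<subseteq> {..<4}" for j by (auto simp: P6_def)
    show "i < 3 \<Longrightarrow> c6 i = (\<lambda>m. if m = i then 1 else 0 :: 'k)" for i by (rule cl)
    show "j \<in> {..<4} \<Longrightarrow> i \<in> P6 j \<Longrightarrow> i' \<in> P6 j \<Longrightarrow> i \<noteq> i' \<Longrightarrow> m < 3 \<Longrightarrow> c6 i m = 0 \<or> c6 i' m = (0 :: 'k)" for j i i' m
      by (auto simp: P6_def c6_def split: if_splits)
    show "actl (c6 j) (form (c6 i)) = (0 :: 'k ncpoly)" if "j \<in> {..<4}" "i \<in> P6 j" for i j
    proof
      fix w
      have ji: "(j, i) \<in> {(0, 0), (0, 1), (1, 0), (1, 2), (2, 2), (2, 3), (3, 0)}"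
        using that by (auto simp: P6_def less_4 split: if_splits)
      have len: "form (c6 i) v = (0 :: 'k)" if "length v \<noteq> 1" for v
        using that by (auto simp: form_apply delta_def)
      show "actl (c6 j) (form (c6 i)) w = (0 :: 'k ncpoly) w"
      proof (cases "w \<in> N6 \<and> length w = 2")
        case True
        then have "w \<in> {[0, 2], [2, 0], [1, 1]}" by (auto simp: N6_iff length_Suc_conv numeral_2_eq_2)
        then show ?thesis using ji
          by (elim insertE emptyE) (simp_all add: actl_apply act6 c6_def form_apply delta_def N6_iff zero_fun_apply)
      next
        case False
        then have "act m (form (c6 i)) w = (0 :: 'k)" for m
          using len[of "butlast w"] by (auto simp: act6)
        then show ?thesis by (simp add: actl_apply zero_fun_apply)
      qed
    qed
    show "\<exists>b. (\<forall>i. b i \<in> polys 3 \<and> (\<forall>w. w \<notin> N6 \<longrightarrow> b i w = 0)) \<and> a = (\<Sum>i\<in>P6 j. actl (c6 i) (b i))"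
      if j: "j \<in> {..<4}" and a: "a \<in> polys 3" "\<And>w. w \<notin> N6 \<Longrightarrow> a w = 0" "actl (c6 j) a = 0" for j and a :: "'k ncpoly"
    proof -
      have z: "actl (c6 j) a w = 0" for w using a(3) by (simp add: zero_fun_apply)
      have ones: "v @ [1] \<in> N6" if "set v \<subseteq> {1}" for v using that by (simp add: N6_snoc)
      note s = actl_apply act6 c6_def N6_snoc
      consider "j = 0" | "j = 1" | "j = 2" | "j = 3" using j by (auto simp: less_4)
      then show ?thesis
      proof cases
        case 1
        have "a [] = 0" "a [2] = 0" "a [0, 2] = 0"
          using z[of "[0]"] z[of "[2, 0]"] z[of "[0, 2, 0]"] 1 by (simp_all add: actl_apply act6 c6_def N6_iff)
        then show ?thesis using 1 by (intro letter_annihilator[OF a(1,2) _ _ _ cl]) (auto simp: P6_def N6_snoc less_3)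
      next
        case 2
        have one: "a v = 0" if "set v \<subseteq> {1}" for v
          using z[of "v @ [1]"] ones[OF that] 2 that by (simp add: actl_apply act6 c6_def)
        then have "a [] = 0" by simp
        then show ?thesis using 2 one by (intro letter_annihilator[OF a(1,2) _ _ _ cl]) (auto simp: P6_def N6_snoc less_3)
      next
        case 4
        have ends: "a [] = 0" "a [2] = 0" "a [0, 2] = 0"
          using z[of "[0]"] z[of "[2, 0]"] z[of "[0, 2, 0]"] 4 by (simp_all add: actl_apply act6 c6_def N6_iff)
        have one: "a v = 0" if "set v \<subseteq> {1}" for v
          using z[of "v @ [1]"] ones[OF that] 4 that by (simp add: actl_apply act6 c6_def)
        show ?thesis using 4 ends one by (intro letter_annihilator[OF a(1,2) _ _ _ cl]) (auto simp: P6_def N6_snoc less_3)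
      next
        case 3
        have a0: "a [] = 0" and a1: "a [Suc 0] = - a [0]"
          using z[of "[2]"] z[of "[0, 2]"] 3 by (simp_all add: actl_apply act6 c6_def N6_iff add_eq_0_iff)
        \<comment> \<open>The coefficient of x - y: words v x enter with sign plus, words v y with
          sign minus. For empty v both words occur, with opposite coefficients, so the entry of y is
          taken out to count this coefficient only once.\<close>
        let ?u = "shift 0 a - (shift 1 a - scl (a [1]) (delta []))"
        define b where "b i = (if i = 2 then shift 2 a else ?u)" for i :: nat
        have bp: "b i \<in> polys 3" for i
          unfolding b_def using shift_polys[OF a(1)] const_polys[of 1 3]
          by (auto simp: delta_word(3)[symmetric] intro!: fs.subspace_diff[OF polys_subspace] fs.subspace_scale[OF polys_subspace])
        have b0: "b i w = 0" if w: "w \<notin> N6" for i w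
        proof -
          have "a (w @ [i]) = 0" for i using a(2)[of "w @ [i]"] N_prefix w by blast
          moreover have "w \<noteq> []" using N_nil w by blast
          ultimately show ?thesis by (simp add: b_def shift_def pointwise delta_def)
        qed
        have sh: "shift i a v = a (v @ [i])" for i v by (simp add: shift_def)
        have off: "a w = 0" if "w \<notin> N6" for w using a(2) that .
        have e: "a w = actl (c6 2) (b 2) w + actl (c6 3) (b 3) w" for w
        proof (cases "w \<in> N6")
          case True
          then show ?thesis
          proof (cases rule: N6_cases)
            case (8 v)
            have "v @ [0] \<notin> N6" using 8 by (auto simp: N6_snoc)
            then have "actl (c6 3) (b 3) w = a w"
              using True 8 off
              by (auto simp: actl_apply act6 c6_def b_def sh pointwise delta_def append_eq_Cons_conv)
            moreover have "actl (c6 2) (b 2) w = 0" using 8 by (simp add: actl_apply act6 c6_def)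
            ultimately show ?thesis by simp
          qed (simp_all add: actl_apply act6 c6_def b_def sh pointwise delta_def N6_iff off a0 a1)
        next
          case False
          then show ?thesis by (simp add: actl_apply act6 off)
        qed
        have "a = (\<Sum>i\<in>P6 j. actl (c6 i) (b i))" using 3 e by (simp add: P6_def fun_eq_iff pointwise)
        then show ?thesis using b0 bp by (intro exI[of _ b]) auto
      qed
    qed
  qed (simp_all add: lessThan_subset_iff)
qed

lemma koszul_H6: "\<exists>n (I :: 'k::field ncpoly set). koszul n I \<and> hilbert_series n I = H 6"
proof -
  interpret koszul_presentation N6 "[Suc 0, 2]" "[0, 2]" ls6 "{..<4}" P6 "c6 :: nat \<Rightarrow> nat \<Rightarrow> 'k" by (rule koszul_presentation_6)
  have card: "card {w \<in> N6. length w = m} = hs 6 m" for m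
  proof -
    have N: "{w \<in> N6. length w = m} = insert (replicate m 1) (set (filter (\<lambda>w. length w = m) [[0], [2], [0, 2], [2, 0], [0, 2, 0]]))"
      by (auto simp: N6_iff intro: replicate_eqI)
    consider "m = 0" | "m = 1" | "m = 2" | "m = 3" | "m > 3" by linarith
    then show ?thesis unfolding N by cases (simp_all add: hs_def numeral_2_eq_2 numeral_3_eq_3)
  qed
  have "hilbert_series 3 (rel_ideal :: 'k ncpoly set) = H 6"
    by (subst hilbert_series_hs) (simp_all add: comp_dim_rel_ideal card)
  then show ?thesis using koszul_rel_ideal by blast
qed

theorem ex_koszul: "j \<in> {2, 5, 6, 7, 8, 9, 10, 11} \<Longrightarrow> \<exists>n (I :: 'k::field ncpoly set). koszul n I \<and> hilbert_series n I = H j"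
  using koszul_H2 koszul_H5 koszul_H6 koszul_H7 koszul_H8 koszul_H9 koszul_H10 koszul_H11 by auto

section \<open>The complete list\<close>

theorem theorem1p2:
  shows "(\<forall>n (I :: 'k::field ncpoly set).
            koszul n I \<and> comp_dim n I 1 = 3 \<and> comp_dim n I 2 = 3 \<longrightarrow>
            (\<exists>j\<in>{2, 5, 6, 7, 8, 9, 10, 11}. hilbert_series n I = H j)) \<and>
         (\<forall>j\<in>{2, 5, 6, 7, 8, 9, 10, 11}. \<exists>n (I :: 'k ncpoly set).
            koszul n I \<and> hilbert_series n I = H j) \<and>
         (\<forall>j\<in>{1, 3, 4}. \<forall>n (R :: 'k ncpoly set).
            quadratic_relations n R \<and> hilbert_series n (quadratic_ideal n R) = H j \<longrightarrow>
            \<not> koszul n (quadratic_ideal n R))"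
proof (intro conjI allI ballI impI)
  fix n and I :: "'k ncpoly set"
  assume "koszul n I \<and> comp_dim n I 1 = 3 \<and> comp_dim n I 2 = 3"
  then obtain j where j: "j \<in> {2, 5, 6, 7, 8, 9, 10, 11}" "\<forall>m. comp_dim n I m = hs j m"
    using koszul_comp_dim by blast
  have "hilbert_series n I = H j" by (subst hilbert_series_hs) (use j in auto)
  then show "\<exists>j\<in>{2, 5, 6, 7, 8, 9, 10, 11}. hilbert_series n I = H j" using j(1) by blast
next
  fix j :: nat
  assume "j \<in> {2, 5, 6, 7, 8, 9, 10, 11}"
  then show "\<exists>n (I :: 'k ncpoly set). koszul n I \<and> hilbert_series n I = H j" by (rule ex_koszul)
next
  fix j n and R :: "'k ncpoly set"
  assume "j \<in> {1, 3, 4}" "quadratic_relations n R \<and> hilbert_series n (quadratic_ideal n R) = H j"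
  then show "\<not> koszul n (quadratic_ideal n R)" using not_koszul by blast
qed

end
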